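(* Let $f\in H$, $u_0,w_0\in V$, and let $u$ be the global regular solution of the incompressible three-dimensional Navier-Stokes-$\alpha$ equations $$\frac{d}{dt}(u+\alpha^2Au)+\nu A(u+\alpha^2Au)+\widetilde B(u,u+\alpha^2Au)=f,\qquad u(0)=u_0.$$ Let $h>0$ and let $I_h:\dot H^1(\Omega)\to\dot L^2(\Omega)$ be a linear map for which there is a constant $c_1>0$ with $$|\mathcal P(\varphi-I_h\varphi)|^2\le c_1^2h^2\|\varphi\|^2\quad\text{for all }\varphi\in V.$$ Assume that $\mu>0$ is large enough that $$\mu>24k_3^2\nu\lambda_1G^2+\frac{15k_3^2\nu G^2}{\alpha^2},$$ where $G=\frac{|f|}{\nu^2\lambda_1^{3/4}}$, and that $h$ is small enough that $$h^2<\frac{\nu}{2\mu c_1^2}.$$ Then the global unique regular solution $w$ of $$\frac{d}{dt}(w+\alpha^2Aw)+\nu A(w+\alpha^2Aw)+\widetilde B(w,w+\alpha^2Aw)=f-\mu(I+\alpha^2A)\mathcal P\big(I_h(w)-I_h(u)\big),\qquad w(0)=w_0,$$ satisfies $|w(t)-u(t)|\to0$ and $\|w(t)-u(t)\|\to0$ as $t\to\infty$.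
   Context: Fix $L,\nu,\alpha>0$ and $\Omega=[0,L]^3$ with periodic boundary conditions; all functions are $\Omega$-periodic. A dot over a space denotes the subspace of zero-mean functions; $\dot L^2(\Omega),\dot H^1(\Omega),\dot H^2(\Omega)$ are used here for $\mathbb R^3$-valued fields. $\mathcal V$ is the set of $\mathbb R^3$-valued trigonometric polynomials on $\Omega$ that are divergence-free with zero mean; $H$ and $V$ are the closures of $\mathcal V$ in $(L^2(\Omega))^3$ and $(H^1(\Omega))^3$. The inner product of $L^2$ (and $H$) is $(u,v)=\int_\Omega u\cdot v\,dx$ with norm $|u|$; the inner product of $V$ is $((u,v))=\sum_{i,j=1}^3\int_\Omega\partial_{x_j}u_i\,\partial_{x_j}v_i\,dx$ with norm $\|u\|$. $\mathcal P:\dot L^2(\Omega)\to H$ is the Leray (orthogonal) projector, and $A=-\mathcal P\Delta$ is the Stokes operator with domain $D(A)=(H^2(\Omega))^3\cap V$ (so $A=-\Delta$ on $D(A)$), with first eigenvalue $\lambda_1=(2\pi/L)^2$; $A$ is extended by duality to $A:H\to D(A)'$. For $u,v\in\mathcal V$, $\widetilde B(u,v)=-\mathcal P(u\times(\nabla\times v))$. This extends continuously to $V\times V\to V'$, to $V\times H\to D(A)'$ and to $D(A)\times H\to V'$. The constant $k_3>0$ is a (scale-invariant) constant such that for all $u\in D(A)$, $v\in H$, $w\in V$, $$|\langle\widetilde B(u,v),w\rangle_{V',V}|\le k_3\big(\|u\|^{1/2}|Au|^{1/2}|v|\,\|w\|+|Au|\,|v|\,|w|^{1/2}\|w\|^{1/2}\big).$$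 $f\in H$ is time independent. It is known that for every $f\in H$ and $u_0\in V$ the Navier-Stokes-$\alpha$ equations have, for every $T>0$, a unique regular solution on $[0,T]$. A regular solution on $[0,T]$ of either evolution equation is a function in $C([0,T];V)\cap L^2([0,T];D(A))$ with time derivative in $L^2([0,T];H)$ that satisfies the equation in $D(A)'$ for almost every $t\in[0,T]$ and the initial condition; a global regular solution is a function on $[0,\infty)$ that is a regular solution on $[0,T]$ for every $T>0$. *)

theory Defs
  imports "HOL-Analysis.Analysis"
begin

text \<open>
  Elements of the function spaces below are represented by functions on the whole space that are
  periodic with period \<open>L\<close> in each coordinate. Functions that agree almost everywhere represent the
  same element; equality of elements is \<open>ae_eq\<close>.
\<close>

type_synonym field = "real^3 \<Rightarrow> real^3"

definition cube :: "real \<Rightarrow> (real^3) set" where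
  "cube L = {x. \<forall>i. 0 \<le> x $ i \<and> x $ i \<le> L}"

definition periodic :: "real \<Rightarrow> (real^3 \<Rightarrow> 'b) \<Rightarrow> bool" where
  "periodic L f \<longleftrightarrow> (\<forall>x i. f (x + axis i L) = f x)"

definition ae_eq :: "real \<Rightarrow> field \<Rightarrow> field \<Rightarrow> bool" where
  "ae_eq L u v \<longleftrightarrow> (AE x in lebesgue_on (cube L). u x = v x)"

definition zero_mean :: "real \<Rightarrow> field \<Rightarrow> bool" where
  "zero_mean L u \<longleftrightarrow> (LINT x|lebesgue_on (cube L). u x) = 0"


subsection \<open>Classical differential operators\<close>

definition partial :: "3 \<Rightarrow> (real^3 \<Rightarrow> 'b::real_normed_vector) \<Rightarrow> real^3 \<Rightarrow> 'b" where
  "partial j f x = frechet_derivative f (at x) (axis j 1)"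

definition divergence :: "field \<Rightarrow> real^3 \<Rightarrow> real" where
  "divergence u x = (\<Sum>i\<in>UNIV. partial i u x $ i)"

definition curl :: "field \<Rightarrow> field" where
  "curl u x = vector [partial 2 u x $ 3 - partial 3 u x $ 2,
                      partial 3 u x $ 1 - partial 1 u x $ 3,
                      partial 1 u x $ 2 - partial 2 u x $ 1]"

primrec C_k :: "nat \<Rightarrow> (real^3 \<Rightarrow> real) \<Rightarrow> bool" where
  "C_k 0 \<phi> \<longleftrightarrow> continuous_on UNIV \<phi>"
| "C_k (Suc n) \<phi> \<longleftrightarrow> (\<forall>x. \<phi> differentiable (at x)) \<and> (\<forall>j. C_k n (partial j \<phi>))"


subsection \<open>Lebesgue and Sobolev spaces of periodic fields\<close>

definition L2_per :: "real \<Rightarrow> field set" where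
  "L2_per L = {u. u \<in> borel_measurable lebesgue \<and> periodic L u \<and>
                  integrable (lebesgue_on (cube L)) (\<lambda>x. (norm (u x))\<^sup>2)}"

definition L2_inner :: "real \<Rightarrow> field \<Rightarrow> field \<Rightarrow> real" where
  "L2_inner L u v = (LINT x|lebesgue_on (cube L). u x \<bullet> v x)"

definition L2_norm :: "real \<Rightarrow> field \<Rightarrow> real" where
  "L2_norm L u = sqrt (L2_inner L u u)"

definition is_weak_partial :: "real \<Rightarrow> 3 \<Rightarrow> field \<Rightarrow> field \<Rightarrow> bool" where
  "is_weak_partial L j u g \<longleftrightarrow> g \<in> L2_per L \<and>
     (\<forall>\<phi>. periodic L \<phi> \<and> (\<forall>n. C_k n \<phi>) \<longrightarrow>
        (LINT x|lebesgue_on (cube L). partial j \<phi> x *\<^sub>R u x) =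
        - (LINT x|lebesgue_on (cube L). \<phi> x *\<^sub>R g x))"

definition weak_partial :: "real \<Rightarrow> 3 \<Rightarrow> field \<Rightarrow> field" where
  "weak_partial L j u = (SOME g. is_weak_partial L j u g)"

definition H1_per :: "real \<Rightarrow> field set" where
  "H1_per L = {u \<in> L2_per L. \<forall>j. \<exists>g. is_weak_partial L j u g}"

definition H2_per :: "real \<Rightarrow> field set" where
  "H2_per L = {u \<in> H1_per L. \<forall>j. weak_partial L j u \<in> H1_per L}"

definition L2_dot :: "real \<Rightarrow> field set" where
  "L2_dot L = {u \<in> L2_per L. zero_mean L u}"

definition H1_dot :: "real \<Rightarrow> field set" where
  "H1_dot L = {u \<in> H1_per L. zero_mean L u}"

definition V_inner :: "real \<Rightarrow> field \<Rightarrow> field \<Rightarrow> real" where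
  "V_inner L u v = (\<Sum>i\<in>UNIV. \<Sum>j\<in>UNIV.
     LINT x|lebesgue_on (cube L). weak_partial L j u x $ i * weak_partial L j v x $ i)"

definition V_norm :: "real \<Rightarrow> field \<Rightarrow> real" where
  "V_norm L u = sqrt (V_inner L u u)"


subsection \<open>Solenoidal fields, Leray projector and Stokes operator\<close>

definition trig_polynomial :: "real \<Rightarrow> field \<Rightarrow> bool" where
  "trig_polynomial L u \<longleftrightarrow>
     (\<exists>(K :: (int^3) set) a b. finite K \<and>
        u = (\<lambda>x. \<Sum>k\<in>K. cos (2 * pi / L * (\<Sum>i\<in>UNIV. real_of_int (k $ i) * x $ i)) *\<^sub>R a k
                       + sin (2 * pi / L * (\<Sum>i\<in>UNIV. real_of_int (k $ i) * x $ i)) *\<^sub>R b k))"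

definition solenoidal_trig :: "real \<Rightarrow> field set" where
  "solenoidal_trig L = {u. trig_polynomial L u \<and> (\<forall>x. divergence u x = 0) \<and> zero_mean L u}"

definition H_space :: "real \<Rightarrow> field set" where
  "H_space L = {u \<in> L2_per L. \<forall>\<epsilon>>0. \<exists>p\<in>solenoidal_trig L. L2_norm L (\<lambda>x. u x - p x) < \<epsilon>}"

definition V_space :: "real \<Rightarrow> field set" where
  "V_space L = {u \<in> H1_per L. \<forall>\<epsilon>>0. \<exists>p\<in>solenoidal_trig L.
     sqrt ((L2_norm L (\<lambda>x. u x - p x))\<^sup>2 + (V_norm L (\<lambda>x. u x - p x))\<^sup>2) < \<epsilon>}"

text \<open>
  The projector is defined on all square-integrable fields, because \<open>u \<times> curl v\<close> need not have
  zero mean when \<open>u \<noteq> v\<close>. Constants are orthogonal to \<open>H_space L\<close> and are mapped to zero.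
\<close>

definition leray :: "real \<Rightarrow> field \<Rightarrow> field" where
  "leray L u = (SOME g. g \<in> H_space L \<and> (\<forall>v\<in>H_space L. L2_inner L (\<lambda>x. u x - g x) v = 0))"

definition dom_A :: "real \<Rightarrow> field set" where
  "dom_A L = H2_per L \<inter> V_space L"

definition laplacian :: "real \<Rightarrow> field \<Rightarrow> field" where
  "laplacian L u x = (\<Sum>j\<in>UNIV. weak_partial L j (weak_partial L j u) x)"

definition stokes :: "real \<Rightarrow> field \<Rightarrow> field" where
  "stokes L u x = - leray L (laplacian L u) x"

definition A_norm :: "real \<Rightarrow> field \<Rightarrow> real" where
  "A_norm L u = L2_norm L (stokes L u)"

text \<open>
  Elements of the duals of \<open>dom_A L\<close> and \<open>V_space L\<close> are represented by their action on test fields.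
\<close>

definition stokes_dual :: "real \<Rightarrow> field \<Rightarrow> field \<Rightarrow> real" where
  "stokes_dual L v \<phi> = L2_inner L v (stokes L \<phi>)"


subsection \<open>The bilinear term\<close>

definition B_trig :: "real \<Rightarrow> field \<Rightarrow> field \<Rightarrow> field" where
  "B_trig L u v x = - leray L (\<lambda>y. cross3 (u y) (curl v y)) x"

text \<open>
  The extension by continuity, with \<open>u\<close> approximated in the norm \<open>N\<close> and \<open>v\<close> in the norm of the
  space \<open>H\<close>. The result is a functional of the last argument.
\<close>

definition B_extension ::
    "real \<Rightarrow> (field \<Rightarrow> real) \<Rightarrow> field \<Rightarrow> field \<Rightarrow> field \<Rightarrow> real" where
  "B_extension L N u v w = (THE r. \<forall>p q.
     (\<forall>n. p n \<in> solenoidal_trig L \<and> q n \<in> solenoidal_trig L) \<and>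
     (\<lambda>n. N (\<lambda>x. p n x - u x)) \<longlonglongrightarrow> 0 \<and>
     (\<lambda>n. L2_norm L (\<lambda>x. q n x - v x)) \<longlonglongrightarrow> 0 \<longrightarrow>
     (\<lambda>n. L2_inner L (B_trig L (p n) (q n)) w) \<longlonglongrightarrow> r)"

text \<open>\<open>B_VH\<close> maps \<open>V \<times> H\<close> to the dual of \<open>D(A)\<close>; \<open>B_DH\<close> maps \<open>D(A) \<times> H\<close> to the dual of \<open>V\<close>.\<close>

definition B_VH :: "real \<Rightarrow> field \<Rightarrow> field \<Rightarrow> field \<Rightarrow> real" where
  "B_VH L = B_extension L (V_norm L)"

definition B_DH :: "real \<Rightarrow> field \<Rightarrow> field \<Rightarrow> field \<Rightarrow> real" where
  "B_DH L = B_extension L (A_norm L)"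

definition B_bound :: "real \<Rightarrow> real \<Rightarrow> bool" where
  "B_bound L k3 \<longleftrightarrow> (\<forall>u\<in>dom_A L. \<forall>v\<in>H_space L. \<forall>w\<in>V_space L.
     \<bar>B_DH L u v w\<bar> \<le> k3 *
       (sqrt (V_norm L u) * sqrt (A_norm L u) * L2_norm L v * V_norm L w
        + A_norm L u * L2_norm L v * sqrt (L2_norm L w) * sqrt (V_norm L w)))"


subsection \<open>Regular solutions\<close>

definition continuous_in_V :: "real \<Rightarrow> real \<Rightarrow> (real \<Rightarrow> field) \<Rightarrow> bool" where
  "continuous_in_V L T u \<longleftrightarrow> (\<forall>t\<in>{0..T}. u t \<in> V_space L \<and>
     ((\<lambda>s. V_norm L (\<lambda>x. u s x - u t x)) \<longlongrightarrow> 0) (at t within {0..T}))"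

text \<open>Strongly measurable, square-integrable functions of time with values in \<open>X\<close>, normed by \<open>N\<close>.\<close>

definition L2_time :: "real \<Rightarrow> field set \<Rightarrow> (field \<Rightarrow> real) \<Rightarrow> (real \<Rightarrow> field) \<Rightarrow> bool" where
  "L2_time T X N g \<longleftrightarrow>
     (AE t in lebesgue_on {0..T}. g t \<in> X) \<and>
     (\<exists>s :: nat \<Rightarrow> real \<Rightarrow> field.
        (\<forall>n. simple_function (lebesgue_on {0..T}) (s n) \<and> (\<forall>t\<in>{0..T}. s n t \<in> X)) \<and>
        (AE t in lebesgue_on {0..T}. (\<lambda>n. N (\<lambda>x. s n t x - g t x)) \<longlonglongrightarrow> 0)) \<and>
     integrable (lebesgue_on {0..T}) (\<lambda>t. (N (g t))\<^sup>2)"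

text \<open>
  For \<open>g\<close> square integrable in time with values in \<open>H\<close>: \<open>u t - u s\<close> is the Bochner integral in \<open>H\<close>
  of \<open>g\<close> over \<open>[s, t]\<close>, an identity in \<open>H\<close> expressed by testing with all elements of \<open>H\<close>.
\<close>

definition time_derivative :: "real \<Rightarrow> real \<Rightarrow> (real \<Rightarrow> field) \<Rightarrow> (real \<Rightarrow> field) \<Rightarrow> bool" where
  "time_derivative L T u g \<longleftrightarrow> (\<forall>\<psi>\<in>H_space L. \<forall>s t. 0 \<le> s \<and> s \<le> t \<and> t \<le> T \<longrightarrow>
     L2_inner L (\<lambda>x. u t x - u s x) \<psi> = (LINT \<tau>|lebesgue_on {s..t}. L2_inner L (g \<tau>) \<psi>))"

definition helmholtz :: "real \<Rightarrow> real \<Rightarrow> field \<Rightarrow> field" where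
  "helmholtz L \<alpha> u x = u x + \<alpha>\<^sup>2 *\<^sub>R stokes L u x"

text \<open>
  The same map \<open>I + \<alpha>\<^sup>2 A\<close> from \<open>H\<close> to the dual of \<open>D(A)\<close>. It is bounded, so the time derivative of
  \<open>u + \<alpha>\<^sup>2 A u\<close> is its value at the time derivative \<open>g\<close> of \<open>u\<close>.
\<close>

definition helmholtz_dual :: "real \<Rightarrow> real \<Rightarrow> field \<Rightarrow> field \<Rightarrow> real" where
  "helmholtz_dual L \<alpha> v \<phi> = L2_inner L v \<phi> + \<alpha>\<^sup>2 * stokes_dual L v \<phi>"

definition regular_solution ::
    "real \<Rightarrow> real \<Rightarrow> real \<Rightarrow> (real \<Rightarrow> field \<Rightarrow> real) \<Rightarrow> field \<Rightarrow> real \<Rightarrow> (real \<Rightarrow> field) \<Rightarrow> bool" where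
  "regular_solution L \<nu> \<alpha> F u0 T u \<longleftrightarrow>
     continuous_in_V L T u \<and>
     L2_time T (dom_A L) (A_norm L) u \<and>
     ae_eq L (u 0) u0 \<and>
     (\<exists>g. L2_time T (H_space L) (L2_norm L) g \<and>
          time_derivative L T u g \<and>
          (AE t in lebesgue_on {0..T}. \<forall>\<phi>\<in>dom_A L.
             helmholtz_dual L \<alpha> (g t) \<phi>
             + \<nu> * stokes_dual L (helmholtz L \<alpha> (u t)) \<phi>
             + B_VH L (u t) (helmholtz L \<alpha> (u t)) \<phi>
             = F t \<phi>))"

definition NS_alpha_solution ::
    "real \<Rightarrow> real \<Rightarrow> real \<Rightarrow> field \<Rightarrow> field \<Rightarrow> (real \<Rightarrow> field) \<Rightarrow> bool" where
  "NS_alpha_solution L \<nu> \<alpha> f u0 u \<longleftrightarrow>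
     (\<forall>T>0. regular_solution L \<nu> \<alpha> (\<lambda>t \<phi>. L2_inner L f \<phi>) u0 T u)"

definition nudged_solution ::
    "real \<Rightarrow> real \<Rightarrow> real \<Rightarrow> field \<Rightarrow> real \<Rightarrow> (field \<Rightarrow> field) \<Rightarrow> (real \<Rightarrow> field) \<Rightarrow> field
      \<Rightarrow> (real \<Rightarrow> field) \<Rightarrow> bool" where
  "nudged_solution L \<nu> \<alpha> f \<mu> Ih u w0 w \<longleftrightarrow>
     (\<forall>T>0. regular_solution L \<nu> \<alpha>
        (\<lambda>t \<phi>. L2_inner L f \<phi>
                - \<mu> * helmholtz_dual L \<alpha> (leray L (\<lambda>x. Ih (w t) x - Ih (u t) x)) \<phi>) w0 T w)"

definition linear_H1_L2 :: "real \<Rightarrow> (field \<Rightarrow> field) \<Rightarrow> bool" where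
  "linear_H1_L2 L J \<longleftrightarrow>
     (\<forall>\<phi>\<in>H1_dot L. J \<phi> \<in> L2_dot L) \<and>
     (\<forall>\<phi>\<in>H1_dot L. \<forall>\<psi>\<in>H1_dot L. ae_eq L \<phi> \<psi> \<longrightarrow> ae_eq L (J \<phi>) (J \<psi>)) \<and>
     (\<forall>\<phi>\<in>H1_dot L. \<forall>\<psi>\<in>H1_dot L. ae_eq L (J (\<lambda>x. \<phi> x + \<psi> x)) (\<lambda>x. J \<phi> x + J \<psi> x)) \<and>
     (\<forall>c. \<forall>\<phi>\<in>H1_dot L. ae_eq L (J (\<lambda>x. c *\<^sub>R \<phi> x)) (\<lambda>x. c *\<^sub>R J \<phi> x))"

definition lambda1 :: "real \<Rightarrow> real" where
  "lambda1 L = (2 * pi / L)\<^sup>2"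

definition grashof :: "real \<Rightarrow> real \<Rightarrow> field \<Rightarrow> real" where
  "grashof L \<nu> f = L2_norm L f / (\<nu>\<^sup>2 * lambda1 L powr (3/4))"

end

theory Submission
 imports Defs
begin

text \<open>
  Everything is read off in a basis of eigenfields of the Stokes operator. A Fourier frequency
  \<open>k \<noteq> 0\<close> carries two polarisations orthogonal to \<open>k\<close>; multiplying them by the real function
  \<open>chi k\<close>, a normalised cosine plus sine, gives an orthonormal basis \<open>ev\<close> of the space \<open>H\<close> with
  eigenvalues \<open>lm\<close>. In the coefficients \<open>c\<close> of a field, membership in \<open>H\<close>, \<open>V\<close> and the domain of the
  Stokes operator says that \<open>c\<close> is square summable with weight \<open>1\<close>, \<open>lm\<close> and \<open>lm^2\<close>
  (\<open>H_iff\<close>, \<open>V_iff\<close>, \<open>dom_A_iff\<close>). The bilinear term becomes an antisymmetric trilinear form, bounded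
  in these weights (\<open>th_trilinear\<close>, \<open>B_VH_form\<close>, \<open>B_DH_form\<close>). So the theorem reduces to an infinite
  system of ordinary differential equations for \<open>c\<close>.

  The decay rests on the energy \<open>en d = |d|^2 + \<alpha>^2 ||d||^2\<close> of a difference \<open>d\<close> of two solutions.
  Pairing the equation for \<open>d\<close> with \<open>d\<close> removes, by antisymmetry, the part of the bilinear
  term with first argument \<open>d\<close> and leaves \<open>B(u, d + \<alpha>^2 A d)\<close>, where \<open>u\<close> is the reference
  solution. The bound with \<open>k3\<close> splits this into a part that the viscosity absorbs and a rest that is
  at most \<open>en d\<close> times a multiple of
  \<open>|A u|^2\<close> (\<open>form_en_dis\<close>). The nudging contributes \<open>- \<mu> en d\<close>, up to viscous terms that are small
  because \<open>h\<close> is (\<open>nudge_coercive\<close>). By Gronwall's inequality \<open>en d\<close> is at most its initial value times the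
  exponential of the time integral of a constant times \<open>|A u|^2\<close> minus \<open>\<mu>\<close> (\<open>difference_decay\<close>). The energy inequality of
  \<open>u\<close> bounds the time average of \<open>|A u|^2\<close> in terms of the Grashof number (\<open>dissipation_bound\<close>,
  \<open>grashof_sq\<close>), so that the exponent is negative when \<open>\<mu>\<close> is as large as assumed.

  Existence of the nudged solution is by the Galerkin method. The truncated systems are solved by
  Picard iteration (\<open>quadratic_ode\<close>, \<open>gal_exists\<close>), their solutions form a Cauchy sequence in the
  energy norm uniformly in time (\<open>gal_cauchy\<close>), by the same energy argument applied to two
  truncations, and the limit solves the full system (\<open>sol_exists\<close>). Uniqueness is \<open>difference_decay\<close>
  with equal initial data. The reference solution itself solves the nudged system, with a forcing that
  contains its own observations; hence it can be compared with \<open>w\<close> inside one system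
  (\<open>force\<close>, \<open>synchronisation\<close>).
\<close>

section \<open>Integral inequalities in one time variable\<close>
abbreviation (input) seq_limit :: "(nat => 'a::topological_space) => 'a => bool" (infixr "---->" 60)
 where "X ----> l \<equiv> X \<longlonglongrightarrow> l"
abbreviation Leb :: "real => real => real measure" where "Leb a b \<equiv> lebesgue_on {a..b}"

text \<open>Summing over a fine partition of \<open>[0, T]\<close> the increments of \<open>m\<close> telescope, so \<open>D T - D 0\<close> is at most \<open>eps * (m T - m 0)\<close>
  for every \<open>eps\<close>. This replaces differentiation almost everywhere for absolutely continuous functions.\<close>

lemma le_of_small_increments:
 fixes D m :: "real => real"
 assumes T: "0 <= T"
  and inc: "!!eps. eps > 0 ==> \<exists>delta>0. \<forall>s t. 0 <= s & s <= t & t <= T & t - s < delta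
          --> D t - D s <= eps * (m t - m s)"
 shows "D T <= D 0"
proof -
 have *: "D T - D 0 <= eps * (m T - m 0)" if e: "eps > 0" for eps
 proof -
  obtain delta where delta: "delta > 0" and h: "!!s t. 0 <= s ==> s <= t ==> t <= T ==> t - s < delta ==> D t - D s <= eps * (m t - m s)"
   using inc[OF e] by blast
  obtain N :: nat where N: "T / delta < real N" using reals_Archimedean2 by blast
  have N0: "0 < real N" using N T delta by (smt (verit) divide_nonneg_pos)
  define p where "p k = real k * (T / real N)" for k
  have step: "T / real N < delta" using N N0 delta by (simp add: field_simps)
  have "D (p k) - D 0 <= eps * (m (p k) - m 0)" if "k <= N" for k
   using that
  proof (induction k)
   case 0 then show ?case by (simp add: p_def)
  next
   case (Suc k)
   have a: "p (Suc k) = p k + T / real N" by (simp add: p_def algebra_simps add_divide_distrib)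
   have "p (Suc k) <= T"
   proof -
    have "real (Suc k) * T <= real N * T" by (intro mult_right_mono) (use Suc.prems T in auto)
    then show ?thesis using N0 by (simp add: p_def field_simps)
   qed
   moreover have "0 <= p k" using T N0 by (simp add: p_def)
   moreover have "0 <= T / real N" using T N0 by simp
   ultimately have "D (p (Suc k)) - D (p k) <= eps * (m (p (Suc k)) - m (p k))"
    using step a by (intro h) auto
   with Suc show ?case by (simp add: algebra_simps)
  qed
  from this[of N] N0 show ?thesis by (simp add: p_def)
 qed
 show ?thesis
 proof (rule ccontr)
  assume n: "~ D T <= D 0"
  define Z where "Z = abs (m T - m 0) + 1"
  define eps where "eps = (D T - D 0) / (2 * Z)"
  have Z: "Z > 0" "m T - m 0 <= Z" by (auto simp: Z_def)
  have e: "eps > 0" using n Z by (simp add: eps_def)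
  have "eps * (m T - m 0) <= eps * Z" using e Z by (intro mult_left_mono) auto
  also have "... = (D T - D 0) / 2" using Z by (simp add: eps_def)
  finally show False using *[OF e] n by simp
 qed
qed

text \<open>By completeness of Lebesgue measure.\<close>

lemma borel_measurable_AE_eq_on:
 fixes f g :: "'a::euclidean_space => 'b::euclidean_space"
 assumes f: "f \<in> borel_measurable (lebesgue_on S)" and S: "S \<in> sets lebesgue"
  and ae: "AE x in lebesgue_on S. f x = g x"
 shows "g \<in> borel_measurable (lebesgue_on S)"
proof -
 have 1: "(%x. if x \<in> S then f x else 0) \<in> borel_measurable lebesgue"
  using f S borel_measurable_if by blast
 have 2: "AE x in lebesgue. (if x \<in> S then f x else 0) = (if x \<in> S then g x else 0)"
  using ae S by (subst (asm) AE_restrict_space_iff) auto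
 from borel_measurable_AE[OF 1 2] show ?thesis
  using S borel_measurable_if by blast
qed

lemma integrable_AE_eq_on:
 fixes f g :: "'a::euclidean_space => 'b::euclidean_space"
 assumes "integrable (lebesgue_on S) f" "S \<in> sets lebesgue" "AE x in lebesgue_on S. f x = g x"
 shows "integrable (lebesgue_on S) g"
 using assms borel_measurable_AE_eq_on[OF _ assms(2,3)] integrable_cong_AE[of f "lebesgue_on S" g]
 by (metis borel_measurable_integrable)

lemma borel_measurable_AE_lim_on:
 fixes f :: "nat => 'a::euclidean_space => 'b::euclidean_space"
 assumes f: "!!n. f n \<in> borel_measurable (lebesgue_on S)" and S: "S \<in> sets lebesgue"
  and ae: "AE x in lebesgue_on S. (%n. f n x) ----> g x"
 shows "g \<in> borel_measurable (lebesgue_on S)"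
proof (rule borel_measurable_AE_eq_on[OF _ S])
 show "(%x. lim (%n. f n x)) \<in> borel_measurable (lebesgue_on S)" using f by measurable
 show "AE x in lebesgue_on S. lim (%n. f n x) = g x" using ae by eventually_elim (rule limI)
qed

lemma integrable_within:
 fixes g :: "real => real"
 assumes "integrable (Leb 0 T) g" "0 <= s" "t <= T"
 shows "integrable (Leb s t) g"
 by (rule integrable_subinterval[OF assms(1)]) (use assms in auto)

lemma integral_interval_diff:
 fixes g :: "real => real"
 assumes "integrable (Leb 0 T) g" "0 <= s" "s <= t" "t <= T"
 shows "(LINT tau|Leb 0 t. g tau) - (LINT tau|Leb 0 s. g tau) = (LINT tau|Leb s t. g tau)"
proof -
 have "integrable (Leb 0 t) g" by (rule integrable_subinterval[OF assms(1)]) (use assms in auto)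
 from integral_combine[OF this, of s] assms show ?thesis by simp
qed

lemma integral_subinterval_le:
 fixes g :: "real => real"
 assumes "integrable (Leb 0 T) g" "0 <= s" "s <= t" "t <= T" "!!tau. 0 <= tau ==> tau <= T ==> 0 <= g tau"
 shows "(LINT tau|Leb s t. g tau) <= (LINT tau|Leb 0 T. g tau)"
 using assms by (intro integral_mono_lebesgue_on_AE) (auto intro!: AE_I2)

lemma continuous_of_integral:
 fixes y g :: "real => real"
 assumes g: "integrable (Leb 0 T) g"
  and y: "!!s t. 0 <= s ==> s <= t ==> t <= T ==> y t - y s = (LINT tau|Leb s t. g tau)"
 shows "continuous_on {0..T} y"
proof -
 have "continuous_on {0..T} (%t. y 0 + (LINT tau|Leb 0 t. g tau))"
  using indefinite_integral_continuous_real[OF g] by (intro continuous_intros)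
 moreover have "y t = y 0 + (LINT tau|Leb 0 t. g tau)" if "t \<in> {0..T}" for t
  using y[of 0 t] that by auto
 ultimately show ?thesis by (metis (no_types, lifting) continuous_on_eq)
qed

lemma continuous_interval_bound:
 fixes f :: "real => real"
 assumes "continuous_on {a..b} f"
 obtains C where "C > 0" "!!t. t \<in> {a..b} ==> \<bar>f t\<bar> <= C"
proof -
 have "bounded (f ` {a..b})" using compact_continuous_image[OF assms compact_Icc] by (rule compact_imp_bounded)
 then obtain C where "\<forall>x\<in>f ` {a..b}. norm x <= C" unfolding bounded_iff by blast
 then have "abs (f t) <= max C 1" if "t \<in> {a..b}" for t using that by force
 then show thesis by (intro that[of "max C 1"]) auto
qed

lemma integrable_mult_continuous:
 fixes y g :: "real => real"
 assumes g: "integrable (Leb 0 T) g" and y: "continuous_on {0..T} y"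
 shows "integrable (Leb 0 T) (%t. y t * g t)"
proof -
 obtain B where B: "!!t. t \<in> {0..T} ==> \<bar>y t\<bar> <= B"
  using continuous_interval_bound[OF y] by metis
 have ym: "y \<in> borel_measurable (Leb 0 T)"
  using continuous_imp_measurable_on_sets_lebesgue[OF y] by auto
 have gm: "g \<in> borel_measurable (Leb 0 T)" using g by auto
 show ?thesis
 proof (rule Bochner_Integration.integrable_bound[where f="%t. B * g t"])
  show "integrable (Leb 0 T) (%t. B * g t)" using g by simp
  show "(%t. y t * g t) \<in> borel_measurable (Leb 0 T)" using ym gm by (rule borel_measurable_times)
  show "AE t in Leb 0 T. norm (y t * g t) <= norm (B * g t)"
  proof (rule AE_I2)
   fix t assume "t \<in> space (Leb 0 T)"
   then have "abs (y t) <= abs B" using B[of t] by auto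
   then show "norm (y t * g t) <= norm (B * g t)" by (simp add: abs_mult mult_right_mono)
  qed
 qed
qed

text \<open>The chain rule for the square of an absolutely continuous function. On short intervals
  \<open>y t + y s\<close> differs little from \<open>2 * y tau\<close>, so that the error is small against the integral of \<open>|g|\<close>.\<close>

lemma ac_square:
 fixes y g :: "real => real"
 assumes T: "0 <= T" and g: "integrable (Leb 0 T) g"
  and y: "!!s t. 0 <= s ==> s <= t ==> t <= T ==> y t - y s = (LINT tau|Leb s t. g tau)"
 shows "(y T)^2 - (y 0)^2 = (LINT tau|Leb 0 T. 2 * y tau * g tau)"
proof -
 note yc = continuous_of_integral[OF g y]
 have yg: "integrable (Leb 0 T) (%t. 2 * y t * g t)"
  using integrable_mult_continuous[OF g yc] by (simp add: mult.assoc)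
 define D where "D t = (y t)^2 - (LINT tau|Leb 0 t. 2 * y tau * g tau)" for t
 define m where "m t = (LINT tau|Leb 0 t. abs (g tau))" for t
 have gabs: "integrable (Leb 0 T) (%t. abs (g t))" using g by simp
 have key: "\<exists>delta>0. \<forall>s t. 0 <= s & s <= t & t <= T & t - s < delta --> \<bar>D t - D s\<bar> <= eps * (m t - m s)"
  if e: "eps > 0" for eps
 proof -
  have "uniformly_continuous_on {0..T} y" using yc compact_Icc by (rule compact_uniformly_continuous)
  then obtain delta where delta: "delta > 0" "!!s t. s \<in> {0..T} ==> t \<in> {0..T} ==> dist t s < delta ==> dist (y t) (y s) < eps/2"
   using e unfolding uniformly_continuous_on_def by (metis half_gt_zero)
  show ?thesis
  proof (intro exI conjI allI impI)
   show "delta > 0" by fact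
   fix s t assume st: "0 <= s & s <= t & t <= T & t - s < delta"
   have gi: "integrable (Leb s t) g" "integrable (Leb s t) (%t. 2 * y t * g t)"
    "integrable (Leb s t) (%t. abs (g t))"
    using st by (blast intro: integrable_within[OF g] integrable_within[OF yg] integrable_within[OF gabs])+
   have "D t - D s = (y t + y s) * (y t - y s) - (LINT tau|Leb s t. 2 * y tau * g tau)"
    using integral_interval_diff[OF yg, of s t] st by (simp add: D_def power2_eq_square algebra_simps)
   also have "... = (LINT tau|Leb s t. (y t + y s) * g tau) - (LINT tau|Leb s t. 2 * y tau * g tau)"
    using y[of s t] st by simp
   also have "... = (LINT tau|Leb s t. (y t + y s) * g tau - 2 * y tau * g tau)"
    using gi by simp
   finally have eq: "D t - D s = ..." .
   have "abs (LINT tau|Leb s t. (y t + y s) * g tau - 2 * y tau * g tau) <= (LINT tau|Leb s t. abs ((y t + y s) * g tau - 2 * y tau * g tau))"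
    by (rule integral_abs_bound)
   also have "... <= (LINT tau|Leb s t. eps * abs (g tau))"
   proof (rule integral_mono)
    fix x assume "x \<in> space (Leb s t)"
    then have x: "s <= x" "x <= t" by auto
    have "abs (y t - y x) < eps/2" "abs (y s - y x) < eps/2"
     using delta(2)[of x t] delta(2)[of x s] x st by (auto simp: dist_real_def)
    then have "abs (y t + y s - 2 * y x) <= eps" by linarith
    then have "abs (y t + y s - 2 * y x) * abs (g x) <= eps * abs (g x)" by (intro mult_right_mono) auto
    then show "abs ((y t + y s) * g x - 2 * y x * g x) <= eps * abs (g x)"
     by (simp add: abs_mult[symmetric] left_diff_distrib)
   qed (use gi in auto)
   also have "... = eps * (m t - m s)"
    using integral_interval_diff[OF gabs, of s t] st by (simp add: m_def)
   finally show "abs (D t - D s) <= eps * (m t - m s)" using eq by simp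
  qed
 qed
 have "c * D T <= c * D 0" if c: "c = 1 \<or> c = -1" for c
 proof (rule le_of_small_increments[OF T, where m=m])
  fix eps :: real assume "eps > 0"
  from key[OF this] obtain delta where d: "delta > 0" and
   k: "!!s t. 0 <= s & s <= t & t <= T & t - s < delta ==> \<bar>D t - D s\<bar> <= eps * (m t - m s)" by blast
  show "\<exists>delta>0. \<forall>s t. 0 <= s & s <= t & t <= T & t - s < delta --> c * D t - c * D s <= eps * (m t - m s)"
  proof (intro exI[of _ delta] conjI allI impI d)
   fix s t assume "0 <= s & s <= t & t <= T & t - s < delta"
   from k[OF this] have "D t - D s <= eps * (m t - m s)" "D s - D t <= eps * (m t - m s)" by linarith+
   with c show "c * D t - c * D s <= eps * (m t - m s)" by auto
  qed
 qed
 from this[of 1] this[of "-1"] have "D T = D 0" by auto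
 moreover have "D 0 = (y 0)^2"
 proof -
  have "(LINT tau|Leb 0 0. 2 * y tau * g tau) = integral {0..0} (%tau. 2 * y tau * g tau)"
   by (rule lebesgue_integral_eq_integral) (use integrable_subinterval[OF yg, of 0 0] T in auto)
  then show ?thesis by (simp add: D_def)
 qed
 ultimately show ?thesis by (simp add: D_def)
qed

lemma integral_point_zero [simp]: "(LINT tau|lebesgue_on {a::real}. f tau) = (0::real)"
 by (rule integral_eq_zero_null_sets) (auto simp: null_sets_restrict_space)

text \<open>The inequality is assumed between any two times, because the rate \<open>k\<close> may change sign: in the
  application it is \<open>- mu\<close> plus a nonnegative integrable function.\<close>

lemma gronwall:
 fixes E k :: "real => real"
 assumes T: "0 <= T" and Ec: "continuous_on {0..T} E" and E0: "!!t. 0 <= t ==> t <= T ==> 0 <= E t"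
  and k: "integrable (Leb 0 T) k"
  and E: "!!s t. 0 <= s ==> s <= t ==> t <= T ==> E t - E s <= (LINT tau|Leb s t. E tau * k tau)"
 shows "E T <= E 0 * exp (LINT tau|Leb 0 T. k tau)"
proof -
 define K where "K t = (LINT tau|Leb 0 t. k tau)" for t
 define m where "m t = (LINT tau|Leb 0 t. abs (k tau))" for t
 define W where "W t = E t * exp (- K t)" for t
 have kabs: "integrable (Leb 0 T) (%t. abs (k t))" using k by simp
 have Ek: "integrable (Leb 0 T) (%t. E t * k t)" by (rule integrable_mult_continuous[OF k Ec])
 have Kc: "continuous_on {0..T} K" unfolding K_def by (rule indefinite_integral_continuous_real[OF k])
 then have "continuous_on {0..T} (%t. exp (- K t))" by (intro continuous_intros)
 then obtain C where C0: "C > 0" and "!!t. t \<in> {0..T} ==> \<bar>exp (- K t)\<bar> <= C"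
  using continuous_interval_bound by metis
 then have C: "!!t. t \<in> {0..T} ==> exp (- K t) <= C" by simp
 have "W T <= W 0"
 proof (rule le_of_small_increments[OF T, where m=m])
  fix eps :: real assume e: "eps > 0"
  have "uniformly_continuous_on {0..T} E" using Ec compact_Icc by (rule compact_uniformly_continuous)
  then obtain delta where delta: "delta > 0" "!!s t. s \<in> {0..T} ==> t \<in> {0..T} ==> dist t s < delta ==> dist (E t) (E s) < eps/C"
   using e C0 unfolding uniformly_continuous_on_def by (metis divide_pos_pos)
  show "\<exists>delta>0. \<forall>s t. 0 <= s & s <= t & t <= T & t - s < delta --> W t - W s <= eps * (m t - m s)"
  proof (intro exI conjI allI impI)
   show "delta > 0" by fact
   fix s t assume st: "0 <= s & s <= t & t <= T & t - s < delta"
   have ki: "integrable (Leb s t) k" "integrable (Leb s t) (%t. E t * k t)"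
    "integrable (Leb s t) (%t. abs (k t))"
    using st by (blast intro: integrable_within[OF k] integrable_within[OF Ek] integrable_within[OF kabs])+
   have Kd: "K t - K s = (LINT tau|Leb s t. k tau)"
    using integral_interval_diff[OF k, of s t] st by (simp add: K_def)
   have md: "m t - m s = (LINT tau|Leb s t. abs (k tau))"
    using integral_interval_diff[OF kabs, of s t] st by (simp add: m_def)
   have "(LINT tau|Leb s t. E tau * k tau) <= (LINT tau|Leb s t. E s * k tau + eps/C * abs (k tau))"
   proof (rule integral_mono)
    fix x assume "x \<in> space (Leb s t)"
    then have x: "s <= x" "x <= t" by auto
    have "abs (E x - E s) <= eps/C" using delta(2)[of s x] x st by (auto simp: dist_real_def)
    then have "abs (E x - E s) * abs (k x) <= eps/C * abs (k x)" by (intro mult_right_mono) auto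
    moreover have "(E x - E s) * k x <= abs (E x - E s) * abs (k x)" by (metis abs_ge_self abs_mult)
    ultimately show "E x * k x <= E s * k x + eps/C * abs (k x)" by (simp add: algebra_simps)
   qed (use ki in auto)
   also have "... = E s * (K t - K s) + eps/C * (m t - m s)" using ki by (simp add: Kd md)
   finally have 1: "E t - E s <= E s * (K t - K s) + eps/C * (m t - m s)" using E[of s t] st by linarith
   have "W t - W s = exp (- K t) * (E t - E s * exp (K t - K s))"
    by (simp add: W_def exp_diff exp_minus field_simps)
   also have "... <= exp (- K t) * (E t - E s * (1 + (K t - K s)))"
    using E0[of s] st by (intro mult_left_mono diff_left_mono exp_ge_add_one_self) auto
   also have "... <= exp (- K t) * (eps/C * (m t - m s))"
    using 1 by (intro mult_left_mono) (auto simp: algebra_simps)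
   also have "... <= C * (eps/C * (m t - m s))"
   proof (intro mult_right_mono C)
    have "0 <= m t - m s" unfolding md by (rule integral_nonneg_AE) simp
    then show "0 <= eps/C * (m t - m s)" using e C0 by simp
   qed (use st in auto)
   also have "... = eps * (m t - m s)" using C0 by simp
   finally show "W t - W s <= eps * (m t - m s)" .
  qed
 qed
 then show ?thesis by (simp add: W_def K_def exp_minus field_simps)
qed

text \<open>The right-hand side of the assumption, with the integral up to \<open>t\<close>, satisfies the hypothesis of \<open>gronwall\<close>.\<close>

lemma gronwall_forced:
 fixes E k :: "real => real"
 assumes T: "0 <= T" and Ec: "continuous_on {0..T} E" and E0: "!!t. 0 <= t ==> t <= T ==> 0 <= E t"
  and k: "integrable (Leb 0 T) k" and k0: "!!t. 0 <= t ==> t <= T ==> 0 <= k t" and M: "0 <= M"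
  and E: "!!t. 0 <= t ==> t <= T ==> E t <= M + (LINT tau|Leb 0 t. E tau * k tau)"
 shows "E T <= M * exp (LINT tau|Leb 0 T. k tau)"
proof -
 define F where "F t = M + (LINT tau|Leb 0 t. E tau * k tau)" for t
 have Ek: "integrable (Leb 0 T) (%t. E t * k t)" by (rule integrable_mult_continuous[OF k Ec])
 have Fc: "continuous_on {0..T} F" unfolding F_def
  using indefinite_integral_continuous_real[OF Ek] by (intro continuous_intros)
 have EF: "E t <= F t" if "0 <= t" "t <= T" for t using E that by (simp add: F_def)
 have "F T <= F 0 * exp (LINT tau|Leb 0 T. k tau)"
 proof (rule gronwall[OF T Fc _ k])
  show "0 <= F t" if "0 <= t" "t <= T" for t using EF[OF that] E0[OF that] by linarith
  fix s t assume st: "0 <= s" "s <= t" "t <= T"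
  have Fk: "integrable (Leb 0 T) (%t. F t * k t)" by (rule integrable_mult_continuous[OF k Fc])
  have "F t - F s = (LINT tau|Leb s t. E tau * k tau)"
   using integral_interval_diff[OF Ek st] by (simp add: F_def)
  also have "... <= (LINT tau|Leb s t. F tau * k tau)"
  proof (rule integral_mono)
   show "E x * k x <= F x * k x" if "x \<in> space (Leb s t)" for x
    using that st by (intro mult_right_mono EF k0) auto
  qed (use st integrable_within[OF Ek] integrable_within[OF Fk] in auto)
  finally show "F t - F s <= ..." .
 qed
 then show ?thesis using EF[of T] T by (simp add: F_def)
qed

text \<open>Monotone convergence, with almost everywhere summability as part of the conclusion.\<close>

lemma monotone_series_integral:
 fixes f :: "nat => 'a => real"
 assumes i: "!!i. integrable M (f i)" and f0: "!!i x. x \<in> space M ==> 0 <= f i x"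
  and B: "!!r. (LINT x|M. (\<Sum>i<r. f i x)) <= B"
 shows "AE x in M. summable (%i. f i x)" "integrable M (%x. \<Sum>i. f i x)" "(LINT x|M. (\<Sum>i. f i x)) <= B"
  "(%i. LINT x|M. f i x) sums (LINT x|M. (\<Sum>i. f i x))"
proof -
 have sm: "summable (%i. LINT x|M. f i x)"
 proof (rule summableI_nonneg_bounded)
  show "0 <= (LINT x|M. f i x)" for i using f0 by (intro integral_nonneg_AE AE_I2) auto
  show "(\<Sum>i<n. LINT x|M. f i x) <= B" for n using B[of n] i by (subst (asm) Bochner_Integration.integral_sum) auto
 qed
 have "(\<integral>\<^sup>+x. (\<Sum>i. ennreal (f i x)) \<partial>M) = (\<Sum>i. \<integral>\<^sup>+x. ennreal (f i x) \<partial>M)"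
  using i by (intro nn_integral_suminf) auto
 also have "... = (\<Sum>i. ennreal (LINT x|M. f i x))"
  using i f0 by (intro suminf_cong nn_integral_eq_integral AE_I2) auto
 also have "... = ennreal (\<Sum>i. LINT x|M. f i x)"
  using sm f0 by (intro suminf_ennreal2) (auto intro!: integral_nonneg_AE)
 finally have "(\<integral>\<^sup>+x. (\<Sum>i. ennreal (f i x)) \<partial>M) ~= \<infinity>" by simp
 then have "AE x in M. (\<Sum>i. ennreal (f i x)) ~= \<infinity>"
  using i by (intro nn_integral_PInf_AE) (auto intro!: borel_measurable_suminf)
 then show ae: "AE x in M. summable (%i. f i x)"
 proof (rule AE_mp, intro AE_I2 impI)
  fix x assume "x \<in> space M" "(\<Sum>i. ennreal (f i x)) ~= \<infinity>"
  then show "summable (%i. f i x)" using f0 by (intro summable_suminf_not_top) auto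
 qed
 have ae': "AE x in M. summable (%i. norm (f i x))" 
  using ae by (rule AE_mp) (auto intro!: AE_I2 simp: f0)
 have sm': "summable (%i. LINT x|M. norm (f i x))"
 proof -
  have "(LINT x|M. norm (f i x)) = (LINT x|M. f i x)" for i
   using f0 by (intro Bochner_Integration.integral_cong) auto
  then show ?thesis using sm by simp
 qed
 show "integrable M (%x. \<Sum>i. f i x)" by (rule integrable_suminf[OF i ae' sm'])
 show s: "(%i. LINT x|M. f i x) sums (LINT x|M. (\<Sum>i. f i x))" by (rule sums_integral[OF i ae' sm'])
 have "(\<Sum>i<n. LINT x|M. f i x) <= B" for n using B[of n] i by (subst (asm) Bochner_Integration.integral_sum) auto
 then show "(LINT x|M. (\<Sum>i. f i x)) <= B" 
  using s unfolding sums_def by (intro LIMSEQ_le_const2[of _ _ B]) auto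
qed

section \<open>Weighted sequence spaces and trilinear forms\<close>
type_synonym seq = "nat => real"

definition wfin :: "seq => seq => bool" where
 "wfin om c \<longleftrightarrow> summable (%i. om i * (c i)^2)"

definition wsq :: "seq => seq => real" where
 "wsq om c = (\<Sum>i. om i * (c i)^2)"

definition wnorm :: "seq => seq => real" where
 "wnorm om c = sqrt (wsq om c)"

definition ip :: "seq => seq => real" where
 "ip a b = (\<Sum>i. a i * b i)"

definition trunc :: "nat => seq => nat => real" where
 "trunc n c = (%i. if i < n then c i else 0)"

definition unit :: "nat => nat => real" where
 "unit i = (%j. if j = i then 1 else 0)"

abbreviation one :: "nat => real" where "one \<equiv> %_. 1"

definition nonneg :: "seq => bool" where "nonneg om \<longleftrightarrow> (\<forall>i. 0 <= om i)"

lemma nonneg_one [simp]: "nonneg one" by (simp add: nonneg_def)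

lemma wsq_nonneg: "nonneg om ==> wfin om c ==> 0 <= wsq om c"
 unfolding wsq_def wfin_def nonneg_def by (rule suminf_nonneg) auto

lemma wnorm_nonneg: "nonneg om ==> wfin om c ==> 0 <= wnorm om c"
 by (simp add: wnorm_def wsq_nonneg)

lemma wnorm_sq: "nonneg om ==> wfin om c ==> (wnorm om c)^2 = wsq om c"
 by (simp add: wnorm_def wsq_nonneg)

lemma wsq_partial_le: "nonneg om ==> wfin om c ==> (\<Sum>i<n. om i * (c i)^2) <= wsq om c"
 unfolding wsq_def wfin_def nonneg_def by (rule sum_le_suminf) auto

lemma wfin_bounded:
 assumes "nonneg om" "!!n. (\<Sum>i<n. om i * (c i)^2) <= B"
 shows "wfin om c" "wsq om c <= B"
proof -
 show "wfin om c" unfolding wfin_def by (rule summableI_nonneg_bounded[where x=B]) (use assms in "auto simp: nonneg_def")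
 then show "wsq om c <= B" unfolding wfin_def wsq_def by (rule suminf_le_const) (rule assms)
qed

lemma wfin_mono:
 assumes "nonneg om" "nonneg om'" "wfin om' c" "!!i. om i <= K * om' i"
 shows "wfin om c" "wsq om c <= K * wsq om' c"
proof -
 have le: "om i * (c i)^2 <= K * (om' i * (c i)^2)" for i
  using mult_right_mono[OF assms(4), of "(c i)^2" i] by (simp add: mult.assoc)
 have s: "summable (%i. K * (om' i * (c i)^2))" using assms(3) unfolding wfin_def by (rule summable_mult)
 show f: "wfin om c" unfolding wfin_def
  by (rule summable_comparison_test'[OF s, of 0]) (use le assms(1) in "auto simp: nonneg_def")
 have "wsq om c <= (\<Sum>i. K * (om' i * (c i)^2))"
  unfolding wsq_def by (rule suminf_le[OF le]) (use f s in "auto simp: wfin_def")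
 also have "... = K * wsq om' c" using assms(3) unfolding wfin_def wsq_def by (rule suminf_mult)
 finally show "wsq om c <= K * wsq om' c" .
qed

lemma partial_L2_le_wnorm:
 assumes "nonneg om" "wfin om c"
 shows "L2_set (%i. sqrt (om i) * c i) {..<n} <= wnorm om c"
proof -
 have "(\<Sum>i<n. (sqrt (om i) * c i)^2) = (\<Sum>i<n. om i * (c i)^2)"
  using assms(1) by (simp add: power_mult_distrib nonneg_def)
 then show ?thesis unfolding L2_set_def wnorm_def using wsq_partial_le[OF assms] by simp
qed

lemma wfin_add:
 assumes "nonneg om" "wfin om a" "wfin om b"
 shows "wfin om (%i. a i + b i)" "wnorm om (%i. a i + b i) <= wnorm om a + wnorm om b"
proof -
 have B: "(\<Sum>i<n. om i * (a i + b i)^2) <= (wnorm om a + wnorm om b)^2" for n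
 proof -
  have "L2_set (%i. sqrt (om i) * (a i + b i)) {..<n}
    <= L2_set (%i. sqrt (om i) * a i) {..<n} + L2_set (%i. sqrt (om i) * b i) {..<n}"
   using L2_set_triangle_ineq[of "%i. sqrt (om i) * a i" "%i. sqrt (om i) * b i" "{..<n}"] by (simp add: distrib_left)
  also have "... <= wnorm om a + wnorm om b" using partial_L2_le_wnorm assms by (intro add_mono) auto
  finally have "(L2_set (%i. sqrt (om i) * (a i + b i)) {..<n})^2 <= (wnorm om a + wnorm om b)^2"
   by (intro power_mono) (auto simp: L2_set_nonneg)
  moreover have "(L2_set (%i. sqrt (om i) * (a i + b i)) {..<n})^2 = (\<Sum>i<n. om i * (a i + b i)^2)"
   using assms(1) by (simp add: L2_set_def sum_nonneg power_mult_distrib nonneg_def)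
  ultimately show ?thesis by simp
 qed
 show "wfin om (%i. a i + b i)" using wfin_bounded[OF assms(1) B] by blast
 have "wsq om (%i. a i + b i) <= (wnorm om a + wnorm om b)^2" using wfin_bounded[OF assms(1) B] by blast
 then show "wnorm om (%i. a i + b i) <= wnorm om a + wnorm om b"
  unfolding wnorm_def[of om "%i. a i + b i"] using wnorm_nonneg[OF assms(1,2)] wnorm_nonneg[OF assms(1,3)]
  by (intro real_le_lsqrt) auto
qed

lemma wfin_scale:
 assumes "wfin om a" shows "wfin om (%i. k * a i)" "wsq om (%i. k * a i) = k^2 * wsq om a"
  "wnorm om (%i. k * a i) = abs k * wnorm om a"
proof -
 have e: "om i * (k * a i)^2 = k^2 * (om i * (a i)^2)" for i by (simp add: power_mult_distrib)
 show "wfin om (%i. k * a i)" using assms unfolding wfin_def e by (rule summable_mult)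
 show q: "wsq om (%i. k * a i) = k^2 * wsq om a" using assms unfolding wfin_def wsq_def e by (rule suminf_mult)
 show "wnorm om (%i. k * a i) = abs k * wnorm om a" unfolding wnorm_def q by (simp add: real_sqrt_mult)
qed

lemma wfin_diff:
 assumes "nonneg om" "wfin om a" "wfin om b"
 shows "wfin om (%i. a i - b i)" "wnorm om (%i. a i - b i) <= wnorm om a + wnorm om b"
 using wfin_add[OF assms(1,2) wfin_scale(1)[OF assms(3), of "-1"]] wfin_scale(3)[OF assms(3), of "-1"]
 by (simp_all add: algebra_simps)

lemma wnorm_triangle_sub:
 assumes "nonneg om" "wfin om a" "wfin om b"
 shows "wnorm om a <= wnorm om b + wnorm om (%i. a i - b i)"
 using wfin_add(2)[OF assms(1,3) wfin_diff(1)[OF assms]] by simp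

lemma wnorm_diff_commute: "wnorm om (%i. a i - b i) = wnorm om (%i. b i - a i)"
 by (simp add: wnorm_def wsq_def power2_commute)

lemma wfin_support:
 assumes "!!i. i >= n ==> c i = 0"
 shows "wfin om c" "wsq om c = (\<Sum>i<n. om i * (c i)^2)"
proof -
 have z: "om i * (c i)^2 = 0" if "i \<notin> {..<n}" for i using assms that by simp
 show "wfin om c" unfolding wfin_def by (rule summable_finite[of "{..<n}"]) (simp, rule z)
 show "wsq om c = (\<Sum>i<n. om i * (c i)^2)" unfolding wsq_def by (rule suminf_finite) (simp, rule z)
qed

lemma wfin_trunc [simp]: "wfin om (trunc n c)" by (rule wfin_support(1)[of n]) (simp add: trunc_def)
lemma wsq_trunc: "wsq om (trunc n c) = (\<Sum>i<n. om i * (c i)^2)"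
 using wfin_support(2)[of n "trunc n c" om] by (simp add: trunc_def)

lemma wnorm_trunc_le: "nonneg om ==> wfin om c ==> wnorm om (trunc n c) <= wnorm om c"
 by (simp add: wnorm_def wsq_trunc wsq_partial_le)

lemma wfin_unit [simp]: "wfin om (unit i)" by (rule wfin_support(1)[of "Suc i"]) (simp add: unit_def)
lemma wsq_unit: "wsq om (unit i) = om i"
proof -
 have "wsq om (unit i) = (\<Sum>j<Suc i. om j * (unit i j)^2)" by (rule wfin_support(2)) (simp add: unit_def)
 also have "... = (\<Sum>j<Suc i. if j = i then om j else 0)" by (intro sum.cong) (auto simp: unit_def)
 finally show ?thesis by simp
qed

lemma wsq_tail:
 assumes "wfin om c"
 shows "wsq om (%i. c i - trunc n c i) = wsq om c - (\<Sum>i<n. om i * (c i)^2)"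
proof -
 have 1: "summable (%i. om i * (c i)^2)" "summable (%i. om i * (trunc n c i)^2)"
  using assms wfin_trunc[of om n c] unfolding wfin_def by auto
 have "wsq om (%i. c i - trunc n c i) = (\<Sum>i. om i * (c i)^2 - om i * (trunc n c i)^2)"
  unfolding wsq_def by (intro suminf_cong) (auto simp: trunc_def)
 also have "... = wsq om c - wsq om (trunc n c)" unfolding wsq_def by (rule suminf_diff[symmetric]) (use 1 in auto)
 finally show ?thesis by (simp add: wsq_trunc)
qed

lemma wnorm_tail_tendsto:
 assumes "wfin om c"
 shows "(%n. wnorm om (%i. c i - trunc n c i)) ----> 0"
proof -
 have "(%n. \<Sum>i<n. om i * (c i)^2) ----> wsq om c"
  using assms unfolding wfin_def wsq_def by (rule summable_LIMSEQ)
 then have "(%n. wsq om c - (\<Sum>i<n. om i * (c i)^2)) ----> wsq om c - wsq om c" by (intro tendsto_intros)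
 then have "(%n. sqrt (wsq om (%i. c i - trunc n c i))) ----> sqrt 0"
  unfolding wsq_tail[OF assms] by (intro tendsto_intros) simp
 then show ?thesis by (simp add: wnorm_def)
qed

lemma ip_summable:
 assumes "wfin one a" "wfin one b"
 shows "summable (%i. abs (a i * b i))" "summable (%i. a i * b i)" "(\<Sum>i. abs (a i * b i)) <= wnorm one a * wnorm one b"
  "abs (ip a b) <= wnorm one a * wnorm one b"
proof -
 have B: "(\<Sum>i<n. abs (a i * b i)) <= wnorm one a * wnorm one b" for n
 proof -
  have "(\<Sum>i<n. abs (a i * b i)) <= L2_set a {..<n} * L2_set b {..<n}"
   using L2_set_mult_ineq[of a b "{..<n}"] by (simp add: abs_mult)
  also have "... <= wnorm one a * wnorm one b"
   using partial_L2_le_wnorm[OF nonneg_one assms(1)] partial_L2_le_wnorm[OF nonneg_one assms(2)]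
   by (intro mult_mono) (auto simp: L2_set_nonneg wnorm_nonneg assms)
  finally show ?thesis .
 qed
 show s: "summable (%i. abs (a i * b i))" by (rule summableI_nonneg_bounded[OF _ B]) auto
 then show "summable (%i. a i * b i)" by (rule summable_rabs_cancel)
 show "(\<Sum>i. abs (a i * b i)) <= wnorm one a * wnorm one b" by (rule suminf_le_const[OF s B])
 with summable_rabs[OF s] show "abs (ip a b) <= wnorm one a * wnorm one b" unfolding ip_def by linarith
qed

lemma ip_diff_right: "wfin one a ==> wfin one b ==> wfin one c ==> ip a (%i. b i - c i) = ip a b - ip a c"
 unfolding ip_def by (subst suminf_diff) (auto intro: ip_summable simp: right_diff_distrib)

lemma ip_diff_left: "wfin one a ==> wfin one b ==> wfin one c ==> ip (%i. b i - c i) a = ip b a - ip c a"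
 unfolding ip_def by (subst suminf_diff) (auto intro: ip_summable simp: left_diff_distrib)

lemma ip_commute: "ip a b = ip b a" by (simp add: ip_def mult.commute)

lemma ip_scale: "wfin one a ==> wfin one b ==> ip (%i. k * a i) b = k * ip a b"
 unfolding ip_def by (subst suminf_mult[symmetric]) (auto intro: ip_summable simp: mult.assoc)

lemma ip_add_right: "wfin one a ==> wfin one b ==> wfin one c ==> ip a (%i. b i + c i) = ip a b + ip a c"
 unfolding ip_def by (subst suminf_add) (auto intro: ip_summable simp: distrib_left)

text \<open>Testing a functional with its own truncated coefficients shows that these are square summable.\<close>

lemma ip_bound_imp_wfin:
 assumes "!!n. \<bar>\<Sum>i<n. g i * g i\<bar> <= B * wnorm one (trunc n g)" "B >= 0"
 shows "wfin one g" "wnorm one g <= B"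
proof -
 have le: "(\<Sum>i<n. 1 * (g i)^2) <= B^2" for n
 proof -
  define S where "S = (\<Sum>i<n. (g i)^2)"
  have S0: "S >= 0" by (simp add: S_def sum_nonneg)
  have "S <= B * sqrt S" using assms(1)[of n] S0 by (simp add: wnorm_def wsq_trunc S_def power2_eq_square[symmetric])
  then have "sqrt S * sqrt S <= B * sqrt S" using S0 by simp
  then have "sqrt S <= B" using S0 assms(2) mult_right_le_imp_le[of "sqrt S" "sqrt S" B] by (cases "S = 0") auto
  then have "S <= B^2" using S0 real_sqrt_le_iff sqrt_le_D by blast
  then show ?thesis by (simp add: S_def)
 qed
 show "wfin one g" by (rule wfin_bounded(1)[OF nonneg_one le])
 have "wsq one g <= B^2" by (rule wfin_bounded(2)[OF nonneg_one le])
 then show "wnorm one g <= B" unfolding wnorm_def using assms(2) by (simp add: real_le_lsqrt)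
qed

definition tri :: "(nat => nat => nat => real) => nat => seq => seq => seq => real" where
 "tri theta n a b c = (\<Sum>i<n. \<Sum>j<n. \<Sum>l<n. a i * b j * c l * theta i j l)"

definition form :: "(nat => nat => nat => real) => seq => seq => seq => real" where
 "form theta a b c = lim (%n. tri theta n a b c)"

lemma tri_diff1: "tri theta n (%i. a i - a' i) b c = tri theta n a b c - tri theta n a' b c"
 by (simp add: tri_def sum_subtractf left_diff_distrib)
lemma tri_diff2: "tri theta n a (%i. b i - b' i) c = tri theta n a b c - tri theta n a b' c"
 by (simp add: tri_def sum_subtractf left_diff_distrib right_diff_distrib)
lemma tri_diff3: "tri theta n a b (%i. c i - c' i) = tri theta n a b c - tri theta n a b c'"
 by (simp add: tri_def sum_subtractf left_diff_distrib right_diff_distrib)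

lemma sum_trunc_gen:
 assumes "m <= n" shows "(\<Sum>i<n. trunc m a i * f i) = (\<Sum>i<m. a i * f i)"
proof -
 have "(\<Sum>i<n. trunc m a i * f i) = (\<Sum>i\<in>{..<m}. trunc m a i * f i)"
  by (rule sum.mono_neutral_right) (use assms in "auto simp: trunc_def")
 then show ?thesis by (simp add: trunc_def)
qed

lemma tri_trunc:
 assumes "m <= n" shows "tri theta n (trunc m a) (trunc m b) (trunc m c) = tri theta m a b c"
proof -
 have "tri theta n (trunc m a) (trunc m b) (trunc m c)
   = (\<Sum>i<n. trunc m a i * (\<Sum>j<n. trunc m b j * (\<Sum>l<n. trunc m c l * theta i j l)))"
  by (simp add: tri_def sum_distrib_left mult.assoc)
 also have "... = (\<Sum>i<m. a i * (\<Sum>j<m. b j * (\<Sum>l<m. c l * theta i j l)))"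
  using assms by (simp add: sum_trunc_gen)
 finally show ?thesis by (simp add: tri_def sum_distrib_left mult.assoc)
qed

text \<open>A bound for truncated sequences, uniform in the truncation, is all that is assumed; it lets the form
  be defined as a limit on the weighted spaces.\<close>

locale bounded_trilinear =
 fixes theta :: "nat => nat => nat => real" and om1 om2 om3 :: "nat => real" and C :: real
 assumes pos: "nonneg om1" "nonneg om2" "nonneg om3" "C >= 0"
  and tri_bound: "!!n a b c. abs (tri theta n a b c) <= C * wnorm om1 (trunc n a) * wnorm om2 (trunc n b) * wnorm om3 (trunc n c)"
begin

lemma tri_bound_full:
 assumes "wfin om1 a" "wfin om2 b" "wfin om3 c"
 shows "abs (tri theta n a b c) <= C * wnorm om1 a * wnorm om2 b * wnorm om3 c"
proof -
 have "C * wnorm om1 (trunc n a) * wnorm om2 (trunc n b) * wnorm om3 (trunc n c) <= C * wnorm om1 a * wnorm om2 b * wnorm om3 c"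
  using pos assms by (intro mult_mono wnorm_trunc_le mult_nonneg_nonneg wnorm_nonneg) auto
 with tri_bound[of n a b c] show ?thesis by linarith
qed

text \<open>The truncated forms are Cauchy, since a difference of two of them involves the tail of one of the arguments.\<close>

lemma form_tendsto:
 assumes a: "wfin om1 a" and b: "wfin om2 b" and c: "wfin om3 c"
 shows "(%n. tri theta n a b c) ----> form theta a b c"
proof -
 define r where "r m = C * wnorm om1 (%i. a i - trunc m a i) * wnorm om2 b * wnorm om3 c
  + C * wnorm om1 a * wnorm om2 (%i. b i - trunc m b i) * wnorm om3 c
  + C * wnorm om1 a * wnorm om2 b * wnorm om3 (%i. c i - trunc m c i)" for m
 have r: "r ----> C * 0 * wnorm om2 b * wnorm om3 c + C * wnorm om1 a * 0 * wnorm om3 c + C * wnorm om1 a * wnorm om2 b * 0"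
  unfolding r_def by (intro tendsto_intros wnorm_tail_tendsto assms)
 have d: "abs (tri theta n a b c - tri theta m a b c) <= r m" if "m <= n" for m n
 proof -
  let ?a = "trunc m a" and ?b = "trunc m b" and ?c = "trunc m c"
  have f: "wfin om1 (%i. a i - ?a i)" "wfin om2 (%i. b i - ?b i)" "wfin om3 (%i. c i - ?c i)"
   using pos assms by (auto intro: wfin_diff)
  have eq: "tri theta n a b c - tri theta m a b c = tri theta n (%i. a i - ?a i) b c + tri theta n ?a (%i. b i - ?b i) c + tri theta n ?a ?b (%i. c i - ?c i)"
   by (simp add: tri_diff1 tri_diff2 tri_diff3 tri_trunc[OF that])
  have "abs (tri theta n a b c - tri theta m a b c) <= C * wnorm om1 (%i. a i - ?a i) * wnorm om2 b * wnorm om3 c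
   + C * wnorm om1 ?a * wnorm om2 (%i. b i - ?b i) * wnorm om3 c + C * wnorm om1 ?a * wnorm om2 ?b * wnorm om3 (%i. c i - ?c i)"
   unfolding eq using tri_bound_full[OF f(1) b c, of n] tri_bound_full[OF _ f(2) c, of ?a n] tri_bound_full[OF _ _ f(3), of ?a ?b n]
   by (simp add: abs_le_iff)
  also have "... <= r m"
  proof -
   have ta: "wnorm om1 ?a <= wnorm om1 a" and tb: "wnorm om2 ?b <= wnorm om2 b" 
    by (rule wnorm_trunc_le[OF pos(1) a], rule wnorm_trunc_le[OF pos(2) b])
   have n: "0 <= wnorm om1 ?a" "0 <= wnorm om2 ?b" "0 <= wnorm om2 b" "0 <= wnorm om3 c" "0 <= wnorm om1 a"
    "0 <= wnorm om2 (%i. b i - ?b i)" "0 <= wnorm om3 (%i. c i - ?c i)"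
    by (intro wnorm_nonneg pos f a b c wfin_trunc)+
   have ab: "wnorm om1 ?a * wnorm om2 ?b <= wnorm om1 a * wnorm om2 b" by (rule mult_mono[OF ta tb n(5) n(2)])
   have "C * wnorm om1 ?a * wnorm om2 (%i. b i - ?b i) * wnorm om3 c <= C * wnorm om1 a * wnorm om2 (%i. b i - ?b i) * wnorm om3 c"
    by (intro mult_right_mono mult_left_mono ta pos n)
   moreover have "C * (wnorm om1 ?a * wnorm om2 ?b) * wnorm om3 (%i. c i - ?c i) <= C * (wnorm om1 a * wnorm om2 b) * wnorm om3 (%i. c i - ?c i)"
    by (intro mult_right_mono mult_left_mono ab pos n)
   ultimately show ?thesis unfolding r_def mult.assoc by linarith
  qed
  finally show ?thesis .
 qed
 have "Cauchy (%n. tri theta n a b c)"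
 proof (rule metric_CauchyI)
  fix e :: real assume e: "0 < e"
  with r have "\<forall>\<^sub>F m in sequentially. dist (r m) 0 < e/2" by (intro tendstoD) auto
  then obtain M where M: "!!m. m >= M ==> \<bar>r m\<bar> < e/2" unfolding eventually_sequentially by auto
  show "\<exists>M. \<forall>m\<ge>M. \<forall>n\<ge>M. dist (tri theta m a b c) (tri theta n a b c) < e"
  proof (intro exI allI impI)
   fix m n assume mn: "m >= M" "n >= M"
   have "abs (tri theta m a b c - tri theta M a b c) < e/2" "abs (tri theta n a b c - tri theta M a b c) < e/2"
    using d[OF mn(1)] d[OF mn(2)] M[of M] by linarith+
   then show "dist (tri theta m a b c) (tri theta n a b c) < e" unfolding dist_real_def by linarith
  qed
 qed
 then show ?thesis unfolding form_def by (simp add: Cauchy_convergent convergent_LIMSEQ_iff[symmetric])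
qed

lemma form_bound:
 assumes "wfin om1 a" "wfin om2 b" "wfin om3 c"
 shows "abs (form theta a b c) <= C * wnorm om1 a * wnorm om2 b * wnorm om3 c"
 by (rule LIMSEQ_le_const2[OF tendsto_rabs[OF form_tendsto[OF assms]]]) (use tri_bound_full[OF assms] in auto)

lemma form_diff1:
 assumes "wfin om1 a" "wfin om1 a'" "wfin om2 b" "wfin om3 c"
 shows "form theta (%i. a i - a' i) b c = form theta a b c - form theta a' b c"
 by (rule LIMSEQ_unique[OF form_tendsto]) (use assms pos wfin_diff(1) in "auto simp: tri_diff1 intro!: tendsto_diff form_tendsto")

lemma form_diff2:
 assumes "wfin om1 a" "wfin om2 b" "wfin om2 b'" "wfin om3 c"
 shows "form theta a (%i. b i - b' i) c = form theta a b c - form theta a b' c"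
 by (rule LIMSEQ_unique[OF form_tendsto]) (use assms pos wfin_diff(1) in "auto simp: tri_diff2 intro!: tendsto_diff form_tendsto")

lemma form_diff3:
 assumes "wfin om1 a" "wfin om2 b" "wfin om3 c" "wfin om3 c'"
 shows "form theta a b (%i. c i - c' i) = form theta a b c - form theta a b c'"
 by (rule LIMSEQ_unique[OF form_tendsto]) (use assms pos wfin_diff(1) in "auto simp: tri_diff3 intro!: tendsto_diff form_tendsto")

lemma form_scale3:
 assumes "wfin om1 a" "wfin om2 b" "wfin om3 c"
 shows "form theta a b (%i. k * c i) = k * form theta a b c"
proof (rule LIMSEQ_unique[OF form_tendsto])
 have "tri theta n a b (%i. k * c i) = k * tri theta n a b c" for n
  by (simp add: tri_def sum_distrib_left mult.assoc mult.left_commute)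
 then show "(%n. tri theta n a b (%i. k * c i)) ----> k * form theta a b c"
  by (auto intro!: tendsto_mult form_tendsto assms)
qed (use assms wfin_scale in auto)

lemma form_trunc3:
 assumes a: "wfin om1 a" and b: "wfin om2 b"
 shows "form theta a b (trunc n c) = (\<Sum>i<n. c i * form theta a b (unit i))"
proof (induction n)
 case 0
 have "trunc 0 c = (%i. 0 * unit 0 i)" by (auto simp: trunc_def)
 with form_scale3[OF a b, of "unit 0" 0] show ?case by simp
next
 case (Suc n)
 have e: "trunc (Suc n) c = (%i. trunc n c i - (- c n) * unit n i)"
  by (auto simp: trunc_def unit_def fun_eq_iff less_Suc_eq)
 show ?case unfolding e
  using form_diff3[OF a b wfin_trunc[of _ n c] wfin_scale(1)[where k="- c n", OF wfin_unit[of _ n]]]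
  unfolding form_scale3[OF a b wfin_unit] Suc by simp
qed

lemma form_expand3:
 assumes a: "wfin om1 a" and b: "wfin om2 b" and c: "wfin om3 c"
 shows "(%i. c i * form theta a b (unit i)) sums form theta a b c"
proof -
 have "(%n. form theta a b c - form theta a b (trunc n c)) ----> 0"
 proof (rule Lim_null_comparison)
  show "\<forall>\<^sub>F n in sequentially. norm (form theta a b c - form theta a b (trunc n c)) <= C * wnorm om1 a * wnorm om2 b * wnorm om3 (%i. c i - trunc n c i)"
   using form_bound[OF a b wfin_diff(1)[OF pos(3) c wfin_trunc]] form_diff3[OF a b c wfin_trunc]
   by (intro always_eventually allI) simp
  have "(%n. C * wnorm om1 a * wnorm om2 b * wnorm om3 (%i. c i - trunc n c i)) ----> C * wnorm om1 a * wnorm om2 b * 0"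
   by (intro tendsto_intros wnorm_tail_tendsto c)
  then show "(%n. C * wnorm om1 a * wnorm om2 b * wnorm om3 (%i. c i - trunc n c i)) ----> 0" by simp
 qed
 then have "(%n. form theta a b c - (form theta a b c - form theta a b (trunc n c))) ----> form theta a b c - 0"
  by (intro tendsto_intros)
 then show ?thesis by (simp add: sums_def form_trunc3[OF a b])
qed

end

section \<open>The nudged system in mode space\<close>
text \<open>The eigenvalues \<open>lam\<close> of the Stokes operator, the coefficients \<open>theta\<close> of the bilinear term and the
  estimates that the analysis uses. The bound with \<open>C\<close> defines the form on the weighted
  spaces; the rate of decay comes from the one with \<open>k3\<close>.\<close>

locale alpha_modes =
 fixes lam :: "nat => real" and theta :: "nat => nat => nat => real" and l1 nu alpha k3 C :: real
 assumes l1: "0 < l1" "!!i. l1 <= lam i"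
  and lam_at_top: "filterlim lam at_top sequentially"
  and nu: "0 < nu" and alpha: "0 < alpha" and k3: "0 < k3" and C: "0 <= C"
  and antisym: "!!i j l. theta i j l = - theta l j i"
  and tri_bound: "!!n a b c. abs (tri theta n a b c) <= C * wnorm lam (trunc n a) * wnorm one (trunc n b) * wnorm (%i. (lam i)^2) (trunc n c)"
  and form_k3: "!!u v w. wfin (%i. (lam i)^2) u ==> wfin one v ==> wfin lam w ==>
    \<bar>form theta u v w\<bar> <= k3 * (sqrt (wnorm lam u) * sqrt (wnorm (%i. (lam i)^2) u) * wnorm one v * wnorm lam w
    + wnorm (%i. (lam i)^2) u * wnorm one v * sqrt (wnorm one w) * sqrt (wnorm lam w))"
begin

abbreviation lam2 :: "nat => real" where "lam2 \<equiv> %i. (lam i)^2"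
abbreviation "D0 \<equiv> wfin one"
abbreviation "D1 \<equiv> wfin lam"
abbreviation "D2 \<equiv> wfin lam2"
abbreviation "n0 \<equiv> wnorm one"
abbreviation "n1 \<equiv> wnorm lam"
abbreviation "n2 \<equiv> wnorm lam2"
abbreviation "beta \<equiv> form theta"
abbreviation "hw i \<equiv> 1 + alpha^2 * lam i"
abbreviation "k8 \<equiv> 8 * k3^2 / (sqrt l1 * nu)"

text \<open>\<open>en\<close> is the energy, \<open>dis\<close> the dissipation, and \<open>hel\<close> multiplies by the symbol of \<open>I + alpha^2 A\<close>.\<close>

definition en :: "seq => real" where "en c = (n0 c)^2 + alpha^2 * (n1 c)^2"
definition dis :: "seq => real" where "dis c = (n1 c)^2 + alpha^2 * (n2 c)^2"
definition hel :: "seq => nat => real" where "hel c = (%i. hw i * c i)"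

lemma lam_pos: "0 < lam i" using l1(1) l1(2)[of i] by linarith
lemma nn [simp]: "nonneg lam" "nonneg lam2"
 using lam_pos by (auto simp: nonneg_def less_imp_le)

lemma hel_pos: "0 < 1 + alpha^2 * lam i" using lam_pos[of i] alpha by (simp add: add_pos_pos)

lemma D2_D1: assumes "D2 c" shows "D1 c" "l1 * (n1 c)^2 <= (n2 c)^2"
proof -
 have le: "lam i <= (1/l1) * lam2 i" for i
  using mult_right_mono[OF l1(2)[of i], of "lam i"] lam_pos[of i] l1(1) by (simp add: field_simps power2_eq_square)
 show "D1 c" by (rule wfin_mono(1)[OF nn assms le])
 then show "l1 * (n1 c)^2 <= (n2 c)^2"
  using wfin_mono(2)[OF nn assms le] assms l1(1) by (simp add: wnorm_sq field_simps)
qed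

lemma D1_D0: assumes "D1 c" shows "D0 c" "l1 * (n0 c)^2 <= (n1 c)^2"
proof -
 have le: "one i <= (1/l1) * lam i" for i using l1(1) l1(2)[of i] by (simp add: field_simps)
 show "D0 c" by (rule wfin_mono(1)[OF nonneg_one nn(1) assms le])
 then show "l1 * (n0 c)^2 <= (n1 c)^2"
  using wfin_mono(2)[OF nonneg_one nn(1) assms le] assms l1(1) by (simp add: wnorm_sq field_simps)
qed

lemma D2_D0: "D2 c ==> D0 c" using D2_D1 D1_D0 by blast

lemma n_nonneg: "D0 c ==> 0 <= n0 c" "D1 c ==> 0 <= n1 c" "D2 c ==> 0 <= n2 c"
 by (auto intro: wnorm_nonneg)

lemma n1_le: "D2 c ==> n1 c <= n2 c / sqrt l1"
proof -
 assume c: "D2 c"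
 have "sqrt (l1 * (n1 c)^2) <= sqrt ((n2 c)^2)" using D2_D1(2)[OF c] by (rule real_sqrt_le_mono)
 then have "sqrt l1 * n1 c <= n2 c" using n_nonneg c D2_D1(1)[OF c] by (simp add: real_sqrt_mult)
 then show ?thesis using l1(1) by (simp add: field_simps)
qed

lemma n0_le: "D1 c ==> n0 c <= n1 c / sqrt l1"
proof -
 assume c: "D1 c"
 have "sqrt (l1 * (n0 c)^2) <= sqrt ((n1 c)^2)" using D1_D0(2)[OF c] by (rule real_sqrt_le_mono)
 then have "sqrt l1 * n0 c <= n1 c" using n_nonneg c D1_D0(1)[OF c] by (simp add: real_sqrt_mult)
 then show ?thesis using l1(1) by (simp add: field_simps)
qed

lemma en_nonneg: "0 <= en c" and dis_nonneg: "0 <= dis c" by (simp_all add: en_def dis_def)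

lemma lam_scale: assumes "D2 c" shows "D0 (%i. lam i * c i)" "n0 (%i. lam i * c i) = n2 c"
proof -
 have e: "one i * (lam i * c i)^2 = lam2 i * (c i)^2" for i by (simp add: power_mult_distrib)
 show "D0 (%i. lam i * c i)" using assms unfolding wfin_def e .
 show "n0 (%i. lam i * c i) = n2 c" unfolding wnorm_def wsq_def e ..
qed

lemma hel_eq: "hel c = (%i. c i + alpha^2 * (lam i * c i))" by (auto simp: hel_def algebra_simps)

lemma hel_D0: assumes "D2 c" shows "D0 (hel c)"
 unfolding hel_eq using wfin_add(1)[OF nonneg_one D2_D0[OF assms] wfin_scale(1)[OF lam_scale(1)[OF assms], of "alpha^2"]] .

lemma ip_lam: assumes "D2 c" shows "ip c (%i. lam i * c i) = (n1 c)^2"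
 unfolding wnorm_sq[OF nn(1) D2_D1(1)[OF assms]] ip_def wsq_def by (simp add: power2_eq_square mult.left_commute)

lemma ip_self: "D0 c ==> ip c c = (n0 c)^2"
 unfolding wnorm_sq[OF nonneg_one] ip_def wsq_def by (simp add: power2_eq_square)

lemma ip_hel: assumes "D2 c" shows "ip c (hel c) = en c"
proof -
 note d = D2_D0[OF assms] lam_scale(1)[OF assms]
 have "ip c (hel c) = ip c c + ip c (%i. alpha^2 * (lam i * c i))"
  unfolding hel_eq by (rule ip_add_right[OF d(1) d(1) wfin_scale(1)[OF d(2)]])
 also have "ip c (%i. alpha^2 * (lam i * c i)) = alpha^2 * ip c (%i. lam i * c i)"
  using ip_scale[OF d(2,1), of "alpha^2"] by (simp add: ip_commute)
 finally show ?thesis by (simp add: ip_self d ip_lam assms en_def)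
qed

lemma ip_lam_hel: assumes "D2 c" shows "ip (%i. lam i * c i) (hel c) = dis c"
proof -
 note d = D2_D0[OF assms] lam_scale(1)[OF assms]
 have "ip (%i. lam i * c i) (hel c) = ip (%i. lam i * c i) c + ip (%i. lam i * c i) (%i. alpha^2 * (lam i * c i))"
  unfolding hel_eq by (rule ip_add_right[OF d(2) d(1) wfin_scale(1)[OF d(2)]])
 also have "ip (%i. lam i * c i) (%i. alpha^2 * (lam i * c i)) = alpha^2 * ip (%i. lam i * c i) (%i. lam i * c i)"
  using ip_scale[OF d(2,2), of "alpha^2"] by (simp add: ip_commute)
 finally show ?thesis using ip_lam[OF assms] by (simp add: ip_self[OF d(2)] lam_scale(2) assms dis_def ip_commute)
qed

lemma hel_norm: assumes "D2 c" shows "(n0 (hel c))^2 = en c + alpha^2 * dis c"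
proof -
 note d = D2_D0[OF assms] lam_scale(1)[OF assms]
 have "(n0 (hel c))^2 = ip (hel c) (hel c)" by (simp add: ip_self hel_D0 assms)
 also have "... = ip (hel c) c + ip (hel c) (%i. alpha^2 * (lam i * c i))"
  using ip_add_right[OF hel_D0[OF assms] d(1) wfin_scale(1)[OF d(2)], of "alpha^2"] by (simp only: hel_eq[symmetric])
 also have "ip (hel c) (%i. alpha^2 * (lam i * c i)) = alpha^2 * ip (%i. lam i * c i) (hel c)"
  using ip_scale[OF d(2) hel_D0[OF assms], of "alpha^2"] by (simp add: ip_commute)
 finally show ?thesis using ip_hel[OF assms] ip_lam_hel[OF assms] by (simp add: ip_commute)
qed

lemma hel_norm_le: assumes "D2 c" shows "n0 (hel c) <= (1/l1 + alpha^2) * n2 c"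
proof -
 have "n0 (hel c) <= n0 c + n0 (%i. alpha^2 * (lam i * c i))"
  unfolding hel_eq by (rule wfin_add(2)[OF nonneg_one D2_D0[OF assms] wfin_scale(1)[OF lam_scale(1)[OF assms]]])
 also have "n0 (%i. alpha^2 * (lam i * c i)) = alpha^2 * n2 c" by (simp add: wfin_scale lam_scale assms)
 also have "n0 c <= n2 c / l1"
 proof -
  have "n0 c <= n1 c / sqrt l1" by (rule n0_le[OF D2_D1(1)[OF assms]])
  also have "... <= (n2 c / sqrt l1) / sqrt l1" using n1_le[OF assms] l1(1) by (intro divide_right_mono) auto
  also have "... = n2 c / l1" using l1(1) by simp
  finally show ?thesis .
 qed
 finally show ?thesis by (simp add: algebra_simps)
qed

lemma tri_antisym: "tri theta n a b c = - tri theta n c b a"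
proof -
 have "tri theta n a b c = (\<Sum>l<n. \<Sum>j<n. \<Sum>i<n. a i * b j * c l * theta i j l)"
  unfolding tri_def by (subst sum.swap, subst (2) sum.swap, subst sum.swap, rule refl) 
 also have "... = (\<Sum>l<n. \<Sum>j<n. \<Sum>i<n. - (c l * b j * a i * theta l j i))"
  by (intro sum.cong refl) (subst antisym, simp)
 finally show ?thesis by (simp add: tri_def sum_negf)
qed

text \<open>The form is bounded on \<open>V \<times> H \<times> D(A)\<close> and, by antisymmetry, on \<open>D(A) \<times> H \<times> V\<close>.\<close>

sublocale VH: bounded_trilinear theta lam one lam2 C
 by unfold_locales (use C tri_bound in auto)

sublocale DH: bounded_trilinear theta lam2 one lam C
proof unfold_locales
 show "abs (tri theta n a b c) <= C * n2 (trunc n a) * n0 (trunc n b) * n1 (trunc n c)" for n a b c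
  using tri_bound[of n c b a] by (subst tri_antisym) (simp add: mult_ac)
qed (use C in auto)

lemma form_cancel: assumes "D2 u" "D0 v" shows "beta u v u = 0"
proof -
 have "(%n. tri theta n u v u) ----> beta u v u" by (rule DH.form_tendsto) (use assms D2_D1 in auto)
 moreover have "tri theta n u v u = 0" for n using tri_antisym[of n u v u] by simp
 ultimately show ?thesis by (simp add: LIMSEQ_const_iff)
qed

lemma form_k3': assumes "D2 u" "D0 v" "D1 w"
 shows "abs (beta u v w) <= 2 * k3 / sqrt (sqrt l1) * n2 u * n0 v * n1 w"
proof -
 let ?q = "sqrt (sqrt l1)"
 note n = n_nonneg(1)[OF assms(2)] n_nonneg(2)[OF assms(3)] n_nonneg(3)[OF assms(1)] n_nonneg(1)[OF D1_D0(1)[OF assms(3)]]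
 have q: "?q > 0" using l1 by simp
 have "sqrt (n1 u) * sqrt (n2 u) <= (sqrt (n2 u) / ?q) * sqrt (n2 u)"
  using real_sqrt_le_mono[OF n1_le[OF assms(1)]] n by (intro mult_right_mono) (auto simp: real_sqrt_divide)
 then have 1: "sqrt (n1 u) * sqrt (n2 u) <= n2 u / ?q" using n by simp
 have "sqrt (n0 w) * sqrt (n1 w) <= (sqrt (n1 w) / ?q) * sqrt (n1 w)"
  using real_sqrt_le_mono[OF n0_le[OF assms(3)]] n by (intro mult_right_mono) (auto simp: real_sqrt_divide)
 then have 2: "sqrt (n0 w) * sqrt (n1 w) <= n1 w / ?q" using n by simp
 have A: "sqrt (n1 u) * sqrt (n2 u) * (n0 v * n1 w) <= n2 u / ?q * (n0 v * n1 w)"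
  by (intro mult_right_mono 1 mult_nonneg_nonneg n)
 have B: "n2 u * n0 v * (sqrt (n0 w) * sqrt (n1 w)) <= n2 u * n0 v * (n1 w / ?q)"
  by (intro mult_left_mono 2 mult_nonneg_nonneg n)
 have "sqrt (n1 u) * sqrt (n2 u) * n0 v * n1 w + n2 u * n0 v * sqrt (n0 w) * sqrt (n1 w) <= 2 * (n2 u * n0 v * n1 w / ?q)"
  using add_mono[OF A B] by (simp add: mult_ac)
 then have "k3 * (sqrt (n1 u) * sqrt (n2 u) * n0 v * n1 w + n2 u * n0 v * sqrt (n0 w) * sqrt (n1 w)) <= k3 * (2 * (n2 u * n0 v * n1 w / ?q))"
  using k3 by (intro mult_left_mono) auto
 with form_k3[OF assms] show ?thesis by (simp add: mult_ac)
qed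

text \<open>Both products in the bound with \<open>k3\<close> are split by Young's inequality into a part absorbed by the
  viscosity and a part proportional to \<open>|A x|^2\<close> times the energy of \<open>d\<close>.\<close>

lemma form_en_dis: assumes x: "D2 x" and d: "D2 d"
 shows "2 * abs (beta x (hel d) d) <= nu * dis d + k8 * (n2 x)^2 * en d"
proof -
 note n = n_nonneg(1)[OF hel_D0[OF d]] n_nonneg(2)[OF D2_D1(1)[OF d]] n_nonneg(3)[OF x]
 define b where "b = abs (beta x (hel d) d)"
 define K where "K = 2 * k3 / sqrt (sqrt l1)"
 have b0: "b >= 0" by (simp add: b_def)
 have K2: "K^2 = 4 * k3^2 / sqrt l1" using l1 by (simp add: K_def power_divide power_mult_distrib)
 have K0: "0 <= K" using k3 l1 by (simp add: K_def)
 have y: "(n1 d)^2 <= dis d" "alpha^2 * (n1 d)^2 <= en d" by (simp_all add: dis_def en_def)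
 have "(n0 (hel d) * n1 d)^2 = en d * (n1 d)^2 + dis d * (alpha^2 * (n1 d)^2)"
  by (simp add: power_mult_distrib hel_norm[OF d] algebra_simps)
 also have "... <= en d * dis d + dis d * en d"
  by (intro add_mono mult_left_mono y en_nonneg dis_nonneg)
 finally have P: "(n0 (hel d) * n1 d)^2 <= 2 * (en d * dis d)" by (simp add: mult.commute)
 have "b <= K * n2 x * (n0 (hel d) * n1 d)"
  using form_k3'[OF x hel_D0[OF d] D2_D1(1)[OF d]] by (simp add: b_def K_def mult.assoc)
 then have "b^2 <= (K * n2 x * (n0 (hel d) * n1 d))^2" using b0 by (intro power_mono)
 also have "... = K^2 * (n2 x)^2 * (n0 (hel d) * n1 d)^2" by (simp add: power_mult_distrib)
 also have "... <= K^2 * (n2 x)^2 * (2 * (en d * dis d))" using P by (intro mult_left_mono) auto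
 finally have b2: "b^2 <= 8 * k3^2 / sqrt l1 * (n2 x)^2 * (en d * dis d)" by (simp add: K2)
 define S where "S = k8 * (n2 x)^2 * en d"
 have S0: "0 <= S" using l1 nu en_nonneg by (simp add: S_def)
 have b3: "b^2 <= (nu * dis d) * S" using b2 nu by (simp add: S_def field_simps)
 have "(2*b)^2 <= (nu * dis d + S)^2"
 proof -
  have "4 * ((nu * dis d) * S) <= (nu * dis d + S)^2"
   using zero_le_power2[of "nu * dis d - S"] by (simp add: power2_sum power2_diff mult_ac)
  then show ?thesis using b3 by (simp add: power_mult_distrib)
 qed
 then have "2 * b <= nu * dis d + S" by (rule power2_le_imp_le) (use nu dis_nonneg S0 in auto)
 then show ?thesis by (simp add: b_def S_def)
qed

end

text \<open>\<open>R\<close> is the interpolation operator on coefficients, and \<open>rho\<close> stands for \<open>c1 * h\<close>: the assumption on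
  \<open>mu * rho^2\<close> expresses that \<open>h\<close> is small.\<close>

locale nudged_modes = alpha_modes +
 fixes mu rho :: real and R :: "seq => nat => real"
 assumes mu: "0 < mu" and rho: "0 <= rho" "mu * rho^2 <= nu / 2"
  and R_D0: "!!c. D1 c ==> D0 (R c)"
  and R_add: "!!a b. D1 a ==> D1 b ==> R (%i. a i + b i) = (%i. R a i + R b i)"
  and R_scale: "!!a k. D1 a ==> R (%i. k * a i) = (%i. k * R a i)"
  and R_near: "!!c. D1 c ==> n0 (%i. c i - R c i) <= rho * n1 c"
begin

lemma R_diff: assumes "D1 a" "D1 b" shows "R (%i. a i - b i) = (%i. R a i - R b i)"
 using R_add[OF assms(1) wfin_scale(1)[OF assms(2)], of "-1"] R_scale[OF assms(2), of "-1"] by simp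

definition CR :: real where "CR = 1 / sqrt l1 + rho"

lemma CR_nonneg: "0 <= CR" using l1 rho by (simp add: CR_def)

lemma R_bound: assumes "D1 c" shows "n0 (R c) <= CR * n1 c"
proof -
 have "n0 (R c) <= n0 c + n0 (%i. R c i - c i)"
  by (rule wnorm_triangle_sub[OF nonneg_one R_D0[OF assms] D1_D0(1)[OF assms]])
 also have "... <= n1 c / sqrt l1 + rho * n1 c"
  using n0_le[OF assms] R_near[OF assms] wnorm_diff_commute[of one c "R c"] by simp
 finally show ?thesis by (simp add: CR_def algebra_simps)
qed

text \<open>If \<open>R\<close> were the identity, the nudging would give \<open>mu * en d\<close>. The defect \<open>d - R d\<close> is at most \<open>rho\<close> times
  the norm in \<open>V\<close>, and costs half of this and a quarter of the viscous dissipation.\<close>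

lemma nudge_coercive: assumes d: "D2 d"
 shows "mu / 2 * en d - nu / 4 * dis d <= mu * ip (R d) (hel d)"
proof -
 note d1 = D2_D1(1)[OF d] and d0 = D2_D0[OF d] and dl = lam_scale[OF d]
 define r where "r = (%i. d i - R d i)"
 have r0: "D0 r" unfolding r_def by (rule wfin_diff(1)[OF nonneg_one d0 R_D0[OF d1]])
 have rn: "n0 r <= rho * n1 d" unfolding r_def by (rule R_near[OF d1])
 note nn0 = n_nonneg(1)[OF d0] n_nonneg(2)[OF d1] n_nonneg(3)[OF d] n_nonneg(1)[OF r0]
 have "ip (R d) (hel d) = ip d (hel d) - ip r (hel d)"
  using ip_diff_left[OF hel_D0[OF d] d0 R_D0[OF d1]] by (simp add: r_def)
 then have 1: "ip (R d) (hel d) = en d - ip r (hel d)" by (simp add: ip_hel d)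
 have "ip r (hel d) = ip r d + ip r (%i. alpha^2 * (lam i * d i))"
  unfolding hel_eq by (rule ip_add_right[OF r0 d0 wfin_scale(1)[OF dl(1)]])
 also have "... = ip r d + alpha^2 * ip r (%i. lam i * d i)" using ip_scale[OF dl(1) r0, of "alpha^2"] by (simp add: ip_commute)
 also have "... <= n0 r * n0 d + alpha^2 * (n0 r * n2 d)"
  using ip_summable(4)[OF r0 d0] ip_summable(4)[OF r0 dl(1)] dl(2) by (intro add_mono mult_left_mono) auto
 also have "... <= (rho * n1 d) * n0 d + alpha^2 * ((rho * n1 d) * n2 d)"
  by (intro add_mono mult_left_mono mult_right_mono rn nn0) auto
 finally have 2: "ip r (hel d) <= rho * n1 d * n0 d + alpha^2 * (rho * n1 d * n2 d)" by simp
 have am: "a * b <= (a^2 + b^2) / 2" for a b :: real using zero_le_power2[of "a - b"] by (simp add: power2_diff)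
 have A: "rho * n1 d * n0 d <= (rho^2 * (n1 d)^2 + (n0 d)^2) / 2" using am[of "rho * n1 d" "n0 d"] by (simp add: power_mult_distrib)
 have B: "rho * n1 d * n2 d <= (rho^2 * (n2 d)^2 + (n1 d)^2) / 2" using am[of "rho * n2 d" "n1 d"] by (simp add: power_mult_distrib mult_ac)
 have "ip r (hel d) <= (rho^2 * (n1 d)^2 + (n0 d)^2) / 2 + alpha^2 * ((rho^2 * (n2 d)^2 + (n1 d)^2) / 2)"
  using 2 A mult_left_mono[OF B zero_le_power2[of alpha]] by linarith
 also have "... = en d / 2 + rho^2 * dis d / 2" by (simp add: en_def dis_def field_simps)
 finally have "mu * ip r (hel d) <= mu * (en d / 2 + rho^2 * dis d / 2)" using mu by (intro mult_left_mono) auto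
 also have "... = mu / 2 * en d + (mu * rho^2) * dis d / 2" by (simp add: algebra_simps)
 also have "... <= mu / 2 * en d + (nu / 2) * dis d / 2"
  using mult_right_mono[OF rho(2) dis_nonneg[of d]] by (simp add: mult_ac)
 finally show ?thesis by (simp add: 1 algebra_simps)
qed

lemma key_estimate: assumes x: "D2 x" and d: "D2 d"
 shows "- 2 * nu * dis d - 2 * beta x (hel d) d - 2 * mu * ip (R d) (hel d)
  <= - nu / 2 * dis d + (- mu + k8 * (n2 x)^2) * en d"
 using form_en_dis[OF x d] nudge_coercive[OF d] by (simp add: algebra_simps)

end

section \<open>Energy identity and decay of differences\<close>
lemma AE_lebesgue_on_subset:
 assumes "AE x in lebesgue_on S. P x" "A \<subseteq> S" "S \<in> sets lebesgue" "A \<in> sets lebesgue"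
 shows "AE x in lebesgue_on A. P x"
 using assms by (auto simp: AE_restrict_space_iff elim!: eventually_mono)

context alpha_modes
begin

text \<open>The regularity of a regular solution \<open>c\<close> with time derivative \<open>g\<close>, written in coefficients. Continuity
  in the norm of \<open>V\<close> is not part of it; the energy is continuous by \<open>energy_continuous\<close>.\<close>

definition traj :: "real => (real => seq) => (real => seq) => bool" where
 "traj T c g \<longleftrightarrow> (\<forall>t\<in>{0..T}. D1 (c t)) & (AE t in Leb 0 T. D2 (c t))
   & integrable (Leb 0 T) (%t. (n2 (c t))^2)
   & (\<forall>i. integrable (Leb 0 T) (%t. g t i)) & (AE t in Leb 0 T. D0 (g t))
   & integrable (Leb 0 T) (%t. (n0 (g t))^2)
   & (\<forall>i s t. 0 <= s --> s <= t --> t <= T --> c t i - c s i = (LINT tau|Leb s t. g tau i))"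

lemma trajD:
 assumes "traj T c g"
 shows "!!t. 0 <= t ==> t <= T ==> D1 (c t)" "AE t in Leb 0 T. D2 (c t)"
  "integrable (Leb 0 T) (%t. (n2 (c t))^2)"
  "!!i. integrable (Leb 0 T) (%t. g t i)" "AE t in Leb 0 T. D0 (g t)"
  "integrable (Leb 0 T) (%t. (n0 (g t))^2)"
  "!!i s t. 0 <= s ==> s <= t ==> t <= T ==> c t i - c s i = (LINT tau|Leb s t. g tau i)"
 using assms unfolding traj_def by auto

lemma traj_mono: assumes "traj T c g" "0 <= t" "t <= T" shows "traj t c g"
proof -
 note d = trajD[OF assms(1)]
 have ae: "AE tau in Leb 0 T. P tau ==> AE tau in Leb 0 t. P tau" for P
  by (erule AE_lebesgue_on_subset) (use assms in auto)
 show ?thesis unfolding traj_def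
  using d(1,7) ae[OF d(2)] ae[OF d(5)] integrable_within[OF d(3) order_refl assms(3)]
   integrable_within[OF d(4) order_refl assms(3)] integrable_within[OF d(6) order_refl assms(3)] assms(2,3) by auto
qed

lemma traj_continuous: "traj T c g ==> continuous_on {0..T} (%t. c t i)"
 by (rule continuous_of_integral[OF trajD(4) trajD(7)])

lemma sq_le_wnorm_sq: assumes "nonneg om" "wfin om c" shows "om i * (c i)^2 <= (wnorm om c)^2"
proof -
 have "om i * (c i)^2 <= (\<Sum>j<Suc i. om j * (c j)^2)"
  using assms(1) by (intro member_le_sum[of i "{..<Suc i}" "%j. om j * (c j)^2"]) (auto simp: nonneg_def)
 also have "... <= (wnorm om c)^2" unfolding wnorm_sq[OF assms] by (rule wsq_partial_le[OF assms])
 finally show ?thesis .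
qed

lemma en_sums: assumes "D1 c" shows "(%i. hw i * (c i)^2) sums en c"
proof -
 have "(%i. one i * (c i)^2) sums (n0 c)^2" using D1_D0(1)[OF assms] unfolding wnorm_sq[OF nonneg_one D1_D0(1)[OF assms]]
  unfolding wfin_def wsq_def by (rule summable_sums)
 moreover have "(%i. lam i * (c i)^2) sums (n1 c)^2" using assms unfolding wnorm_sq[OF nn(1) assms]
  unfolding wfin_def wsq_def by (rule summable_sums)
 ultimately have "(%i. one i * (c i)^2 + alpha^2 * (lam i * (c i)^2)) sums en c"
  unfolding en_def by (intro sums_add sums_mult)
 moreover have "one i * (c i)^2 + alpha^2 * (lam i * (c i)^2) = hw i * (c i)^2" for i by (simp add: algebra_simps)
 ultimately show ?thesis by simp
qed

text \<open>Each coefficient satisfies the chain rule \<open>ac_square\<close>; the weighted sum over all of them converges,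
  because \<open>hel c\<close> and \<open>g\<close> are square integrable in time with values in \<open>H\<close>.\<close>

lemma energy_identity:
 assumes tr: "traj T c g" and T: "0 <= T"
 shows "integrable (Leb 0 T) (%t. 2 * ip (hel (c t)) (g t))"
  "en (c T) - en (c 0) = (LINT t|Leb 0 T. 2 * ip (hel (c t)) (g t))"
proof -
 note d = trajD[OF tr]
 let ?M = "Leb 0 T"
 define f where "f i t = 2 * (hel (c t) i * g t i)" for i t
 have cc: "continuous_on {0..T} (%t. c t i)" for i by (rule traj_continuous[OF tr])
 have fi: "integrable ?M (f i)" for i
 proof -
  have "integrable ?M (%t. (2 * hw i) * c t i * g t i)"
   by (rule integrable_mult_continuous[OF d(4) continuous_on_mult_left[OF cc]])
  moreover have "f i = (%t. (2 * hw i) * c t i * g t i)" by (auto simp: f_def hel_def)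
  ultimately show ?thesis by (simp only:)
 qed
 have ae: "AE t in ?M. D2 (c t) & D0 (g t)" using d(2,5) by eventually_elim simp
 have s1: "AE t in ?M. summable (%i. norm (f i t))" using ae
 proof eventually_elim
  case (elim t)
  have "summable (%i. 2 * abs (hel (c t) i * g t i))" using elim by (intro summable_mult ip_summable hel_D0) auto
  then show ?case by (simp add: f_def abs_mult)
 qed
 define K where "K = 1/l1 + alpha^2"
 define B where "B = (LINT t|?M. K^2 * (n2 (c t))^2 + (n0 (g t))^2)"
 have Bi: "integrable ?M (%t. K^2 * (n2 (c t))^2 + (n0 (g t))^2)" using d(3,6) by simp
 have bound: "(\<Sum>i<n. norm (f i t)) <= K^2 * (n2 (c t))^2 + (n0 (g t))^2" if "D2 (c t) & D0 (g t)" for n t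
 proof -
  have am: "2 * abs (a * b) <= a^2 + b^2" for a b :: real
   using zero_le_power2[of "abs a - abs b"] by (simp add: power2_diff abs_mult)
  have "(\<Sum>i<n. norm (f i t)) <= (\<Sum>i<n. one i * (hel (c t) i)^2 + one i * (g t i)^2)"
   unfolding f_def using am by (intro sum_mono) (simp add: abs_mult)
  also have "... <= (n0 (hel (c t)))^2 + (n0 (g t))^2"
  proof -
   have p: "(\<Sum>i<n. one i * (x i)^2) <= (n0 x)^2" if "D0 x" for x
    unfolding wnorm_sq[OF nonneg_one that] by (rule wsq_partial_le[OF nonneg_one that])
   from that have "D0 (hel (c t))" "D0 (g t)" using hel_D0 by auto
   from this[THEN p] show ?thesis unfolding sum.distrib by (rule add_mono)
  qed
  also have "(n0 (hel (c t)))^2 <= (K * n2 (c t))^2"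
   using that hel_norm_le[of "c t"] hel_D0[of "c t"] by (intro power_mono n_nonneg) (auto simp: K_def)
  finally show ?thesis by (simp add: power_mult_distrib)
 qed
 have s2: "summable (%i. LINT t|?M. norm (f i t))"
 proof (rule summableI_nonneg_bounded)
  show "0 <= (LINT t|?M. norm (f i t))" for i by simp
  fix n
  have "(\<Sum>i<n. LINT t|?M. norm (f i t)) = (LINT t|?M. (\<Sum>i<n. norm (f i t)))"
   using fi by (subst Bochner_Integration.integral_sum) auto
  also have "... <= B" unfolding B_def
  proof (rule integral_mono_AE[OF _ Bi])
   show "integrable ?M (%t. \<Sum>i<n. norm (f i t))" using fi by auto
   show "AE t in ?M. (\<Sum>i<n. norm (f i t)) <= K^2 * (n2 (c t))^2 + (n0 (g t))^2"
    using ae by eventually_elim (rule bound)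
  qed
  finally show "(\<Sum>i<n. LINT t|?M. norm (f i t)) <= B" .
 qed
 have eq: "AE t in ?M. (\<Sum>i. f i t) = 2 * ip (hel (c t)) (g t)" using ae
 proof eventually_elim
  case (elim t)
  then show ?case unfolding f_def ip_def by (intro suminf_mult ip_summable(2) hel_D0) auto
 qed
 have I: "integrable ?M (%t. \<Sum>i. f i t)" by (rule integrable_suminf[OF fi s1 s2])
 show I2: "integrable ?M (%t. 2 * ip (hel (c t)) (g t))" by (rule integrable_AE_eq_on[OF I _ eq]) simp
 have "(%i. LINT t|?M. f i t) sums (LINT t|?M. (\<Sum>i. f i t))" by (rule sums_integral[OF fi s1 s2])
 also have "(LINT t|?M. (\<Sum>i. f i t)) = (LINT t|?M. 2 * ip (hel (c t)) (g t))"
  by (rule integral_cong_AE) (use I I2 eq in auto)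
 finally have S: "(%i. LINT t|?M. f i t) sums (LINT t|?M. 2 * ip (hel (c t)) (g t))" .
 have "(LINT t|?M. f i t) = hw i * (c T i)^2 - hw i * (c 0 i)^2" for i
 proof -
  have "(LINT t|?M. f i t) = (LINT t|?M. hw i * (2 * c t i * g t i))"
   by (simp add: f_def hel_def mult_ac)
  also have "... = hw i * (LINT t|?M. 2 * c t i * g t i)" by (rule integral_mult_right_zero)
  also have "(LINT t|?M. 2 * c t i * g t i) = (c T i)^2 - (c 0 i)^2"
   by (rule ac_square[OF T d(4) d(7), symmetric])
  finally show ?thesis by (simp add: right_diff_distrib)
 qed
 moreover have "(%i. hw i * (c T i)^2 - hw i * (c 0 i)^2) sums (en (c T) - en (c 0))"
  by (intro sums_diff en_sums d(1)) (use T in auto)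
 ultimately show "en (c T) - en (c 0) = (LINT t|?M. 2 * ip (hel (c t)) (g t))"
  using S sums_unique2 by force
qed

lemma energy_identity_between:
 assumes tr: "traj T c g" and st: "0 <= s" "s <= t" "t <= T"
 shows "en (c t) - en (c s) = (LINT tau|Leb s t. 2 * ip (hel (c tau)) (g tau))"
proof -
 have "en (c t) - en (c 0) = (LINT tau|Leb 0 t. 2 * ip (hel (c tau)) (g tau))"
  "en (c s) - en (c 0) = (LINT tau|Leb 0 s. 2 * ip (hel (c tau)) (g tau))"
  by (rule energy_identity(2)[OF traj_mono[OF tr]]; use st in linarith)+
 with integral_interval_diff[OF energy_identity(1)[OF tr] st] st show ?thesis by simp
qed

lemma energy_continuous: "traj T c g ==> 0 <= T ==> continuous_on {0..T} (%t. en (c t))"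
 by (rule continuous_of_integral[OF energy_identity(1) energy_identity_between])

lemma traj_diff:
 assumes a: "traj T c g" and b: "traj T c' g'"
 shows "traj T (%t i. c t i - c' t i) (%t i. g t i - g' t i)"
proof -
 note d = trajD[OF a] and d' = trajD[OF b]
 let ?M = "Leb 0 T"
 have sq: "(wnorm om (%i. x i - y i))^2 <= 2 * (wnorm om x)^2 + 2 * (wnorm om y)^2"
  if "nonneg om" "wfin om x" "wfin om y" for om x y
 proof -
  have "(wnorm om (%i. x i - y i))^2 <= (wnorm om x + wnorm om y)^2"
   using that by (intro power_mono wfin_diff wnorm_nonneg) auto
  also have "... <= 2 * (wnorm om x)^2 + 2 * (wnorm om y)^2"
   using zero_le_power2[of "wnorm om x - wnorm om y"] by (simp add: power2_sum power2_diff)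
  finally show ?thesis .
 qed
 have meas: "(%t. (wnorm om (%i. x t i - y t i))^2) \<in> borel_measurable ?M"
  if nn: "nonneg om" and x: "!!i. (%t. x t i) \<in> borel_measurable ?M" "!!i. (%t. y t i) \<in> borel_measurable ?M"
   and ae: "AE t in ?M. wfin om (x t)" "AE t in ?M. wfin om (y t)" for om and x y :: "real => seq"
 proof (rule borel_measurable_AE_lim_on)
  show "(%t. \<Sum>i<n. om i * (x t i - y t i)^2) \<in> borel_measurable ?M" for n using x by measurable
  show "AE t in ?M. (%n. \<Sum>i<n. om i * (x t i - y t i)^2) ----> (wnorm om (%i. x t i - y t i))^2" using ae
  proof eventually_elim
   case (elim t)
   note w = wfin_diff(1)[OF nn elim]
   show ?case unfolding wnorm_sq[OF nn w] using w unfolding wfin_def wsq_def by (rule summable_LIMSEQ)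
  qed
 qed auto
 have int: "integrable ?M (%t. (wnorm om (%i. x t i - y t i))^2)"
  if nn: "nonneg om" and x: "!!i. (%t. x t i) \<in> borel_measurable ?M" "!!i. (%t. y t i) \<in> borel_measurable ?M"
   and ae: "AE t in ?M. wfin om (x t)" "AE t in ?M. wfin om (y t)"
   and i: "integrable ?M (%t. (wnorm om (x t))^2)" "integrable ?M (%t. (wnorm om (y t))^2)" for om and x y :: "real => seq"
 proof (rule Bochner_Integration.integrable_bound)
  show "integrable ?M (%t. 2 * (wnorm om (x t))^2 + 2 * (wnorm om (y t))^2)" using i by simp
  show "AE t in ?M. norm ((wnorm om (%i. x t i - y t i))^2) <= norm (2 * (wnorm om (x t))^2 + 2 * (wnorm om (y t))^2)"
   using ae by eventually_elim (use sq[OF nn] in simp)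
 qed (rule meas[OF nn x ae])
 have cm: "(%t. c t i) \<in> borel_measurable ?M" "(%t. c' t i) \<in> borel_measurable ?M" for i
  using traj_continuous[OF a] traj_continuous[OF b] by (auto intro: continuous_imp_measurable_on_sets_lebesgue)
 have gm: "(%t. g t i) \<in> borel_measurable ?M" "(%t. g' t i) \<in> borel_measurable ?M" for i using d(4) d'(4) by auto
 show ?thesis unfolding traj_def
 proof (intro conjI allI impI ballI)
  show "D1 (%i. c t i - c' t i)" if "t \<in> {0..T}" for t using that d(1) d'(1) by (intro wfin_diff) auto
  show "AE t in ?M. D2 (%i. c t i - c' t i)" using d(2) d'(2) by eventually_elim (auto intro: wfin_diff)
  show "integrable ?M (%t. (n2 (%i. c t i - c' t i))^2)" by (rule int[OF nn(2) cm d(2) d'(2) d(3) d'(3)])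
  show "integrable ?M (%t. g t i - g' t i)" for i using d(4) d'(4) by auto
  show "AE t in ?M. D0 (%i. g t i - g' t i)" using d(5) d'(5) by eventually_elim (auto intro: wfin_diff)
  show "integrable ?M (%t. (n0 (%i. g t i - g' t i))^2)" by (rule int[OF nonneg_one gm d(5) d'(5) d(6) d'(6)])
  fix i s t assume st: "0 <= s" "s <= t" "t <= T"
  have "integrable (Leb s t) (%t. g t i)" "integrable (Leb s t) (%t. g' t i)"
   using integrable_within[OF d(4)] integrable_within[OF d'(4)] st by auto
  then show "c t i - c' t i - (c s i - c' s i) = (LINT tau|Leb s t. g tau i - g' tau i)"
   using d(7)[OF st, of i] d'(7)[OF st, of i] by simp
 qed
qed

end

context nudged_modes
begin

text \<open>The equation after division by the symbol of \<open>I + alpha^2 A\<close>. The forcing \<open>F\<close> is therefore the forcing of the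
  original equation divided by this symbol.\<close>

definition flow :: "seq => seq => nat => real" where
 "flow F c i = - nu * lam i * c i - beta c (hel c) (unit i) / hw i + F i - mu * R c i"

definition sol :: "real => (real => seq) => (real => seq) => bool" where
 "sol T F c \<longleftrightarrow> (\<exists>g. traj T c g & (AE t in Leb 0 T. \<forall>i. g t i = flow (F t) (c t) i))"

text \<open>The rate \<open>g\<close> needs to agree with the flow only where the test sequence is nonzero, which covers
  Galerkin truncations as well as the full system.\<close>

lemma test_flow:
 assumes c: "D2 c" and F: "D0 F" and g: "!!i. d i ~= 0 ==> g i = flow F c i" and d: "D2 d"
 shows "ip (hel d) g = - nu * ip (%i. lam i * c i) (hel d) - beta c (hel c) d + ip F (hel d) - mu * ip (R c) (hel d)"
proof -
 have hp: "1 + alpha^2 * lam i ~= 0" for i using hel_pos[of i] by simp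
 note h = hel_D0[OF d]
 have "(%i. - nu * ((lam i * c i) * hel d i) - d i * beta c (hel c) (unit i) + F i * hel d i - mu * (R c i * hel d i))
  sums (- nu * ip (%i. lam i * c i) (hel d) - beta c (hel c) d + ip F (hel d) - mu * ip (R c) (hel d))"
  unfolding ip_def
  by (intro sums_add sums_diff sums_mult VH.form_expand3 summable_sums ip_summable(2) h F R_D0 lam_scale(1) c hel_D0 D2_D1(1) d)
 moreover have "- nu * ((lam i * c i) * hel d i) - d i * beta c (hel c) (unit i) + F i * hel d i - mu * (R c i * hel d i) = hel d i * g i" for i
 proof -
  have "hel d i * (beta c (hel c) (unit i) / hw i) = d i * beta c (hel c) (unit i)"
   using hp[of i] by (simp add: hel_def)
  moreover have "hel d i * g i = hel d i * flow F c i" using g[of i] by (cases "d i = 0") (auto simp: hel_def)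
  ultimately show ?thesis unfolding flow_def by (simp add: algebra_simps)
 qed
 ultimately show ?thesis unfolding ip_def using sums_unique by force
qed

lemma difference_dissipation:
 assumes c: "D2 c" "D2 c'" and F: "D0 F" and g: "D0 g" "D0 g'"
  "!!i. g i = flow F c i" "!!i. g' i = flow F c' i"
 defines "d \<equiv> %i. c i - c' i"
 shows "2 * ip (hel d) (%i. g i - g' i) <= - nu / 2 * dis d + (- mu + k8 * (n2 c')^2) * en d"
proof -
 have d: "D2 d" unfolding d_def using c by (intro wfin_diff) auto
 note h = hel_D0[OF d] and cs = lam_scale(1)[OF c(1)] lam_scale(1)[OF c(2)]
 have "ip (hel d) (%i. g i - g' i) = ip (hel d) g - ip (hel d) g'" by (rule ip_diff_right[OF h g(1,2)])
 also have "... = - nu * (ip (%i. lam i * c i) (hel d) - ip (%i. lam i * c' i) (hel d)) - (beta c (hel c) d - beta c' (hel c') d)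
   - mu * (ip (R c) (hel d) - ip (R c') (hel d))"
  using test_flow[OF c(1) F g(3) d] test_flow[OF c(2) F g(4) d] by (simp add: algebra_simps)
 also have "ip (%i. lam i * c i) (hel d) - ip (%i. lam i * c' i) (hel d) = dis d"
  using ip_diff_left[OF h cs] ip_lam_hel[OF d] by (simp add: d_def right_diff_distrib)
 also have "ip (R c) (hel d) - ip (R c') (hel d) = ip (R d) (hel d)"
  using ip_diff_left[OF h R_D0 R_D0, of c c'] R_diff[of c c'] D2_D1(1) c by (simp add: d_def)
 also have "beta c (hel c) d - beta c' (hel c') d = beta c' (hel d) d"
 proof -
  have "beta d (hel c) d = beta c (hel c) d - beta c' (hel c) d"
   unfolding d_def by (rule DH.form_diff1) (use c hel_D0 D2_D1(1) wfin_diff(1)[OF nn(1)] in auto)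
  moreover have "beta d (hel c) d = 0" by (rule form_cancel[OF d hel_D0[OF c(1)]])
  moreover have "beta c' (hel d) d = beta c' (hel c) d - beta c' (hel c') d"
  proof -
   have "hel d = (%i. hel c i - hel c' i)" by (auto simp: hel_def d_def algebra_simps)
   then show ?thesis using DH.form_diff2[OF c(2) hel_D0[OF c(1)] hel_D0[OF c(2)] D2_D1(1)[OF d]] by simp
  qed
  ultimately show ?thesis by simp
 qed
 finally have "2 * ip (hel d) (%i. g i - g' i) = - 2 * nu * dis d - 2 * beta c' (hel d) d - 2 * mu * ip (R d) (hel d)" by simp
 with key_estimate[OF c(2) d] show ?thesis by simp
qed

text \<open>The solution \<open>c'\<close> plays the part of the reference solution: only its dissipation enters the exponent.\<close>

theorem difference_decay:
 assumes T: "0 <= T" and c: "sol T F c" "sol T F c'" and F: "AE t in Leb 0 T. D0 (F t)"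
 shows "en (%i. c T i - c' T i) <= en (%i. c 0 i - c' 0 i)
   * exp (LINT t|Leb 0 T. - mu + k8 * (n2 (c' t))^2)"
proof -
 obtain g where g: "traj T c g" "AE t in Leb 0 T. \<forall>i. g t i = flow (F t) (c t) i"
  using c(1) unfolding sol_def by blast
 obtain g' where g': "traj T c' g'" "AE t in Leb 0 T. \<forall>i. g' t i = flow (F t) (c' t) i"
  using c(2) unfolding sol_def by blast
 define d where "d t = (%i. c t i - c' t i)" for t
 define k where "k t = - mu + k8 * (n2 (c' t))^2" for t
 have tr: "traj T d (%t i. g t i - g' t i)" unfolding d_def by (rule traj_diff[OF g(1) g'(1)])
 have ki: "integrable (Leb 0 T) k" unfolding k_def using trajD(3)[OF g'(1)] by auto
 note ec = energy_continuous[OF tr T]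
 have ae: "AE t in Leb 0 T. 2 * ip (hel (d t)) (%i. g t i - g' t i) <= en (d t) * k t"
  using trajD(2)[OF g(1)] trajD(5)[OF g(1)] g(2) trajD(2)[OF g'(1)] trajD(5)[OF g'(1)] g'(2) F
 proof eventually_elim
  case (elim t)
  have "2 * ip (hel (d t)) (%i. g t i - g' t i) <= - nu / 2 * dis (d t) + k t * en (d t)"
   unfolding d_def k_def
   by (rule difference_dissipation[OF elim(1,4,7,2,5)]) (use elim(3,6) in blast)+
  also have "... <= en (d t) * k t" using nu dis_nonneg[of "d t"] by (simp add: mult.commute)
  finally show ?case .
 qed
 have "en (d T) <= en (d 0) * exp (LINT t|Leb 0 T. k t)"
 proof (rule gronwall[OF T ec en_nonneg ki])
  fix s t assume st: "0 <= s" "s <= t" "t <= T"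
  have "en (d t) - en (d s) = (LINT tau|Leb s t. 2 * ip (hel (d tau)) (%i. g tau i - g' tau i))"
   by (rule energy_identity_between[OF tr st])
  also have "... <= (LINT tau|Leb s t. en (d tau) * k tau)"
  proof (rule integral_mono_AE)
   show "integrable (Leb s t) (%tau. 2 * ip (hel (d tau)) (%i. g tau i - g' tau i))"
    by (rule integrable_within[OF energy_identity(1)[OF tr T] st(1,3)])
   show "integrable (Leb s t) (%tau. en (d tau) * k tau)"
    by (rule integrable_within[OF integrable_mult_continuous[OF ki ec] st(1,3)])
   show "AE tau in Leb s t. 2 * ip (hel (d tau)) (%i. g tau i - g' tau i) <= en (d tau) * k tau"
    by (rule AE_lebesgue_on_subset[OF ae]) (use st in auto)
  qed
  finally show "en (d t) - en (d s) <= (LINT tau|Leb s t. en (d tau) * k tau)" .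
 qed
 then show ?thesis by (simp add: d_def k_def)
qed

text \<open>In a system that is nudged towards its own solution the nudging cancels, and the energy inequality of
  the equation without nudging remains.\<close>

theorem dissipation_bound:
 assumes T: "0 <= T" and f: "D0 f"
  and c: "sol T (%t i. f i / hw i + mu * R (c t) i) c"
 shows "2 * nu * alpha^2 * (LINT t|Leb 0 T. (n2 (c t))^2) <= en (c 0) + T * ((n0 f)^2 / (2 * nu * l1))"
proof -
 define f' where "f' = (%i. f i / hw i)"
 obtain g where g: "traj T c g" "AE t in Leb 0 T. \<forall>i. g t i = flow (%i. f' i + mu * R (c t) i) (c t) i"
  using c unfolding sol_def f'_def by blast
 have f'0: "D0 f'"
 proof -
  have "abs (f' i) <= abs (f i)" for i
   using hel_pos[of i] lam_pos[of i] by (simp add: f'_def field_simps mult_nonneg_nonneg)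
  then have le: "(f' i)^2 <= (f i)^2" for i by (simp add: abs_le_square_iff)
  show ?thesis unfolding wfin_def
   by (rule summable_comparison_test'[OF f[unfolded wfin_def], of 0]) (simp add: le)
 qed
 define b where "b = (n0 f)^2 / (2 * nu * l1)"
 have ae: "AE t in Leb 0 T. 2 * ip (hel (c t)) (g t) <= b - 2 * nu * alpha^2 * (n2 (c t))^2"
  using trajD(2)[OF g(1)] trajD(5)[OF g(1)] g(2)
 proof eventually_elim
  case (elim t)
  note ct = elim(1) and c1 = D2_D1(1)[OF elim(1)]
  note c0 = D1_D0(1)[OF c1] and h = hel_D0[OF ct]
  have F: "D0 (%i. f' i + mu * R (c t) i)" by (intro wfin_add wfin_scale R_D0 f'0 c1 nonneg_one)
  have "ip (%i. f' i + mu * R (c t) i) (hel (c t)) = ip (hel (c t)) f' + ip (hel (c t)) (%i. mu * R (c t) i)"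
   by (subst ip_commute, rule ip_add_right) (intro h f'0 wfin_scale R_D0 c1)+
  also have "ip (hel (c t)) (%i. mu * R (c t) i) = mu * ip (R (c t)) (hel (c t))"
   by (subst ip_commute, rule ip_scale) (intro h R_D0 c1)+
  also have "ip (hel (c t)) f' = ip f (c t)"
  proof -
   have "hel (c t) i * f' i = f i * c t i" for i using hel_pos[of i] by (simp add: hel_def f'_def)
   then show ?thesis by (simp add: ip_def)
  qed
  finally have "ip (hel (c t)) (g t) = - nu * dis (c t) + ip f (c t)"
   using test_flow[OF ct F _ ct, of "g t"] elim(3) ip_lam_hel[OF ct] form_cancel[OF ct h] by simp
  moreover have "2 * ip f (c t) <= 2 * nu * (n1 (c t))^2 + b"
  proof -
   have "ip f (c t) <= n0 f * n0 (c t)" using ip_summable(4)[OF f c0] by simp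
   also have "... <= n0 f * (n1 (c t) / sqrt l1)" using n0_le[OF c1] n_nonneg(1)[OF f] by (intro mult_left_mono)
   finally have 1: "ip f (c t) <= (n0 f / sqrt l1) * n1 (c t)" by simp
   have b': "b = (n0 f / sqrt l1)^2 / (2 * nu)" using l1 by (simp add: b_def power_divide)
   define a where "a = n0 f / sqrt l1"
   have "0 <= (a - 2 * nu * n1 (c t))^2 / (2 * nu)" using nu by simp
   also have "... = b - 2 * a * n1 (c t) + 2 * nu * (n1 (c t))^2"
    using nu by (simp add: b' a_def[symmetric] power2_eq_square field_simps)
   finally show ?thesis using 1 by (simp add: a_def)
  qed
  ultimately show ?case by (simp add: dis_def algebra_simps)
 qed
 have "en (c T) - en (c 0) = (LINT t|Leb 0 T. 2 * ip (hel (c t)) (g t))" by (rule energy_identity(2)[OF g(1) T])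
 also have "... <= (LINT t|Leb 0 T. b - 2 * nu * alpha^2 * (n2 (c t))^2)"
  by (rule integral_mono_AE[OF energy_identity(1)[OF g(1) T] _ ae]) (use trajD(3)[OF g(1)] in auto)
 also have "... = (LINT t|Leb 0 T. b) - 2 * nu * alpha^2 * (LINT t|Leb 0 T. (n2 (c t))^2)"
  using trajD(3)[OF g(1)] by (subst Bochner_Integration.integral_diff) auto
 also have "(LINT t|Leb 0 T. b) = T * b"
  using T by (simp add: measure_restrict_space)
 finally show ?thesis using en_nonneg[of "c T"] by (simp add: b_def)
qed

end

section \<open>Ordinary differential equations with quadratic right-hand side\<close>
lemma integral_exp_le:
 fixes L t :: real assumes "0 < L" "0 <= t"
 shows "(LINT s|Leb 0 t. exp (L * s)) <= exp (L * t) / L"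
proof -
 have "((%s. exp (L * s)) has_integral (exp (L * t) / L - exp (L * 0) / L)) {0..t}"
  using assms by (intro fundamental_theorem_of_calculus)
   (auto intro!: derivative_eq_intros simp: has_real_derivative_iff_has_vector_derivative[symmetric])
 then have "integral {0..t} (%s. exp (L * s)) = exp (L * t) / L - 1 / L" by (simp add: integral_unique)
 moreover have "(LINT s|Leb 0 t. exp (L * s)) = integral {0..t} (%s. exp (L * s))"
  by (intro lebesgue_integral_eq_integral continuous_imp_integrable_real) (auto intro!: continuous_intros)
 ultimately show ?thesis using assms by simp
qed

text \<open>The bound of the differences of iterates carries the weight \<open>exp (L * t)\<close>. With \<open>L\<close> large compared with the
  Lipschitz constant the iteration contracts by one half on the whole interval at once.\<close>

lemma picard:
 fixes G :: "real => seq => nat => real" and n :: nat and x0 :: "nat => real"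
 assumes T: "0 <= T" and K: "0 <= K"
  and lip: "!!t x y i. 0 <= t ==> t <= T ==> i < n ==> \<bar>G t x i - G t y i\<bar> <= K * (\<Sum>j<n. abs (x j - y j))"
  and cont: "!!x i. i < n ==> (!!j. j < n ==> continuous_on {0..T} (%t. x t j)) ==> continuous_on {0..T} (%t. G t (x t) i)"
 shows "\<exists>x. \<forall>i<n. continuous_on {0..T} (%t. x t i) \<and>
   (\<forall>t\<in>{0..T}. x t i = x0 i + (LINT s|Leb 0 t. G s (x s) i))"
proof -
 define X where "X = rec_nat (%t. x0) (%m Xm t i. x0 i + (LINT s|Leb 0 t. G s (Xm s) i))"
 have X0: "X 0 t i = x0 i" for t i by (simp add: X_def)
 have XS: "X (Suc m) t i = x0 i + (LINT s|Leb 0 t. G s (X m s) i)" for m t i by (simp add: X_def)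
 have Xc: "continuous_on {0..T} (%t. X m t i)" if "i < n" for m i
  using that
 proof (induction m arbitrary: i)
  case (Suc m)
  have "continuous_on {0..T} (%t. G t (X m t) i)" by (rule cont[OF Suc.prems Suc.IH])
  then show ?case unfolding XS
   by (intro continuous_on_add continuous_on_const indefinite_integral_continuous_real continuous_imp_integrable_real)
 qed (simp add: X0)
 have GX: "continuous_on {0..T} (%t. G t (X m t) i)" if "i < n" for m i by (rule cont[OF that Xc])
 have GXi: "integrable (Leb 0 t) (%t. G t (X m t) i)" if "i < n" "t <= T" for m i t
  using continuous_imp_integrable_real[OF continuous_on_subset[OF GX[OF that(1)]]] that by force
 define d where "d m t = (\<Sum>i<n. abs (X (Suc m) t i - X m t i))" for m t
 have dc: "continuous_on {0..T} (d m)" for m unfolding d_def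
  by (intro continuous_on_sum continuous_on_rabs continuous_on_diff Xc) auto
 obtain A where A: "A > 0" "!!t. t \<in> {0..T} ==> \<bar>d 0 t\<bar> <= A" using continuous_interval_bound[OF dc] by metis
 define L where "L = 2 * real n * K + 1"
 have L: "L > 0" using K by (simp add: L_def add_nonneg_pos)
 have nKL: "real n * K / L <= 1 / 2" using L by (simp add: L_def field_simps)
 have db: "d m t <= A * (1/2)^m * exp (L * t)" if "t \<in> {0..T}" for m t
  using that
 proof (induction m arbitrary: t)
  case 0
  have "d 0 t <= A * 1" using A(2)[OF 0] by simp
  also have "... <= A * exp (L * t)" using A(1) L 0 by (intro mult_left_mono) auto
  finally show ?case by simp
 next
  case (Suc m)
  define Q where "Q = A * (1/2)^m"
  have Q0: "Q >= 0" using A by (simp add: Q_def)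
  have "abs (X (Suc (Suc m)) t i - X (Suc m) t i) <= K * Q * (exp (L * t) / L)" if i: "i < n" for i
  proof -
   have "X (Suc (Suc m)) t i - X (Suc m) t i = (LINT s|Leb 0 t. G s (X (Suc m) s) i - G s (X m s) i)"
    unfolding XS[of "Suc m"] XS[of m t] using GXi[OF i] Suc.prems by simp
   also have "abs (...) <= (LINT s|Leb 0 t. abs (G s (X (Suc m) s) i - G s (X m s) i))" by (rule integral_abs_bound)
   also have "... <= (LINT s|Leb 0 t. K * Q * exp (L * s))"
   proof (rule integral_mono)
    show "integrable (Leb 0 t) (%s. abs (G s (X (Suc m) s) i - G s (X m s) i))"
     using GXi[OF i] Suc.prems by auto
    show "integrable (Leb 0 t) (%s. K * Q * exp (L * s))"
     by (intro continuous_imp_integrable_real continuous_intros)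
    fix s assume "s \<in> space (Leb 0 t)"
    then have s: "0 <= s" "s <= T" using Suc.prems by auto
    have "abs (G s (X (Suc m) s) i - G s (X m s) i) <= K * d m s" using lip[OF s i] by (simp add: d_def)
    also have "... <= K * (Q * exp (L * s))" unfolding Q_def using s by (intro mult_left_mono Suc.IH K) auto
    finally show "abs (G s (X (Suc m) s) i - G s (X m s) i) <= K * Q * exp (L * s)" by simp
   qed
   also have "... = K * Q * (LINT s|Leb 0 t. exp (L * s))" by simp
   also have "... <= K * Q * (exp (L * t) / L)" using K Q0 L Suc.prems by (intro mult_left_mono integral_exp_le) auto
   finally show ?thesis .
  qed
  then have "d (Suc m) t <= (\<Sum>i<n. K * Q * (exp (L * t) / L))" unfolding d_def by (intro sum_mono) auto
  also have "... = (real n * K / L) * (Q * exp (L * t))" by simp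
  also have "... <= (1/2) * (Q * exp (L * t))" using Q0 by (intro mult_right_mono nKL) auto
  finally show ?case by (simp add: Q_def)
 qed
 define x where "x t i = x0 i + (\<Sum>m. X (Suc m) t i - X m t i)" for t i
 have tele: "X m t i = x0 i + (\<Sum>k<m. X (Suc k) t i - X k t i)" for m t i
  by (induction m) (auto simp: X0)
 have ul: "uniform_limit {0..T} (%m t. X m t i) (%t. x t i) sequentially" if i: "i < n" for i
 proof -
  have "uniform_limit {0..T} (%m t. \<Sum>k<m. X (Suc k) t i - X k t i) (%t. \<Sum>k. X (Suc k) t i - X k t i) sequentially"
  proof (rule Weierstrass_m_test)
   fix m t assume t: "t \<in> {0..T}"
   have "abs (X (Suc m) t i - X m t i) <= d m t" unfolding d_def using i
    by (intro member_le_sum[of i "{..<n}" "%i. abs (X (Suc m) t i - X m t i)"]) auto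
   also have "... <= A * (1/2)^m * exp (L * t)" by (rule db[OF t])
   also have "... <= A * (1/2)^m * exp (L * T)" using A L t by (intro mult_left_mono) auto
   finally show "norm (X (Suc m) t i - X m t i) <= A * exp (L * T) * (1/2)^m" by (simp add: mult_ac)
  next
   show "summable (%m. A * exp (L * T) * (1/2)^m)" by (intro summable_mult summable_geometric) simp
  qed
  then have "uniform_limit {0..T} (%m t. x0 i + (\<Sum>k<m. X (Suc k) t i - X k t i)) (%t. x0 i + (\<Sum>k. X (Suc k) t i - X k t i)) sequentially"
   by (intro uniform_limit_intros)
  then show ?thesis by (simp only: tele[symmetric] x_def[symmetric])
 qed
 have xc: "continuous_on {0..T} (%t. x t i)" if "i < n" for i
  by (rule uniform_limit_theorem[OF _ ul[OF that]]) (auto intro!: always_eventually Xc that)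
 have Gx: "continuous_on {0..T} (%t. G t (x t) i)" if "i < n" for i by (rule cont[OF that xc])
 have fixpoint: "x t i = x0 i + (LINT s|Leb 0 t. G s (x s) i)" if i: "i < n" and t: "t \<in> {0..T}" for i t
 proof -
  have Gxi: "integrable (Leb 0 t) (%t. G t (x t) i)"
   using continuous_imp_integrable_real[OF continuous_on_subset[OF Gx[OF i]]] t by force
  have "(%m. (LINT s|Leb 0 t. G s (X m s) i)) ----> (LINT s|Leb 0 t. G s (x s) i)"
  proof (rule LIMSEQ_I)
   fix e :: real assume e: "e > 0"
   define e' where "e' = e / ((T + 1) * (K * real n + 1))"
   have pos: "(T + 1) * (K * real n + 1) > 0" using T K by (intro mult_pos_pos add_nonneg_pos) auto
   have e': "e' > 0" unfolding e'_def using e pos by simp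
   have "\<forall>\<^sub>F m in sequentially. \<forall>j\<in>{..<n}. \<forall>s\<in>{0..T}. dist (X m s j) (x s j) < e'"
    using uniform_limitD[OF ul e'] by (intro eventually_ball_finite) auto
   then obtain N where N: "!!m j s. m >= N ==> j < n ==> s \<in> {0..T} ==> \<bar>X m s j - x s j\<bar> < e'"
    unfolding eventually_sequentially dist_real_def by (metis lessThan_iff)
   have "abs ((LINT s|Leb 0 t. G s (X m s) i) - (LINT s|Leb 0 t. G s (x s) i)) < e" if m: "m >= N" for m
   proof -
    have "(LINT s|Leb 0 t. G s (X m s) i) - (LINT s|Leb 0 t. G s (x s) i)
      = (LINT s|Leb 0 t. G s (X m s) i - G s (x s) i)" using GXi[OF i] Gxi t by simp
    also have "abs (...) <= (LINT s|Leb 0 t. abs (G s (X m s) i - G s (x s) i))" by (rule integral_abs_bound)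
    also have "... <= (LINT s|Leb 0 t. K * (real n * e'))"
    proof (rule integral_mono)
     show "integrable (Leb 0 t) (%s. abs (G s (X m s) i - G s (x s) i))" using GXi[OF i] Gxi t by auto
     fix s assume "s \<in> space (Leb 0 t)"
     then have s: "0 <= s" "s <= T" using t by auto
     have "(\<Sum>j<n. abs (X m s j - x s j)) <= (\<Sum>j<n. e')" using N[OF m] s by (intro sum_mono less_imp_le) auto
     then have "K * (\<Sum>j<n. abs (X m s j - x s j)) <= K * (real n * e')" using K by (intro mult_left_mono) auto
     with lip[OF s i, of "X m s" "x s"] show "abs (G s (X m s) i - G s (x s) i) <= K * (real n * e')" by linarith
    qed auto
    also have "... = t * (K * (real n * e'))" using t by (simp add: measure_restrict_space)
    also have "... <= T * (K * (real n * e'))" using t K e' by (intro mult_right_mono) auto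
    also have "... < (T + 1) * (K * real n + 1) * e'" using T K e' by (simp add: algebra_simps add_pos_nonneg add_nonneg_pos)
    also have "... = e" unfolding e'_def times_divide_eq_right
     by (rule nonzero_mult_div_cancel_left) (use pos in linarith)
    finally show ?thesis .
   qed
   then show "\<exists>no. \<forall>n\<ge>no. norm ((LINT s|Leb 0 t. G s (X n s) i) - (LINT s|Leb 0 t. G s (x s) i)) < e" by auto
  qed
  then have "(%m. X (Suc m) t i) ----> x0 i + (LINT s|Leb 0 t. G s (x s) i)"
   unfolding XS by (intro tendsto_intros)
  moreover have "(%m. X (Suc m) t i) ----> x t i"
   using tendsto_uniform_limitI[OF ul[OF i] t] by (rule LIMSEQ_Suc)
  ultimately show ?thesis using LIMSEQ_unique by blast
 qed
 show ?thesis using xc fixpoint by blast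
qed

definition clip :: "real => real => real" where "clip r z = max (- r) (min r z)"

lemma clip_le: "0 <= r ==> \<bar>clip r z\<bar> <= r" by (auto simp: clip_def)
lemma clip_lip: "abs (clip r y - clip r z) <= abs (y - z)" by (auto simp: clip_def max_def min_def)
lemma clip_id: "abs z <= r ==> clip r z = z" by (auto simp: clip_def max_def min_def)

text \<open>The quadratic terms are cut off at level \<open>r\<close>, which makes the right-hand side Lipschitz. The a priori
  bound shows that the cut-off is never active: at the first time where it could be, the solution of
  the cut-off system still solves the original one.\<close>

lemma quadratic_ode:
 fixes n :: nat and F :: "real => seq" and a :: "nat => nat => real" and q :: "nat => nat => nat => real" and x0 :: "nat => real"
 defines "P \<equiv> %t (y :: nat => real) i. F t i + (\<Sum>j<n. a i j * y j) + (\<Sum>j<n. \<Sum>k<n. q i j k * (y j * y k))"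
 assumes T: "0 <= T" and F: "!!i. i < n ==> continuous_on {0..T} (%t. F t i)" and r: "0 <= r"
  and apriori: "!!t1 y. 0 <= t1 ==> t1 <= T ==> (!!i. i < n ==> continuous_on {0..t1} (%t. y t i)) ==>
    (!!t i. 0 <= t ==> t <= t1 ==> i < n ==> y t i = x0 i + (LINT s|Leb 0 t. P s (y s) i)) ==> \<forall>i<n. abs (y t1 i) < r"
 shows "\<exists>x. \<forall>i<n. continuous_on {0..T} (%t. x t i) \<and>
   (\<forall>t\<in>{0..T}. x t i = x0 i + (LINT s|Leb 0 t. P s (x s) i))"
proof -
 define G where "G t y i = F t i + (\<Sum>j<n. a i j * y j) + (\<Sum>j<n. \<Sum>k<n. q i j k * (clip r (y j) * clip r (y k)))" for t y i
 define K where "K = (\<Sum>i<n. (\<Sum>j<n. abs (a i j)) + (\<Sum>j<n. \<Sum>k<n. abs (q i j k) * (2 * r)))"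
 have K0: "0 <= K" unfolding K_def using r by (intro sum_nonneg add_nonneg_nonneg mult_nonneg_nonneg) auto
 have lip: "abs (G t x i - G t y i) <= K * (\<Sum>j<n. abs (x j - y j))" if i: "i < n" for t x y i
 proof -
  define S where "S = (\<Sum>j<n. abs (x j - y j))"
  have S: "abs (x j - y j) <= S" if "j < n" for j unfolding S_def using that
   by (intro member_le_sum[of j "{..<n}" "%j. abs (x j - y j)"]) auto
  have S0: "0 <= S" by (simp add: S_def sum_nonneg)
  have 1: "\<bar>(\<Sum>j<n. a i j * x j) - (\<Sum>j<n. a i j * y j)\<bar> <= (\<Sum>j<n. abs (a i j)) * S"
  proof -
   have "\<bar>\<Sum>j<n. a i j * (x j - y j)\<bar> <= (\<Sum>j<n. abs (a i j) * S)"
    by (rule order_trans[OF sum_abs]) (auto intro!: sum_mono mult_left_mono S simp: abs_mult)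
   then show ?thesis by (simp add: right_diff_distrib sum_subtractf sum_distrib_right)
  qed
  have c: "abs (clip r (x j) * clip r (x k) - clip r (y j) * clip r (y k)) <= 2 * r * S" if "j < n" "k < n" for j k
  proof -
   have "clip r (x j) * clip r (x k) - clip r (y j) * clip r (y k)
    = clip r (x j) * (clip r (x k) - clip r (y k)) + (clip r (x j) - clip r (y j)) * clip r (y k)" by (simp add: algebra_simps)
   moreover have "abs (clip r (x j) * (clip r (x k) - clip r (y k))) <= r * S"
    unfolding abs_mult using clip_le[OF r] order_trans[OF clip_lip S] that r by (intro mult_mono) auto
   moreover have "abs ((clip r (x j) - clip r (y j)) * clip r (y k)) <= S * r"
    unfolding abs_mult using clip_le[OF r] order_trans[OF clip_lip S] that r S0 by (intro mult_mono) auto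
   ultimately show ?thesis by (simp add: mult.commute)
  qed
  have 2: "\<bar>(\<Sum>j<n. \<Sum>k<n. q i j k * (clip r (x j) * clip r (x k))) - (\<Sum>j<n. \<Sum>k<n. q i j k * (clip r (y j) * clip r (y k)))\<bar>
   <= (\<Sum>j<n. \<Sum>k<n. abs (q i j k) * (2 * r)) * S"
  proof -
   have "\<bar>\<Sum>j<n. \<Sum>k<n. q i j k * (clip r (x j) * clip r (x k) - clip r (y j) * clip r (y k))\<bar> <= (\<Sum>j<n. \<Sum>k<n. abs (q i j k) * (2 * r * S))"
    by (rule order_trans[OF sum_abs] sum_mono)+ (auto intro!: mult_left_mono c simp: abs_mult)
   then show ?thesis by (simp add: right_diff_distrib sum_subtractf sum_distrib_right mult.assoc)
  qed
  have "abs (G t x i - G t y i) <= ((\<Sum>j<n. abs (a i j)) + (\<Sum>j<n. \<Sum>k<n. abs (q i j k) * (2 * r))) * S"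
   using 1 2 unfolding G_def distrib_right by linarith
  also have "... <= K * S" unfolding K_def using i r S0
   by (intro mult_right_mono member_le_sum[of i "{..<n}" "%i. (\<Sum>j<n. abs (a i j)) + (\<Sum>j<n. \<Sum>k<n. abs (q i j k) * (2 * r))"])
    (auto intro!: add_nonneg_nonneg sum_nonneg)
  finally show ?thesis by (simp add: S_def)
 qed
 have clip_c: "continuous_on S (%t. clip r (f t))" if "continuous_on S f" for S :: "real set" and f
  unfolding clip_def by (intro continuous_intros that)
 have cont: "continuous_on {0..T} (%t. G t (x t) i)"
  if "i < n" "!!j. j < n ==> continuous_on {0..T} (%t. x t j)" for x i
  unfolding G_def using that by (intro continuous_on_add F continuous_on_sum continuous_on_mult continuous_on_const clip_c) auto
 have "\<exists>x. \<forall>i<n. continuous_on {0..T} (%t. x t i) \<and>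
   (\<forall>t\<in>{0..T}. x t i = x0 i + (LINT s|Leb 0 t. G s (x s) i))"
  by (rule picard[OF T K0]) (use lip cont in blast)+
 then obtain x where x: "!!i. i < n ==> continuous_on {0..T} (%t. x t i)"
  and xe: "!!t i. t \<in> {0..T} ==> i < n ==> x t i = x0 i + (LINT s|Leb 0 t. G s (x s) i)" by blast
 have GP: "G s (x s) i = P s (x s) i" if "\<forall>i<n. abs (x s i) <= r" for s i
  unfolding G_def P_def using that by (simp add: clip_id)
 define A where "A = (\<Union>i<n. {t \<in> {0..T}. r <= abs (x t i)})"
 have A0: "A = {}"
 proof (rule ccontr)
  assume ne: "A ~= {}"
  have "closed {t \<in> {0..T}. r <= abs (x t i)}" if "i < n" for i
   using continuous_closed_preimage[OF continuous_on_rabs[OF x[OF that]] closed_real_atLeastAtMost, of "{r..}"]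
   by (simp add: vimage_def Int_def)
  then have "closed A" unfolding A_def by (intro closed_UN) auto
  moreover have "bounded A" by (rule bounded_subset[OF bounded_closed_interval[of 0 T]]) (auto simp: A_def)
  ultimately have "compact A" using compact_eq_bounded_closed by blast
  then obtain t1 where t1: "t1 \<in> A" "!!t. t \<in> A ==> t1 <= t" using compact_attains_inf[OF _ ne] by blast
  have t1T: "0 <= t1" "t1 <= T" using t1(1) by (auto simp: A_def)
  have below: "\<forall>i<n. abs (x s i) <= r" if "0 <= s" "s < t1" for s
   using t1(2)[of s] that t1T unfolding A_def by force
  have "\<forall>i<n. abs (x t1 i) < r"
  proof (rule apriori[OF t1T])
   show "continuous_on {0..t1} (%t. x t i)" if "i < n" for i
    using continuous_on_subset[OF x[OF that]] t1T by auto
   fix t i assume t: "0 <= t" "t <= t1" and i: "i < n"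
   have AE: "AE s in Leb 0 t. s ~= t1"
    by (subst AE_restrict_space_iff) (auto intro!: AE_completion AE_lborel_singleton[THEN eventually_mono])
   have Gc: "continuous_on {0..t} (%s. G s (x s) i)" 
    by (rule continuous_on_subset[OF cont[OF i x]]) (use t t1T in auto)
   have Pc: "continuous_on {0..t} (%s. P s (x s) i)"
    unfolding P_def by (rule continuous_on_subset[of "{0..T}"], intro continuous_on_add F continuous_on_sum continuous_on_mult continuous_on_const x i)
     (use t t1T in auto)
   have "(LINT s|Leb 0 t. G s (x s) i) = (LINT s|Leb 0 t. P s (x s) i)"
   proof (rule integral_cong_AE)
    show "(%s. G s (x s) i) \<in> borel_measurable (Leb 0 t)"
     "(%s. P s (x s) i) \<in> borel_measurable (Leb 0 t)"
     using Gc Pc by (auto intro: continuous_imp_measurable_on_sets_lebesgue)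
    show "AE s in Leb 0 t. G s (x s) i = P s (x s) i"
     by (rule AE_mp[OF AE], rule AE_I2) (use t in "auto intro!: GP[OF below]")
   qed
   then show "x t i = x0 i + (LINT s|Leb 0 t. P s (x s) i)" using xe[of t i] t t1T i by simp
  qed
  with t1(1) show False by (auto simp: A_def)
 qed
 have "\<forall>i<n. abs (x s i) <= r" if "s \<in> {0..T}" for s
 proof (intro allI impI)
  fix i assume "i < n"
  with that A0 have "~ r <= abs (x s i)" unfolding A_def by blast
  then show "abs (x s i) <= r" by simp
 qed
 then have "x t i = x0 i + (LINT s|Leb 0 t. P s (x s) i)" if "t \<in> {0..T}" "i < n" for t i
  unfolding xe[OF that] using that GP by (intro arg_cong[of _ _ "%z. x0 i + z"] Bochner_Integration.integral_cong) auto
 with x show ?thesis by blast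
qed

section \<open>Galerkin approximations\<close>
definition tail :: "nat => seq => nat => real" where "tail m c = (%i. c i - trunc m c i)"

lemma tail_eq: "tail m c i = (if i < m then 0 else c i)" by (simp add: tail_def trunc_def)

lemma wfin_tail: assumes "nonneg om" "wfin om c"
 shows "wfin om (tail m c)" "wnorm om (tail m c) <= wnorm om c" "(%m. wnorm om (tail m c)) ----> 0"
proof -
 show "wfin om (tail m c)" unfolding tail_def by (rule wfin_diff(1)[OF assms wfin_trunc])
 have "0 <= (\<Sum>i<m. om i * (c i)^2)" using assms(1) by (intro sum_nonneg) (auto simp: nonneg_def)
 then show "wnorm om (tail m c) <= wnorm om c" unfolding wnorm_def tail_def wsq_tail[OF assms(2)] by simp
 show "(%m. wnorm om (tail m c)) ----> 0" unfolding tail_def by (rule wnorm_tail_tendsto[OF assms(2)])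
qed

context nudged_modes
begin

lemma form_trunc: "beta (trunc n a) (trunc n b) (trunc n c) = tri theta n a b c"
proof -
 have "(%N. tri theta N (trunc n a) (trunc n b) (trunc n c)) ----> beta (trunc n a) (trunc n b) (trunc n c)"
  by (rule VH.form_tendsto) simp_all
 moreover have "(%N. tri theta N (trunc n a) (trunc n b) (trunc n c)) ----> tri theta n a b c"
  by (rule tendsto_eventually) (auto simp: eventually_sequentially tri_trunc intro: exI[of _ n])
 ultimately show ?thesis by (rule LIMSEQ_unique)
qed

lemma R_trunc: "R (trunc n y) i = (\<Sum>j<n. y j * R (unit j) i)"
proof (induction n)
 case 0
 have "trunc 0 y = (%i. 0 * unit 0 i)" by (auto simp: trunc_def)
 then show ?case using R_scale[OF wfin_unit, of 0 0] by simp
next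
 case (Suc n)
 have "trunc (Suc n) y = (%i. trunc n y i + y n * unit n i)" by (auto simp: trunc_def unit_def fun_eq_iff less_Suc_eq)
 then show ?case using R_add[OF wfin_trunc[of _ n y] wfin_scale(1)[where k="y n", OF wfin_unit[of _ n]]] R_scale[OF wfin_unit, of "y n" n] Suc by simp
qed

definition lin_coeff :: "nat => nat => real" where
 "lin_coeff i j = (if j = i then - nu * lam i else 0) - mu * R (unit j) i"
definition quad_coeff :: "nat => nat => nat => real" where
 "quad_coeff i j k = - (hw k * theta j k i / hw i)"

text \<open>On truncated sequences the flow is the polynomial required by \<open>quadratic_ode\<close>.\<close>

lemma flow_trunc: assumes "i < n"
 shows "flow F (trunc n y) i = F i + (\<Sum>j<n. lin_coeff i j * y j) + (\<Sum>j<n. \<Sum>k<n. quad_coeff i j k * (y j * y k))"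
proof -
 have "hel (trunc n y) = trunc n (hel y)" "unit i = trunc n (unit i)"
  using assms by (auto simp: hel_def trunc_def unit_def)
 then have "beta (trunc n y) (hel (trunc n y)) (unit i) = tri theta n y (hel y) (unit i)" by (metis form_trunc)
 also have "... = (\<Sum>j<n. \<Sum>k<n. y j * hel y k * theta j k i)"
 proof -
  have "(\<Sum>l<n. y j * hel y k * unit i l * theta j k l) = y j * hel y k * theta j k i" for j k
  proof -
   have "(\<Sum>l<n. y j * hel y k * unit i l * theta j k l) = (\<Sum>l<n. if l = i then y j * hel y k * theta j k l else 0)"
    by (intro sum.cong) (auto simp: unit_def)
   then show ?thesis using assms by simp
  qed
  then show ?thesis by (simp add: tri_def)
 qed
 finally have 1: "- beta (trunc n y) (hel (trunc n y)) (unit i) / hw i = (\<Sum>j<n. \<Sum>k<n. quad_coeff i j k * (y j * y k))"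
  by (simp add: quad_coeff_def hel_def sum_negf sum_divide_distrib mult_ac)
 have "(\<Sum>j<n. lin_coeff i j * y j) = (\<Sum>j<n. if j = i then - nu * lam i * y j else 0) - (\<Sum>j<n. mu * (y j * R (unit j) i))"
  unfolding sum_subtractf[symmetric] by (intro sum.cong) (auto simp: lin_coeff_def algebra_simps)
 also have "... = - nu * lam i * trunc n y i - mu * R (trunc n y) i"
 proof -
  have "trunc n y i = y i" using assms by (simp add: trunc_def)
  then show ?thesis using assms by (simp add: R_trunc sum_distrib_left)
 qed
 finally show ?thesis unfolding flow_def using 1 by simp
qed

lemma finite_traj:
 assumes T: "0 <= T" and z: "!!t i. n <= i ==> c t i = 0" "!!t i. n <= i ==> g t i = 0"
  and g: "!!i. i < n ==> continuous_on {0..T} (%t. g t i)"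
  and c: "!!t i. 0 <= t ==> t <= T ==> i < n ==> c t i = c0 i + (LINT s|Leb 0 t. g s i)"
 shows "traj T c g"
proof -
 have gc: "continuous_on {0..T} (%t. g t i)" for i using g z(2) by (cases "i < n") auto
 note gi = continuous_imp_integrable_real[OF gc]
 have d: "c t i - c s i = (LINT tau|Leb s t. g tau i)" if st: "0 <= s" "s <= t" "t <= T" for i s t
  using c[of t i] c[of s i] integral_interval_diff[OF gi st, of i] st z by (cases "i < n") auto
 have cc: "continuous_on {0..T} (%t. c t i)" for i by (rule continuous_of_integral[OF gi d])
 have sq: "(wnorm om a)^2 = (\<Sum>i<n. om i * (a i)^2)" if "!!i. n <= i ==> a i = 0" "nonneg om" for om a
  using wnorm_sq[OF that(2) wfin_support(1)[of n a]] wfin_support(2)[of n a om] that(1) by simp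
 show ?thesis unfolding traj_def
 proof (intro conjI allI impI ballI AE_I2)
  show "D1 (c t)" "D2 (c t)" "D0 (g t)" for t by (rule wfin_support[of n], simp add: z)+
  show "integrable (Leb 0 T) (%t. (n2 (c t))^2)" 
   by (subst sq) (auto intro!: z continuous_imp_integrable_real continuous_on_sum continuous_on_mult continuous_on_power cc)
  show "integrable (Leb 0 T) (%t. (n0 (g t))^2)" 
   by (subst sq) (auto intro!: z continuous_imp_integrable_real continuous_on_sum continuous_on_mult continuous_on_power gc)
  show "integrable (Leb 0 T) (%t. g t i)" for i by (rule gi)
  show "c t i - c s i = (LINT tau|Leb s t. g tau i)" if "0 <= s" "s <= t" "t <= T" for i s t using d that .
 qed
qed

definition gal_rate :: "nat => (real => seq) => (real => seq) => real => seq" where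
 "gal_rate n F x t i = (if i < n then flow (F t) (x t) i else 0)"

definition gal :: "real => (real => seq) => seq => nat => (real => seq) => bool" where
 "gal T F c0 n x \<longleftrightarrow> traj T x (gal_rate n F x) & (\<forall>t i. n <= i --> x t i = 0) & x 0 = trunc n c0"

definition en_bound :: "real => real => seq => real" where
 "en_bound T Fb c0 = (en c0 + T * (2 * alpha^2 * Fb^2 / nu)) * exp (T * (nu / (2 * alpha^2)))"
definition dis_bound :: "real => real => seq => real" where
 "dis_bound T Fb c0 = (en c0 + T * (2 * alpha^2 * Fb^2 / nu) + T * (nu / (2 * alpha^2)) * en_bound T Fb c0) / (nu * alpha^2)"

lemma en_trunc_le: assumes "D1 c" shows "en (trunc n c) <= en c" "en (tail n c) <= en c"
proof -
 have m: "(wnorm om a)^2 <= (wnorm om c)^2" if "nonneg om" "wfin om a" "wnorm om a <= wnorm om c" for om a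
  using that by (intro power_mono wnorm_nonneg) auto
 note c0 = D1_D0(1)[OF assms]
 show "en (trunc n c) <= en c" unfolding en_def
  by (intro add_mono mult_left_mono m wnorm_trunc_le wfin_trunc nonneg_one nn c0 assms zero_le_power2)
 show "en (tail n c) <= en c" unfolding en_def
  by (intro add_mono mult_left_mono m wfin_tail nonneg_one nn c0 assms zero_le_power2)
qed

text \<open>The bilinear term vanishes by antisymmetry, and the nudging is coercive up to viscosity.\<close>

lemma gal_energy_rate:
 assumes c: "!!i. n <= i ==> c i = 0" and g: "!!i. i < n ==> g i = flow F c i" and F: "D0 F" "n0 F <= Fb"
 shows "2 * ip (hel c) g <= - (nu * alpha^2) * (n2 c)^2 + nu / (2 * alpha^2) * en c + 2 * alpha^2 * Fb^2 / nu"
proof -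
 have c2: "D2 c" by (rule wfin_support(1)[of n]) (rule c)
 note h = hel_D0[OF c2]
 have "ip (hel c) g = - nu * dis c + ip F (hel c) - mu * ip (R c) (hel c)"
  using test_flow[OF c2 F(1) _ c2, of g] g c ip_lam_hel[OF c2] form_cancel[OF c2 h] by (metis diff_0_right linorder_not_less)
 moreover have "2 * ip F (hel c) <= 2 * alpha^2 * Fb^2 / nu + nu / (2 * alpha^2) * en c + nu / 2 * dis c"
 proof -
  have "ip F (hel c) <= n0 F * n0 (hel c)" using ip_summable(4)[OF F(1) h] by simp
  also have "... <= Fb * n0 (hel c)" by (intro mult_right_mono F n_nonneg(1)[OF h])
  finally have 1: "ip F (hel c) <= Fb * n0 (hel c)" .
  define s where "s = nu / (2 * alpha^2)"
  have s: "s > 0" using nu alpha by (simp add: s_def)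
  have "0 <= (Fb - s * n0 (hel c))^2 / s" using s by simp
  also have "... = Fb^2 / s - 2 * (Fb * n0 (hel c)) + s * (n0 (hel c))^2"
   using s by (simp add: power2_eq_square field_simps)
  finally have "2 * ip F (hel c) <= Fb^2 / s + s * (en c + alpha^2 * dis c)" using 1 by (simp add: hel_norm[OF c2])
  moreover have "Fb^2 / s = 2 * alpha^2 * Fb^2 / nu" by (simp add: s_def)
  moreover have "s * (en c + alpha^2 * dis c) = nu / (2 * alpha^2) * en c + nu / 2 * dis c"
   using alpha by (simp add: s_def field_simps)
  ultimately show ?thesis by simp
 qed
 moreover have "- 2 * (mu * ip (R c) (hel c)) <= nu / 2 * dis c"
  using nudge_coercive[OF c2] mult_nonneg_nonneg[OF less_imp_le[OF mu] en_nonneg[of c]] by simp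
 moreover have "nu * alpha^2 * (n2 c)^2 <= nu * dis c" using nu by (simp add: dis_def algebra_simps)
 ultimately show ?thesis by simp
qed

lemma gal_bounds:
 assumes x: "gal T F c0 n x" and T: "0 <= T" and c0: "D1 c0"
  and F: "!!t. 0 <= t ==> t <= T ==> D0 (F t) & n0 (F t) <= Fb"
 shows "en (x T) <= en_bound T Fb c0" "(LINT t|Leb 0 T. (n2 (x t))^2) <= dis_bound T Fb c0"
proof -
 let ?g = "gal_rate n F x"
 define b where "b = 2 * alpha^2 * Fb^2 / nu"
 define kappa where "kappa = nu / (2 * alpha^2)"
 have b0: "0 <= b" "0 <= kappa" using nu alpha by (simp_all add: b_def kappa_def)
 have tr: "traj T x ?g" and z: "!!t i. n <= i ==> x t i = 0" and x0: "x 0 = trunc n c0" using x by (auto simp: gal_def)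
 have e0: "en (x 0) <= en c0" unfolding x0 by (rule en_trunc_le(1)[OF c0])
 have rate: "2 * ip (hel (x t)) (?g t) <= - (nu * alpha^2) * (n2 (x t))^2 + kappa * en (x t) + b" if "0 <= t" "t <= T" for t
  unfolding b_def kappa_def by (rule gal_energy_rate[of n _ _ "F t"]) (use F that z in "auto simp: gal_rate_def")
 note eci = continuous_imp_integrable_real[OF energy_continuous[OF tr T]]
 have int: "en (x t) <= en c0 + t * b + (LINT s|Leb 0 t. - (nu * alpha^2) * (n2 (x s))^2 + en (x s) * kappa)" if t: "0 <= t" "t <= T" for t
 proof -
  have i1: "integrable (Leb 0 t) (%s. (n2 (x s))^2)" "integrable (Leb 0 t) (%s. en (x s))"
   by (rule integrable_within[OF trajD(3)[OF tr] order_refl t(2)], rule integrable_within[OF eci order_refl t(2)])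
  have "en (x t) - en (x 0) = (LINT s|Leb 0 t. 2 * ip (hel (x s)) (?g s))"
   by (rule energy_identity_between[OF tr order_refl t])
  also have "... <= (LINT s|Leb 0 t. (- (nu * alpha^2) * (n2 (x s))^2 + en (x s) * kappa) + b)"
  proof (rule integral_mono)
   show "integrable (Leb 0 t) (%s. 2 * ip (hel (x s)) (?g s))"
    by (rule integrable_within[OF energy_identity(1)[OF tr T] order_refl t(2)])
   show "2 * ip (hel (x s)) (?g s) <= (- (nu * alpha^2) * (n2 (x s))^2 + en (x s) * kappa) + b" if "s \<in> space (Leb 0 t)" for s
    using rate[of s] that t by (simp add: mult.commute)
  qed (use i1 in auto)
  also have "... = (LINT s|Leb 0 t. - (nu * alpha^2) * (n2 (x s))^2 + en (x s) * kappa) + (LINT s|Leb 0 t. b)"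
   by (rule Bochner_Integration.integral_add) (use i1 in auto)
  also have "(LINT s|Leb 0 t. b) = t * b" using t by (simp add: measure_restrict_space)
  finally show ?thesis using e0 by simp
 qed
 have bd: "en (x t) <= en_bound T Fb c0" if t: "0 <= t" "t <= T" for t
 proof -
  have "en (x t) <= (en c0 + T * b) * exp (LINT s|Leb 0 t. kappa)"
  proof (rule gronwall_forced[OF t(1)])
   show "continuous_on {0..t} (%t. en (x t))" by (rule continuous_on_subset[OF energy_continuous[OF tr T]]) (use t in auto)
   show "0 <= en c0 + T * b" using en_nonneg T b0 by simp
   fix s assume s: "0 <= s" "s <= t"
   then have sT: "s <= T" using t by simp
   have i1: "integrable (Leb 0 s) (%s. (n2 (x s))^2)" "integrable (Leb 0 s) (%s. en (x s))"
    by (rule integrable_within[OF trajD(3)[OF tr] order_refl sT], rule integrable_within[OF eci order_refl sT])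
   have "(LINT s|Leb 0 s. - (nu * alpha^2) * (n2 (x s))^2 + en (x s) * kappa) <= (LINT s|Leb 0 s. en (x s) * kappa)"
    by (rule integral_mono) (use i1 nu in auto)
   moreover have "s * b <= T * b" using sT b0 by (intro mult_right_mono)
   ultimately show "en (x s) <= en c0 + T * b + (LINT s|Leb 0 s. en (x s) * kappa)" using int[OF s(1) sT] by linarith
  qed (use b0 en_nonneg in auto)
  also have "(LINT s|Leb 0 t. kappa) = t * kappa" using t by (simp add: measure_restrict_space)
  also have "(en c0 + T * b) * exp (t * kappa) <= (en c0 + T * b) * exp (T * kappa)"
   using en_nonneg[of c0] T b0 t by (intro mult_left_mono) (auto intro: mult_right_mono)
  finally show ?thesis by (simp add: en_bound_def b_def kappa_def)
 qed
 then show "en (x T) <= en_bound T Fb c0" using T by simp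
 have "0 <= en c0 + T * b + (LINT s|Leb 0 T. - (nu * alpha^2) * (n2 (x s))^2 + en (x s) * kappa)"
  using int[OF T order_refl] en_nonneg[of "x T"] by simp
 also have "(LINT s|Leb 0 T. - (nu * alpha^2) * (n2 (x s))^2 + en (x s) * kappa)
  = - (nu * alpha^2) * (LINT s|Leb 0 T. (n2 (x s))^2) + (LINT s|Leb 0 T. en (x s) * kappa)"
  using trajD(3)[OF tr] eci by (subst Bochner_Integration.integral_add) auto
 also have "(LINT s|Leb 0 T. en (x s) * kappa) <= (LINT s|Leb 0 T. en_bound T Fb c0 * kappa)"
  by (rule integral_mono) (use eci bd b0 in "auto intro!: mult_right_mono")
 also have "... = T * kappa * en_bound T Fb c0" using T by (simp add: measure_restrict_space)
 finally have "(nu * alpha^2) * (LINT s|Leb 0 T. (n2 (x s))^2) <= en c0 + T * b + T * kappa * en_bound T Fb c0" by simp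
 then show "(LINT t|Leb 0 T. (n2 (x t))^2) <= dis_bound T Fb c0"
  using nu alpha by (simp add: dis_bound_def b_def kappa_def pos_le_divide_eq mult.commute)
qed

lemma en_bound_mono: assumes "0 <= t" "t <= T" shows "en_bound t Fb c0 <= en_bound T Fb c0"
proof -
 have b: "0 <= 2 * alpha^2 * Fb^2 / nu" "0 <= nu / (2 * alpha^2)" using nu alpha by simp_all
 show ?thesis unfolding en_bound_def
  using assms en_nonneg[of c0] b by (intro mult_mono add_mono mult_right_mono) (auto intro!: mult_right_mono add_nonneg_nonneg mult_nonneg_nonneg simp del: times_divide_eq_right times_divide_eq_left)
qed

lemma gal_mono: assumes "gal T F c0 n x" "0 <= t" "t <= T" shows "gal t F c0 n x"
 using assms traj_mono by (auto simp: gal_def)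

lemma gal_exists:
 assumes T: "0 <= T" and c0: "D1 c0"
  and F: "!!t. 0 <= t ==> t <= T ==> D0 (F t) & n0 (F t) <= Fb" and Fc: "!!i. continuous_on {0..T} (%t. F t i)"
 shows "\<exists>x. gal T F c0 n x"
proof -
 define r where "r = sqrt (en_bound T Fb c0) + 1"
 have M0: "0 <= en_bound T Fb c0" unfolding en_bound_def using en_nonneg[of c0] T nu by simp
 have mk: "gal t1 F c0 n (%t. trunc n (y t))"
  if t1: "0 <= t1" "t1 <= T" and yc: "!!i. i < n ==> continuous_on {0..t1} (%t. y t i)"
   and y: "!!t i. 0 <= t ==> t <= t1 ==> i < n ==> y t i = c0 i + (LINT s|Leb 0 t. F s i + (\<Sum>j<n. lin_coeff i j * y s j)
    + (\<Sum>j<n. \<Sum>k<n. quad_coeff i j k * (y s j * y s k)))" for t1 y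
 proof -
  define P where "P t i = F t i + (\<Sum>j<n. lin_coeff i j * y t j) + (\<Sum>j<n. \<Sum>k<n. quad_coeff i j k * (y t j * y t k))" for t i
  have Pf: "gal_rate n F (%t. trunc n (y t)) t i = (if i < n then P t i else 0)" for t i
   by (simp add: gal_rate_def flow_trunc P_def)
  have Pc: "continuous_on {0..t1} (%t. P t i)" if "i < n" for i unfolding P_def
   by (intro continuous_on_add continuous_on_sum continuous_on_mult continuous_on_const yc that continuous_on_subset[OF Fc])
    (use t1 in auto)
  have "traj t1 (%t. trunc n (y t)) (gal_rate n F (%t. trunc n (y t)))"
  proof (rule finite_traj[OF t1(1), of n _ _ c0])
   show "continuous_on {0..t1} (%t. gal_rate n F (%t. trunc n (y t)) t i)" if "i < n" for i using Pc[OF that] that by (simp add: Pf)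
   show "trunc n (y t) i = c0 i + (LINT s|Leb 0 t. gal_rate n F (%t. trunc n (y t)) s i)"
    if "0 <= t" "t <= t1" "i < n" for t i
   proof -
    have "trunc n (y t) i = y t i" using that(3) by (simp add: trunc_def)
    then show ?thesis using y[OF that] that(3) by (simp add: Pf P_def)
   qed
  qed (auto simp: trunc_def gal_rate_def)
  moreover have "trunc n (y 0) = trunc n c0" using y[OF order_refl t1(1)] by (auto simp: trunc_def)
  ultimately show ?thesis by (auto simp: gal_def trunc_def)
 qed
 have "\<exists>x. \<forall>i<n. continuous_on {0..T} (%t. x t i) \<and>
   (\<forall>t\<in>{0..T}. x t i = c0 i + (LINT s|Leb 0 t. F s i + (\<Sum>j<n. lin_coeff i j * x s j)
    + (\<Sum>j<n. \<Sum>k<n. quad_coeff i j k * (x s j * x s k))))"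
 proof (rule quadratic_ode[OF T Fc, of r])
  show "0 <= r" using M0 by (simp add: r_def)
  fix t1 :: real and y :: "real => seq"
  assume t1: "0 <= t1" "t1 <= T" and yc: "!!i. i < n ==> continuous_on {0..t1} (%t. y t i)"
   and y: "!!t i. 0 <= t ==> t <= t1 ==> i < n ==> y t i = c0 i + (LINT s|Leb 0 t. F s i + (\<Sum>j<n. lin_coeff i j * y s j)
    + (\<Sum>j<n. \<Sum>k<n. quad_coeff i j k * (y s j * y s k)))"
  have "en (trunc n (y t1)) <= en_bound t1 Fb c0"
   by (rule gal_bounds(1)[OF mk[OF t1 yc y] t1(1) c0 F]) (use t1 in auto)
  also have "... <= en_bound T Fb c0" by (rule en_bound_mono[OF t1])
  finally have e: "en (trunc n (y t1)) <= en_bound T Fb c0" .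
  show "\<forall>i<n. abs (y t1 i) < r"
  proof (intro allI impI)
   fix i assume i: "i < n"
   have "(y t1 i)^2 <= (n0 (trunc n (y t1)))^2"
    using sq_le_wnorm_sq[OF nonneg_one wfin_trunc[of one n "y t1"], of i] i by (simp add: trunc_def)
   also have "... <= en (trunc n (y t1))" by (simp add: en_def)
   finally have "sqrt ((y t1 i)^2) <= sqrt (en_bound T Fb c0)" using e by (intro real_sqrt_le_mono) simp
   then show "abs (y t1 i) < r" by (simp add: r_def)
  qed
 qed
 then obtain x where "!!i. i < n ==> continuous_on {0..T} (%t. x t i)"
   "!!t i. 0 <= t ==> t <= T ==> i < n ==> x t i = c0 i + (LINT s|Leb 0 t. F s i + (\<Sum>j<n. lin_coeff i j * x s j)
    + (\<Sum>j<n. \<Sum>k<n. quad_coeff i j k * (x s j * x s k)))" by fastforce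
 from mk[OF T order_refl this] show ?thesis by blast
qed

end

section \<open>Galerkin approximations form a Cauchy sequence\<close>
context nudged_modes
begin

text \<open>On sequences supported above \<open>m\<close> every eigenvalue is at least \<open>Lambda\<close>, so that higher norms gain factors of \<open>Lambda\<close>.\<close>

lemma tail_weight:
 assumes Lambda: "0 < Lambda" "!!i. m <= i ==> Lambda <= lam i" and q: "D2 q" "!!i. i < m ==> q i = 0"
 shows "n1 q <= n2 q / sqrt Lambda" "n0 q <= n1 q / sqrt Lambda"
proof -
 note q1 = D2_D1(1)[OF q(1)] and q0 = D2_D0[OF q(1)]
 have gen: "Lambda * (wnorm om q)^2 <= (wnorm om' q)^2"
  if "nonneg om" "nonneg om'" "wfin om q" "wfin om' q" "!!i. m <= i ==> Lambda * om i <= om' i" for om om'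
 proof -
  have "Lambda * wsq om q = (\<Sum>i. Lambda * (om i * (q i)^2))" unfolding wsq_def
   by (rule suminf_mult[symmetric]) (use that(3) in "simp add: wfin_def")
  also have "... <= (\<Sum>i. om' i * (q i)^2)"
  proof (rule suminf_le)
   fix i show "Lambda * (om i * (q i)^2) <= om' i * (q i)^2"
    using q(2)[of i] mult_right_mono[OF that(5)[of i], of "(q i)^2"] by (cases "i < m") (auto simp: mult.assoc)
  qed (use that(3,4) in "auto simp: wfin_def intro!: summable_mult")
  finally show ?thesis using that by (simp add: wnorm_sq wsq_def)
 qed
 have "sqrt (Lambda * (n1 q)^2) <= sqrt ((n2 q)^2)"
  by (rule real_sqrt_le_mono[OF gen[OF nn q1 q(1)]])
   (use Lambda(2) lam_pos in "auto simp: power2_eq_square intro!: mult_right_mono less_imp_le")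
 then show "n1 q <= n2 q / sqrt Lambda" using n_nonneg(2)[OF q1] n_nonneg(3)[OF q(1)] Lambda(1) by (simp add: real_sqrt_mult field_simps)
 have "sqrt (Lambda * (n0 q)^2) <= sqrt ((n1 q)^2)"
  by (rule real_sqrt_le_mono[OF gen[OF nonneg_one nn(1) q0 q1]]) (use Lambda(2) in auto)
 then show "n0 q <= n1 q / sqrt Lambda" using n_nonneg(2)[OF q1] n_nonneg(1)[OF q0] Lambda(1) by (simp add: real_sqrt_mult field_simps)
qed

text \<open>The quarter power of \<open>Lambda\<close> is the gain that remains from the square roots of lower norms of the tail in the bound with \<open>k3\<close>.\<close>

lemma form_tail_bound:
 assumes Lambda: "0 < Lambda" "!!i. m <= i ==> Lambda <= lam i" and x: "D2 x" and y: "D2 y"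
  and B: "n1 x <= B" "n1 y <= B"
 shows "abs (beta x (hel x) (tail m y)) <= 2 * k3 * (1/l1 + alpha^2) * B / sqrt (sqrt Lambda) * ((n2 x)^2 + (n2 y)^2)"
proof -
 define q where "q = tail m y"
 define c where "c = 1/l1 + alpha^2"
 define s where "s = sqrt (sqrt Lambda)"
 define X where "X = n2 x"
 define Y where "Y = n2 y"
 have c0: "0 <= c" using l1 by (simp add: c_def)
 have s0: "0 < s" using Lambda by (simp add: s_def)
 have q2: "D2 q" "n2 q <= Y" unfolding q_def Y_def by (rule wfin_tail[OF nn(2) y])+
 note x1 = D2_D1(1)[OF x] and y1 = D2_D1(1)[OF y] and q1 = D2_D1(1)[OF q2(1)] and q0 = D2_D0[OF q2(1)]
 have qB: "n1 q <= B" using wfin_tail(2)[OF nn(1) y1, of m] B by (simp add: q_def)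
 have qz: "q i = 0" if "i < m" for i using that by (simp add: q_def tail_eq)
 note tw1 = tail_weight(1)[where m=m, OF Lambda q2(1) qz] and tw0 = tail_weight(2)[where m=m, OF Lambda q2(1) qz]
 note p = n_nonneg(3)[OF x] n_nonneg(3)[OF y] n_nonneg(2)[OF q1] n_nonneg(2)[OF x1] n_nonneg(1)[OF hel_D0[OF x]]
  n_nonneg(1)[OF q0] n_nonneg(3)[OF q2(1)]
 have B0: "0 <= B" using B p by linarith
 have XY: "0 <= X" "0 <= Y" using p by (simp_all add: X_def Y_def)
 have h: "n0 (hel x) <= c * X" unfolding c_def X_def by (rule hel_norm_le[OF x])
 have sq1: "sqrt (n1 q) <= sqrt Y / s"
 proof -
  have "sqrt (n1 q) <= sqrt (Y / sqrt Lambda)" using tw1 q2(2) Lambda(1)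
   by (intro real_sqrt_le_mono) (auto elim!: order_trans intro!: divide_right_mono)
  then show ?thesis by (simp add: real_sqrt_divide s_def)
 qed
 have sqB: "sqrt (n1 q) <= sqrt B" "sqrt (n1 x) <= sqrt B" using qB B by simp_all
 have sq0: "sqrt (n0 q) <= sqrt (n1 q) / s"
 proof -
  have "sqrt (n0 q) <= sqrt (n1 q / sqrt Lambda)" using tw0 by (rule real_sqrt_le_mono)
  then show ?thesis by (simp add: real_sqrt_divide s_def)
 qed
 have n1q: "n1 q <= sqrt B * (sqrt Y / s)"
 proof -
  have "n1 q = sqrt (n1 q) * sqrt (n1 q)" using p by simp
  also have "... <= sqrt B * (sqrt Y / s)" using p B0 by (intro mult_mono sqB sq1) auto
  finally show ?thesis .
 qed
 have T1: "sqrt (n1 x) * sqrt (n2 x) * n0 (hel x) * n1 q <= c * B / s * (X^2 + Y^2)"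
 proof -
  have "sqrt (n1 x) * sqrt (n2 x) * n0 (hel x) * n1 q <= (sqrt B * sqrt X) * (c * X) * (sqrt B * (sqrt Y / s))"
   unfolding X_def[symmetric] using p XY c0 B0 s0
   by (intro mult_mono[OF _ n1q] mult_mono[OF _ h] mult_right_mono sqB) auto
  also have "... = c * (sqrt B * sqrt B) / s * (X * (sqrt X * sqrt Y))" by simp
  also have "... = c * B / s * (X * (sqrt X * sqrt Y))" using B0 by simp
  also have "... <= c * B / s * (X^2 + Y^2)"
  proof (rule mult_left_mono)
   have "sqrt X * sqrt Y <= (X + Y) / 2"
    using zero_le_power2[of "sqrt X - sqrt Y"] XY by (simp add: power2_diff)
   then have "X * (sqrt X * sqrt Y) <= X * ((X + Y) / 2)" using XY by (intro mult_left_mono)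
   also have "X * ((X + Y) / 2) = (X^2 + X * Y) / 2" by (simp add: power2_eq_square algebra_simps add_divide_distrib)
   also have "... <= X^2 + Y^2"
   proof -
    define w where "w = X * Y"
    have "2 * w <= X^2 + Y^2" using zero_le_power2[of "X - Y"] by (simp add: power2_diff w_def mult.assoc)
    then have "X^2 + w <= 2 * X^2 + 2 * Y^2" using zero_le_power2[of X] zero_le_power2[of Y] by linarith
    then show ?thesis unfolding w_def[symmetric] by simp
   qed
   finally show "X * (sqrt X * sqrt Y) <= X^2 + Y^2" .
  qed (use c0 B0 s0 in simp)
  finally show ?thesis .
 qed
 have T2: "n2 x * n0 (hel x) * sqrt (n0 q) * sqrt (n1 q) <= c * B / s * (X^2 + Y^2)"
 proof -
  have "n2 x * n0 (hel x) * sqrt (n0 q) * sqrt (n1 q) = X * n0 (hel x) * (sqrt (n0 q) * sqrt (n1 q))" by (simp add: X_def)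
  also have "... <= X * (c * X) * (B / s)"
  proof (rule mult_mono)
   have "sqrt (n0 q) * sqrt (n1 q) <= sqrt (n1 q) / s * sqrt (n1 q)" using p by (intro mult_right_mono sq0) auto
   also have "... = n1 q / s" using p by simp
   also have "... <= B / s" using qB s0 by (intro divide_right_mono) auto
   finally show "sqrt (n0 q) * sqrt (n1 q) <= B / s" .
  qed (use p XY c0 h in "auto intro: mult_left_mono")
  also have "... = c * B / s * X^2" by (simp add: power2_eq_square)
  also have "... <= c * B / s * (X^2 + Y^2)" using c0 B0 s0 by (intro mult_left_mono) auto
  finally show ?thesis .
 qed
 have "abs (beta x (hel x) q) <= k3 * (c * B / s * (X^2 + Y^2) + c * B / s * (X^2 + Y^2))"
  using order_trans[OF form_k3[OF x hel_D0[OF x] q1] mult_left_mono[OF add_mono[OF T1 T2] less_imp_le[OF k3]]] .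
 also have "... = 2 * k3 * c * B / s * (X^2 + Y^2)" by simp
 finally show ?thesis by (simp only: q_def c_def s_def X_def Y_def)
qed

lemma ip_tail_bound:
 assumes z: "D0 z" and y: "D2 y"
 shows "abs (ip z (hel (tail m y))) <= n0 (tail m z) * ((1/l1 + alpha^2) * n2 y)"
proof -
 have q: "D2 (tail m y)" "n2 (tail m y) <= n2 y" by (rule wfin_tail[OF nn(2) y])+
 have "ip z (hel (tail m y)) = ip (tail m z) (hel (tail m y))"
  unfolding ip_def by (intro suminf_cong) (simp add: hel_def tail_eq)
 moreover have "abs (ip (tail m z) (hel (tail m y))) <= n0 (tail m z) * n0 (hel (tail m y))"
  by (rule ip_summable(4)[OF wfin_tail(1)[OF nonneg_one z] hel_D0[OF q(1)]])
 moreover have "n0 (hel (tail m y)) <= (1/l1 + alpha^2) * n2 y"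
  using hel_norm_le[OF q(1)] mult_left_mono[OF q(2), of "1/l1 + alpha^2"] l1 by simp
 ultimately show ?thesis
  using mult_left_mono[OF _ n_nonneg(1)[OF wfin_tail(1)[OF nonneg_one z]], of "n0 (hel (tail m y))" "(1/l1 + alpha^2) * n2 y" m] by linarith
qed

lemma tail_add: "tail m (%i. a i + b i) = (%i. tail m a i + tail m b i)"
 and tail_scale: "tail m (%i. k * a i) = (%i. k * tail m a i)"
 by (auto simp: tail_eq)

text \<open>\<open>R\<close> need not preserve truncations. It is compact from \<open>D(A)\<close> to \<open>H\<close>: up to a small error only finitely many
  modes enter, and each of their images has small tails.\<close>

lemma R_tail_small:
 assumes "0 < eps"
 shows "\<exists>M. \<forall>m\<ge>M. \<forall>c. D2 c --> n0 (tail m (R c)) <= eps * n2 c"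
proof -
 (* With this Lambda the modes above l contribute at most half of eps. *)
 define Lambda where "Lambda = (2 * CR / eps + 1)^2"
 have pos: "0 < 2 * CR / eps + 1" using CR_nonneg assms by (intro add_nonneg_pos) auto
 have sqLambda: "sqrt Lambda = 2 * CR / eps + 1" using pos by (simp add: Lambda_def)
 have Lambda: "0 < Lambda" "CR / sqrt Lambda <= eps / 2"
  unfolding sqLambda using pos assms by (simp add: Lambda_def, simp add: pos_divide_le_eq field_simps)
 obtain l where l: "!!i. l <= i ==> Lambda <= lam i"
  using lam_at_top unfolding filterlim_at_top eventually_sequentially by blast
 define eta where "eta = eps * l1 / (2 * (real l + 1))"
 have eta: "0 < eta" using assms l1 by (simp add: eta_def)
 have "\<forall>\<^sub>F m in sequentially. \<forall>j\<in>{..<l}. n0 (tail m (R (unit j))) < eta"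
 proof (rule eventually_ball_finite)
  show "\<forall>j\<in>{..<l}. \<forall>\<^sub>F m in sequentially. n0 (tail m (R (unit j))) < eta"
   using order_tendstoD(2)[OF wfin_tail(3)[OF nonneg_one R_D0[OF wfin_unit]] eta] by blast
 qed simp
 then obtain M where M: "!!m j. M <= m ==> j < l ==> n0 (tail m (R (unit j))) < eta"
  unfolding eventually_sequentially by (metis lessThan_iff)
 have tl: "D0 (tail m (R c))" if "D1 c" for m c by (rule wfin_tail(1)[OF nonneg_one R_D0[OF that]])
 show ?thesis
 proof (intro exI[of _ M] allI impI)
  fix m c assume m: "M <= m" and c: "D2 c"
  note c1 = D2_D1(1)[OF c]
  have cj: "abs (c j) <= n2 c / l1" for j
  proof -
   have "l1^2 * (c j)^2 <= lam2 j * (c j)^2" using l1 by (intro mult_right_mono power_mono) auto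
   also have "... <= (n2 c)^2" by (rule sq_le_wnorm_sq[OF nn(2) c])
   finally have "(l1 * abs (c j))^2 <= (n2 c)^2" by (simp add: power_mult_distrib)
   then have "l1 * abs (c j) <= n2 c" by (rule power2_le_imp_le) (rule n_nonneg(3)[OF c])
   then show ?thesis using l1 by (simp add: field_simps)
  qed
  have part: "n0 (tail m (R (trunc k c))) <= (\<Sum>j<k. abs (c j) * n0 (tail m (R (unit j))))" for k
  proof (induction k)
   case 0
   have "trunc 0 c = (%i. 0 * unit 0 i)" by (auto simp: trunc_def)
   then have "R (trunc 0 c) = (%i. 0)" using R_scale[OF wfin_unit, of 0 0] by simp
   then show ?case by (simp add: tail_eq wnorm_def wsq_def)
  next
   case (Suc k)
   have e: "trunc (Suc k) c = (%i. trunc k c i + c k * unit k i)" by (auto simp: trunc_def unit_def fun_eq_iff less_Suc_eq)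
   have "tail m (R (trunc (Suc k) c)) = (%i. tail m (R (trunc k c)) i + c k * tail m (R (unit k)) i)"
    unfolding e using R_add[OF wfin_trunc[of _ k c] wfin_scale(1)[where k="c k", OF wfin_unit[of _ k]]] R_scale[OF wfin_unit, of "c k" k]
    by (simp add: tail_add tail_scale)
   then have "n0 (tail m (R (trunc (Suc k) c))) <= n0 (tail m (R (trunc k c))) + n0 (%i. c k * tail m (R (unit k)) i)"
    using wfin_add(2)[OF nonneg_one tl[OF wfin_trunc] wfin_scale(1)[OF tl[OF wfin_unit]]] by simp
   also have "n0 (%i. c k * tail m (R (unit k)) i) = abs (c k) * n0 (tail m (R (unit k)))" by (rule wfin_scale(3)[OF tl[OF wfin_unit]])
   finally show ?case using Suc by simp
  qed
  have 1: "n0 (tail m (R (trunc l c))) <= eps / 2 * n2 c"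
  proof -
   have "n0 (tail m (R (trunc l c))) <= (\<Sum>j<l. abs (c j) * n0 (tail m (R (unit j))))" by (rule part)
   also have "... <= (\<Sum>j<l. n2 c / l1 * eta)"
    using cj M[OF m] n_nonneg(1)[OF tl[OF wfin_unit]] n_nonneg(3)[OF c] l1 by (intro sum_mono mult_mono) (auto intro: less_imp_le)
   also have "... = (eps / 2 * n2 c) * (real l / (real l + 1))" using l1 by (simp add: eta_def field_simps)
   also have "... <= (eps / 2 * n2 c) * 1" using n_nonneg(3)[OF c] assms by (intro mult_left_mono) auto
   finally show ?thesis by simp
  qed
  have t2: "D2 (tail l c)" "n2 (tail l c) <= n2 c" by (rule wfin_tail[OF nn(2) c])+
  have 2: "n0 (tail m (R (tail l c))) <= eps / 2 * n2 c"
  proof -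
   have "n0 (tail m (R (tail l c))) <= n0 (R (tail l c))" by (rule wfin_tail(2)[OF nonneg_one R_D0[OF D2_D1(1)[OF t2(1)]]])
   also have "... <= CR * n1 (tail l c)" by (rule R_bound[OF D2_D1(1)[OF t2(1)]])
   also have "... <= CR * (n2 c / sqrt Lambda)"
   proof (rule mult_left_mono[OF _ CR_nonneg])
    have "n1 (tail l c) <= n2 (tail l c) / sqrt Lambda" by (rule tail_weight(1)[OF Lambda(1) l t2(1)]) (auto simp: tail_eq)
    also have "... <= n2 c / sqrt Lambda" using t2(2) Lambda(1) by (intro divide_right_mono) auto
    finally show "n1 (tail l c) <= n2 c / sqrt Lambda" .
   qed
   also have "... = (CR / sqrt Lambda) * n2 c" by simp
   also have "... <= eps / 2 * n2 c" using Lambda(2) n_nonneg(3)[OF c] by (intro mult_right_mono)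
   finally show ?thesis .
  qed
  have "c = (%i. trunc l c i + tail l c i)" by (auto simp: tail_def)
  then have "R c = (%i. R (trunc l c) i + R (tail l c) i)"
   using R_add[OF wfin_trunc[of lam l c] D2_D1(1)[OF t2(1)]] by metis
  then have "n0 (tail m (R c)) <= n0 (tail m (R (trunc l c))) + n0 (tail m (R (tail l c)))"
   using wfin_add(2)[OF nonneg_one tl[OF wfin_trunc] tl[OF D2_D1(1)[OF t2(1)]]] by (simp add: tail_add)
  with 1 2 show "n0 (tail m (R c)) <= eps * n2 c" by simp
 qed
qed

text \<open>The terms by which the Galerkin solution with \<open>m\<close> modes fails to solve the system with more modes.\<close>

definition gal_err :: "nat => seq => seq => seq => real" where
 "gal_err m F x y = abs (beta x (hel x) (tail m y)) + abs (ip F (hel (tail m y))) + mu * abs (ip (R x) (hel (tail m y)))"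

text \<open>The difference of two Galerkin solutions satisfies the estimate for differences of solutions, with \<open>gal_err\<close> as an additional term.\<close>

lemma gal_difference_rate:
 assumes mn: "m <= n" and x: "!!i. m <= i ==> x i = 0" and y: "!!i. n <= i ==> y i = 0" and F: "D0 F"
 defines "d \<equiv> %i. y i - x i"
 shows "2 * ip (hel d) (%i. (if i < n then flow F y i else 0) - (if i < m then flow F x i else 0))
  <= - (nu / 2) * dis d + k8 * (n2 x)^2 * en d + 2 * gal_err m F x y"
proof -
 define g where "g i = (if i < n then flow F y i else 0)" for i
 define g' where "g' i = (if i < m then flow F x i else 0)" for i
 define q where "q = tail m y"
 have x2: "D2 x" by (rule wfin_support(1)[of m]) (rule x)
 have y2: "D2 y" by (rule wfin_support(1)[of n]) (rule y)
 have d2: "D2 d" unfolding d_def by (rule wfin_diff(1)[OF nn(2) y2 x2])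
 have q2: "D2 q" unfolding q_def by (rule wfin_tail(1)[OF nn(2) y2])
 have g0: "D0 g" "D0 g'" by (rule wfin_support(1)[of n], simp add: g_def, rule wfin_support(1)[of m], simp add: g'_def)
 (* The equation for x has no modes above m, so it may be tested only with the part of d below m. *)
 define d' where "d' = (%i. d i - q i)"
 have d'2: "D2 d'" unfolding d'_def by (rule wfin_diff(1)[OF nn(2) d2 q2])
 have d'0: "d' i = 0" if "m <= i" for i using x[OF that] that by (simp add: d'_def d_def q_def tail_eq)
 have q0: "q i = 0" if "i < m" for i using that by (simp add: q_def tail_eq)
 note h = hel_D0[OF d2] and h' = hel_D0[OF d'2] and hq = hel_D0[OF q2] and x1 = D2_D1(1)[OF x2] and y1 = D2_D1(1)[OF y2]
 have hd': "hel d' = (%i. hel d i - hel q i)" by (auto simp: hel_def d'_def algebra_simps)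
 have A: "ip (hel d) g = - nu * ip (%i. lam i * y i) (hel d) - beta y (hel y) d + ip F (hel d) - mu * ip (R y) (hel d)"
  by (rule test_flow[OF y2 F _ d2]) (use x y mn in "force simp: g_def d_def")
 have B: "ip (hel d) g' = - nu * ip (%i. lam i * x i) (hel d') - beta x (hel x) d' + ip F (hel d') - mu * ip (R x) (hel d')"
 proof -
  have "ip (hel d) g' = ip (hel d') g'" unfolding ip_def
   by (intro suminf_cong) (use q0 in "auto simp: hel_def d'_def g'_def")
  also have "... = - nu * ip (%i. lam i * x i) (hel d') - beta x (hel x) d' + ip F (hel d') - mu * ip (R x) (hel d')"
   by (rule test_flow[OF x2 F _ d'2]) (use d'0 in "force simp: g'_def")
  finally show ?thesis .
 qed
 have C: "ip (%i. lam i * x i) (hel d') = ip (%i. lam i * x i) (hel d)" unfolding ip_def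
 proof (rule suminf_cong)
  fix i show "lam i * x i * hel d' i = lam i * x i * hel d i"
   using x[of i] q0[of i] by (cases "i < m") (auto simp: hel_def d'_def)
 qed
 have D: "ip (%i. lam i * y i) (hel d) - ip (%i. lam i * x i) (hel d) = dis d"
  using ip_diff_left[OF h lam_scale(1)[OF y2] lam_scale(1)[OF x2]] ip_lam_hel[OF d2] by (simp add: d_def right_diff_distrib)
 have E: "beta y (hel y) d - beta x (hel x) d = beta x (hel d) d"
 proof -
  have "beta d (hel y) d = beta y (hel y) d - beta x (hel y) d"
   unfolding d_def by (rule DH.form_diff1) (use x2 y2 hel_D0 D2_D1(1) wfin_diff(1)[OF nn(1)] in auto)
  moreover have "beta d (hel y) d = 0" by (rule form_cancel[OF d2 hel_D0[OF y2]])
  moreover have "hel d = (%i. hel y i - hel x i)" by (auto simp: hel_def d_def algebra_simps)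
  then have "beta x (hel d) d = beta x (hel y) d - beta x (hel x) d"
   using DH.form_diff2[OF x2 hel_D0[OF y2] hel_D0[OF x2] D2_D1(1)[OF d2]] by simp
  ultimately show ?thesis by simp
 qed
 have E': "beta x (hel x) d' = beta x (hel x) d - beta x (hel x) q"
  unfolding d'_def by (rule VH.form_diff3[OF x1 hel_D0[OF x2] d2 q2])
 have I: "ip F (hel d') = ip F (hel d) - ip F (hel q)" unfolding hd' by (rule ip_diff_right[OF F h hq])
 have J: "ip (R x) (hel d') = ip (R x) (hel d) - ip (R x) (hel q)" unfolding hd' by (rule ip_diff_right[OF R_D0[OF x1] h hq])
 have Kk: "ip (R y) (hel d) - ip (R x) (hel d) = ip (R d) (hel d)"
  using ip_diff_left[OF h R_D0[OF y1] R_D0[OF x1]] R_diff[OF y1 x1] by (simp add: d_def)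
 have "ip (hel d) (%i. g i - g' i) = ip (hel d) g - ip (hel d) g'" by (rule ip_diff_right[OF h g0])
 also have "... = - nu * (ip (%i. lam i * y i) (hel d) - ip (%i. lam i * x i) (hel d)) - (beta y (hel y) d - beta x (hel x) d)
   - mu * (ip (R y) (hel d) - ip (R x) (hel d)) - beta x (hel x) q + ip F (hel q) - mu * ip (R x) (hel q)"
  unfolding A B C E' I J by (simp add: algebra_simps)
 finally have "2 * ip (hel d) (%i. g i - g' i) = (- 2 * nu * dis d - 2 * beta x (hel d) d - 2 * mu * ip (R d) (hel d))
   + 2 * (- beta x (hel x) q + ip F (hel q) - mu * ip (R x) (hel q))" unfolding D E Kk by simp
 moreover have "- beta x (hel x) q + ip F (hel q) - mu * ip (R x) (hel q) <= gal_err m F x y"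
 proof -
  have "- (mu * ip (R x) (hel q)) <= mu * abs (ip (R x) (hel q))" using mu by (metis abs_ge_minus_self abs_mult abs_of_pos)
  moreover have "- beta x (hel x) q <= abs (beta x (hel x) q)" "ip F (hel q) <= abs (ip F (hel q))" by simp_all
  ultimately show ?thesis unfolding gal_err_def q_def by linarith
 qed
 moreover have "(- mu + k8 * (n2 x)^2) * en d <= k8 * (n2 x)^2 * en d"
  using mu en_nonneg[of d] by (simp add: algebra_simps)
 ultimately show ?thesis using key_estimate[OF x2 d2] by (simp add: g_def g'_def)
qed

lemma gal_err_bound:
 assumes Lambda: "0 < Lambda" "!!i. m <= i ==> Lambda <= lam i" and x: "D2 x" and y: "D2 y" and F: "D0 F"
  and B: "n1 x <= B" "n1 y <= B" and eps: "0 <= eps" "n0 (tail m (R x)) <= eps * n2 x" and sg: "0 < sg"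
 defines "c \<equiv> 1/l1 + alpha^2"
 shows "gal_err m F x y <= (2 * k3 * c * B / sqrt (sqrt Lambda) + sg * c^2 + mu * eps * c) * ((n2 x)^2 + (n2 y)^2) + (n0 (tail m F))^2 / sg"
proof -
 have c0: "0 <= c" using l1 by (simp add: c_def)
 have S: "0 <= (n2 x)^2 + (n2 y)^2" by simp
 have 1: "abs (beta x (hel x) (tail m y)) <= 2 * k3 * c * B / sqrt (sqrt Lambda) * ((n2 x)^2 + (n2 y)^2)"
  unfolding c_def by (rule form_tail_bound[OF Lambda x y B])
 have 2: "abs (ip F (hel (tail m y))) <= (n0 (tail m F))^2 / sg + sg * c^2 * ((n2 x)^2 + (n2 y)^2)"
 proof -
  define p where "p = n0 (tail m F)"
  define z where "z = c * n2 y"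
  have "abs (ip F (hel (tail m y))) <= p * z" using ip_tail_bound[OF F y, of m] by (simp add: p_def z_def c_def)
  also have "p * z <= p^2 / sg + sg * z^2"
  proof -
   have "0 <= (p - sg * z)^2 / sg + p^2 / sg + sg * z^2" using sg by simp
   also have "... = 2 * (p^2 / sg + sg * z^2 - p * z)" using sg by (simp add: power2_eq_square field_simps)
   finally show ?thesis by simp
  qed
  also have "sg * z^2 <= sg * c^2 * ((n2 x)^2 + (n2 y)^2)" using sg by (simp add: z_def power_mult_distrib algebra_simps)
  finally show ?thesis by (simp add: p_def)
 qed
 have 3: "mu * abs (ip (R x) (hel (tail m y))) <= mu * eps * c * ((n2 x)^2 + (n2 y)^2)"
 proof -
  have "abs (ip (R x) (hel (tail m y))) <= n0 (tail m (R x)) * (c * n2 y)"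
   using ip_tail_bound[OF R_D0[OF D2_D1(1)[OF x]] y, of m] by (simp add: c_def)
  also have "... <= eps * n2 x * (c * n2 y)" using eps c0 n_nonneg(3)[OF y] by (intro mult_right_mono) auto
  also have "... = eps * c * (n2 x * n2 y)" by simp
  also have "... <= eps * c * ((n2 x)^2 + (n2 y)^2)"
  proof (rule mult_left_mono)
   show "n2 x * n2 y <= (n2 x)^2 + (n2 y)^2"
    using zero_le_power2[of "n2 x - n2 y"] zero_le_power2[of "n2 x"] zero_le_power2[of "n2 y"] unfolding power2_diff by linarith
  qed (use eps c0 in simp)
  finally have "mu * abs (ip (R x) (hel (tail m y))) <= mu * (eps * c * ((n2 x)^2 + (n2 y)^2))" using mu by (intro mult_left_mono) auto
  then show ?thesis by (simp add: mult.assoc)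
 qed
 from 1 2 3 show ?thesis unfolding gal_err_def distrib_right by linarith
qed

lemma n1_le_en: assumes "D1 c" "en c <= M" shows "n1 c <= sqrt M / alpha"
proof -
 have "(alpha * n1 c)^2 <= M" using assms(2) zero_le_power2[of "n0 c"] unfolding en_def power_mult_distrib by linarith
 then have "alpha * n1 c <= sqrt M" by (rule real_le_rsqrt)
 then show ?thesis using alpha by (simp add: field_simps)
qed

lemma forcing_tail:
 fixes F :: "real => seq"
 assumes F: "!!t. 0 <= t ==> t <= T ==> D0 (F t) & n0 (F t) <= Fb" and Fc: "!!i. continuous_on {0..T} (%t. F t i)"
 shows "integrable (Leb 0 T) (%t. (n0 (tail m (F t)))^2)"
  "(%m. LINT t|Leb 0 T. (n0 (tail m (F t)))^2) ----> 0"
proof -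
 let ?M = "Leb 0 T"
 have meas: "(%t. (n0 (tail m (F t)))^2) \<in> borel_measurable ?M" for m
 proof (rule borel_measurable_AE_lim_on)
  show "(%t. \<Sum>i<k. (tail m (F t) i)^2) \<in> borel_measurable ?M" for k
  proof (rule continuous_imp_measurable_on_sets_lebesgue)
   have "continuous_on {0..T} (%t. tail m (F t) i)" for i by (cases "i < m") (auto simp: tail_eq intro: Fc)
   then show "continuous_on {0..T} (%t. \<Sum>i<k. (tail m (F t) i)^2)" by (intro continuous_on_sum continuous_on_power)
  qed simp
  show "AE t in ?M. (%k. \<Sum>i<k. (tail m (F t) i)^2) ----> (n0 (tail m (F t)))^2"
  proof (rule AE_I2)
   fix t assume "t \<in> space ?M"
   then have f: "D0 (tail m (F t))" using F by (intro wfin_tail(1)) auto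
   show "(%k. \<Sum>i<k. (tail m (F t) i)^2) ----> (n0 (tail m (F t)))^2"
    using summable_LIMSEQ[OF f[unfolded wfin_def]] by (simp add: wnorm_sq[OF nonneg_one f] wsq_def)
  qed
 qed auto
 have bd: "norm ((n0 (tail m (F t)))^2) <= Fb^2" if "t \<in> space ?M" for t m
 proof -
  have "n0 (tail m (F t)) <= Fb" using wfin_tail(2)[OF nonneg_one, of "F t" m] F[of t] that by auto
  then show ?thesis using n_nonneg(1)[OF wfin_tail(1)[OF nonneg_one, of "F t" m]] F[of t] that by (auto intro!: power_mono)
 qed
 show "integrable ?M (%t. (n0 (tail m (F t)))^2)"
  by (rule Bochner_Integration.integrable_bound[OF _ meas, of "%t. Fb^2"]) (use bd in "auto intro!: AE_I2")
 have "(%m. LINT t|?M. (n0 (tail m (F t)))^2) ----> (LINT t|?M. 0)"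
 proof (rule integral_dominated_convergence[where w="%t. Fb^2"])
  show "AE t in ?M. (%m. (n0 (tail m (F t)))^2) ----> 0"
  proof (rule AE_I2)
   fix t assume "t \<in> space ?M"
   then have "(%m. n0 (tail m (F t))) ----> 0" using F by (intro wfin_tail(3)) auto
   from tendsto_power[OF this, of 2] show "(%m. (n0 (tail m (F t)))^2) ----> 0" by simp
  qed
 qed (use meas bd in "auto intro!: AE_I2")
 then show "(%m. LINT t|?M. (n0 (tail m (F t)))^2) ----> 0" by simp
qed

text \<open>\<open>S\<close> collects the tail of the initial data and a bound for the time integral of \<open>gal_err\<close>; it tends to zero with \<open>m\<close>
  when \<open>Lambda\<close>, \<open>eps\<close> and \<open>sg\<close> are chosen suitably.\<close>

lemma gal_difference:
 assumes T: "0 <= T" and c0: "D1 c0" and F: "!!t. 0 <= t ==> t <= T ==> D0 (F t) & n0 (F t) <= Fb"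
  and Fc: "!!i. continuous_on {0..T} (%t. F t i)"
  and mn: "m <= n" and x: "gal T F c0 m x" and y: "gal T F c0 n y"
  and Lambda: "0 < Lambda" "!!i. m <= i ==> Lambda <= lam i"
  and eps: "0 <= eps" "!!c. D2 c ==> n0 (tail m (R c)) <= eps * n2 c" and sg: "0 < sg"
 defines "c \<equiv> 1/l1 + alpha^2" and "J \<equiv> dis_bound T Fb c0" and "K \<equiv> k8"
 defines "A \<equiv> 2 * k3 * c * (sqrt (en_bound T Fb c0) / alpha) / sqrt (sqrt Lambda) + sg * c^2 + mu * eps * c"
 defines "S \<equiv> en (tail m c0) + (4 * A * J + 2 / sg * (LINT t|Leb 0 T. (n0 (tail m (F t)))^2))"
 shows "0 <= t ==> t <= T ==> en (%i. y t i - x t i) <= S * exp (K * J)"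
  "nu / 2 * alpha^2 * (LINT t|Leb 0 T. (n2 (%i. y t i - x t i))^2) <= S + K * J * (S * exp (K * J))"
  "0 <= S"
proof -
 define d where "d t = (%i. y t i - x t i)" for t
 define gamma where "gamma t i = gal_rate n F y t i - gal_rate m F x t i" for t i
 define e where "e t = A * ((n2 (x t))^2 + (n2 (y t))^2) + (n0 (tail m (F t)))^2 / sg" for t
 have xt: "traj T x (gal_rate m F x)" "!!t i. m <= i ==> x t i = 0" "x 0 = trunc m c0" using x by (auto simp: gal_def)
 have yt: "traj T y (gal_rate n F y)" "!!t i. n <= i ==> y t i = 0" "y 0 = trunc n c0" using y by (auto simp: gal_def)
 have dt: "traj T d gamma" unfolding d_def gamma_def by (rule traj_diff[OF yt(1) xt(1)])
 have x2: "D2 (x t)" and y2: "D2 (y t)" for t by (rule wfin_support(1)[of m], simp add: xt, rule wfin_support(1)[of n], simp add: yt)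
 have M0: "0 <= en_bound T Fb c0" unfolding en_bound_def using en_nonneg[of c0] T nu by simp
 have c: "0 <= c" using l1 by (simp add: c_def)
 have K: "0 <= K" using nu l1 by (simp add: K_def)
 have A: "0 <= A" unfolding A_def using k3 c alpha M0 Lambda(1) sg mu eps(1) by (intro add_nonneg_nonneg mult_nonneg_nonneg divide_nonneg_nonneg) auto
 have Jx: "(LINT t|Leb 0 T. (n2 (x t))^2) <= J" and Jy: "(LINT t|Leb 0 T. (n2 (y t))^2) <= J"
  unfolding J_def by (rule gal_bounds(2)[OF x T c0 F], assumption+, rule gal_bounds(2)[OF y T c0 F], assumption+)
 have J0: "0 <= J" using Jx by (rule order_trans[rotated]) simp
 have enb: "en (x t) <= en_bound T Fb c0" "en (y t) <= en_bound T Fb c0" if t: "0 <= t" "t <= T" for t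
 proof -
  have "en (x t) <= en_bound t Fb c0" by (rule gal_bounds(1)[OF gal_mono[OF x t] t(1) c0 F]) (use t in auto)
  moreover have "en (y t) <= en_bound t Fb c0" by (rule gal_bounds(1)[OF gal_mono[OF y t] t(1) c0 F]) (use t in auto)
  ultimately show "en (x t) <= en_bound T Fb c0" "en (y t) <= en_bound T Fb c0" using en_bound_mono[OF t, of Fb c0] by linarith+
 qed
 note xi = trajD(3)[OF xt(1)] and yi = trajD(3)[OF yt(1)] and di = trajD(3)[OF dt]
 note ec = energy_continuous[OF dt T] and phi = forcing_tail(1)[where F=F and T=T and m=m, OF F Fc]
 have ei: "integrable (Leb 0 T) e" unfolding e_def using xi yi phi by auto
 have e0: "0 <= e t" for t unfolding e_def using A sg by simp
 have eint: "(LINT t|Leb 0 T. 2 * e t) <= 4 * A * J + 2 / sg * (LINT t|Leb 0 T. (n0 (tail m (F t)))^2)"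
 proof -
  have "(LINT t|Leb 0 T. e t) = A * ((LINT t|Leb 0 T. (n2 (x t))^2) + (LINT t|Leb 0 T. (n2 (y t))^2))
    + (LINT t|Leb 0 T. (n0 (tail m (F t)))^2) / sg"
   unfolding e_def using xi yi phi by simp
  also have "... <= A * (J + J) + (LINT t|Leb 0 T. (n0 (tail m (F t)))^2) / sg"
   using Jx Jy A by (intro add_right_mono mult_left_mono add_mono) auto
  finally show ?thesis by (simp add: algebra_simps)
 qed
 have S0: "0 <= S" unfolding S_def using en_nonneg A J0 sg by (intro add_nonneg_nonneg mult_nonneg_nonneg) auto
 then show "0 <= S" .
 have d0: "en (d 0) <= en (tail m c0)"
 proof -
  have "d 0 = trunc n (tail m c0)" using mn by (auto simp: d_def xt(3) yt(3) trunc_def tail_eq)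
  then show ?thesis using en_trunc_le(1)[OF wfin_tail(1)[OF nn(1) c0]] by simp
 qed
 have rate: "2 * ip (hel (d t)) (gamma t) <= - (nu / 2 * alpha^2) * (n2 (d t))^2 + en (d t) * (K * (n2 (x t))^2) + 2 * e t"
  if t: "0 <= t" "t <= T" for t
 proof -
  have Ft: "D0 (F t)" using F t by blast
  have "2 * ip (hel (d t)) (gamma t) <= - (nu / 2) * dis (d t) + K * (n2 (x t))^2 * en (d t) + 2 * gal_err m (F t) (x t) (y t)"
   unfolding d_def gamma_def gal_rate_def K_def by (rule gal_difference_rate[OF mn xt(2) yt(2) Ft])
  moreover have "gal_err m (F t) (x t) (y t) <= e t" unfolding e_def A_def c_def
   by (rule gal_err_bound[OF Lambda x2 y2 Ft n1_le_en[OF D2_D1(1)[OF x2] enb(1)[OF t]] n1_le_en[OF D2_D1(1)[OF y2] enb(2)[OF t]] eps(1) eps(2)[OF x2] sg])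
  moreover have "nu / 2 * alpha^2 * (n2 (d t))^2 <= nu / 2 * dis (d t)" using nu by (simp add: dis_def algebra_simps)
  ultimately show ?thesis by (simp add: mult_ac)
 qed
 have ki: "integrable (Leb 0 T) (%t. K * (n2 (x t))^2)" using xi by simp
 note eki = integrable_mult_continuous[OF ki ec]
 have int: "en (d t) <= S + (LINT s|Leb 0 t. - (nu / 2 * alpha^2) * (n2 (d s))^2 + en (d s) * (K * (n2 (x s))^2))"
  if t: "0 <= t" "t <= T" for t
 proof -
  have i: "integrable (Leb 0 t) (%s. - (nu / 2 * alpha^2) * (n2 (d s))^2 + en (d s) * (K * (n2 (x s))^2))"
   "integrable (Leb 0 t) (%s. 2 * e s)"
   by (rule integrable_within[OF _ order_refl t(2)], use di eki in auto)
     (rule integrable_within[OF _ order_refl t(2)], use ei in auto)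
  have "en (d t) - en (d 0) = (LINT s|Leb 0 t. 2 * ip (hel (d s)) (gamma s))"
   by (rule energy_identity_between[OF dt order_refl t])
  also have "... <= (LINT s|Leb 0 t. (- (nu / 2 * alpha^2) * (n2 (d s))^2 + en (d s) * (K * (n2 (x s))^2)) + 2 * e s)"
  proof (rule integral_mono)
   show "integrable (Leb 0 t) (%s. 2 * ip (hel (d s)) (gamma s))"
    by (rule integrable_within[OF energy_identity(1)[OF dt T] order_refl t(2)])
   show "integrable (Leb 0 t) (%s. (- (nu / 2 * alpha^2) * (n2 (d s))^2 + en (d s) * (K * (n2 (x s))^2)) + 2 * e s)"
    by (rule Bochner_Integration.integrable_add[OF i])
  qed (use rate t in auto)
  also have "... = (LINT s|Leb 0 t. - (nu / 2 * alpha^2) * (n2 (d s))^2 + en (d s) * (K * (n2 (x s))^2)) + (LINT s|Leb 0 t. 2 * e s)"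
   by (rule Bochner_Integration.integral_add[OF i])
  also have "(LINT s|Leb 0 t. 2 * e s) <= (LINT s|Leb 0 T. 2 * e s)"
   by (rule integral_subinterval_le) (use ei t e0 in auto)
  finally show ?thesis using d0 eint unfolding S_def by linarith
 qed
 have bd: "en (d t) <= S * exp (K * J)" if t: "0 <= t" "t <= T" for t
 proof -
  have "en (d t) <= S * exp (LINT s|Leb 0 t. K * (n2 (x s))^2)"
  proof (rule gronwall_forced[OF t(1)])
   show "continuous_on {0..t} (%t. en (d t))" by (rule continuous_on_subset[OF ec]) (use t in auto)
   show "integrable (Leb 0 t) (%s. K * (n2 (x s))^2)" by (rule integrable_within[OF ki order_refl t(2)])
   fix s assume s: "0 <= s" "s <= t"
   then have sT: "s <= T" using t by simp
   have "(LINT s|Leb 0 s. - (nu / 2 * alpha^2) * (n2 (d s))^2 + en (d s) * (K * (n2 (x s))^2)) <= (LINT s|Leb 0 s. en (d s) * (K * (n2 (x s))^2))"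
   proof (rule integral_mono)
    show "integrable (Leb 0 s) (%s. - (nu / 2 * alpha^2) * (n2 (d s))^2 + en (d s) * (K * (n2 (x s))^2))"
     by (rule integrable_within[OF _ order_refl sT]) (use di eki in auto)
    show "integrable (Leb 0 s) (%s. en (d s) * (K * (n2 (x s))^2))" by (rule integrable_within[OF eki order_refl sT])
   qed (use nu in simp)
   then show "en (d s) <= S + (LINT s|Leb 0 s. en (d s) * (K * (n2 (x s))^2))" using int[OF s(1) sT] by linarith
  qed (use S0 K en_nonneg in auto)
  also have "(LINT s|Leb 0 t. K * (n2 (x s))^2) <= (LINT s|Leb 0 T. K * (n2 (x s))^2)"
   by (rule integral_subinterval_le[OF ki]) (use t K in auto)
  then have "S * exp (LINT s|Leb 0 t. K * (n2 (x s))^2) <= S * exp (K * J)"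
   using Jx K S0 by (intro mult_left_mono) (auto elim!: order_trans intro!: mult_left_mono)
  finally show ?thesis .
 qed
 then show "en (%i. y t i - x t i) <= S * exp (K * J)" if "0 <= t" "t <= T" for t using that by (simp add: d_def)
 have "(LINT s|Leb 0 T. en (d s) * (K * (n2 (x s))^2)) <= (LINT s|Leb 0 T. S * exp (K * J) * (K * (n2 (x s))^2))"
  by (rule integral_mono[OF eki]) (use ki bd K in "auto intro!: mult_right_mono")
 also have "... = S * exp (K * J) * (K * (LINT s|Leb 0 T. (n2 (x s))^2))" by simp
 also have "... <= S * exp (K * J) * (K * J)" using S0 K Jx by (intro mult_left_mono) auto
 finally have 1: "(LINT s|Leb 0 T. en (d s) * (K * (n2 (x s))^2)) <= K * J * (S * exp (K * J))" by (simp add: mult_ac)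
 have "(LINT s|Leb 0 T. - (nu / 2 * alpha^2) * (n2 (d s))^2 + en (d s) * (K * (n2 (x s))^2))
   = - (nu / 2 * alpha^2) * (LINT s|Leb 0 T. (n2 (d s))^2) + (LINT s|Leb 0 T. en (d s) * (K * (n2 (x s))^2))"
  using di eki by (subst Bochner_Integration.integral_add) auto
 then show "nu / 2 * alpha^2 * (LINT t|Leb 0 T. (n2 (%i. y t i - x t i))^2) <= S + K * J * (S * exp (K * J))"
  using int[OF T order_refl] en_nonneg[of "d T"] 1 by (simp add: d_def)
qed

theorem gal_cauchy:
 assumes T: "0 <= T" and c0: "D1 c0" and F: "!!t. 0 <= t ==> t <= T ==> D0 (F t) & n0 (F t) <= Fb"
  and Fc: "!!i. continuous_on {0..T} (%t. F t i)" and e: "0 < e"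
 shows "\<exists>N. \<forall>m n x y. N <= m --> m <= n --> gal T F c0 m x --> gal T F c0 n y -->
   (\<forall>t\<in>{0..T}. en (%i. y t i - x t i) <= e) & (LINT t|Leb 0 T. (n2 (%i. y t i - x t i))^2) <= e"
proof -
 define c where "c = 1/l1 + alpha^2"
 define J where "J = dis_bound T Fb c0"
 define K where "K = k8"
 define B where "B = 2 * k3 * c * (sqrt (en_bound T Fb c0) / alpha)"
 have M0: "0 <= en_bound T Fb c0" unfolding en_bound_def using en_nonneg[of c0] T nu by simp
 have c: "0 < c" using l1 by (simp add: c_def add_pos_nonneg)
 have K: "0 <= K" using nu l1 by (simp add: K_def)
 have J: "0 <= J" unfolding J_def dis_bound_def using en_nonneg[of c0] T nu M0 by simp
 have B: "0 <= B" using k3 c alpha M0 by (simp add: B_def)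
 define Z where "Z = exp (K * J) + 2 / (nu * alpha^2) * (1 + K * J * exp (K * J))"
 have Z1: "0 < exp (K * J)" "0 <= 2 / (nu * alpha^2) * (1 + K * J * exp (K * J))" using nu K J by auto
 have Z: "0 < Z" unfolding Z_def by (rule add_pos_nonneg[OF Z1])
 define S0 where "S0 = e / Z"
 have S0: "0 < S0" using e Z by (simp add: S0_def)
 define sg where "sg = S0 / (16 * (c^2 * J + 1))"
 define eps where "eps = S0 / (16 * (mu * c * J + 1))"
 define r where "r = 16 * B * J / S0 + 1"
 have r: "0 < r" using B J S0 by (simp add: r_def add_nonneg_pos)
 have p: "0 < c^2 * J + 1" "0 < mu * c * J + 1" using c mu J by (simp_all add: add_nonneg_pos)
 have sg: "0 < sg" "4 * (sg * c^2) * J <= S0 / 4"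
 proof -
  show "0 < sg" using S0 p by (simp add: sg_def)
  have "4 * (sg * c^2) * J = S0 / 4 * ((c^2 * J) / (c^2 * J + 1))" using p(1) by (simp add: sg_def field_simps)
  also have "... <= S0 / 4 * 1" using S0 p by (intro mult_left_mono) auto
  finally show "4 * (sg * c^2) * J <= S0 / 4" by simp
 qed
 have eps: "0 < eps" "4 * (mu * eps * c) * J <= S0 / 4"
 proof -
  show "0 < eps" using S0 p by (simp add: eps_def)
  have "4 * (mu * eps * c) * J = S0 / 4 * ((mu * c * J) / (mu * c * J + 1))" using p(2) by (simp add: eps_def field_simps)
  also have "... <= S0 / 4 * 1" using S0 p by (intro mult_left_mono) auto
  finally show "4 * (mu * eps * c) * J <= S0 / 4" by simp
 qed
 define Lambda where "Lambda = (r^2)^2"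
 have Lambda: "0 < Lambda" "sqrt (sqrt Lambda) = r" unfolding Lambda_def real_sqrt_abs abs_power2 using r by simp_all
 have Br: "4 * (B / r) * J <= S0 / 4"
 proof -
  have "16 * B * J <= S0 * r" using S0 by (simp add: r_def field_simps)
  then show ?thesis using r by (simp add: field_simps)
 qed
 obtain N1 where N1: "!!i. N1 <= i ==> Lambda <= lam i"
  using lam_at_top unfolding filterlim_at_top eventually_sequentially by blast
 obtain N2 where N2: "!!m c. N2 <= m ==> D2 c ==> n0 (tail m (R c)) <= eps * n2 c" using R_tail_small[OF eps(1)] by blast
 have "(%m. en (tail m c0) + 2 / sg * (LINT t|Leb 0 T. (n0 (tail m (F t)))^2)) ----> (0^2 + alpha^2 * 0^2) + 2 / sg * 0"
  unfolding en_def by (intro tendsto_intros wfin_tail(3) nonneg_one nn c0 D1_D0(1) forcing_tail(2)[where Fb=Fb] F Fc)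
 then have "\<forall>\<^sub>F m in sequentially. en (tail m c0) + 2 / sg * (LINT t|Leb 0 T. (n0 (tail m (F t)))^2) < S0 / 4"
  using S0 by (intro order_tendstoD(2)) auto
 then obtain N3 where N3: "!!m. N3 <= m ==> en (tail m c0) + 2 / sg * (LINT t|Leb 0 T. (n0 (tail m (F t)))^2) < S0 / 4"
  unfolding eventually_sequentially by blast
 show ?thesis
 proof (intro exI[of _ "max N1 (max N2 N3)"] allI impI)
  fix m n x y assume m: "max N1 (max N2 N3) <= m" and mn: "m <= n" and x: "gal T F c0 m x" and y: "gal T F c0 n y"
  define A where "A = B / sqrt (sqrt Lambda) + sg * c^2 + mu * eps * c"
  define S where "S = en (tail m c0) + (4 * A * J + 2 / sg * (LINT t|Leb 0 T. (n0 (tail m (F t)))^2))"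
  have l: "!!i. m <= i ==> Lambda <= lam i" using N1 m by auto
  have ee: "!!c. D2 c ==> n0 (tail m (R c)) <= eps * n2 c" using N2 m by auto
  note gd = gal_difference[OF T c0 F Fc mn x y Lambda(1) l less_imp_le[OF eps(1)] ee sg(1), folded c_def J_def K_def, folded B_def, folded A_def, folded S_def]
  have "4 * A * J = 4 * (B / r) * J + 4 * (sg * c^2) * J + 4 * (mu * eps * c) * J" by (simp add: A_def Lambda(2) algebra_simps)
  then have SS: "S <= S0" using Br sg(2) eps(2) N3[of m] m unfolding S_def by simp
  have Sn: "0 <= S" by (rule gd(3)) 
  have eZ: "S0 * Z = e" using Z by (simp add: S0_def)
  show "(\<forall>t\<in>{0..T}. en (%i. y t i - x t i) <= e) & (LINT t|Leb 0 T. (n2 (%i. y t i - x t i))^2) <= e"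
  proof (intro conjI ballI)
   fix t assume "t \<in> {0..T}"
   then have "en (%i. y t i - x t i) <= S * exp (K * J)" by (intro gd(1)) auto
   also have "... <= S0 * Z" using SS Z1 S0 by (intro mult_mono) (auto simp: Z_def)
   finally show "en (%i. y t i - x t i) <= e" by (simp add: eZ)
  next
   have "nu / 2 * alpha^2 * (LINT t|Leb 0 T. (n2 (%i. y t i - x t i))^2) <= S * (1 + K * J * exp (K * J))"
    using gd(2) by (simp add: algebra_simps)
   then have "(LINT t|Leb 0 T. (n2 (%i. y t i - x t i))^2) <= S * (2 / (nu * alpha^2) * (1 + K * J * exp (K * J)))"
    using nu alpha by (simp add: field_simps)
   also have "... <= S0 * Z" using SS Z1 S0 by (intro mult_mono) (auto simp: Z_def)
   finally show "(LINT t|Leb 0 T. (n2 (%i. y t i - x t i))^2) <= e" by (simp add: eZ)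
  qed
 qed
qed

end

section \<open>Existence of solutions in mode space\<close>
context nudged_modes
begin

lemma en_limit:
 assumes y: "!!n. D1 (y n)" and z: "!!i. (%n. y n i) ----> z i" and e: "\<forall>\<^sub>F n in sequentially. en (y n) <= e"
 shows "D1 z" "en z <= e"
proof -
 let ?om = "%i. 1 + alpha^2 * lam i"
 have w: "nonneg ?om" using hel_pos by (auto simp: nonneg_def less_imp_le)
 have B: "(\<Sum>i<r. ?om i * (z i)^2) <= e" for r
 proof (rule tendsto_upperbound)
  show "(%n. \<Sum>i<r. ?om i * (y n i)^2) ----> (\<Sum>i<r. ?om i * (z i)^2)" by (intro tendsto_intros z)
  show "\<forall>\<^sub>F n in sequentially. (\<Sum>i<r. ?om i * (y n i)^2) <= e" using e
  proof eventually_elim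
   case (elim n)
   have "(\<Sum>i<r. ?om i * (y n i)^2) <= en (y n)"
    using en_sums[OF y[of n]] w by (intro sum_le_suminf[THEN order_trans[OF _ eq_refl]])
     (auto simp: sums_iff nonneg_def)
   with elim show ?case by simp
  qed
 qed simp
 have f: "wfin ?om z" "wsq ?om z <= e" by (rule wfin_bounded[OF w B])+
 have le: "lam i <= (1 / alpha^2) * ?om i" for i using alpha by (simp add: field_simps)
 show "D1 z" by (rule wfin_mono(1)[OF nn(1) w f(1) le])
 then have "(%i. ?om i * (z i)^2) sums en z" by (rule en_sums)
 then have "en z = wsq ?om z" by (simp add: wsq_def sums_iff)
 with f show "en z <= e" by simp
qed

text \<open>Lower semicontinuity of the dissipation integral, from coefficientwise convergence.\<close>

lemma dissipation_limit:
 fixes y :: "nat => real => seq"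
 assumes yc: "!!n i. continuous_on {0..T} (%t. y n t i)" and y2: "!!n t. D2 (y n t)"
  and yi: "!!n. integrable (Leb 0 T) (%t. (n2 (y n t))^2)"
  and z: "!!t i. 0 <= t ==> t <= T ==> (%n. y n t i) ----> z t i" and zc: "!!i. continuous_on {0..T} (%t. z t i)"
  and B: "!!n t i. N <= n ==> 0 <= t ==> t <= T ==> (y n t i)^2 <= B" and e: "!!n. N <= n ==> (LINT t|Leb 0 T. (n2 (y n t))^2) <= e"
 shows "AE t in Leb 0 T. D2 (z t)" "integrable (Leb 0 T) (%t. (n2 (z t))^2)"
  "(LINT t|Leb 0 T. (n2 (z t))^2) <= e"
proof -
 let ?M = "Leb 0 T"
 define f where "f i t = lam2 i * (z t i)^2" for i t
 have fi: "integrable ?M (f i)" for i unfolding f_def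
  by (intro continuous_imp_integrable_real continuous_on_mult continuous_on_power continuous_on_const zc)
 have f0: "0 <= f i t" for i t by (simp add: f_def)
 have bound: "(LINT t|?M. (\<Sum>i<r. f i t)) <= e" for r
 proof (rule LIMSEQ_le_const2)
  have yci: "continuous_on {0..T} (%t. \<Sum>i<r. lam2 i * (y n t i)^2)" for n
   by (intro continuous_on_sum continuous_on_mult continuous_on_power continuous_on_const yc)
  show "(%n. LINT t|?M. (\<Sum>i<r. lam2 i * (y (n + N) t i)^2)) ----> (LINT t|?M. (\<Sum>i<r. f i t))"
  proof (rule integral_dominated_convergence[where w="%t. \<Sum>i<r. lam2 i * B"])
   show "(%t. \<Sum>i<r. f i t) \<in> borel_measurable ?M" using fi by auto
   show "(%t. \<Sum>i<r. lam2 i * (y (n + N) t i)^2) \<in> borel_measurable ?M" for n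
    by (rule continuous_imp_measurable_on_sets_lebesgue[OF yci]) simp
   show "AE t in ?M. (%n. \<Sum>i<r. lam2 i * (y (n + N) t i)^2) ----> (\<Sum>i<r. f i t)"
   proof (rule AE_I2)
    fix t assume "t \<in> space ?M"
    then have "(%n. y (n + N) t i) ----> z t i" for i using z[of t i] by (intro LIMSEQ_ignore_initial_segment) auto
    then show "(%n. \<Sum>i<r. lam2 i * (y (n + N) t i)^2) ----> (\<Sum>i<r. f i t)" unfolding f_def by (intro tendsto_intros)
   qed
   show "AE t in ?M. norm (\<Sum>i<r. lam2 i * (y (n + N) t i)^2) <= (\<Sum>i<r. lam2 i * B)" for n
   proof (rule AE_I2)
    fix t assume t: "t \<in> space ?M"
    have "norm (\<Sum>i<r. lam2 i * (y (n + N) t i)^2) = (\<Sum>i<r. lam2 i * (y (n + N) t i)^2)" by (simp add: sum_nonneg)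
    also have "... <= (\<Sum>i<r. lam2 i * B)" by (intro sum_mono mult_left_mono B) (use t in auto)
    finally show "norm (\<Sum>i<r. lam2 i * (y (n + N) t i)^2) <= (\<Sum>i<r. lam2 i * B)" .
   qed
  qed auto
  have "(LINT t|?M. (\<Sum>i<r. lam2 i * (y (n + N) t i)^2)) <= e" for n
  proof -
   have "(LINT t|?M. (\<Sum>i<r. lam2 i * (y (n + N) t i)^2)) <= (LINT t|?M. (n2 (y (n + N) t))^2)"
    by (rule integral_mono[OF continuous_imp_integrable_real[OF yci] yi]) (simp add: wnorm_sq[OF nn(2) y2] wsq_partial_le[OF nn(2) y2])
   also have "... <= e" by (rule e) simp
   finally show ?thesis .
  qed
  then show "\<exists>k. \<forall>n\<ge>k. (LINT t|?M. (\<Sum>i<r. lam2 i * (y (n + N) t i)^2)) <= e" by blast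
 qed
 note m = monotone_series_integral[OF fi f0 bound]
 show d: "AE t in ?M. D2 (z t)" using m(1) by (simp add: wfin_def f_def)
 have eq: "AE t in ?M. (\<Sum>i. f i t) = (n2 (z t))^2" using d
  by eventually_elim (simp add: wnorm_sq[OF nn(2)] wsq_def f_def)
 show i: "integrable ?M (%t. (n2 (z t))^2)" by (rule integrable_AE_eq_on[OF m(2) _ eq]) simp
 have "(LINT t|?M. (\<Sum>i. f i t)) = (LINT t|?M. (n2 (z t))^2)" by (rule integral_cong_AE) (use m(2) i eq in auto)
 with m(3) show "(LINT t|?M. (n2 (z t))^2) <= e" by simp
qed

definition nonlin :: "seq => nat => real" where
 "nonlin c i = beta c (hel c) (unit i) / hw i"

text \<open>The form loses two derivatives on its last argument; division by the symbol of \<open>I + alpha^2 A\<close> recovers them.\<close>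

lemma nonlin_bound: assumes "D2 c"
 shows "D0 (nonlin c)" "n0 (nonlin c) <= C / alpha^2 * n1 c * n0 (hel c)"
proof -
 note c1 = D2_D1(1)[OF assms] and h = hel_D0[OF assms]
 let ?N = "nonlin c"
 have b: "\<bar>\<Sum>i<n. ?N i * ?N i\<bar> <= C / alpha^2 * n1 c * n0 (hel c) * n0 (trunc n ?N)" for n
 proof -
  define phi where "phi i = ?N i / hw i" for i
  have "(\<Sum>i<n. ?N i * ?N i) = (\<Sum>i<n. phi i * beta c (hel c) (unit i))" by (simp add: phi_def nonlin_def)
  also have "... = beta c (hel c) (trunc n phi)" by (rule VH.form_trunc3[OF c1 h, symmetric])
  finally have 1: "\<bar>\<Sum>i<n. ?N i * ?N i\<bar> <= C * n1 c * n0 (hel c) * n2 (trunc n phi)" using VH.form_bound[OF c1 h wfin_trunc] by simp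
  have 2: "n2 (trunc n phi) <= n0 (trunc n ?N) / alpha^2"
  proof -
   have "wsq lam2 (trunc n phi) <= (\<Sum>i<n. (?N i)^2 / (alpha^2)^2)"
    unfolding wsq_trunc
   proof (rule sum_mono)
    fix i
    have "0 <= lam i / hw i" "lam i / hw i <= 1 / alpha^2"
     using lam_pos[of i] hel_pos[of i] alpha by (auto simp: field_simps)
    then have "(lam i / hw i)^2 <= (1 / alpha^2)^2" by (intro power_mono)
    then have "(lam i / hw i)^2 * (?N i)^2 <= (1 / alpha^2)^2 * (?N i)^2" by (intro mult_right_mono) auto
    then show "lam2 i * (phi i)^2 <= (?N i)^2 / (alpha^2)^2" by (simp add: phi_def power_divide)
   qed
   also have "... = (n0 (trunc n ?N) / alpha^2)^2"
    by (simp add: wnorm_sq power_divide wsq_trunc sum_divide_distrib)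
   finally show ?thesis unfolding wnorm_def[of lam2] by (intro real_le_lsqrt) (auto simp: wnorm_nonneg)
  qed
  have "C * n1 c * n0 (hel c) * n2 (trunc n phi) <= C * n1 c * n0 (hel c) * (n0 (trunc n ?N) / alpha^2)"
   using C n_nonneg(2)[OF c1] n_nonneg(1)[OF h] by (intro mult_left_mono 2) auto
  with 1 show ?thesis by (simp add: mult_ac)
 qed
 have B0: "0 <= C / alpha^2 * n1 c * n0 (hel c)" using C n_nonneg(2)[OF c1] n_nonneg(1)[OF h] by simp
 show "D0 ?N" "n0 ?N <= C / alpha^2 * n1 c * n0 (hel c)" by (rule ip_bound_imp_wfin[OF b B0])+
qed

lemma flow_nonlin: "flow F c = (%i. (F i - nu * (lam i * c i)) - (nonlin c i + mu * R c i))"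
 by (auto simp: flow_def nonlin_def)

lemma flow_norm: assumes c: "D2 c" and F: "D0 F" and B: "n1 c <= B" "n0 F <= Fb"
 shows "D0 (flow F c)" "n0 (flow F c) <= (nu + C / alpha^2 * B * (1/l1 + alpha^2)) * n2 c + (Fb + mu * CR * B)"
proof -
 note c1 = D2_D1(1)[OF c] and h = hel_D0[OF c] and l = lam_scale[OF c]
 note N = nonlin_bound[OF c] and Rc = R_D0[OF c1]
 have l': "D0 (%i. nu * (lam i * c i))" by (rule wfin_scale(1)[OF l(1)])
 have r': "D0 (%i. mu * R c i)" by (rule wfin_scale(1)[OF Rc])
 have s1: "D0 (%i. F i - nu * (lam i * c i))" by (rule wfin_diff(1)[OF nonneg_one F l'])
 have s2: "D0 (%i. nonlin c i + mu * R c i)" by (rule wfin_add(1)[OF nonneg_one N(1) r'])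
 show "D0 (flow F c)" unfolding flow_nonlin by (rule wfin_diff(1)[OF nonneg_one s1 s2])
 have "n0 (flow F c) <= n0 (%i. F i - nu * (lam i * c i)) + n0 (%i. nonlin c i + mu * R c i)"
  unfolding flow_nonlin by (rule wfin_diff(2)[OF nonneg_one s1 s2])
 also have "n0 (%i. F i - nu * (lam i * c i)) <= n0 F + n0 (%i. nu * (lam i * c i))" by (rule wfin_diff(2)[OF nonneg_one F l'])
 also have "n0 (%i. nonlin c i + mu * R c i) <= n0 (nonlin c) + n0 (%i. mu * R c i)" by (rule wfin_add(2)[OF nonneg_one N(1) r'])
 also have "n0 (%i. nu * (lam i * c i)) = nu * n2 c" using wfin_scale(3)[OF l(1), of nu] nu l(2) by simp
 also have "n0 (%i. mu * R c i) = mu * n0 (R c)" using wfin_scale(3)[OF Rc, of mu] mu by simp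
 finally have 1: "n0 (flow F c) <= n0 F + nu * n2 c + (n0 (nonlin c) + mu * n0 (R c))" by simp
 have B0: "0 <= B" using B n_nonneg(2)[OF c1] by linarith
 have "n0 (nonlin c) <= C / alpha^2 * n1 c * n0 (hel c)" by (rule N(2))
 also have "... <= C / alpha^2 * B * ((1/l1 + alpha^2) * n2 c)"
  using C B B0 n_nonneg(1)[OF h] hel_norm_le[OF c] by (intro mult_mono mult_left_mono) auto
 finally have 2: "n0 (nonlin c) <= C / alpha^2 * B * ((1/l1 + alpha^2) * n2 c)" .
 have "n0 (R c) <= CR * B" using R_bound[OF c1] mult_left_mono[OF B(1) CR_nonneg] by linarith
 then have 3: "mu * n0 (R c) <= mu * (CR * B)" using mu by (intro mult_left_mono) auto
 from 1 2 3 B(2) show "n0 (flow F c) <= (nu + C / alpha^2 * B * (1/l1 + alpha^2)) * n2 c + (Fb + mu * CR * B)"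
  unfolding distrib_right mult.assoc by linarith
qed

lemma coord_le: assumes "D0 c" shows "abs (c i) <= n0 c"
proof -
 have "(c i)^2 <= (n0 c)^2" using sq_le_wnorm_sq[OF nonneg_one assms, of i] by simp
 then have "abs (c i) <= abs (n0 c)" by (simp only: abs_le_square_iff)
 then show ?thesis using n_nonneg(1)[OF assms] by simp
qed

text \<open>The products are split with a free weight \<open>r\<close>, since the integral of the square of the last factor is itself of order \<open>r^2\<close>.\<close>

lemma flow_difference: assumes x: "D2 x" and w: "D2 w" and B: "n1 w <= B"
 and r: "0 < r" "en (%i. w i - x i) <= r^2"
 shows "abs (flow F x i - flow F w i) <= r * (nu * lam i + mu * CR / alpha) + C * lam i * (1/l1 + alpha^2) * (r / alpha * (1 + (n2 x)^2)
   + B * (r + (n2 (%i. w i - x i))^2 / r))"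
proof -
 define d where "d = (%i. w i - x i)"
 define c where "c = 1/l1 + alpha^2"
 note x1 = D2_D1(1)[OF x] and w1 = D2_D1(1)[OF w]
 have d2: "D2 d" unfolding d_def by (rule wfin_diff(1)[OF nn(2) w x])
 note d1 = D2_D1(1)[OF d2] and d0 = D2_D0[OF d2]
 have c0: "0 <= c" using l1 by (simp add: c_def)
 have B0: "0 <= B" using B n_nonneg(2)[OF w1] by linarith
 have e: "en d <= r^2" using r(2) by (simp add: d_def)
 have n1d: "n1 d <= r / alpha" using n1_le_en[OF d1 e] r(1) by simp
 have n0d: "n0 d <= r"
 proof -
  have "(n0 d)^2 <= en d" by (simp add: en_def)
  with e have "(n0 d)^2 <= r^2" by linarith
  then show ?thesis by (rule power2_le_imp_le) (use r in simp)
 qed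
 have A: "abs (nu * lam i * d i) <= r * (nu * lam i)"
 proof -
  have "abs (d i) <= r" using coord_le[OF d0, of i] n0d by linarith
  then have "(nu * lam i) * abs (d i) <= (nu * lam i) * r" using nu lam_pos[of i] by (intro mult_left_mono) auto
  then show ?thesis using nu lam_pos[of i] by (simp add: abs_mult mult_ac)
 qed
 have Rr: "abs (mu * R d i) <= r * (mu * CR / alpha)"
 proof -
  have "abs (R d i) <= CR * (r / alpha)" using coord_le[OF R_D0[OF d1], of i] R_bound[OF d1] mult_left_mono[OF n1d CR_nonneg] by linarith
  then have "mu * abs (R d i) <= mu * (CR * (r / alpha))" using mu by (intro mult_left_mono) auto
  then show ?thesis using mu by (simp add: abs_mult mult_ac)
 qed
 have u: "D2 (unit i)" "n2 (unit i) = lam i" using lam_pos[of i] by (auto simp: wnorm_def wsq_unit)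
 have hx: "D0 (hel x)" "D0 (hel w)" "D0 (hel d)" by (rule hel_D0, fact)+
 have "beta w (hel w) (unit i) - beta x (hel x) (unit i) = beta d (hel x) (unit i) + beta w (hel d) (unit i)"
 proof -
  have "beta d (hel x) (unit i) = beta w (hel x) (unit i) - beta x (hel x) (unit i)"
   unfolding d_def by (rule VH.form_diff1[OF w1 x1 hx(1) u(1)])
  moreover have "hel d = (%i. hel w i - hel x i)" by (auto simp: hel_def d_def algebra_simps)
  then have "beta w (hel d) (unit i) = beta w (hel w) (unit i) - beta w (hel x) (unit i)"
   using VH.form_diff2[OF w1 hx(2) hx(1) u(1)] by simp
  ultimately show ?thesis by simp
 qed
 moreover have "abs (beta d (hel x) (unit i)) <= C * lam i * c * (r / alpha * (1 + (n2 x)^2))"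
 proof -
  have "abs (beta d (hel x) (unit i)) <= C * n1 d * n0 (hel x) * lam i" using VH.form_bound[OF d1 hx(1) u(1)] u(2) by simp
  also have "... <= C * (r / alpha) * (c * (1 + (n2 x)^2)) * lam i"
  proof (rule mult_right_mono[OF mult_mono[OF mult_left_mono[OF n1d C]]])
   have "n2 x <= 1 + (n2 x)^2" using zero_le_power2[of "n2 x - 1"] n_nonneg(3)[OF x] by (simp add: power2_diff)
   then have "c * n2 x <= c * (1 + (n2 x)^2)" using c0 by (intro mult_left_mono)
   then show "n0 (hel x) <= c * (1 + (n2 x)^2)" using hel_norm_le[OF x] by (simp add: c_def)
  qed (use C r alpha n_nonneg(1)[OF hx(1)] lam_pos[of i] in auto)
  finally show ?thesis by (simp add: mult_ac)
 qed
 moreover have "abs (beta w (hel d) (unit i)) <= C * lam i * c * (B * (r + (n2 d)^2 / r))"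
 proof -
  have "abs (beta w (hel d) (unit i)) <= C * n1 w * n0 (hel d) * lam i" using VH.form_bound[OF w1 hx(3) u(1)] u(2) by simp
  also have "... <= C * B * (c * (r + (n2 d)^2 / r)) * lam i"
  proof (rule mult_right_mono[OF mult_mono[OF mult_left_mono[OF B C]]])
   have "0 <= (n2 d - r)^2 / r + n2 d" using r n_nonneg(3)[OF d2] by simp
   also have "(n2 d - r)^2 / r + n2 d = r + (n2 d)^2 / r - n2 d" using r by (simp add: power2_eq_square field_simps)
   finally have "c * n2 d <= c * (r + (n2 d)^2 / r)" using c0 by (intro mult_left_mono) auto
   then show "n0 (hel d) <= c * (r + (n2 d)^2 / r)" using hel_norm_le[OF d2] by (simp add: c_def)
  qed (use C B0 n_nonneg(1)[OF hx(3)] lam_pos[of i] in auto)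
  finally show ?thesis by (simp add: mult_ac)
 qed
 ultimately have N: "abs (beta w (hel w) (unit i) - beta x (hel x) (unit i)) <= C * lam i * c * (r / alpha * (1 + (n2 x)^2) + B * (r + (n2 d)^2 / r))"
  unfolding distrib_left[of "C * lam i * c"] by linarith
 have "abs ((beta w (hel w) (unit i) - beta x (hel x) (unit i)) / hw i) <= abs (beta w (hel w) (unit i) - beta x (hel x) (unit i))"
 proof -
  have "abs (z / k) <= abs z" if "1 <= k" for z k :: real using that by (simp add: abs_div pos_divide_le_eq mult_left_mono[of 1 k "abs z", simplified])
  then show ?thesis using lam_pos[of i] by (simp add: less_imp_le)
 qed
 moreover have "flow F x i - flow F w i = nu * lam i * d i + (beta w (hel w) (unit i) - beta x (hel x) (unit i)) / hw i + mu * R d i"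
  unfolding flow_def d_def R_diff[OF w1 x1] by (simp add: algebra_simps diff_divide_distrib)
 ultimately have "abs (flow F x i - flow F w i) <= r * (nu * lam i) + C * lam i * c * (r / alpha * (1 + (n2 x)^2) + B * (r + (n2 d)^2 / r)) + r * (mu * CR / alpha)"
  using A Rr N by linarith
 then show ?thesis unfolding d_def c_def by (simp add: distrib_left)
qed

theorem sol_exists:
 assumes T: "0 <= T" and c0: "D1 c0" and F: "!!t. 0 <= t ==> t <= T ==> D0 (F t) & n0 (F t) <= Fb"
  and Fc: "!!i. continuous_on {0..T} (%t. F t i)"
 shows "\<exists>w. sol T F w & w 0 = c0 & (\<forall>t\<in>{0..T}. ((%s. n1 (%i. w s i - w t i)) \<longlongrightarrow> 0) (at t within {0..T}))"
proof -
 let ?M = "Leb 0 T"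
 have "\<forall>n. \<exists>x. gal T F c0 n x" using gal_exists[OF T c0 F Fc] by blast
 then obtain x where x: "!!n. gal T F c0 n (x n)" by metis
 have xt: "traj T (x n) (gal_rate n F (x n))" "!!t i. n <= i ==> x n t i = 0" "x n 0 = trunc n c0" for n using x[of n] by (auto simp: gal_def)
 have x2: "D2 (x n t)" for n t by (rule wfin_support(1)[of n]) (simp add: xt)
 note x1 = D2_D1(1)[OF x2] and x0 = D2_D0[OF x2]
 note xc = traj_continuous[OF xt(1)]
 define M where "M = en_bound T Fb c0"
 define J where "J = dis_bound T Fb c0"
 define B where "B = sqrt M / alpha"
 have xM: "en (x n t) <= M" if t: "0 <= t" "t <= T" for n t
 proof -
  have "en (x n t) <= en_bound t Fb c0" by (rule gal_bounds(1)[OF gal_mono[OF x t] t(1) c0 F]) (use t in auto)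
  then show ?thesis using en_bound_mono[OF t, of Fb c0] by (simp add: M_def)
 qed
 have xJ: "(LINT t|?M. (n2 (x n t))^2) <= J" for n unfolding J_def by (rule gal_bounds(2)[OF x T c0 F])
 have cauchy: "\<exists>N. \<forall>m n. N <= m --> m <= n --> (\<forall>t\<in>{0..T}. en (%i. x n t i - x m t i) <= e) & (LINT t|?M. (n2 (%i. x n t i - x m t i))^2) <= e"
  if "0 < e" for e
  using gal_cauchy[OF T c0 F Fc that] x by meson
 have sq_en: "(c i)^2 <= en c" if "D0 c" for c i
 proof -
  have "(c i)^2 <= (n0 c)^2" using sq_le_wnorm_sq[OF nonneg_one that, of i] by simp
  then show ?thesis by (simp add: en_def add_increasing2)
 qed
 have dx: "D2 (%i. x n t i - x m t i)" for n m t by (rule wfin_diff(1)[OF nn(2) x2 x2])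
 have conv: "convergent (%n. x n t i)" if t: "t \<in> {0..T}" for t i
 proof (rule Cauchy_convergent, rule metric_CauchyI)
  fix e :: real assume e: "0 < e"
  obtain N where N: "!!m n. N <= m ==> m <= n ==> en (%i. x n t i - x m t i) <= (e/2)^2"
   using cauchy[OF zero_less_power[OF half_gt_zero[OF e]]] t by blast
  have h: "abs (x n t i - x m t i) < e" if "N <= m" "m <= n" for m n
  proof -
   have "(x n t i - x m t i)^2 <= (e/2)^2" using sq_en[OF D2_D0[OF dx[of n t m]], of i] N[OF that] by linarith
   then have "abs (x n t i - x m t i) <= abs (e/2)" by (simp only: abs_le_square_iff)
   with e show ?thesis by simp
  qed
  show "\<exists>N. \<forall>m\<ge>N. \<forall>n\<ge>N. dist (x m t i) (x n t i) < e"
  proof (intro exI allI impI)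
   fix m n assume "N <= m" "N <= n"
   then show "dist (x m t i) (x n t i) < e" using h[of m n] h[of n m] by (cases "m <= n") (auto simp: dist_real_def abs_minus_commute)
  qed
 qed
 define w where "w t i = lim (%n. x n t i)" for t i
 have w: "(%n. x n t i) ----> w t i" if "t \<in> {0..T}" for t i
  using conv[OF that, of i] by (simp add: w_def convergent_LIMSEQ_iff)
 have w1: "D1 (w t)" "en (w t) <= M" if "t \<in> {0..T}" for t
  using en_limit[of "%n. x n t" "w t" M, OF x1 w[OF that]] xM that by auto
 have wB: "n1 (w t) <= B" if "t \<in> {0..T}" for t unfolding B_def by (rule n1_le_en[OF w1[OF that]])
 have wx: "en (%i. w t i - x m t i) <= e"
  if N: "!!n. m <= n ==> en (%i. x n t i - x m t i) <= e" and t: "t \<in> {0..T}" for m e t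
  by (rule en_limit(2)[of "%n i. x n t i - x m t i"])
   (auto intro!: D2_D1(1)[OF dx] tendsto_diff w[OF t] N simp: eventually_sequentially)
 have ulim: "uniform_limit {0..T} (%n t. x n t i) (%t. w t i) sequentially" for i
 proof (rule uniform_limitI)
  fix e :: real assume e: "0 < e"
  obtain N where N: "!!m n t. N <= m ==> m <= n ==> t \<in> {0..T} ==> en (%i. x n t i - x m t i) <= (e/2)^2"
   using cauchy[OF zero_less_power[OF half_gt_zero[OF e]]] by blast
  have "dist (x m t i) (w t i) < e" if m: "N <= m" and t: "t \<in> {0..T}" for m t
  proof -
   have "(w t i - x m t i)^2 <= en (%i. w t i - x m t i)"
    by (rule sq_en) (rule wfin_diff(1)[OF nonneg_one D1_D0(1)[OF w1(1)[OF t]] x0])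
   also have "... <= (e/2)^2" by (rule wx[OF N[OF m _ t] t])
   finally have "abs (w t i - x m t i) <= abs (e/2)" by (simp only: abs_le_square_iff)
   with e show ?thesis by (simp add: dist_real_def abs_minus_commute)
  qed
  then show "\<forall>\<^sub>F n in sequentially. \<forall>t\<in>{0..T}. dist (x n t i) (w t i) < e" unfolding eventually_sequentially by blast
 qed
 have wc: "continuous_on {0..T} (%t. w t i)" for i
  by (rule uniform_limit_theorem[OF _ ulim]) (auto intro!: always_eventually xc)
 have w2: "AE t in ?M. D2 (w t)" "integrable ?M (%t. (n2 (w t))^2)" "(LINT t|?M. (n2 (w t))^2) <= J"
  by (rule dissipation_limit[of T x w 0 M J], use xc x2 trajD(3)[OF xt(1)] w wc xJ order_trans[OF sq_en[OF x0] xM] in "auto")+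
 have wx2: "AE t in ?M. D2 (%i. w t i - x m t i)" "integrable ?M (%t. (n2 (%i. w t i - x m t i))^2)"
   "(LINT t|?M. (n2 (%i. w t i - x m t i))^2) <= e"
  if N: "!!n. m <= n ==> (\<forall>t\<in>{0..T}. en (%i. x n t i - x m t i) <= e) & (LINT t|?M. (n2 (%i. x n t i - x m t i))^2) <= e" for m e
 proof -
  have a: "continuous_on {0..T} (%t. x n t i - x m t i)" for n i by (intro continuous_on_diff xc)
  have b: "integrable ?M (%t. (n2 (%i. x n t i - x m t i))^2)" for n using trajD(3)[OF traj_diff[OF xt(1) xt(1)]] .
  have c: "(%n. x n t i - x m t i) ----> w t i - x m t i" if "0 <= t" "t <= T" for t i
   by (rule tendsto_diff[OF w tendsto_const]) (use that in auto)
  have d: "continuous_on {0..T} (%t. w t i - x m t i)" for i by (intro continuous_on_diff xc wc)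
  have f: "(x n t i - x m t i)^2 <= e" if "m <= n" "0 <= t" "t <= T" for n t i
   using sq_en[OF D2_D0[OF dx[of n t m]], of i] N[OF that(1)] that by force
  have g: "(LINT t|?M. (n2 (%i. x n t i - x m t i))^2) <= e" if "m <= n" for n using N[OF that] by blast
  note r = dissipation_limit[of T "%n t i. x n t i - x m t i" "%t i. w t i - x m t i" m e e, OF a dx b c d f g]
  show "AE t in ?M. D2 (%i. w t i - x m t i)" "integrable ?M (%t. (n2 (%i. w t i - x m t i))^2)"
   "(LINT t|?M. (n2 (%i. w t i - x m t i))^2) <= e" by (rule r; assumption)+
 qed
 define g where "g t = flow (F t) (w t)" for t
 have R_meas: "(%t. R (w t) i) \<in> borel_measurable ?M" for i
 proof (rule borel_measurable_AE_lim_on)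
  show "(%t. \<Sum>j<n. w t j * R (unit j) i) \<in> borel_measurable ?M" for n
   by (rule continuous_imp_measurable_on_sets_lebesgue) (intro continuous_on_sum continuous_on_mult continuous_on_const wc, simp)
  show "AE t in ?M. (%n. \<Sum>j<n. w t j * R (unit j) i) ----> R (w t) i"
  proof (rule AE_I2)
   fix t assume "t \<in> space ?M"
   then have wt: "D1 (w t)" using w1 by auto
   have tl: "D1 (%i. w t i - trunc n (w t) i)" for n by (rule wfin_diff(1)[OF nn(1) wt wfin_trunc])
   have "(%n. R (w t) i - R (trunc n (w t)) i) ----> 0"
   proof (rule Lim_null_comparison)
    have "abs (R (w t) i - R (trunc n (w t)) i) <= CR * n1 (%i. w t i - trunc n (w t) i)" for n
     using coord_le[OF R_D0[OF tl], of n i] R_bound[OF tl, of n] R_diff[OF wt wfin_trunc] by simp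
    then show "\<forall>\<^sub>F n in sequentially. norm (R (w t) i - R (trunc n (w t)) i) <= CR * n1 (%i. w t i - trunc n (w t) i)" by simp
    show "(%n. CR * n1 (%i. w t i - trunc n (w t) i)) ----> 0"
     using tendsto_mult_left[OF wnorm_tail_tendsto[OF wt], of CR] by simp
   qed
   from tendsto_diff[OF tendsto_const[of "R (w t) i"] this]
   show "(%n. \<Sum>j<n. w t j * R (unit j) i) ----> R (w t) i" by (simp add: R_trunc)
  qed
 qed simp
 have N_meas: "(%t. beta (w t) (hel (w t)) (unit i)) \<in> borel_measurable ?M" for i
 proof (rule borel_measurable_AE_lim_on)
  show "(%t. tri theta n (w t) (hel (w t)) (unit i)) \<in> borel_measurable ?M" for n
   unfolding tri_def hel_def
   by (rule continuous_imp_measurable_on_sets_lebesgue) (intro continuous_on_sum continuous_on_mult continuous_on_const wc, simp)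
  show "AE t in ?M. (%n. tri theta n (w t) (hel (w t)) (unit i)) ----> beta (w t) (hel (w t)) (unit i)"
   using w2(1) by eventually_elim (intro VH.form_tendsto D2_D1(1) hel_D0 wfin_unit)
 qed simp
 have g_meas: "(%t. g t i) \<in> borel_measurable ?M" for i unfolding g_def flow_def
  by (intro borel_measurable_diff borel_measurable_add borel_measurable_times borel_measurable_divide borel_measurable_const N_meas R_meas
   continuous_imp_measurable_on_sets_lebesgue[OF wc] continuous_imp_measurable_on_sets_lebesgue[OF Fc]) auto
 have gae: "AE t in ?M. D0 (g t) & n0 (g t) <= (nu + C / alpha^2 * B * (1/l1 + alpha^2)) * n2 (w t) + (Fb + mu * CR * B)"
  using w2(1) AE_space
 proof eventually_elim
  case (elim t)
  then have t: "t \<in> {0..T}" by simp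
  then have ft: "D0 (F t)" "n0 (F t) <= Fb" using F[of t] by auto
  from flow_norm[OF elim(1) ft(1) wB[OF t] ft(2)] show ?case by (simp add: g_def)
 qed
 define a where "a = nu + C / alpha^2 * B * (1/l1 + alpha^2)"
 define b where "b = Fb + mu * CR * B"
 have sqi: "integrable ?M (%t. 2 * (a^2 * (n2 (w t))^2) + 2 * b^2)" using w2(2) by simp
 have gb: "AE t in ?M. (n0 (g t))^2 <= 2 * (a^2 * (n2 (w t))^2) + 2 * b^2" using gae
 proof eventually_elim
  case (elim t)
  then have "(n0 (g t))^2 <= (a * n2 (w t) + b)^2" using n_nonneg(1)[of "g t"] by (intro power_mono) (auto simp: a_def b_def)
  also have "... <= 2 * (a * n2 (w t))^2 + 2 * b^2" using zero_le_power2[of "a * n2 (w t) - b"] by (simp add: power2_sum power2_diff)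
  finally show ?case by (simp add: power_mult_distrib)
 qed
 have g2i: "integrable ?M (%t. (n0 (g t))^2)"
 proof (rule Bochner_Integration.integrable_bound[OF sqi])
  show "(%t. (n0 (g t))^2) \<in> borel_measurable ?M"
  proof (rule borel_measurable_AE_lim_on)
   show "(%t. \<Sum>i<n. (g t i)^2) \<in> borel_measurable ?M" for n using g_meas by measurable
   show "AE t in ?M. (%n. \<Sum>i<n. (g t i)^2) ----> (n0 (g t))^2" using gae
   proof eventually_elim
    case (elim t)
    then have f: "D0 (g t)" by simp
    show ?case using summable_LIMSEQ[OF f[unfolded wfin_def]] by (simp add: wnorm_sq[OF nonneg_one f] wsq_def)
   qed
  qed simp
  show "AE t in ?M. norm ((n0 (g t))^2) <= norm (2 * (a^2 * (n2 (w t))^2) + 2 * b^2)" using gb by eventually_elim simp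
 qed
 have gi: "integrable ?M (%t. g t i)" for i
 proof (rule Bochner_Integration.integrable_bound[of _ "%t. 1 + (n0 (g t))^2"])
  show "integrable ?M (%t. 1 + (n0 (g t))^2)" using g2i by simp
  show "AE t in ?M. norm (g t i) <= norm (1 + (n0 (g t))^2)" using gae
  proof eventually_elim
   case (elim t)
   have "n0 (g t) <= 1 + (n0 (g t))^2" using zero_le_power2[of "n0 (g t) - 1"] n_nonneg(1)[of "g t"] elim by (simp add: power2_diff)
   then show ?case using coord_le[of "g t" i] elim by simp
  qed
 qed (rule g_meas)
 have eqn: "w t i - w s i = (LINT tau|Leb s t. g tau i)" if st: "0 <= s" "s <= t" "t <= T" for s t i
 proof -
  define c where "c = 1/l1 + alpha^2"
  have c: "0 <= c" using l1 by (simp add: c_def)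
  have J0: "0 <= J" using xJ[of 0] by (rule order_trans[rotated]) simp
  have M0: "0 <= M" using en_nonneg w1(2)[of 0] T by (metis atLeastAtMost_iff order_refl order_trans)
  have B0: "0 <= B" using M0 alpha by (simp add: B_def)
  define Q where "Q = T * (nu * lam i + mu * CR / alpha) + C * lam i * c * ((T + J) / alpha + B * (T + 1))"
  have Q: "0 <= Q" unfolding Q_def using T nu lam_pos[of i] mu CR_nonneg alpha C c J0 B0 by (intro add_nonneg_nonneg mult_nonneg_nonneg divide_nonneg_nonneg) auto
  have est: "abs ((x n t i - x n s i) - (LINT tau|Leb s t. g tau i)) <= r * Q"
   if r: "0 < r" and N: "!!k. n <= k ==> (\<forall>t\<in>{0..T}. en (%i. x k t i - x n t i) <= r^2) & (LINT t|?M. (n2 (%i. x k t i - x n t i))^2) <= r^2" and i: "i < n" for r n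
  proof -
   note wn = wx2[OF N]
   define q where "q tau = r * (nu * lam i + mu * CR / alpha) + C * lam i * c * (r / alpha * (1 + (n2 (x n tau))^2) + B * (r + (n2 (%i. w tau i - x n tau i))^2 / r))" for tau
   have qi: "integrable ?M q" unfolding q_def using trajD(3)[OF xt(1)] wn(2) by simp
   have xg: "x n t i - x n s i = (LINT tau|Leb s t. gal_rate n F (x n) tau i)" by (rule trajD(7)[OF xt(1) st])
   have i1: "integrable (Leb s t) (%tau. gal_rate n F (x n) tau i)" "integrable (Leb s t) (%tau. g tau i)" "integrable (Leb s t) q"
    by (rule integrable_within[OF _ st(1,3)], rule trajD(4)[OF xt(1)] gi qi)+
   have ae0: "AE tau in ?M. abs (gal_rate n F (x n) tau i - g tau i) <= q tau" using w2(1) AE_space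
   proof eventually_elim
    case (elim tau)
    then have tau: "tau \<in> {0..T}" by simp
    have "abs (flow (F tau) (x n tau) i - flow (F tau) (w tau) i) <= q tau"
     unfolding q_def c_def by (rule flow_difference[OF x2 elim(1) wB[OF tau] r wx[OF _ tau]]) (use N tau in blast)
    then show ?case using i by (simp add: gal_rate_def g_def)
   qed
   have ae: "AE tau in Leb s t. abs (gal_rate n F (x n) tau i - g tau i) <= q tau"
    by (rule AE_lebesgue_on_subset[OF ae0]) (use st in auto)
   have "(x n t i - x n s i) - (LINT tau|Leb s t. g tau i) = (LINT tau|Leb s t. gal_rate n F (x n) tau i - g tau i)"
    unfolding xg using i1 by simp
   then have "abs ((x n t i - x n s i) - (LINT tau|Leb s t. g tau i)) <= (LINT tau|Leb s t. abs (gal_rate n F (x n) tau i - g tau i))"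
    using integral_abs_bound by simp
   also have "... <= (LINT tau|Leb s t. q tau)" by (rule integral_mono_AE[OF _ i1(3) ae]) (use i1 in auto)
   also have "... <= (LINT tau|?M. q tau)"
   proof (rule integral_subinterval_le[OF qi st])
    show "0 <= q tau" for tau unfolding q_def using r nu lam_pos[of i] mu CR_nonneg alpha C c B0
     by (intro add_nonneg_nonneg mult_nonneg_nonneg divide_nonneg_nonneg) auto
   qed
   also have "... = T * (r * (nu * lam i + mu * CR / alpha)) + C * lam i * c * (r / alpha * (T + (LINT tau|?M. (n2 (x n tau))^2))
     + B * (T * r + (LINT tau|?M. (n2 (%i. w tau i - x n tau i))^2) / r))"
    unfolding q_def using trajD(3)[OF xt(1)] wn(2) T by (simp add: measure_restrict_space)
   also have "... <= T * (r * (nu * lam i + mu * CR / alpha)) + C * lam i * c * (r / alpha * (T + J) + B * (T * r + r^2 / r))"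
    using xJ[of n] wn(3) r alpha C c B0 lam_pos[of i]
    by (intro add_mono mult_left_mono divide_right_mono order_refl mult_nonneg_nonneg) auto
   also have "... = r * Q" using r by (simp add: Q_def power2_eq_square algebra_simps)
   finally show ?thesis .
  qed
  have "(%n. x n t i - x n s i) ----> (LINT tau|Leb s t. g tau i)"
  proof (rule LIMSEQ_I)
   fix e :: real assume e: "0 < e"
   define r where "r = e / (Q + 1)"
   have r: "0 < r" using e Q by (simp add: r_def)
   have rQ: "r * Q < e" using e Q by (simp add: r_def field_simps)
   obtain N where N: "!!m n. N <= m ==> m <= n ==> (\<forall>t\<in>{0..T}. en (%i. x n t i - x m t i) <= r^2) & (LINT t|?M. (n2 (%i. x n t i - x m t i))^2) <= r^2"
    using cauchy[OF zero_less_power[OF r]] by blast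
   show "\<exists>no. \<forall>n\<ge>no. norm (x n t i - x n s i - (LINT tau|Leb s t. g tau i)) < e"
   proof (intro exI[of _ "max N (Suc i)"] allI impI)
    fix n assume "max N (Suc i) <= n"
    then have "abs ((x n t i - x n s i) - (LINT tau|Leb s t. g tau i)) <= r * Q" by (intro est[OF r] N) auto
    with rQ show "norm (x n t i - x n s i - (LINT tau|Leb s t. g tau i)) < e" by simp
   qed
  qed
  moreover have "(%n. x n t i - x n s i) ----> w t i - w s i" by (intro tendsto_diff w) (use st in auto)
  ultimately show ?thesis using LIMSEQ_unique by blast
 qed
 have "traj T w g" unfolding traj_def
 proof (intro conjI allI impI ballI)
  show "D1 (w t)" if "t \<in> {0..T}" for t by (rule w1(1)[OF that])
  show "AE t in ?M. D0 (g t)" using gae by eventually_elim simp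
 qed (use w2 gi g2i eqn in auto)
 then have "sol T F w" unfolding sol_def g_def by (intro exI[of _ "%t. flow (F t) (w t)"]) simp
 moreover have "w 0 = c0"
 proof
  fix i
  have "(%n. x n 0 i) ----> c0 i"
   by (rule tendsto_eventually) (auto simp: eventually_sequentially xt(3) trunc_def intro!: exI[of _ "Suc i"])
  then show "w 0 i = c0 i" using w[of 0 i] T LIMSEQ_unique by auto
 qed
 moreover have "((%s. n1 (%i. w s i - w t i)) \<longlongrightarrow> 0) (at t within {0..T})" if t: "t \<in> {0..T}" for t
 proof (rule tendstoI)
  fix e :: real assume e: "0 < e"
  define r where "r = alpha * (e / 4)"
  have r: "0 < r" using e alpha by (simp add: r_def)
  obtain m where N: "!!n. m <= n ==> (\<forall>t\<in>{0..T}. en (%i. x n t i - x m t i) <= r^2)" using cauchy[OF zero_less_power[OF r]] by blast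
  have close: "n1 (%i. w s i - x m s i) <= e / 4" if s: "s \<in> {0..T}" for s
  proof -
   have "en (%i. w s i - x m s i) <= r^2" by (rule wx[OF _ s]) (use N s in blast)
   from n1_le_en[OF wfin_diff(1)[OF nn(1) w1(1)[OF s] x1] this] show ?thesis using r alpha by (simp add: r_def)
  qed
  have sq: "n1 (%i. x m s i - x m t i) = sqrt (\<Sum>i<m. lam i * (x m s i - x m t i)^2)" for s
   unfolding wnorm_def by (subst wfin_support(2)[of m]) (auto simp: xt(2))
  have "((%s. sqrt (\<Sum>i<m. lam i * (x m s i - x m t i)^2)) \<longlongrightarrow> sqrt (\<Sum>i<m. lam i * (x m t i - x m t i)^2)) (at t within {0..T})"
   by (intro tendsto_intros) (use xc[of m] t in "auto simp: continuous_on_def")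
  then have "((%s. n1 (%i. x m s i - x m t i)) \<longlongrightarrow> 0) (at t within {0..T})" by (simp add: sq)
  then have "\<forall>\<^sub>F s in at t within {0..T}. n1 (%i. x m s i - x m t i) < e / 4"
   using e by (intro order_tendstoD(2)) auto
  moreover have "\<forall>\<^sub>F s in at t within {0..T}. s \<in> {0..T}" by (simp add: eventually_at_filter)
  ultimately show "\<forall>\<^sub>F s in at t within {0..T}. dist (n1 (%i. w s i - w t i)) 0 < e"
  proof eventually_elim
   case (elim s)
   have f: "D1 (%i. w s i - x m s i)" "D1 (%i. w t i - x m t i)" "D1 (%i. x m s i - x m t i)"
    by (intro wfin_diff(1) nn w1(1) x1 elim t)+
   have f2: "D1 (%i. (w s i - x m s i) + (x m s i - x m t i))" by (rule wfin_add(1)[OF nn(1) f(1,3)])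
   have "n1 (%i. ((w s i - x m s i) + (x m s i - x m t i)) - (w t i - x m t i)) <= n1 (%i. (w s i - x m s i) + (x m s i - x m t i)) + n1 (%i. w t i - x m t i)"
    by (rule wfin_diff(2)[OF nn(1) f2 f(2)])
   also have "n1 (%i. (w s i - x m s i) + (x m s i - x m t i)) <= n1 (%i. w s i - x m s i) + n1 (%i. x m s i - x m t i)"
    by (rule wfin_add(2)[OF nn(1) f(1,3)])
   finally have "n1 (%i. w s i - w t i) < e" using close[OF elim(2)] close[OF t] elim(1) e by simp
   moreover have "0 <= n1 (%i. w s i - w t i)" by (intro n_nonneg wfin_diff(1) nn w1(1) elim t)
   ultimately show ?case by simp
  qed
 qed
 ultimately show ?thesis by blast
qed

end

section \<open>Square-integrable periodic fields\<close>
lemma cube_cbox: "cube L = cbox 0 (\<chi> i. L)"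
 by (auto simp: cube_def mem_box_cart)

lemma cube_sets [simp]: "cube L \<in> sets lebesgue" by (simp add: cube_cbox)

lemma cube_lmeasurable: "cube L \<in> lmeasurable" by (simp add: cube_cbox)

lemma cube_finite: "finite_measure (lebesgue_on (cube L))"
 by (rule finite_measure_lebesgue_on[OF cube_lmeasurable])

locale torus = fixes L :: real assumes L_pos: "0 < L"
begin

abbreviation "nrm2 \<equiv> L2_norm L"
abbreviation "nrmV \<equiv> V_norm L"
abbreviation "inn \<equiv> L2_inner L"
abbreviation "L2p \<equiv> L2_per L"
abbreviation "Hs \<equiv> H_space L"
abbreviation "Vs \<equiv> V_space L"
abbreviation "Ds \<equiv> dom_A L"
abbreviation "St \<equiv> solenoidal_trig L"

abbreviation "M \<equiv> lebesgue_on (cube L)"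

lemma cube_content: "measure M (space M) = L ^ 3"
 using L_pos by (simp add: cube_cbox measure_restrict_space content_cbox_cart interval_eq_empty_cart)

lemma integrable_const_cube [simp]: "integrable M (%x. c)"
 using cube_finite finite_measure.integrable_const by blast

lemma L2_perD:
 assumes "u \<in> L2p"
 shows "u \<in> borel_measurable M" "integrable M (%x. (norm (u x))^2)" "periodic L u" "u \<in> borel_measurable lebesgue"
 using assms by (auto simp: L2_per_def intro: measurable_restrict_space1)

lemma L2_inner_integrable:
 assumes "u \<in> L2p" "v \<in> L2p"
 shows "integrable M (%x. u x \<bullet> v x)"
proof (rule Bochner_Integration.integrable_bound)
 show "integrable M (%x. (norm (u x))^2 + (norm (v x))^2)" using L2_perD assms by auto
 show "(%x. u x \<bullet> v x) \<in> borel_measurable M" using L2_perD(1) assms by (intro borel_measurable_inner) auto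
 have "\<bar>a \<bullet> b\<bar> <= (norm a)^2 + (norm b)^2" for a b :: "real^3"
 proof -
  define p where "p = norm a * norm b"
  have "\<bar>a \<bullet> b\<bar> <= p" unfolding p_def by (rule Cauchy_Schwarz_ineq2)
  moreover have "2 * p <= (norm a)^2 + (norm b)^2" using zero_le_power2[of "norm a - norm b"] by (simp add: power2_diff p_def mult.assoc)
  moreover have "0 <= p" by (simp add: p_def)
  ultimately show ?thesis by linarith
 qed
 then show "AE x in M. norm (u x \<bullet> v x) <= norm ((norm (u x))^2 + (norm (v x))^2)" by auto
qed

lemma L2_add: assumes "u \<in> L2p" "v \<in> L2p" shows "(%x. u x + v x) \<in> L2p"
proof -
 have "integrable M (%x. (norm (u x))^2 + (norm (v x))^2 + 2 * (u x \<bullet> v x))"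
  using L2_perD(2) L2_inner_integrable assms by auto
 moreover have "(norm (u x))^2 + (norm (v x))^2 + 2 * (u x \<bullet> v x) = (norm (u x + v x))^2" for x
  by (simp add: power2_norm_eq_inner inner_add inner_commute)
 ultimately have "integrable M (%x. (norm (u x + v x))^2)" by simp
 then show ?thesis using assms unfolding L2_per_def periodic_def by auto
qed

lemma L2_scale: assumes "u \<in> L2p" shows "(%x. c *\<^sub>R u x) \<in> L2p"
 using assms unfolding L2_per_def periodic_def by (auto simp: power_mult_distrib)

lemma L2_diff: assumes "u \<in> L2p" "v \<in> L2p" shows "(%x. u x - v x) \<in> L2p"
 using L2_add[OF assms(1) L2_scale[OF assms(2), of "-1"]] by simp

lemma L2_zero: "(%x. 0) \<in> L2p"
 by (simp add: L2_per_def periodic_def)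

lemma L2_sum: "(!!i. i \<in> I ==> u i \<in> L2p) ==> (%x. \<Sum>i\<in>I. u i x) \<in> L2p"
 by (induction I rule: infinite_finite_induct) (auto simp: L2_zero intro!: L2_add)

lemma L2_continuous: assumes "continuous_on UNIV u" "periodic L u" shows "u \<in> L2p"
proof -
 have "u \<in> borel_measurable lebesgue"
  using assms(1) by (simp add: borel_measurable_continuous_onI measurable_completion)
 moreover have "integrable M (%x. (norm (u x))^2)" unfolding cube_cbox
  by (intro continuous_imp_integrable continuous_on_power continuous_on_norm continuous_on_subset[OF assms(1)]) auto
 ultimately show ?thesis using assms by (simp add: L2_per_def)
qed

lemma L2_inner_commute: "inn u v = inn v u"
 by (simp add: L2_inner_def inner_commute)

lemma L2_inner_add:
 assumes "u \<in> L2p" "v \<in> L2p" "w \<in> L2p"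
 shows "inn (%x. u x + v x) w = inn u w + inn v w"
 using assms L2_inner_integrable unfolding L2_inner_def by (simp add: inner_add_left)

lemma L2_inner_diff:
 assumes "u \<in> L2p" "v \<in> L2p" "w \<in> L2p"
 shows "inn (%x. u x - v x) w = inn u w - inn v w"
 using assms L2_inner_integrable unfolding L2_inner_def by (simp add: inner_diff_left)

lemma L2_inner_scale: "inn (%x. c *\<^sub>R u x) w = c * inn u w"
 unfolding L2_inner_def by simp

lemma L2_inner_sum:
 assumes "!!i. i \<in> I ==> u i \<in> L2p" "w \<in> L2p"
 shows "inn (%x. \<Sum>i\<in>I. u i x) w = (\<Sum>i\<in>I. inn (u i) w)"
 using assms
proof (induction I rule: infinite_finite_induct)
 case (insert j I)
 then show ?case by (simp add: L2_inner_add L2_sum)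
qed (simp_all add: L2_inner_def)

lemma L2_inner_self_nonneg: "0 <= inn u u" unfolding L2_inner_def by simp

lemma L2_norm_nonneg [simp]: "0 <= nrm2 u" by (simp add: L2_norm_def L2_inner_self_nonneg)

lemma L2_norm_sq: "(nrm2 u)^2 = inn u u" by (simp add: L2_norm_def L2_inner_self_nonneg)

lemma L2_norm_scale: "nrm2 (%x. c *\<^sub>R u x) = abs c * nrm2 u"
proof -
 have "inn (%x. c *\<^sub>R u x) (%x. c *\<^sub>R u x) = c^2 * inn u u"
  using L2_inner_scale[of c u "%x. c *\<^sub>R u x"] L2_inner_scale[of c u u] L2_inner_commute[of u "%x. c *\<^sub>R u x"]
  by (simp add: power2_eq_square)
 then show ?thesis by (simp add: L2_norm_def real_sqrt_mult)
qed

lemma L2_cauchy_schwarz: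
 assumes u: "u \<in> L2p" and v: "v \<in> L2p"
 shows "abs (inn u v) <= nrm2 u * nrm2 v"
proof -
 define a where "a = inn u u"
 define b where "b = inn u v"
 define c where "c = inn v v"
 have q: "0 <= a - 2 * t * b + t^2 * c" for t
 proof -
  have "0 <= inn (%x. u x - t *\<^sub>R v x) (%x. u x - t *\<^sub>R v x)" by (rule L2_inner_self_nonneg)
  also have "... = inn u (%x. u x - t *\<^sub>R v x) - t * inn v (%x. u x - t *\<^sub>R v x)"
   using L2_inner_diff[OF u L2_scale[OF v] L2_diff[OF u L2_scale[OF v]]] by (simp add: L2_inner_scale)
  also have "inn u (%x. u x - t *\<^sub>R v x) = a - t * b"
   using L2_inner_diff[OF u L2_scale[OF v] u, of t] by (simp add: L2_inner_commute[of u "%x. u x - t *\<^sub>R v x"] L2_inner_scale a_def b_def L2_inner_commute[of v u])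
  also have "inn v (%x. u x - t *\<^sub>R v x) = b - t * c"
   using L2_inner_diff[OF u L2_scale[OF v] v, of t] by (simp add: L2_inner_commute[of v "%x. u x - t *\<^sub>R v x"] L2_inner_scale b_def c_def)
  finally show ?thesis by (simp add: power2_eq_square algebra_simps)
 qed
 have c0: "0 <= c" "0 <= a" by (simp_all add: a_def c_def L2_inner_self_nonneg)
 have "b^2 <= a * c"
 proof (cases "c = 0")
  case True
  have "b = 0"
  proof (rule ccontr)
   assume "b ~= 0"
   with q[of "(a + 1) / (2 * b)"] True show False by simp
  qed
  then show ?thesis using True by simp
 next
  case False
  with q[of "b / c"] c0 show ?thesis by (simp add: power2_eq_square field_simps)
 qed
 then have "sqrt (b^2) <= sqrt (a * c)" by (rule real_sqrt_le_mono)
 then show ?thesis by (simp add: L2_norm_def a_def b_def c_def real_sqrt_mult)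
qed

lemma L2_norm_triangle:
 assumes u: "u \<in> L2p" and v: "v \<in> L2p"
 shows "nrm2 (%x. u x + v x) <= nrm2 u + nrm2 v"
proof -
 have "inn (%x. u x + v x) (%x. u x + v x) = inn u u + 2 * inn u v + inn v v"
  using L2_inner_add[OF u v L2_add[OF u v]] L2_inner_add[OF u v u] L2_inner_add[OF u v v]
  by (simp add: L2_inner_commute[of u "%x. u x + v x"] L2_inner_commute[of v "%x. u x + v x"] L2_inner_commute[of v u])
 also have "... <= (nrm2 u)^2 + 2 * (nrm2 u * nrm2 v) + (nrm2 v)^2"
  using L2_cauchy_schwarz[OF u v] by (simp add: L2_norm_sq)
 also have "... = (nrm2 u + nrm2 v)^2" by (simp add: power2_sum)
 finally show ?thesis unfolding L2_norm_def[of L "%x. u x + v x"] by (intro real_le_lsqrt) auto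
qed

lemma L2_norm_minus_commute: "nrm2 (%x. u x - v x) = nrm2 (%x. v x - u x)"
 using L2_norm_scale[of "-1" "%x. v x - u x"] by simp

lemma L2_norm_triangle_diff:
 assumes "u \<in> L2p" "v \<in> L2p" "w \<in> L2p"
 shows "nrm2 (%x. u x - w x) <= nrm2 (%x. u x - v x) + nrm2 (%x. v x - w x)"
 using L2_norm_triangle[OF L2_diff[OF assms(1,2)] L2_diff[OF assms(2,3)]] by simp

lemma ae_eq_iff_norm:
 assumes "u \<in> L2p" "v \<in> L2p"
 shows "ae_eq L u v \<longleftrightarrow> nrm2 (%x. u x - v x) = 0"
proof -
 have i: "integrable M (%x. (u x - v x) \<bullet> (u x - v x))" using L2_inner_integrable[OF L2_diff L2_diff, OF assms assms] .
 have "nrm2 (%x. u x - v x) = 0 \<longleftrightarrow> (AE x in M. (u x - v x) \<bullet> (u x - v x) = 0)"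
  using integral_nonneg_eq_0_iff_AE[OF i] by (simp add: L2_norm_def L2_inner_def)
 then show ?thesis by (simp add: ae_eq_def)
qed

lemma L2_inner_ae_cong:
 assumes "ae_eq L u u'" "u \<in> L2p" "u' \<in> L2p" "w \<in> L2p"
 shows "inn u w = inn u' w"
 unfolding L2_inner_def
 by (rule integral_cong_AE) (use assms L2_perD(1) in "auto simp: ae_eq_def elim!: eventually_mono")

lemma L2_integrable: assumes "u \<in> L2p" shows "integrable M u"
proof (rule Bochner_Integration.integrable_bound)
 show "integrable M (%x. 1 + (norm (u x))^2)" using L2_perD[OF assms] by auto
 have "norm a <= 1 + (norm a)^2" for a :: "real^3" 
 proof -
  have "2 * norm a <= (norm a)^2 + 1" using zero_le_power2[of "norm a - 1"] by (simp add: power2_diff)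
  then show ?thesis using norm_ge_zero[of a] zero_le_power2[of "norm a"] by linarith
 qed
 then show "AE x in M. norm (u x) <= norm (1 + (norm (u x))^2)" by auto
qed (rule L2_perD(1)[OF assms])

text \<open>A subsequence with geometrically small differences converges almost everywhere, and Fatou's lemma
  identifies the limit in the norm.\<close>

theorem L2_complete:
 assumes u: "!!n. u n \<in> L2p"
  and cauchy: "!!e. 0 < e ==> \<exists>N. \<forall>m\<ge>N. \<forall>n\<ge>N. nrm2 (%x. u m x - u n x) < e"
 shows "\<exists>v\<in>L2p. (%n. nrm2 (%x. u n x - v x)) ----> 0"
proof -
 have "\<exists>s. \<forall>k. \<forall>m\<ge>s k. \<forall>n\<ge>s k. nrm2 (%x. u m x - u n x) < (1/2)^k"
  using cauchy[of "(1/2)^k" for k] by (intro choice allI) auto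
 then obtain s0 where s0: "!!k m n. s0 k <= m ==> s0 k <= n ==> nrm2 (%x. u m x - u n x) < (1/2)^k" by blast
 define s where "s k = (\<Sum>j\<le>k. s0 j)" for k
 have ss: "s0 k <= s j" if "k <= j" for j k unfolding s_def
  using member_le_sum[of k "{..j}" s0] that by simp
 have sn: "(norm (a :: real^3))^2 = a \<bullet> a" for a by (simp add: power2_norm_eq_inner)
 have I: "(LINT x|M. (norm (u m x - u n x))^2) <= ((1/2)^k)^2" if "s0 k <= m" "s0 k <= n" for m n k
 proof -
  have "(LINT x|M. (norm (u m x - u n x))^2) = (nrm2 (%x. u m x - u n x))^2" by (simp add: L2_norm_sq L2_inner_def sn)
  also have "... <= ((1/2)^k)^2" using s0[OF that] by (intro power_mono) auto
  finally show ?thesis .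
 qed
 define f where "f k x = norm (u (s (Suc k)) x - u (s k) x)" for k x
 have fi: "integrable M (f k)" for k unfolding f_def by (intro integrable_norm L2_integrable L2_diff u)
 have f0: "0 <= f k x" for k x by (simp add: f_def)
 have fb: "(LINT x|M. f k x) <= (L^3 + 1) * (1/2)^k" for k
 proof -
  define t where "t = (1/2::real)^k"
  have t: "0 < t" by (simp add: t_def)
  have i2: "integrable M (%x. (f k x)^2)" unfolding f_def by (rule L2_perD(2)[OF L2_diff[OF u u]])
  have "(LINT x|M. f k x) <= (LINT x|M. t + (f k x)^2 / t)"
  proof (rule integral_mono[OF fi])
   show "integrable M (%x. t + (f k x)^2 / t)" using i2 by simp
   fix x
   have "0 <= (f k x - t)^2 / t + f k x" using t f0 by simp
   also have "(f k x - t)^2 / t + f k x = t + (f k x)^2 / t - f k x" using t by (simp add: power2_eq_square field_simps)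
   finally show "f k x <= t + (f k x)^2 / t" by simp
  qed
  also have "... = L^3 * t + (LINT x|M. (f k x)^2) / t" using i2 cube_content by simp
  also have "... <= L^3 * t + t^2 / t"
   using I[OF ss ss, of k "Suc k" k] t unfolding f_def t_def by (intro add_left_mono divide_right_mono) auto
  also have "... = (L^3 + 1) * t" using t by (simp add: power2_eq_square algebra_simps)
  finally show ?thesis by (simp add: t_def)
 qed
 have "AE x in M. summable (%k. f k x)"
 proof (rule monotone_series_integral(1)[OF fi f0])
  fix r
  have "(LINT x|M. (\<Sum>k<r. f k x)) = (\<Sum>k<r. LINT x|M. f k x)" using fi by simp
  also have "... <= (\<Sum>k<r. (L^3 + 1) * (1/2)^k)" by (intro sum_mono fb)
  also have "... = (L^3 + 1) * (\<Sum>k<r. (1/2)^k)" by (simp add: sum_distrib_left)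
  also have "... <= (L^3 + 1) * 2"
  proof (rule mult_left_mono)
   have "(\<Sum>k<r. (1/2::real)^k) <= (\<Sum>k. (1/2)^k)" by (intro sum_le_suminf summable_geometric) auto
   then show "(\<Sum>k<r. (1/2::real)^k) <= 2" by (simp add: suminf_geometric)
  qed (use L_pos in simp)
  finally show "(LINT x|M. (\<Sum>k<r. f k x)) <= (L^3 + 1) * 2" .
 qed
 then have conv: "AE x in M. convergent (%k. u (s k) x)"
 proof eventually_elim
  case (elim x)
  have "summable (%k. u (s (Suc k)) x - u (s k) x)" using elim unfolding f_def by (rule summable_norm_cancel)
  then have "convergent (%n. \<Sum>k<n. u (s (Suc k)) x - u (s k) x)" by (rule summable_iff_convergent[THEN iffD1])
  moreover have "(\<Sum>k<n. u (s (Suc k)) x - u (s k) x) = u (s n) x - u (s 0) x" for n by (rule sum_lessThan_telescope)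
  ultimately have "convergent (%n. u (s n) x - u (s 0) x)" by (simp only:)
  then have "convergent (%n. (u (s n) x - u (s 0) x) + u (s 0) x)" by (intro convergent_add convergent_const)
  then show ?case by simp
 qed
 define v where "v x = lim (%k. u (s k) x)" for x
 have vm: "v \<in> borel_measurable lebesgue" unfolding v_def by (intro borel_measurable_lim_metric L2_perD(4) u)
 have vmM: "v \<in> borel_measurable M" using vm by (rule measurable_restrict_space1)
 have vp: "periodic L v" unfolding v_def periodic_def using L2_perD(3)[OF u] by (simp add: periodic_def)
 have bd: "(\<integral>\<^sup>+x. ennreal ((norm (u n x - v x))^2) \<partial>M) <= ennreal (((1/2)^k)^2)" if n: "s0 k <= n" for n k
 proof -
  have "(\<integral>\<^sup>+x. ennreal ((norm (u n x - v x))^2) \<partial>M) = (\<integral>\<^sup>+x. liminf (%j. ennreal ((norm (u n x - u (s j) x))^2)) \<partial>M)"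
  proof (rule nn_integral_cong_AE)
   show "AE x in M. ennreal ((norm (u n x - v x))^2) = liminf (%j. ennreal ((norm (u n x - u (s j) x))^2))" using conv
   proof eventually_elim
    case (elim x)
    then have "(%j. u (s j) x) ----> v x" unfolding v_def by (simp add: convergent_LIMSEQ_iff)
    then have "(%j. ennreal ((norm (u n x - u (s j) x))^2)) ----> ennreal ((norm (u n x - v x))^2)"
     by (intro tendsto_ennrealI tendsto_intros)
    then show ?case by (intro lim_imp_Liminf[symmetric]) auto
   qed
  qed
  also have "... <= liminf (%j. \<integral>\<^sup>+x. ennreal ((norm (u n x - u (s j) x))^2) \<partial>M)"
   by (rule nn_integral_liminf) (use L2_perD(1)[OF u] in measurable)
  also have "... <= ennreal (((1/2)^k)^2)"
  proof (rule Liminf_le)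
   have "(\<integral>\<^sup>+x. ennreal ((norm (u n x - u (s j) x))^2) \<partial>M) <= ennreal (((1/2)^k)^2)" if "k <= j" for j
    using I[OF n ss[OF that]] L2_perD(2)[OF L2_diff[OF u u]] by (subst nn_integral_eq_integral) (auto intro: ennreal_leI)
   then show "\<forall>\<^sub>F j in sequentially. (\<integral>\<^sup>+x. ennreal ((norm (u n x - u (s j) x))^2) \<partial>M) <= ennreal (((1/2)^k)^2)"
    unfolding eventually_sequentially by blast
  qed simp
  finally show ?thesis .
 qed
 have di: "integrable M (%x. (norm (u n x - v x))^2)" if "s0 k <= n" for n k
 proof (rule integrableI_nonneg)
  show "(%x. (norm (u n x - v x))^2) \<in> borel_measurable M" using vmM L2_perD(1)[OF u] by measurable
  show "(\<integral>\<^sup>+x. ennreal ((norm (u n x - v x))^2) \<partial>M) < \<infinity>" using bd[OF that] by (rule order.strict_trans1) simp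
 qed simp
 have "(%x. u (s0 0) x - v x) \<in> L2p"
  using di[OF order_refl] vm vp L2_perD[OF u[of "s0 0"]] by (auto simp: L2_per_def periodic_def)
 from L2_diff[OF u[of "s0 0"] this] have v: "v \<in> L2p" by simp
 have "(%n. nrm2 (%x. u n x - v x)) ----> 0"
 proof (rule LIMSEQ_I)
  fix e :: real assume e: "0 < e"
  obtain k where k: "(1/2)^k < e" using real_arch_pow_inv[OF e, of "1/2"] by auto
  have "norm (nrm2 (%x. u n x - v x) - 0) < e" if n: "s0 k <= n" for n
  proof -
   have "ennreal (LINT x|M. (norm (u n x - v x))^2) <= ennreal (((1/2)^k)^2)"
    using bd[OF n] di[OF n] by (subst (asm) nn_integral_eq_integral) auto
   then have "(nrm2 (%x. u n x - v x))^2 <= ((1/2)^k)^2" by (simp add: L2_norm_sq L2_inner_def sn)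
   then have "nrm2 (%x. u n x - v x) <= (1/2)^k" by (rule power2_le_imp_le) simp
   with k show ?thesis by simp
  qed
  then show "\<exists>no. \<forall>n\<ge>no. norm (nrm2 (%x. u n x - v x) - 0) < e" by blast
 qed
 with v show ?thesis by blast
qed

definition orthonormal :: "(nat => field) => bool" where
 "orthonormal e \<longleftrightarrow> (\<forall>i. e i \<in> L2p) & (\<forall>i j. inn (e i) (e j) = (if i = j then 1 else 0))"

definition comb :: "(nat => field) => seq => nat => field" where
 "comb e c n = (%x. \<Sum>i<n. c i *\<^sub>R e i x)"

lemma comb_L2: "orthonormal e ==> comb e c n \<in> L2p"
 unfolding comb_def orthonormal_def by (intro L2_sum L2_scale) auto

lemma comb_inner: assumes "orthonormal e" shows "inn (comb e c n) (e j) = (if j < n then c j else 0)"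
proof -
 have "inn (comb e c n) (e j) = (\<Sum>i<n. inn (%x. c i *\<^sub>R e i x) (e j))"
  unfolding comb_def using assms by (intro L2_inner_sum) (auto simp: orthonormal_def intro: L2_scale)
 also have "... = (\<Sum>i<n. if i = j then c i else 0)"
  using assms by (intro sum.cong) (auto simp: L2_inner_scale orthonormal_def)
 finally show ?thesis by simp
qed

lemma comb_inner_left: assumes "orthonormal e" "u \<in> L2p"
 shows "inn (comb e c n) u = (\<Sum>i<n. c i * inn u (e i))"
proof -
 have "inn (comb e c n) u = (\<Sum>i<n. inn (%x. c i *\<^sub>R e i x) u)"
  unfolding comb_def using assms by (intro L2_inner_sum) (auto simp: orthonormal_def intro: L2_scale)
 then show ?thesis by (simp add: L2_inner_scale L2_inner_commute)
qed

lemma comb_norm: assumes "orthonormal e" shows "(nrm2 (comb e c n))^2 = (\<Sum>i<n. (c i)^2)"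
proof -
 have "inn (comb e c n) (comb e c n) = (\<Sum>i<n. c i * (if i < n then c i else 0))"
  unfolding comb_inner_left[OF assms comb_L2[OF assms]] by (simp only: comb_inner[OF assms])
 also have "... = (\<Sum>i<n. (c i)^2)" by (rule sum.cong) (auto simp: power2_eq_square)
 finally show ?thesis by (simp only: L2_norm_sq)
qed

lemma comb_diff: "(%x. comb e c n x - comb e d n x) = comb e (%i. c i - d i) n"
 by (auto simp: comb_def sum_subtractf scaleR_left_diff_distrib)

lemma comb_trunc: assumes "m <= n" shows "comb e (trunc m c) n = comb e c m"
proof
 fix x
 have "(\<Sum>i<n. trunc m c i *\<^sub>R e i x) = (\<Sum>i<m. trunc m c i *\<^sub>R e i x)"
  by (rule sum.mono_neutral_right) (use assms in "auto simp: trunc_def")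
 then show "comb e (trunc m c) n x = comb e c m x" by (simp add: comb_def trunc_def)
qed

lemma comb_dist: assumes "orthonormal e" "m <= n"
 shows "(nrm2 (%x. comb e c n x - comb e c m x))^2 = (\<Sum>i=m..<n. (c i)^2)"
proof -
 have "(%x. comb e c n x - comb e c m x) = comb e (%i. c i - trunc m c i) n"
  unfolding comb_diff[symmetric] comb_trunc[OF assms(2)] ..
 then have "(nrm2 (%x. comb e c n x - comb e c m x))^2 = (\<Sum>i<n. (c i - trunc m c i)^2)" by (simp add: comb_norm[OF assms(1)])
 also have "... = (\<Sum>i=m..<n. (c i)^2)" by (rule sum.mono_neutral_cong_right) (auto simp: trunc_def)
 finally show ?thesis .
qed

lemma bessel_identity: assumes e: "orthonormal e" and u: "u \<in> L2p"
 shows "(nrm2 (%x. u x - comb e c n x))^2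
  = (nrm2 u)^2 - (\<Sum>i<n. (inn u (e i))^2) + (\<Sum>i<n. (inn u (e i) - c i)^2)"
proof -
 note s = comb_L2[OF e, of c n]
 have "(nrm2 (%x. u x - comb e c n x))^2 = inn u u - 2 * inn (comb e c n) u + inn (comb e c n) (comb e c n)"
  using L2_inner_diff[OF u s L2_diff[OF u s]] L2_inner_diff[OF u s u] L2_inner_diff[OF u s s]
  by (simp add: L2_norm_sq L2_inner_commute[of u "%x. u x - comb e c n x"] L2_inner_commute[of "comb e c n" "%x. u x - comb e c n x"] L2_inner_commute[of u "comb e c n"])
 also have "... = (nrm2 u)^2 + (\<Sum>i<n. (c i)^2 - 2 * (c i * inn u (e i)))"
  using comb_norm[OF e, of c n] comb_inner_left[OF e u, of c n] by (simp add: L2_norm_sq sum_subtractf sum_distrib_left)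
 also have "(\<Sum>i<n. (c i)^2 - 2 * (c i * inn u (e i))) = - (\<Sum>i<n. (inn u (e i))^2) + (\<Sum>i<n. (inn u (e i) - c i)^2)"
  unfolding sum_negf[symmetric] sum.distrib[symmetric] by (intro sum.cong refl) (simp add: power2_eq_square algebra_simps)
 finally show ?thesis by simp
qed

lemma bessel: assumes e: "orthonormal e" and u: "u \<in> L2p"
 shows "wfin one (%i. inn u (e i))" "wsq one (%i. inn u (e i)) <= (nrm2 u)^2"
proof -
 have "(\<Sum>i<n. one i * (inn u (e i))^2) <= (nrm2 u)^2" for n
  using bessel_identity[OF e u, of "%i. inn u (e i)" n] zero_le_power2[of "nrm2 (%x. u x - comb e (%i. inn u (e i)) n x)"] by simp
 from wfin_bounded[OF nonneg_one this]
 show "wfin one (%i. inn u (e i))" "wsq one (%i. inn u (e i)) <= (nrm2 u)^2" by auto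
qed

definition expands :: "(nat => field) => seq => field => bool" where
 "expands e c u \<longleftrightarrow> u \<in> L2p & (%n. nrm2 (%x. u x - comb e c n x)) ----> 0"

lemma L2_inner_tendsto:
 assumes "!!n. v n \<in> L2p" "u \<in> L2p" "w \<in> L2p" "(%n. nrm2 (%x. u x - v n x)) ----> 0"
 shows "(%n. inn (v n) w) ----> inn u w"
proof -
 have "(%n. inn u w - inn (v n) w) ----> 0"
 proof (rule Lim_null_comparison)
  show "\<forall>\<^sub>F n in sequentially. norm (inn u w - inn (v n) w) <= nrm2 (%x. u x - v n x) * nrm2 w"
   using L2_cauchy_schwarz[OF L2_diff[OF assms(2,1)] assms(3)] L2_inner_diff[OF assms(2,1,3)] by simp
  show "(%n. nrm2 (%x. u x - v n x) * nrm2 w) ----> 0" using tendsto_mult_left_zero[OF assms(4)] .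
 qed
 from tendsto_diff[OF tendsto_const[of "inn u w"] this] show ?thesis by simp
qed

lemma expands_coeff: assumes e: "orthonormal e" and x: "expands e c u"
 shows "inn u (e i) = c i"
proof -
 have "(%n. inn (comb e c n) (e i)) ----> inn u (e i)"
  by (rule L2_inner_tendsto) (use x e comb_L2 in "auto simp: expands_def orthonormal_def")
 moreover have "(%n. inn (comb e c n) (e i)) ----> c i"
  by (rule tendsto_eventually) (auto simp: comb_inner[OF e] eventually_sequentially intro!: exI[of _ "Suc i"])
 ultimately show ?thesis by (rule LIMSEQ_unique)
qed

lemma expands_inner: assumes e: "orthonormal e" and x: "expands e c u" and w: "w \<in> L2p"
 shows "(%i. c i * inn w (e i)) sums inn u w"
proof -
 have "(%n. inn (comb e c n) w) ----> inn u w"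
  by (rule L2_inner_tendsto) (use x e w comb_L2 in "auto simp: expands_def")
 then show ?thesis by (simp add: sums_def comb_inner_left[OF e w])
qed

lemma expands_parseval: assumes e: "orthonormal e" and x: "expands e c u"
 shows "wfin one c" "(nrm2 u)^2 = wsq one c"
proof -
 have u: "u \<in> L2p" using x by (simp add: expands_def)
 show "wfin one c" using bessel(1)[OF e u] expands_coeff[OF e x] by simp
 show "(nrm2 u)^2 = wsq one c" 
  unfolding L2_norm_sq wsq_def
  using sums_unique[OF expands_inner[OF e x u]] expands_coeff[OF e x] by (simp add: power2_eq_square)
qed

lemma riesz_fischer: assumes e: "orthonormal e" and c: "wfin one c"
 shows "\<exists>u. expands e c u"
proof -
 have s: "summable (%i. (c i)^2)" using c by (simp add: wfin_def)
 have "\<exists>u\<in>L2p. (%n. nrm2 (%x. comb e c n x - u x)) ----> 0"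
 proof (rule L2_complete[OF comb_L2[OF e]])
  fix r :: real assume r: "0 < r"
  then obtain N where N: "!!m n. N <= m ==> norm (\<Sum>i=m..<n. (c i)^2) < r^2"
   using s unfolding summable_Cauchy by (meson zero_less_power)
  have h: "nrm2 (%x. comb e c n x - comb e c m x) < r" if "N <= m" "m <= n" for m n
  proof -
   have "(nrm2 (%x. comb e c n x - comb e c m x))^2 < r^2" using N[OF that(1), of n] by (simp add: comb_dist[OF e that(2)])
   then show ?thesis using r by (simp add: power_less_imp_less_base)
  qed
  show "\<exists>N. \<forall>m\<ge>N. \<forall>n\<ge>N. nrm2 (%x. comb e c m x - comb e c n x) < r"
  proof (intro exI allI impI)
   fix m n assume "N <= m" "N <= n"
   then show "nrm2 (%x. comb e c m x - comb e c n x) < r"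
    using h[of m n] h[of n m] L2_norm_minus_commute[of "comb e c m" "comb e c n"] by (cases "m <= n") auto
  qed
 qed
 then obtain u where u: "u \<in> L2p" "(%n. nrm2 (%x. comb e c n x - u x)) ----> 0" by blast
 have "expands e c u" unfolding expands_def by (subst L2_norm_minus_commute) (use u in simp)
 then show ?thesis by blast
qed

lemma expands_ae_eq: assumes "orthonormal e" "expands e c u" "v \<in> L2p"
 shows "ae_eq L u v \<longleftrightarrow> expands e c v"
proof
 assume "ae_eq L u v"
 have u: "u \<in> L2p" using assms by (simp add: expands_def)
 have z: "nrm2 (%x. v x - u x) = 0" using \<open>ae_eq L u v\<close> ae_eq_iff_norm[OF u assms(3)] L2_norm_minus_commute[of v u] by simp
 show "expands e c v" unfolding expands_def
 proof
  show "(%n. nrm2 (%x. v x - comb e c n x)) ----> 0"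
  proof (rule Lim_null_comparison)
   show "\<forall>\<^sub>F n in sequentially. norm (nrm2 (%x. v x - comb e c n x)) <= nrm2 (%x. u x - comb e c n x)"
    using L2_norm_triangle_diff[OF assms(3) u comb_L2[OF assms(1)]] z by simp
  qed (use assms in "simp add: expands_def")
 qed (rule assms)
next
 assume v: "expands e c v"
 have u: "u \<in> L2p" using assms by (simp add: expands_def)
 have "nrm2 (%x. u x - v x) <= nrm2 (%x. u x - comb e c n x) + nrm2 (%x. v x - comb e c n x)" for n
  using L2_norm_triangle_diff[OF u comb_L2[OF assms(1)] assms(3)] L2_norm_minus_commute[of v] by simp
 moreover have "(%n. nrm2 (%x. u x - comb e c n x) + nrm2 (%x. v x - comb e c n x)) ----> 0 + 0"
  using assms(2) v by (intro tendsto_add) (auto simp: expands_def)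
 ultimately have "nrm2 (%x. u x - v x) <= 0 + 0" by (intro LIMSEQ_le_const) auto
 then have "nrm2 (%x. u x - v x) = 0" by (simp add: order_antisym)
 then show "ae_eq L u v" using ae_eq_iff_norm[OF u assms(3)] by simp
qed

end

section \<open>The Hartley system on the torus\<close>
context torus
begin

lemma continuous_integrable:
 fixes f :: "real^3 => 'b::euclidean_space"
 assumes "continuous_on UNIV f" shows "integrable M f"
 unfolding cube_cbox by (rule continuous_imp_integrable[OF continuous_on_subset[OF assms subset_UNIV]])

definition slab :: "3 => real => real => (real^3) set" where
 "slab j a b = cbox (\<chi> i. if i = j then a else 0) (\<chi> i. if i = j then b else L)"

lemma slab_split:
 fixes g :: "real^3 => real"
 assumes g: "continuous_on UNIV g" and ab: "a <= b" "b <= c"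
 shows "integral (slab j a c) g = integral (slab j a b) g + integral (slab j b c) g"
proof -
 have "slab j a c \<inter> {x. x \<bullet> axis j 1 <= b} = slab j a b" "slab j a c \<inter> {x. x \<bullet> axis j 1 >= b} = slab j b c"
  using ab by (auto simp: slab_def mem_box_cart inner_axis split: if_splits) (smt (verit))+
 moreover have "g integrable_on slab j a c" unfolding slab_def
  by (rule integrable_continuous) (rule continuous_on_subset[OF g], simp)
 ultimately show ?thesis unfolding slab_def
  using integral_split[of g "\<chi> i. if i = j then a else 0" "\<chi> i. if i = j then c else L" "axis j 1" b] by (simp add: axis_in_Basis_iff)
qed

lemma integral_shift_cbox:
 fixes g :: "real^3 => real"
 assumes g: "continuous_on UNIV g"
 shows "integral (cbox a b) (%x. g (x + v)) = integral (cbox (a + v) (b + v)) g"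
proof -
 have "g integrable_on cbox (a + v) (b + v)" by (rule integrable_continuous) (rule continuous_on_subset[OF g], simp)
 from has_integral_affinity[OF integrable_integral[OF this], of 1 v]
 have "((%x. g (x + v)) has_integral integral (cbox (a + v) (b + v)) g) ((%x. - v + x) ` cbox (a + v) (b + v))"
  by (simp add: add.commute)
 moreover have "(%x. - v + x) ` cbox (a + v) (b + v) = cbox a b"
  unfolding cbox_translation[symmetric] by simp
 ultimately show ?thesis by (simp add: integral_unique)
qed

text \<open>By periodicity the part of the cube that leaves through one face enters through the opposite one.\<close>

lemma integral_translate:
 fixes g :: "real^3 => real"
 assumes g: "continuous_on UNIV g" and p: "periodic L g" and t: "0 <= t" "t <= L"
 shows "integral (cube L) (%x. g (x + axis j t)) = integral (cube L) g"
proof -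
 have c: "cube L = slab j 0 L" unfolding cube_cbox slab_def by (rule arg_cong2[of _ _ _ _ cbox]) (auto simp: vec_eq_iff)
 have sh: "integral (slab j a b) (%x. g (x + axis j s)) = integral (slab j (a + s) (b + s)) g" for a b s
 proof -
  have "(\<chi> i. if i = j then a else 0) + axis j s = (\<chi> i. if i = j then a + s else 0)"
   "(\<chi> i. if i = j then b else L) + axis j s = (\<chi> i. if i = j then b + s else L)" by (auto simp: vec_eq_iff axis_def)
  then show ?thesis unfolding slab_def using integral_shift_cbox[OF g] by simp
 qed
 have "integral (cube L) (%x. g (x + axis j t)) = integral (slab j t (L + t)) g" using sh[of 0 L t] by (simp add: c)
 also have "... = integral (slab j t L) g + integral (slab j L (L + t)) g" using t by (intro slab_split[OF g]) auto
 also have "integral (slab j L (L + t)) g = integral (slab j 0 t) g"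
  using sh[of 0 t L] p by (simp add: periodic_def add.commute)
 also have "integral (slab j t L) g + integral (slab j 0 t) g = integral (cube L) g"
  using slab_split[OF g t, of j] by (simp add: c)
 finally show ?thesis .
qed

lemma deriv_along:
 fixes g :: "real^3 => real"
 assumes "!!x. g differentiable (at x)"
 shows "((%s. g (x + s *\<^sub>R axis j 1)) has_real_derivative partial j g (x + s *\<^sub>R axis j 1)) (at s)"
proof -
 let ?y = "x + s *\<^sub>R axis j 1"
 have D: "(g has_derivative frechet_derivative g (at ?y)) (at ?y)" using assms frechet_derivative_works by blast
 have "((%s. g (x + s *\<^sub>R axis j 1)) has_derivative (%h. frechet_derivative g (at ?y) (h *\<^sub>R axis j 1))) (at s)"
  by (rule has_derivative_compose[where f="%s. x + s *\<^sub>R axis j 1" and g=g, OF _ D]) (auto intro!: derivative_eq_intros)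
 moreover have "frechet_derivative g (at ?y) (h *\<^sub>R axis j 1) = partial j g ?y * h" for h
  using linear_cmul[OF linear_frechet_derivative[OF assms], of ?y h "axis j 1"] by (simp add: partial_def mult.commute)
 ultimately show ?thesis unfolding has_field_derivative_def by simp
qed

lemma partial_periodic:
 assumes "periodic L phi" shows "periodic L (partial j phi)"
proof -
 have "(phi has_derivative D) (at (x + v)) \<longleftrightarrow> (phi has_derivative D) (at x)" if v: "!!y. phi (y + v) = phi y" for D x v
 proof
  have t: "((%y. y + a) has_derivative (%h. h)) (at b)" for a b :: "real^3" by (auto intro!: derivative_eq_intros)
  show "(phi has_derivative D) (at x)" if "(phi has_derivative D) (at (x + v))"
   using has_derivative_compose[OF t that] by (simp add: v)
  have "phi (y + - v) = phi y" for y using v[of "y - v"] by simp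
  then show "(phi has_derivative D) (at (x + v))" if "(phi has_derivative D) (at x)"
   using has_derivative_compose[OF t[of "- v" "x + v"], of phi D] that by simp
 qed
 then have "frechet_derivative phi (at (x + axis i L)) = frechet_derivative phi (at x)" for x i
  using assms unfolding frechet_derivative_def periodic_def by presburger
 then show ?thesis unfolding periodic_def partial_def by metis
qed

text \<open>Integrating first along the direction \<open>j\<close> over a full period gives zero at every point; exchanging the
  integrals and using translation invariance gives the claim.\<close>

lemma integral_partial_zero:
 fixes g :: "real^3 => real"
 assumes d: "!!x. g differentiable (at x)" and c: "continuous_on UNIV (partial j g)" and p: "periodic L g"
 shows "(LINT x|M. partial j g x) = 0"
proof -
 let ?p = "partial j g"
 have ax: "axis j t = t *\<^sub>R axis j 1" for t :: real by (auto simp: vec_eq_iff axis_def)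
 have sx: "axis j (snd z) = snd z *\<^sub>R axis j 1" for z :: "(real^3) \<times> real" by (rule ax)
 have 0: "integral (cbox 0 L) (%t. ?p (x + axis j t)) = 0" for x
 proof -
  have "((%t. ?p (x + t *\<^sub>R axis j 1)) has_integral (g (x + L *\<^sub>R axis j 1) - g (x + 0 *\<^sub>R axis j 1))) {0..L}"
   using L_pos deriv_along[OF d, of x j] by (intro fundamental_theorem_of_calculus)
    (auto simp: has_real_derivative_iff_has_vector_derivative[symmetric] intro: has_field_derivative_at_within)
  then show ?thesis using p unfolding ax[symmetric] by (simp add: periodic_def integral_unique axis_def[of j 0] zero_vec_def[symmetric])
 qed
 have "continuous_on UNIV (%z. ?p (fst z + axis j (snd z)))"
  unfolding sx by (rule continuous_on_compose2[OF c]) (intro continuous_intros, auto)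
 then have cc: "continuous_on (cbox (0, 0) (\<chi> i. L, L)) (%(x, t). ?p (x + axis j t))"
  unfolding case_prod_beta by (rule continuous_on_subset) simp
 have "0 = integral (cube L) (%x. integral (cbox 0 L) (%t. ?p (x + axis j t)))" unfolding 0 by simp
 also have "... = integral (cbox 0 L) (%t. integral (cube L) (%x. ?p (x + axis j t)))"
  unfolding cube_cbox by (rule integral_swap_continuous[OF cc])
 also have "... = integral (cbox 0 L) (%t. integral (cube L) ?p)"
  by (rule Henstock_Kurzweil_Integration.integral_cong) (simp add: integral_translate[OF c partial_periodic[OF p]])
 also have "... = L * integral (cube L) ?p" using L_pos by simp
 finally have "integral (cube L) ?p = 0" using L_pos by simp
 then show ?thesis using lebesgue_integral_eq_integral[OF continuous_integrable[OF c]] by simp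
qed

text \<open>The functions \<open>chi k\<close> form a real orthonormal system indexed by all integer frequencies. Differentiation maps
  \<open>chi k\<close> to a multiple of \<open>chi (- k)\<close>, and products are again combinations, so no complex coefficients are needed.\<close>

definition ph :: "int^3 => real^3 => real" where
 "ph k x = 2 * pi / L * (\<Sum>i\<in>UNIV. real_of_int (k $ i) * x $ i)"
definition nrm :: real where "nrm = 1 / sqrt (L ^ 3)"
definition chi :: "int^3 => real^3 => real" where "chi k x = nrm * (cos (ph k x) + sin (ph k x))"
definition kap :: "int^3 => 3 => real" where "kap k j = 2 * pi / L * real_of_int (k $ j)"

lemma nrm: "0 < nrm" "nrm^2 * L ^ 3 = 1" using L_pos by (auto simp: nrm_def power_divide)

lemma ph_minus [simp]: "ph (- k) x = - ph k x" by (simp add: ph_def sum_negf)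
lemma ph_add: "ph (k + l) x = ph k x + ph l x" by (simp add: ph_def sum.distrib distrib_right distrib_left)
lemma ph_add_right: "ph k (x + y) = ph k x + ph k y" by (simp add: ph_def sum.distrib distrib_left)
lemma ph_axis: "ph k (axis j a) = kap k j * a"
 by (simp add: ph_def kap_def axis_def if_distrib[of "%z. _ * z"] cong: if_cong)
lemma kap_minus [simp]: "kap (- k) j = - kap k j" by (simp add: kap_def)

lemma chi_deriv: "(chi k has_derivative (%h. ph k h * chi (- k) x)) (at x)"
proof -
 have "(ph k has_derivative ph k) (at x)" unfolding ph_def[abs_def]
  by (intro bounded_linear_imp_has_derivative bounded_linear_const_mult bounded_linear_sum)
    (intro bounded_linear_mult_right[THEN bounded_linear_compose] bounded_linear_vec_nth)
 then show ?thesis unfolding chi_def[abs_def] by (auto intro!: derivative_eq_intros simp: algebra_simps)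
qed

lemma chi_partial: "partial j (chi k) = (%x. kap k j * chi (- k) x)"
 unfolding partial_def using frechet_derivative_at[OF chi_deriv] by (metis (no_types, lifting) ph_axis mult.right_neutral)

lemma chi_periodic: "periodic L (chi k)"
proof -
 have e: "ph k (x + axis i L) = ph k x + of_int (k $ i) * (2 * pi)" for x i
  using L_pos by (simp add: ph_add_right ph_axis kap_def)
 have "cos (of_int m * (2 * pi)) = 1" "sin (of_int m * (2 * pi)) = 0" for m
  using cos_int_2pin[of m] sin_int_2pin[of m] by (simp_all add: mult.commute)
 then show ?thesis unfolding periodic_def chi_def e by (simp add: cos_add sin_add)
qed

lemma chi_prod: "chi k x * chi l x = nrm / 2 * (chi (k - l) x + chi (l - k) x + chi (k + l) x - chi (- (k + l)) x)"
proof -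
 have d: "ph (k - l) x = ph k x - ph l x" for k l
  using ph_add[of k "- l" x] by simp
 show ?thesis unfolding chi_def d ph_minus ph_add cos_minus sin_minus cos_diff sin_diff cos_add sin_add
  by (simp add: algebra_simps)
qed

lemma chi_zero: "chi 0 x = nrm" by (simp add: chi_def ph_def)

text \<open>The algebra of Hartley polynomials, the linear span of the functions \<open>chi k\<close>.\<close>

inductive hp :: "(real^3 => real) => bool" where
 hp_chi: "hp (chi k)"
| hp_add: "hp f ==> hp g ==> hp (%x. f x + g x)"
| hp_scale: "hp f ==> hp (%x. c * f x)"

lemma hp_const: "hp (%x. c)"
 using hp_scale[OF hp_chi[of 0], of "c / nrm"] nrm(1) by (simp add: chi_zero[abs_def])

lemma hp_diff: "hp f ==> hp g ==> hp (%x. f x - g x)" using hp_add[OF _ hp_scale[of g "-1"]] by simp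

lemma hp_sum: "(!!i. i \<in> I ==> hp (f i)) ==> hp (%x. \<Sum>i\<in>I. f i x)"
 by (induction I rule: infinite_finite_induct) (auto intro: hp_add hp_const)

lemma hp_mult: assumes "hp f" "hp g" shows "hp (%x. f x * g x)"
 using assms(1)
proof induction
 case (hp_chi k)
 show ?case using assms(2)
 proof induction
  case (hp_chi l)
  show ?case unfolding chi_prod by (intro hp.hp_scale hp_diff hp.hp_add hp.hp_chi)
 next
  case (hp_add f g) then show ?case by (simp add: distrib_left hp.hp_add)
 next
  case (hp_scale f c) then show ?case using hp.hp_scale[of "%x. chi k x * f x" c] by (simp add: mult.left_commute)
 qed
next
 case (hp_add f g') then show ?case by (simp add: distrib_right hp.hp_add)
next
 case (hp_scale f c) then show ?case using hp.hp_scale[of "%x. f x * g x" c] by (simp add: mult.assoc)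
qed

lemma hp_partial: assumes "hp f" shows "(\<forall>x. f differentiable (at x)) & (\<forall>j. hp (partial j f))"
 using assms
proof induction
 case (hp_chi k)
 show ?case using chi_deriv chi_partial hp.hp_scale[OF hp.hp_chi] by (auto simp: differentiable_def)
next
 case (hp_add f g)
 have "partial j (%x. f x + g x) = (%x. partial j f x + partial j g x)" for j
 proof
  fix x
  have "((%x. f x + g x) has_derivative (%h. frechet_derivative f (at x) h + frechet_derivative g (at x) h)) (at x)"
   using hp_add by (intro has_derivative_add) (auto simp: frechet_derivative_works[symmetric])
  from fun_cong[OF frechet_derivative_at[OF this, symmetric], of "axis j 1"]
  show "partial j (%x. f x + g x) x = partial j f x + partial j g x" by (simp only: partial_def)
 qed
 then show ?case using hp_add hp.hp_add by auto
next
 case (hp_scale f c)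
 have "partial j (%x. c * f x) = (%x. c * partial j f x)" for j
 proof
  fix x
  have "((%x. c * f x) has_derivative (%h. c * frechet_derivative f (at x) h)) (at x)"
   using hp_scale by (intro has_derivative_mult_right) (auto simp: frechet_derivative_works[symmetric])
  from fun_cong[OF frechet_derivative_at[OF this, symmetric], of "axis j 1"]
  show "partial j (%x. c * f x) x = c * partial j f x" by (simp only: partial_def)
 qed
 then show ?case using hp_scale hp.hp_scale by auto
qed

lemma hp_continuous: "hp f ==> continuous_on UNIV f"
 using hp_partial by (simp add: continuous_at_imp_continuous_on differentiable_imp_continuous_within)

lemma hp_periodic: "hp f ==> periodic L f"
 by (induction rule: hp.induct) (use chi_periodic in "auto simp: periodic_def")

lemma hp_C_k: "hp f ==> C_k n f"
 by (induction n arbitrary: f) (auto simp: hp_continuous hp_partial)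

lemma hp_integrable: "hp f ==> integrable M f"
 by (intro continuous_integrable hp_continuous)

lemma hp_integral_partial: "hp f ==> (LINT x|M. partial j f x) = 0"
 by (intro integral_partial_zero hp_continuous hp_periodic) (auto simp: hp_partial)

lemma chi_integral: "(LINT x|M. chi k x) = (if k = 0 then nrm * L ^ 3 else 0)"
proof (cases "k = 0")
 case True then show ?thesis using cube_content by (simp add: chi_zero[abs_def])
next
 case False
 then obtain j where j: "k $ j ~= 0" by (auto simp: vec_eq_iff)
 then have "kap k j ~= 0" using L_pos by (simp add: kap_def)
 then have "chi k = (%x. (- 1 / kap k j) * partial j (chi (- k)) x)" by (auto simp: chi_partial)
 then have "(LINT x|M. chi k x) = (- 1 / kap k j) * (LINT x|M. partial j (chi (- k)) x)" by (metis integral_mult_right_zero)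
 then show ?thesis using False by (simp add: hp_integral_partial[OF hp_chi])
qed

lemma chi_orthonormal: "(LINT x|M. chi k x * chi l x) = (if k = l then 1 else 0)"
proof -
 have i: "integrable M (chi m)" for m by (rule hp_integrable[OF hp_chi])
 have "(LINT x|M. chi k x * chi l x) = nrm / 2 * ((LINT x|M. chi (k - l) x) + (LINT x|M. chi (l - k) x) + (LINT x|M. chi (k + l) x) - (LINT x|M. chi (- (k + l)) x))"
  unfolding chi_prod using i by simp
 also have "(LINT x|M. chi (- (k + l)) x) = (LINT x|M. chi (k + l) x)" unfolding chi_integral neg_equal_0_iff_equal ..
 also have "nrm / 2 * ((LINT x|M. chi (k - l) x) + (LINT x|M. chi (l - k) x) + (LINT x|M. chi (k + l) x) - (LINT x|M. chi (k + l) x))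
   = nrm / 2 * (if k = l then 2 * (nrm * L ^ 3) else 0)" by (auto simp: chi_integral)
 finally show ?thesis using nrm(2) by (auto simp: power2_eq_square)
qed

lemma weak_partial_test:
 assumes phi: "periodic L phi" "!!n. C_k n phi"
 shows "(LINT x|M. partial j phi x * chi k x) = - (LINT x|M. phi x * (kap k j * chi (- k) x))"
proof -
 have d: "phi differentiable (at x)" "partial i phi differentiable (at x)" for x i using phi(2)[of "Suc (Suc 0)"] by auto
 have dc: "(chi k) differentiable (at x)" for x using hp_partial[OF hp_chi] by blast
 have c: "continuous_on UNIV phi" "continuous_on UNIV (partial j phi)"
  using d by (auto simp: continuous_at_imp_continuous_on differentiable_imp_continuous_within)
 have pr: "partial j (%x. phi x * chi k x) x = partial j phi x * chi k x + phi x * (kap k j * chi (- k) x)" for x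
 proof -
  have "(phi has_derivative frechet_derivative phi (at x)) (at x)" using d frechet_derivative_works by blast
  from fun_cong[OF frechet_derivative_at[OF has_derivative_mult[OF this chi_deriv[of k x]], symmetric], of "axis j 1"]
  have "partial j (%x. phi x * chi k x) x = phi x * (ph k (axis j 1) * chi (- k) x) + frechet_derivative phi (at x) (axis j 1) * chi k x"
   by (simp only: partial_def)
  then show ?thesis by (simp add: partial_def ph_axis)
 qed
 note cc = hp_continuous[OF hp_chi]
 have i: "integrable M (%x. partial j phi x * chi k x)" "integrable M (%x. phi x * (kap k j * chi (- k) x))"
  by (intro continuous_integrable continuous_on_mult c cc continuous_on_const)+
 have "(LINT x|M. partial j (%x. phi x * chi k x) x) = 0"
 proof (rule integral_partial_zero)
  show "(%x. phi x * chi k x) differentiable at x" for x using d dc by (intro differentiable_mult)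
  show "continuous_on UNIV (partial j (%x. phi x * chi k x))"
   unfolding pr[abs_def] by (intro continuous_intros c cc)
  show "periodic L (%x. phi x * chi k x)" using phi(1) chi_periodic by (simp add: periodic_def)
 qed
 then have "(LINT x|M. partial j phi x * chi k x) + (LINT x|M. phi x * (kap k j * chi (- k) x)) = 0"
  unfolding pr using i by simp
 then show ?thesis by simp
qed

text \<open>An embedding of the torus in Euclidean space. Polynomials in it are trigonometric polynomials, which
  gives access to the Stone-Weierstrass theorem.\<close>

definition tor :: "real^3 => (real^3) \<times> (real^3)" where
 "tor x = ((\<chi> i. cos (2 * pi / L * x $ i)), (\<chi> i. sin (2 * pi / L * x $ i)))"

lemma tor_continuous: "continuous_on S tor"
 unfolding tor_def by (intro continuous_intros)

lemma hp_cos_sin: "hp (%x. cos (2 * pi / L * x $ i))" "hp (%x. sin (2 * pi / L * x $ i))"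
proof -
 have p: "ph (axis i 1) x = 2 * pi / L * x $ i" for x
  by (simp add: ph_def axis_def if_distrib[of real_of_int] if_distrib[of "%z. z * _"] cong: if_cong)
 have n: "nrm ~= 0" using nrm(1) by simp
 have "cos (2 * pi / L * x $ i) = 1 / (2 * nrm) * (chi (axis i 1) x + chi (- axis i 1) x)"
  "sin (2 * pi / L * x $ i) = 1 / (2 * nrm) * (chi (axis i 1) x - chi (- axis i 1) x)" for x
  unfolding chi_def ph_minus p using n by (simp_all add: field_simps)
 then show "hp (%x. cos (2 * pi / L * x $ i))" "hp (%x. sin (2 * pi / L * x $ i))"
  by (simp_all only:) (intro hp_scale hp_add hp_diff hp_chi)+
qed

lemma hp_polynomial: "real_polynomial_function p ==> hp (%x. p (tor x))"
proof (induction rule: real_polynomial_function.induct)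
 case (linear f)
 then interpret bounded_linear f .
 have v: "(\<chi> i. z i) = (\<Sum>i\<in>UNIV. z i *\<^sub>R axis i 1)" for z :: "3 => real" by (simp add: vec_eq_iff axis_def if_distrib[of "%y. _ * y"] cong: if_cong)
 have "f (tor x) = (\<Sum>i\<in>UNIV. f (axis i 1, 0) * cos (2 * pi / L * x $ i)) + (\<Sum>i\<in>UNIV. f (0, axis i 1) * sin (2 * pi / L * x $ i))" for x
 proof -
  have "tor x = (\<Sum>i\<in>UNIV. cos (2 * pi / L * x $ i) *\<^sub>R (axis i 1, 0)) + (\<Sum>i\<in>UNIV. sin (2 * pi / L * x $ i) *\<^sub>R (0, axis i 1))"
   unfolding tor_def v by (simp add: prod_eq_iff fst_sum snd_sum)
  then show ?thesis by (simp only: add sum scaleR real_scaleR_def mult.commute)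
 qed
 then show ?case by (simp only:) (intro hp_add hp_sum hp_scale hp_cos_sin)
qed (auto intro: hp_const hp_add hp_mult)

lemma tor_inj:
 assumes "tor x = tor y" "!!i. 0 <= x $ i & x $ i < L" "!!i. 0 <= y $ i & y $ i < L"
 shows "x = y"
proof (rule vec_eq_iff[THEN iffD2], rule allI)
 fix i
 have "sin (2 * pi / L * x $ i) = sin (2 * pi / L * y $ i) & cos (2 * pi / L * x $ i) = cos (2 * pi / L * y $ i)"
  using assms(1) by (auto simp: tor_def vec_eq_iff)
 then obtain n :: int where "2 * pi / L * x $ i = 2 * pi / L * y $ i + 2 * of_int n * pi" unfolding sin_cos_eq_iff by auto
 then have "2 * pi / L * (x $ i - y $ i - L * of_int n) = 0" using L_pos by (simp add: field_simps)
 then have e: "x $ i - y $ i = L * of_int n" using L_pos by simp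
 have "abs (L * of_int n) < L * 1" unfolding e[symmetric] using assms(2)[of i] assms(3)[of i] by linarith
 then have "abs (real_of_int n) < 1" using L_pos by (simp add: abs_mult)
 then have "n = 0" by linarith
 with e show "x $ i = y $ i" by simp
qed

lemma null_faces: "AE x in M. \<forall>i. x $ i < L"
proof -
 have h: "AE x in lebesgue. x $ i ~= L" for i :: 3
 proof -
  have "{x :: real^3. x $ i = L} \<in> null_sets lebesgue" 
  proof -
   have "negligible {x :: real^3. x \<bullet> axis i 1 = L}" by (rule negligible_standard_hyperplane) (simp add: axis_in_Basis_iff)
   then show ?thesis by (simp add: negligible_iff_null_sets inner_axis)
  qed
  from AE_not_in[OF this] show ?thesis by simp
 qed
 have "AE x in M. x $ i ~= L" for i
 proof -
  have "AE x in lebesgue. x \<in> cube L --> x $ i ~= L" using h[of i] by eventually_elim simp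
  then show ?thesis by (subst AE_restrict_space_iff) simp_all
 qed
 then have "AE x in M. \<forall>i\<in>UNIV. x $ i ~= L" by (intro AE_finite_allI) auto
 then show ?thesis using AE_space
 proof eventually_elim
  case (elim x)
  then have "x $ i ~= L" "x $ i <= L" for i by (auto simp: cube_def)
  then show ?case by (simp add: order_less_le)
 qed
qed

text \<open>The indicator of \<open>K\<close> is a decreasing limit of continuous functions of \<open>tor\<close>, away from the faces of the cube,
  which are null. Each of these functions is a uniform limit of Hartley polynomials.\<close>

lemma hartley_orthogonal_compact:
 assumes g: "integrable M g" and o: "!!k. (LINT x|M. g x * chi k x) = (0::real)"
  and K: "compact K" "!!x i. x \<in> K ==> 0 <= x $ i & x $ i < L"
 shows "(LINT x|M. g x * indicator K x) = 0"
proof (cases "K = {}")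
 case False
 have gm: "g \<in> borel_measurable M" using g by auto
 have bi: "integrable M (%x. g x * f x)" if f: "continuous_on UNIV f" for f :: "real^3 => real"
 proof -
  have "bounded (f ` cube L)" unfolding cube_cbox
   by (intro compact_imp_bounded compact_continuous_image compact_cbox continuous_on_subset[OF f]) auto
  then obtain B where B: "!!x. x \<in> cube L ==> \<bar>f x\<bar> <= B" unfolding bounded_iff by (metis image_eqI real_norm_def)
  show ?thesis
  proof (rule Bochner_Integration.integrable_bound[of _ "%x. B * g x"])
   show "(%x. g x * f x) \<in> borel_measurable M"
    by (intro borel_measurable_times gm continuous_imp_measurable_on_sets_lebesgue continuous_on_subset[OF f]) auto
   show "AE x in M. norm (g x * f x) <= norm (B * g x)"
   proof (rule AE_I2)
    fix x assume "x \<in> space M"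
    then have "abs (f x) <= abs B" using B[of x] by auto
    then show "norm (g x * f x) <= norm (B * g x)" by (simp add: abs_mult mult.commute[of "abs (g x)"] mult_right_mono)
   qed
  qed (use g in simp)
 qed
 have hp0: "(LINT x|M. g x * f x) = 0" if "hp f" for f using that
 proof induction
  case (hp_add f h)
  then show ?case using bi hp_continuous by (simp add: distrib_left)
 next
  case (hp_scale f c) then show ?case by (simp add: mult.left_commute)
 qed (rule o)
 let ?T = "tor ` K"
 have T: "compact ?T" "?T ~= {}" using K(1) False by (auto intro: compact_continuous_image tor_continuous)
 define F where "F n y = max 0 (1 - real n * infdist y ?T)" for n y
 have Fc: "continuous_on S (F n)" for n S unfolding F_def by (intro continuous_intros)
 have Ft: "continuous_on UNIV (%x. F n (tor x))" for n by (rule continuous_on_compose2[OF Fc tor_continuous]) auto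
 have F0: "(LINT x|M. g x * F n (tor x)) = 0" for n
 proof -
  have "abs (LINT x|M. g x * F n (tor x)) <= e * (LINT x|M. abs (g x))" if e: "0 < e" for e
  proof -
   have "compact (tor ` cube L)" unfolding cube_cbox by (intro compact_continuous_image tor_continuous compact_cbox)
   from Stone_Weierstrass_real_polynomial_function[OF this Fc e]
   obtain p where p: "real_polynomial_function p" "!!y. y \<in> tor ` cube L ==> \<bar>F n y - p y\<bar> < e" by metis
   have hpp: "hp (%x. p (tor x))" by (rule hp_polynomial[OF p(1)])
   have "(LINT x|M. g x * F n (tor x)) = (LINT x|M. g x * F n (tor x)) - (LINT x|M. g x * p (tor x))" using hp0[OF hpp] by simp
   also have "... = (LINT x|M. g x * F n (tor x) - g x * p (tor x))" using bi[OF Ft] bi[OF hp_continuous[OF hpp]] by simp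
   finally have "abs (LINT x|M. g x * F n (tor x)) <= (LINT x|M. abs (g x * F n (tor x) - g x * p (tor x)))" using integral_abs_bound by simp
   also have "... <= (LINT x|M. e * abs (g x))"
   proof (rule integral_mono)
    fix x assume "x \<in> space M"
    then have "abs (F n (tor x) - p (tor x)) <= e" using p(2)[of "tor x"] by auto
    then have "abs (g x) * abs (F n (tor x) - p (tor x)) <= abs (g x) * e" by (intro mult_left_mono) auto
    then show "abs (g x * F n (tor x) - g x * p (tor x)) <= e * abs (g x)" by (simp add: abs_mult[symmetric] right_diff_distrib mult.commute)
   qed (use bi[OF Ft] bi[OF hp_continuous[OF hpp]] g in auto)
   finally show ?thesis by simp
  qed
  note small = this
  show ?thesis
  proof (rule ccontr)
   assume n: "(LINT x|M. g x * F n (tor x)) ~= 0"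
   define I where "I = (LINT x|M. abs (g x))"
   have I: "0 <= I" by (simp add: I_def)
   define a where "a = abs (LINT x|M. g x * F n (tor x))"
   have a: "0 < a" using n by (simp add: a_def)
   have e: "0 < a / (2 * (I + 1))" using a I by (intro divide_pos_pos mult_pos_pos add_nonneg_pos) auto
   have "a <= a / (2 * (I + 1)) * I" using small[OF e] by (simp only: a_def I_def)
   also have "... = a * (I / (2 * (I + 1)))" by simp
   also have "... < a * 1" using a I by (intro mult_strict_left_mono) auto
   finally show False by simp
  qed
 qed
 have "(%n. LINT x|M. g x * F n (tor x)) ----> (LINT x|M. g x * indicator K x)"
 proof (rule integral_dominated_convergence[where w="%x. abs (g x)"])
  have "K \<in> sets lebesgue" using K(1) by (simp add: compact_imp_closed)
  then show "(%x. g x * indicator K x) \<in> borel_measurable M" 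
   by (intro borel_measurable_times gm measurable_restrict_space1 borel_measurable_indicator)
  show "(%x. g x * F n (tor x)) \<in> borel_measurable M" for n using bi[OF Ft] by auto
  show "AE x in M. (%n. g x * F n (tor x)) ----> g x * indicator K x" using null_faces AE_space
  proof eventually_elim
   case (elim x)
   then have x: "!!i. 0 <= x $ i & x $ i < L" by (auto simp: cube_def)
   have "(%n. F n (tor x)) ----> indicator K x"
   proof (cases "x \<in> K")
    case True
    then have "infdist (tor x) ?T = 0" by (intro infdist_zero) auto
    then show ?thesis using True by (simp add: F_def)
   next
    case False
    have "tor x \<notin> ?T" using tor_inj[OF _ x K(2)] False by blast
    then have pos: "0 < infdist (tor x) ?T"
     using infdist_pos_not_in_closed[OF compact_imp_closed[OF T(1)] T(2)] by blast
    obtain N :: nat where N: "1 / infdist (tor x) ?T < real N" using reals_Archimedean2 by blast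
    have "F n (tor x) = 0" if "N <= n" for n
    proof -
     have "1 <= real N * infdist (tor x) ?T" using N pos by (simp add: field_simps)
     also have "... <= real n * infdist (tor x) ?T" using that pos by (intro mult_right_mono) auto
     finally show ?thesis by (simp add: F_def)
    qed
    then show ?thesis using False by (intro tendsto_eventually) (auto simp: eventually_sequentially)
   qed
   then show ?case by (intro tendsto_mult tendsto_const)
  qed
  show "AE x in M. norm (g x * F n (tor x)) <= abs (g x)" for n
  proof (rule AE_I2)
   fix x
   have "abs (F n (tor x)) <= 1" unfolding F_def using infdist_nonneg[of "tor x" ?T] by (auto simp: max_def)
   from mult_left_mono[OF this abs_ge_zero[of "g x"]] show "norm (g x * F n (tor x)) <= abs (g x)" by (simp add: abs_mult)
  qed
 qed (use g in auto)
 then show ?thesis unfolding F0 by (simp add: LIMSEQ_const_iff)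
qed simp

text \<open>If \<open>g\<close> were positive on a set of positive measure, then also on a compact subset of positive measure.\<close>

lemma hartley_orthogonal_nonpos:
 assumes g: "integrable M g" and o: "!!k. (LINT x|M. g x * chi k x) = (0::real)"
 shows "AE x in M. g x <= 0"
proof -
 define Q where "Q = {x \<in> cube L. \<forall>i. x $ i < L}"
 define P where "P = {x \<in> cube L. g x > 0} \<inter> (\<Inter>i. {x. x $ i < L})"
 have gm: "g \<in> borel_measurable M" using g by auto
 have P: "P \<in> sets lebesgue"
 proof -
  have "{x \<in> space M. g x > 0} \<in> sets M" using gm by measurable
  then have "{x \<in> cube L. g x > 0} \<in> sets lebesgue" by (simp add: sets_restrict_space_iff)
  moreover have "{x :: real^3. x $ i < L} \<in> sets lebesgue" for i
   by (rule borel_open[THEN sets_completionI_sets[of _ lborel, simplified]]) (simp add: open_halfspace_component_lt_cart)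
  ultimately show ?thesis unfolding P_def by (intro sets.Int sets.finite_INT) auto
 qed
 have null: "emeasure lebesgue P <= ennreal e" if e: "0 < e" for e
 proof -
  obtain T where T: "closed T" "T \<subseteq> P" "P - T \<in> lmeasurable" "emeasure lebesgue (P - T) < ennreal e"
   using sets_lebesgue_inner_closed[OF P e] by blast
  have "bounded T" by (rule bounded_subset[OF bounded_cbox[of 0 "\<chi> i. L"]]) (use T(2) in "auto simp: P_def cube_cbox")
  then have Tc: "compact T" using T(1) compact_eq_bounded_closed by blast
  have Tl: "T \<in> sets lebesgue" using T(1) by simp
  have "(LINT x|M. g x * indicator T x) = 0"
   by (rule hartley_orthogonal_compact[OF g o Tc]) (use T(2) in "auto simp: P_def cube_def")
  moreover have gi: "integrable M (%x. g x * indicator T x)"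
  proof (rule Bochner_Integration.integrable_bound[OF g])
   show "(%x. g x * indicator T x) \<in> borel_measurable M"
    using Tl by (intro borel_measurable_times gm measurable_restrict_space1 borel_measurable_indicator)
  qed (auto intro!: AE_I2 simp: indicator_def)
  moreover have "AE x in M. 0 <= g x * indicator T x" by (rule AE_I2) (use T(2) in "auto simp: indicator_def P_def")
  ultimately have "AE x in M. g x * indicator T x = 0" using integral_nonneg_eq_0_iff_AE by blast
  then have "AE x in M. x \<notin> T" by eventually_elim (use T(2) in "auto simp: indicator_def P_def split: if_splits")
  then have "AE x in lebesgue. x \<notin> T" using T(2) by (subst (asm) AE_restrict_space_iff) (auto simp: P_def elim: eventually_mono)
  then have "T \<in> null_sets lebesgue" using Tl by (simp add: AE_iff_null_sets)
  then have "emeasure lebesgue (P - T) = emeasure lebesgue P" using P by (simp add: emeasure_Diff_null_set)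
  with T(4) show ?thesis by simp
 qed
 have "emeasure lebesgue P = 0"
  by (rule ccontr) (use null in "metis ennreal_le_epsilon add_0 le_zero_eq ennreal_zero_less_top zero_le")
 then have "AE x in lebesgue. x \<notin> P" using P by (intro AE_not_in) (auto simp: null_sets_def)
 then have "AE x in M. x \<notin> P" by (subst AE_restrict_space_iff) (auto elim: eventually_mono)
 then show ?thesis using null_faces AE_space by eventually_elim (auto simp: P_def not_less)
qed

theorem hartley_complete:
 assumes g: "integrable M g" and o: "!!k. (LINT x|M. g x * chi k x) = (0::real)"
 shows "AE x in M. g x = 0"
proof -
 have "AE x in M. - g x <= 0" by (rule hartley_orthogonal_nonpos) (use g o in auto)
 with hartley_orthogonal_nonpos[OF g o] show ?thesis by eventually_elim simp
qed

end

section \<open>Eigenfields of the Stokes operator\<close>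
definition kv :: "int^3 => real^3" where "kv k = (\<chi> i. real_of_int (k $ i))"

lemma kv_zero_iff: "kv k = 0 \<longleftrightarrow> k = 0" by (simp add: kv_def vec_eq_iff)

text \<open>The second polarisation is the cross product of the direction of \<open>n\<close> with the first.\<close>

lemma polarisation_exists:
 assumes "(n :: real^3) ~= 0"
 shows "\<exists>p q. norm p = 1 & norm q = 1 & p \<bullet> q = 0 & n \<bullet> p = 0 & n \<bullet> q = 0
   & (\<forall>x. n \<bullet> x = 0 --> x = (x \<bullet> p) *\<^sub>R p + (x \<bullet> q) *\<^sub>R q)"
proof -
 obtain y where y: "y ~= 0" "n \<bullet> y = 0"
  using orthogonal_to_vector_exists[of n] by (auto simp: orthogonal_def)
 define m where "m = n /\<^sub>R norm n"
 define p where "p = y /\<^sub>R norm y"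
 define q where "q = cross3 m p"
 have m: "norm m = 1" "m \<bullet> p = 0" using assms y by (auto simp: m_def p_def)
 have p: "norm p = 1" using y by (simp add: p_def)
 have pq: "p \<bullet> q = 0" "m \<bullet> q = 0" by (simp_all add: q_def dot_cross_self)
 have "(norm q)^2 = 1" using norm_cross[of m p] m p by (simp add: q_def)
 then have q: "norm q = 1" using norm_ge_zero[of q] by (simp add: power2_eq_1_iff)
 have nm: "n \<bullet> x = norm n * (m \<bullet> x)" for x using assms by (simp add: m_def)
 have "x = (x \<bullet> p) *\<^sub>R p + (x \<bullet> q) *\<^sub>R q" if x: "n \<bullet> x = 0" for x
 proof -
  define z where "z = x - ((x \<bullet> p) *\<^sub>R p + (x \<bullet> q) *\<^sub>R q)"
  have mx: "m \<bullet> x = 0" using x nm assms by simp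
  have pp: "p \<bullet> p = 1" "q \<bullet> q = 1" using p q by (simp_all add: dot_square_norm)
  have z: "z \<bullet> p = 0" "z \<bullet> q = 0" "z \<bullet> m = 0"
  proof -
   have qp: "q \<bullet> p = 0" "q \<bullet> m = 0" "p \<bullet> m = 0" "x \<bullet> m = 0" using pq m(2) mx by (simp_all add: inner_commute)
   show "z \<bullet> p = 0" "z \<bullet> q = 0" "z \<bullet> m = 0" using pp pq qp by (simp_all add: z_def inner_diff_left inner_add_left)
  qed
  have "cross3 z q = (z \<bullet> p) *\<^sub>R m - (z \<bullet> m) *\<^sub>R p" unfolding q_def by (rule Lagrange)
  then have "cross3 z q = 0" using z by simp
  with norm_cross[of z q] z q have "(norm z)^2 = 0" by simp
  then show ?thesis by (simp add: z_def)
 qed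
 then show ?thesis using p q pq m nm by (intro exI[of _ p] exI[of _ q]) (auto simp: nm)
qed

definition pol :: "int^3 => bool => real^3" where
 "pol k = (SOME f. norm (f True) = 1 & norm (f False) = 1 & f True \<bullet> f False = 0 & kv k \<bullet> f True = 0 & kv k \<bullet> f False = 0
   & (\<forall>x. kv k \<bullet> x = 0 --> x = (x \<bullet> f True) *\<^sub>R f True + (x \<bullet> f False) *\<^sub>R f False))"

lemma pol:
 assumes "k ~= 0"
 shows "norm (pol k b) = 1" "pol k True \<bullet> pol k False = 0" "kv k \<bullet> pol k b = 0"
  "kv k \<bullet> x = 0 ==> x = (x \<bullet> pol k True) *\<^sub>R pol k True + (x \<bullet> pol k False) *\<^sub>R pol k False"
proof -
 obtain p q where pq: "norm p = 1 & norm q = 1 & p \<bullet> q = 0 & kv k \<bullet> p = 0 & kv k \<bullet> q = 0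
   & (\<forall>x. kv k \<bullet> x = 0 --> x = (x \<bullet> p) *\<^sub>R p + (x \<bullet> q) *\<^sub>R q)"
  using polarisation_exists[of "kv k"] assms kv_zero_iff by blast
 have ex: "\<exists>f. norm (f True) = 1 & norm (f False) = 1 & f True \<bullet> f False = 0 & kv k \<bullet> f True = 0 & kv k \<bullet> f False = 0
   & (\<forall>x. kv k \<bullet> x = 0 --> x = (x \<bullet> f True) *\<^sub>R f True + (x \<bullet> f False) *\<^sub>R f False)"
  by (rule exI[of _ "%b. if b then p else q"]) (unfold if_True if_False, rule pq)
 note P = someI_ex[OF ex, folded pol_def]
 note P1 = conjunct1[OF P] conjunct1[OF conjunct2[OF P]] conjunct1[OF conjunct2[OF conjunct2[OF P]]]
  conjunct1[OF conjunct2[OF conjunct2[OF conjunct2[OF P]]]] conjunct1[OF conjunct2[OF conjunct2[OF conjunct2[OF conjunct2[OF P]]]]]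
 note P2 = conjunct2[OF conjunct2[OF conjunct2[OF conjunct2[OF conjunct2[OF P]]]]]
 show "norm (pol k b) = 1" "kv k \<bullet> pol k b = 0" using P1 by (cases b; simp)+
 show "pol k True \<bullet> pol k False = 0" by (rule P1)
 show "x = (x \<bullet> pol k True) *\<^sub>R pol k True + (x \<bullet> pol k False) *\<^sub>R pol k False" if "kv k \<bullet> x = 0" using that by (rule P2[rule_format])
qed

text \<open>A mode is a nonzero frequency together with one of two polarisations; \<open>mode\<close> enumerates them.\<close>

definition modes :: "((int^3) \<times> bool) set" where "modes = {m. fst m ~= 0}"
definition mode :: "nat => (int^3) \<times> bool" where "mode = from_nat_into modes"
definition fr :: "nat => int^3" where "fr i = fst (mode i)"
definition po :: "nat => real^3" where "po i = pol (fr i) (snd (mode i))"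

lemma mode_bij: "bij_betw mode UNIV modes"
proof -
 have "inj (%n :: nat. (axis 1 (int (Suc n)) :: int^3, True))" by (auto intro!: injI simp: axis_eq_axis)
 moreover have "range (%n :: nat. (axis 1 (int (Suc n)) :: int^3, True)) \<subseteq> modes" by (auto simp: modes_def axis_eq_0_iff)
 ultimately have "infinite modes" using infinite_super range_inj_infinite by blast
 then show ?thesis unfolding mode_def by (intro bij_betw_from_nat_into) auto
qed

lemma fr_nonzero: "fr i ~= 0"
 using bij_betwE[OF mode_bij] by (auto simp: fr_def modes_def)

lemma mode_eq: "mode i = mode j \<longleftrightarrow> i = j"
 using mode_bij by (auto simp: bij_betw_def inj_on_def)

lemma po_props: "norm (po i) = 1" "kv (fr i) \<bullet> po i = 0"
 unfolding po_def by (rule pol[OF fr_nonzero])+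

lemma po_inner: "fr i = fr j ==> po i \<bullet> po j = (if i = j then 1 else 0)"
proof -
 assume f: "fr i = fr j"
 have n: "po i \<bullet> po i = 1" using po_props(1)[of i] by (simp add: dot_square_norm)
 have "i = j \<longleftrightarrow> snd (mode i) = snd (mode j)" using f mode_eq[of i j] by (auto simp: fr_def prod_eq_iff)
 then show ?thesis
  using n f pol(2)[OF fr_nonzero[of j]] by (cases "snd (mode i)"; cases "snd (mode j)") (auto simp: po_def inner_commute)
qed

lemma finite_freq: "finite {k :: int^3. \<forall>j. abs (k $ j) <= N}"
proof (rule finite_subset)
 show "{k :: int^3. \<forall>j. abs (k $ j) <= N} \<subseteq> (%(a, b, c). vector [a, b, c]) ` ({-N..N} \<times> {-N..N} \<times> {-N..N})"
 proof
  fix k :: "int^3" assume "k \<in> {k. \<forall>j. abs (k $ j) <= N}"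
  then have "(k $ 1, k $ 2, k $ 3) \<in> {-N..N} \<times> {-N..N} \<times> {-N..N}" by (auto simp: abs_le_iff minus_le_iff)
  moreover have "k = vector [k $ 1, k $ 2, k $ 3]" by (simp add: vec_eq_iff forall_3)
  ultimately show "k \<in> (%(a, b, c). vector [a, b, c]) ` ({-N..N} \<times> {-N..N} \<times> {-N..N})" by (metis (no_types, lifting) case_prod_conv image_eqI)
 qed
qed simp

context torus
begin

definition ev :: "nat => field" where "ev i x = chi (fr i) x *\<^sub>R po i"
definition ev' :: "nat => field" where "ev' i x = chi (- fr i) x *\<^sub>R po i"
definition lm :: "nat => real" where "lm i = (\<Sum>j\<in>UNIV. (kap (fr i) j)^2)"
abbreviation lm2 :: "nat => real" where "lm2 \<equiv> %i. (lm i)^2"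
definition coef :: "field => nat => real" where "coef u i = inn u (ev i)"

lemma chi_vec_L2: "hp f ==> (%x. f x *\<^sub>R a) \<in> L2p"
 using hp_periodic by (intro L2_continuous continuous_on_scaleR hp_continuous continuous_on_const) (auto simp: periodic_def)

lemma chi_vec_inner: "inn (%x. chi k x *\<^sub>R a) (%x. chi l x *\<^sub>R b) = (if k = l then a \<bullet> b else 0)"
proof -
 have "inn (%x. chi k x *\<^sub>R a) (%x. chi l x *\<^sub>R b) = (LINT x|M. (chi k x * chi l x) * (a \<bullet> b))"
  unfolding L2_inner_def by (simp add: mult_ac)
 then show ?thesis by (simp only: integral_mult_left_zero chi_orthonormal) simp
qed

lemma ev_orthonormal: "orthonormal ev" "orthonormal ev'"
 unfolding orthonormal_def ev_def[abs_def] ev'_def[abs_def]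
 by (auto simp: chi_vec_inner po_inner intro!: chi_vec_L2 hp_chi)

lemma ev_L2: "ev i \<in> L2p" "ev' i \<in> L2p" using ev_orthonormal by (auto simp: orthonormal_def)

lemma kap_sq: "(kap k j)^2 = (2 * pi / L)^2 * (real_of_int (k $ j))^2"
 unfolding kap_def by (rule power_mult_distrib)

lemma lm_eq: "lm i = (2 * pi / L)^2 * (norm (kv (fr i)))^2"
 unfolding lm_def kap_sq sum_distrib_left[symmetric] by (simp add: kv_def norm_vec_def L2_set_def sum_nonneg)

lemma lm_lower: "lambda1 L <= lm i"
proof -
 obtain j where j: "fr i $ j ~= 0" using fr_nonzero[of i] by (auto simp: vec_eq_iff)
 have "1 <= abs (fr i $ j)" using j by linarith
 then have "1^2 <= abs (real_of_int (fr i $ j))^2" by (intro power_mono) auto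
 then have "(2 * pi / L)^2 * 1 <= (2 * pi / L)^2 * (real_of_int (fr i $ j))^2" by (intro mult_left_mono) auto
 also have "... = (kap (fr i) j)^2" by (rule kap_sq[symmetric])
 also have "... <= lm i" unfolding lm_def by (intro member_le_sum) auto
 finally show ?thesis by (simp add: lambda1_def)
qed

lemma lambda1_pos: "0 < lambda1 L" using L_pos by (simp add: lambda1_def)

lemma lm_pos: "0 < lm i" using lm_lower[of i] lambda1_pos by linarith

lemma lm_nonneg: "nonneg lm" "nonneg lm2" using lm_pos by (auto simp: nonneg_def less_imp_le)

lemma lm_at_top: "filterlim lm at_top sequentially"
 unfolding filterlim_at_top
proof
 fix Z :: real
 define N where "N = \<lceil>max 0 Z / (2 * pi / L)^2\<rceil> + 1"
 have c: "0 < (2 * pi / L)^2" using L_pos by simp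
 have "{i. lm i < Z} \<subseteq> mode -` ({k. \<forall>j. abs (k $ j) <= N} \<times> UNIV)"
 proof
  fix i assume i: "i \<in> {i. lm i < Z}"
  have "abs (fr i $ j) <= N" for j
  proof -
   have "(kap (fr i) j)^2 <= lm i" unfolding lm_def by (intro member_le_sum) auto
   then have "(2 * pi / L)^2 * (real_of_int (fr i $ j))^2 <= max 0 Z" using i by (simp add: kap_sq)
   then have "(real_of_int (fr i $ j))^2 <= max 0 Z / (2 * pi / L)^2" using c by (simp add: pos_le_divide_eq mult.commute)
   then have 1: "(fr i $ j)^2 <= \<lceil>max 0 Z / (2 * pi / L)^2\<rceil>" by (metis le_of_int_ceiling of_int_le_iff of_int_power order_trans)
   have "abs (fr i $ j) <= (fr i $ j)^2" 
    using mult_right_mono[of 1 "abs (fr i $ j)" "abs (fr i $ j)"] by (cases "fr i $ j = 0") (simp_all add: power2_eq_square)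
   then show ?thesis using 1 by (simp add: N_def)
  qed
  then show "i \<in> mode -` ({k. \<forall>j. abs (k $ j) <= N} \<times> UNIV)" by (auto simp: fr_def mem_Times_iff)
 qed
 moreover have "finite (mode -` ({k. \<forall>j. abs (k $ j) <= N} \<times> UNIV))"
  using finite_freq mode_eq by (intro finite_vimageI) (auto intro: injI)
 ultimately have "finite {i. lm i < Z}" using finite_subset by blast
 then obtain n where "!!i. i \<in> {i. lm i < Z} ==> i < n" unfolding finite_nat_set_iff_bounded by blast
 then show "\<forall>\<^sub>F i in sequentially. Z <= lm i" unfolding eventually_sequentially by (metis linorder_not_less mem_Collect_eq)
qed

section \<open>Solenoidal trigonometric polynomials\<close>

lemma vec_deriv:
 assumes "!!x. f differentiable (at (x :: real^3))"
 shows "partial j (%x. f x *\<^sub>R (a :: real^3)) x = partial j f x *\<^sub>R a"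
proof -
 have "(f has_derivative frechet_derivative f (at x)) (at x)" using assms frechet_derivative_works by blast
 from has_derivative_scaleR_left[OF this, of a]
 have "((%x. f x *\<^sub>R a) has_derivative (%h. frechet_derivative f (at x) h *\<^sub>R a)) (at x)" .
 from fun_cong[OF frechet_derivative_at[OF this, symmetric], of "axis j 1"] show ?thesis by (simp only: partial_def)
qed

lemma hp_differentiable: "hp f ==> f differentiable (at x)" using hp_partial by blast

lemma chi_vec_differentiable: "(%x. chi k x *\<^sub>R (a :: real^3)) differentiable (at x)"
 using hp_differentiable[OF hp_chi] by (intro differentiable_scaleR) auto

lemma partial_add:
 fixes f g :: field
 assumes "f differentiable (at x)" "g differentiable (at x)"
 shows "partial j (%x. f x + g x) x = partial j f x + partial j g x"
proof -
 have "((%x. f x + g x) has_derivative (%h. frechet_derivative f (at x) h + frechet_derivative g (at x) h)) (at x)"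
  using assms by (intro has_derivative_add) (auto simp: frechet_derivative_works[symmetric])
 from fun_cong[OF frechet_derivative_at[OF this, symmetric], of "axis j 1"] show ?thesis by (simp only: partial_def)
qed

lemma partial_const: "partial j (%x. c) x = 0" by (simp add: partial_def)

lemma chi_sum_differentiable: "finite K ==> (%x. \<Sum>k\<in>K. chi (s k) x *\<^sub>R (v k :: real^3)) differentiable (at x)"
 by (intro differentiable_sum) (auto intro: chi_vec_differentiable)

lemma partial_chi_sum:
 assumes "finite K"
 shows "partial j (%x. \<Sum>k\<in>K. chi (s k) x *\<^sub>R (v k :: real^3)) x = (\<Sum>k\<in>K. (kap (s k) j * chi (- s k) x) *\<^sub>R v k)"
 using assms
proof (induction K)
 case (insert k K)
 have "partial j (%x. chi (s k) x *\<^sub>R v k) x = (kap (s k) j * chi (- s k) x) *\<^sub>R v k"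
  using vec_deriv[of "chi (s k)" j "v k" x] hp_differentiable[OF hp_chi] by (simp add: chi_partial)
 then show ?case using insert partial_add[OF chi_vec_differentiable chi_sum_differentiable[OF insert(1)]] by simp
qed (simp add: partial_const)

lemma divergence_chi_sum:
 assumes "finite K"
 shows "divergence (%x. \<Sum>k\<in>K. chi (s k) x *\<^sub>R v k) x = (\<Sum>k\<in>K. 2 * pi / L * (kv (s k) \<bullet> v k) * chi (- s k) x)"
proof -
 have "divergence (%x. \<Sum>k\<in>K. chi (s k) x *\<^sub>R v k) x = (\<Sum>i\<in>UNIV. \<Sum>k\<in>K. kap (s k) i * chi (- s k) x * v k $ i)"
  unfolding divergence_def partial_chi_sum[OF assms] by simp
 also have "... = (\<Sum>k\<in>K. \<Sum>i\<in>UNIV. kap (s k) i * chi (- s k) x * v k $ i)" by (rule sum.swap)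
 also have "... = (\<Sum>k\<in>K. 2 * pi / L * (kv (s k) \<bullet> v k) * chi (- s k) x)"
  by (intro sum.cong refl) (simp add: inner_vec_def kv_def kap_def sum_distrib_left sum_distrib_right mult_ac)
 finally show ?thesis .
qed

lemma comb_ev: "comb ev c n = (%x. \<Sum>i<n. chi (fr i) x *\<^sub>R (c i *\<^sub>R po i))"
 by (auto simp: comb_def ev_def mult.commute)

lemma chi_expand: "chi k x *\<^sub>R (a :: real^3) = cos (2 * pi / L * (\<Sum>i\<in>UNIV. real_of_int (k $ i) * x $ i)) *\<^sub>R (nrm *\<^sub>R a)
   + sin (2 * pi / L * (\<Sum>i\<in>UNIV. real_of_int (k $ i) * x $ i)) *\<^sub>R (nrm *\<^sub>R a)"
proof -
 have "(n * (c + s)) *\<^sub>R a = c *\<^sub>R (n *\<^sub>R a) + s *\<^sub>R (n *\<^sub>R a)" for n c s :: real by (simp add: vec_eq_iff algebra_simps)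
 then show ?thesis unfolding chi_def ph_def .
qed

lemma comb_solenoidal: "comb ev c n \<in> St"
proof -
 have "trig_polynomial L (comb ev c n)" unfolding trig_polynomial_def
 proof (intro exI conjI)
  show "finite (fr ` {..<n})" by simp
  show "comb ev c n = (%x. \<Sum>k\<in>fr ` {..<n}. cos (2 * pi / L * (\<Sum>i\<in>UNIV. real_of_int (k $ i) * x $ i)) *\<^sub>R (nrm *\<^sub>R (\<Sum>i\<in>{i\<in>{..<n}. fr i = k}. c i *\<^sub>R po i))
   + sin (2 * pi / L * (\<Sum>i\<in>UNIV. real_of_int (k $ i) * x $ i)) *\<^sub>R (nrm *\<^sub>R (\<Sum>i\<in>{i\<in>{..<n}. fr i = k}. c i *\<^sub>R po i)))"
  proof
   fix x
   have "comb ev c n x = (\<Sum>k\<in>fr ` {..<n}. \<Sum>i\<in>{i\<in>{..<n}. fr i = k}. chi (fr i) x *\<^sub>R (c i *\<^sub>R po i))"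
    unfolding comb_ev by (rule sum.image_gen) simp
   also have "... = (\<Sum>k\<in>fr ` {..<n}. chi k x *\<^sub>R (\<Sum>i\<in>{i\<in>{..<n}. fr i = k}. c i *\<^sub>R po i))"
    by (intro sum.cong refl) (simp add: scaleR_sum_right)
   finally show "comb ev c n x = (\<Sum>k\<in>fr ` {..<n}. cos (2 * pi / L * (\<Sum>i\<in>UNIV. real_of_int (k $ i) * x $ i)) *\<^sub>R (nrm *\<^sub>R (\<Sum>i\<in>{i\<in>{..<n}. fr i = k}. c i *\<^sub>R po i))
    + sin (2 * pi / L * (\<Sum>i\<in>UNIV. real_of_int (k $ i) * x $ i)) *\<^sub>R (nrm *\<^sub>R (\<Sum>i\<in>{i\<in>{..<n}. fr i = k}. c i *\<^sub>R po i)))"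
    by (simp only: chi_expand)
  qed
 qed
 moreover have "divergence (comb ev c n) x = 0" for x
  unfolding comb_ev using divergence_chi_sum[of "{..<n}" fr "%i. c i *\<^sub>R po i" x] by (simp add: po_props)
 moreover have "zero_mean L (comb ev c n)"
 proof -
  have i: "integrable M (%x. chi (fr i) x *\<^sub>R (c i *\<^sub>R po i))" for i using hp_integrable[OF hp_chi] by (intro integrable_scaleR_left) auto
  have "(LINT x|M. comb ev c n x) = (\<Sum>i<n. LINT x|M. chi (fr i) x *\<^sub>R (c i *\<^sub>R po i))"
   unfolding comb_ev by (rule Bochner_Integration.integral_sum[OF i])
  also have "... = 0" by (rule sum.neutral) (use hp_integrable[OF hp_chi] in "simp add: chi_integral fr_nonzero")
  finally show ?thesis by (simp add: zero_mean_def)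
 qed
 ultimately show ?thesis by (simp add: solenoidal_trig_def)
qed

lemma trig_as_chi_sum:
 assumes "trig_polynomial L p"
 shows "\<exists>K v. finite K & p = (%x. \<Sum>k\<in>K. chi k x *\<^sub>R v k)"
proof -
 obtain K :: "(int^3) set" and a b where K: "finite K" and p: "p = (%x. \<Sum>k\<in>K. cos (ph k x) *\<^sub>R a k + sin (ph k x) *\<^sub>R b k)"
  using assms unfolding trig_polynomial_def ph_def by blast
 have n: "nrm ~= 0" using nrm(1) by simp
 define f where "f k = (1 / (2 * nrm)) *\<^sub>R (a k + b k)" for k
 define g where "g k = (1 / (2 * nrm)) *\<^sub>R (a k - b k)" for k
 define v where "v k = (if k \<in> K then f k else 0) + (if k \<in> uminus ` K then g (- k) else 0)" for k
 have e: "cos (ph k x) *\<^sub>R a k + sin (ph k x) *\<^sub>R b k = chi k x *\<^sub>R f k + chi (- k) x *\<^sub>R g k" for k x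
 proof -
  have "cos (ph k x) = (chi k x + chi (- k) x) / (2 * nrm)" "sin (ph k x) = (chi k x - chi (- k) x) / (2 * nrm)"
   using n by (simp_all add: chi_def field_simps)
  then show ?thesis unfolding f_def g_def using n by (simp add: vec_eq_iff add_divide_distrib diff_divide_distrib) (simp add: algebra_simps add_divide_distrib[symmetric])
 qed
 define U where "U = K \<union> uminus ` K"
 have U: "finite U" using K by (simp add: U_def)
 have "p x = (\<Sum>k\<in>U. chi k x *\<^sub>R v k)" for x
 proof -
  have "p x = (\<Sum>k\<in>K. chi k x *\<^sub>R f k) + (\<Sum>k\<in>K. chi (- k) x *\<^sub>R g k)" unfolding p e sum.distrib ..
  also have "(\<Sum>k\<in>K. chi (- k) x *\<^sub>R g k) = (\<Sum>k\<in>uminus ` K. chi k x *\<^sub>R g (- k))" by (subst sum.reindex) (auto intro: injI)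
  also have "(\<Sum>k\<in>K. chi k x *\<^sub>R f k) = (\<Sum>k\<in>U. chi k x *\<^sub>R (if k \<in> K then f k else 0))"
   by (rule sum.mono_neutral_cong_left) (use U in "auto simp: U_def")
  also have "(\<Sum>k\<in>uminus ` K. chi k x *\<^sub>R g (- k)) = (\<Sum>k\<in>U. chi k x *\<^sub>R (if k \<in> uminus ` K then g (- k) else 0))"
   by (rule sum.mono_neutral_cong_left) (use U in "auto simp: U_def")
  finally show ?thesis by (simp add: v_def scaleR_add_right sum.distrib)
 qed
 then show ?thesis using U by blast
qed

text \<open>Zero mean removes the frequency \<open>0\<close>, and vanishing divergence makes each amplitude orthogonal to its
  frequency, hence a combination of the two polarisations.\<close>

lemma solenoidal_is_comb:
 assumes p: "p \<in> St"
 shows "\<exists>c n. p = comb ev c n"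
proof -
 obtain K v where K: "finite K" and pv: "p = (%x. \<Sum>k\<in>K. chi k x *\<^sub>R v k)"
  using trig_as_chi_sum[of p] p unfolding solenoidal_trig_def by blast
 have ii: "integrable M (%x. chi k x *\<^sub>R v k)" for k using hp_integrable[OF hp_chi] by (intro integrable_scaleR_left) auto
 have v0: "v 0 = 0" if "0 \<in> K"
 proof -
  have "(LINT x|M. p x) = (\<Sum>k\<in>K. LINT x|M. chi k x *\<^sub>R v k)" unfolding pv by (rule Bochner_Integration.integral_sum[OF ii])
  also have "... = (\<Sum>k\<in>K. if k = 0 then (nrm * L ^ 3) *\<^sub>R v k else 0)"
   by (intro sum.cong refl) (use hp_integrable[OF hp_chi] in "simp add: chi_integral")
  also have "... = (nrm * L ^ 3) *\<^sub>R v 0" using K that by simp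
  finally show ?thesis using p nrm(1) L_pos by (simp add: solenoidal_trig_def zero_mean_def)
 qed
 have dv: "kv k \<bullet> v k = 0" if k: "k \<in> K" for k
 proof -
  have "(\<Sum>l\<in>K. 2 * pi / L * (kv l \<bullet> v l) * chi (- l) x) = 0" for x
   using divergence_chi_sum[OF K, of "%k. k" v x] p by (simp add: pv[symmetric] solenoidal_trig_def)
  then have "(LINT x|M. (\<Sum>l\<in>K. 2 * pi / L * (kv l \<bullet> v l) * chi (- l) x) * chi (- k) x) = 0" by simp
  moreover have "(LINT x|M. (\<Sum>l\<in>K. 2 * pi / L * (kv l \<bullet> v l) * chi (- l) x) * chi (- k) x)
   = (\<Sum>l\<in>K. LINT x|M. 2 * pi / L * (kv l \<bullet> v l) * (chi (- l) x * chi (- k) x))"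
  proof -
   have "integrable M (%x. 2 * pi / L * (kv l \<bullet> v l) * (chi (- l) x * chi (- k) x))" for l
    by (rule hp_integrable[OF hp_scale[OF hp_mult[OF hp_chi hp_chi]]])
   then show ?thesis by (subst Bochner_Integration.integral_sum[symmetric]) (auto simp: sum_distrib_right mult.assoc)
  qed
  moreover have "... = (\<Sum>l\<in>K. if l = k then 2 * pi / L * (kv l \<bullet> v l) else 0)"
   by (intro sum.cong refl) (simp add: chi_orthonormal)
  ultimately show ?thesis using K k L_pos by simp
 qed
 define K' where "K' = K - {0}"
 have K': "finite K'" "0 \<notin> K'" using K by (auto simp: K'_def)
 define J where "J = mode -` (K' \<times> UNIV)"
 have J: "finite J" unfolding J_def using K' mode_eq by (intro finite_vimageI) (auto intro: injI)
 then obtain n where n: "J \<subseteq> {..<n}" using finite_nat_iff_bounded by blast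
 define c where "c i = (if i \<in> J then v (fr i) \<bullet> po i else 0)" for i
 have "p x = comb ev c n x" for x
 proof -
  have "p x = (\<Sum>k\<in>K'. chi k x *\<^sub>R v k)"
   unfolding pv K'_def by (rule sum.mono_neutral_right) (use K v0 in auto)
  also have "... = (\<Sum>k\<in>K'. \<Sum>b\<in>UNIV. chi k x *\<^sub>R ((v k \<bullet> pol k b) *\<^sub>R pol k b))"
  proof (rule sum.cong[OF refl])
   fix k assume k: "k \<in> K'"
   then have "v k = (v k \<bullet> pol k True) *\<^sub>R pol k True + (v k \<bullet> pol k False) *\<^sub>R pol k False"
    using pol(4)[of k "v k"] dv by (auto simp: K'_def)
   from arg_cong[OF this, of "%y. chi k x *\<^sub>R y"] show "chi k x *\<^sub>R v k = (\<Sum>b\<in>UNIV. chi k x *\<^sub>R ((v k \<bullet> pol k b) *\<^sub>R pol k b))"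
    by (simp only: UNIV_bool scaleR_add_right) (simp add: add.commute)
  qed
  also have "... = (\<Sum>(k, b)\<in>K' \<times> UNIV. chi k x *\<^sub>R ((v k \<bullet> pol k b) *\<^sub>R pol k b))" using K' by (simp add: sum.cartesian_product)
  also have "... = (\<Sum>i\<in>J. chi (fr i) x *\<^sub>R ((v (fr i) \<bullet> po i) *\<^sub>R po i))"
  proof (rule sum.reindex_bij_betw[symmetric, THEN trans])
   have "inj_on mode J" by (rule inj_onI) (simp add: mode_eq)
   moreover have "K' \<times> UNIV \<subseteq> range mode" using bij_betw_imp_surj_on[OF mode_bij] K' by (auto simp: modes_def)
   ultimately show "bij_betw mode J (K' \<times> UNIV)" unfolding bij_betw_def J_def image_vimage_eq by blast
  qed (simp add: case_prod_beta fr_def po_def)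
  also have "... = comb ev c n x" unfolding comb_ev
   by (rule sum.mono_neutral_cong_left) (use n in "auto simp: c_def")
  finally show ?thesis .
 qed
 then show ?thesis by blast
qed

section \<open>The space H and the projector\<close>

text \<open>Partial sums of the expansion are the best approximations, so an approximation by any
  solenoidal polynomials forces the expansion to converge.\<close>

lemma H_iff: "u \<in> Hs \<longleftrightarrow> expands ev (coef u) u"
proof
 assume u: "u \<in> Hs"
 then have u2: "u \<in> L2p" by (simp add: H_space_def)
 note e = ev_orthonormal(1)
 have dec: "nrm2 (%x. u x - comb ev (coef u) n x) <= nrm2 (%x. u x - comb ev c m x)" if mn: "m <= n" for c m n
 proof -
  have "(nrm2 (%x. u x - comb ev (coef u) n x))^2 = (nrm2 u)^2 - (\<Sum>i<n. (coef u i)^2)"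
   using bessel_identity[OF e u2, of "coef u" n] by (simp add: coef_def)
  also have "... <= (nrm2 u)^2 - (\<Sum>i<m. (coef u i)^2)" using mn by (intro diff_left_mono sum_mono2) auto
  also have "... <= (nrm2 (%x. u x - comb ev c m x))^2"
   using bessel_identity[OF e u2, of c m] sum_nonneg[of "{..<m}" "%i. (coef u i - c i)^2"] by (simp add: coef_def)
  finally show ?thesis by (rule power2_le_imp_le) simp
 qed
 show "expands ev (coef u) u" unfolding expands_def
 proof
  show "(%n. nrm2 (%x. u x - comb ev (coef u) n x)) ----> 0"
  proof (rule LIMSEQ_I)
   fix r :: real assume "0 < r"
   then obtain p where p: "p \<in> St" "nrm2 (%x. u x - p x) < r" using u unfolding H_space_def by blast
   obtain c m where "p = comb ev c m" using solenoidal_is_comb[OF p(1)] by blast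
   then have "norm (nrm2 (%x. u x - comb ev (coef u) n x) - 0) < r" if "m <= n" for n
    using dec[OF that, of c] p(2) by simp
   then show "\<exists>no. \<forall>n\<ge>no. norm (nrm2 (%x. u x - comb ev (coef u) n x) - 0) < r" by blast
  qed
 qed (rule u2)
next
 assume x: "expands ev (coef u) u"
 have "\<exists>p\<in>St. nrm2 (%x. u x - p x) < eps" if "0 < eps" for eps
 proof -
  have "\<forall>\<^sub>F n in sequentially. nrm2 (%x. u x - comb ev (coef u) n x) < eps"
   using x that by (intro order_tendstoD(2)) (auto simp: expands_def)
  then obtain n where "nrm2 (%x. u x - comb ev (coef u) n x) < eps" by (auto simp: eventually_sequentially)
  then show ?thesis using comb_solenoidal by blast
 qed
 then show "u \<in> Hs" using x by (simp add: H_space_def expands_def)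
qed

lemma H_L2: "u \<in> Hs ==> u \<in> L2p" by (simp add: H_space_def)

lemma expands_H: "expands ev c u ==> u \<in> Hs & coef u = c"
 using expands_coeff[OF ev_orthonormal(1)] H_iff by (metis coef_def ext)

lemma H_exists: "wfin one c ==> \<exists>u. u \<in> Hs & coef u = c"
 using riesz_fischer[OF ev_orthonormal(1)] expands_H by blast

lemma H_parseval: assumes "u \<in> Hs"
 shows "wfin one (coef u)" "nrm2 u = wnorm one (coef u)"
proof -
 note x = assms[unfolded H_iff]
 show f: "wfin one (coef u)" by (rule expands_parseval(1)[OF ev_orthonormal(1) x])
 have "(nrm2 u)^2 = (wnorm one (coef u))^2"
  unfolding expands_parseval(2)[OF ev_orthonormal(1) x] wnorm_sq[OF nonneg_one f] ..
 then show "nrm2 u = wnorm one (coef u)" using wnorm_nonneg[OF nonneg_one f] by (simp add: power2_eq_iff_nonneg)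
qed

lemma H_inner: assumes "u \<in> Hs" "w \<in> L2p" shows "inn u w = ip (coef u) (coef w)"
 using expands_inner[OF ev_orthonormal(1) assms(1)[unfolded H_iff] assms(2)] by (simp add: ip_def coef_def sums_iff)

lemma coef_wfin: "u \<in> L2p ==> wfin one (coef u)"
 unfolding coef_def by (rule bessel(1)[OF ev_orthonormal(1)])

lemma coef_add: "u \<in> L2p ==> v \<in> L2p ==> coef (%x. u x + v x) = (%i. coef u i + coef v i)"
 by (auto simp: coef_def L2_inner_add ev_L2)
lemma coef_diff: "u \<in> L2p ==> v \<in> L2p ==> coef (%x. u x - v x) = (%i. coef u i - coef v i)"
 by (auto simp: coef_def L2_inner_diff ev_L2)
lemma coef_scale: "coef (%x. c *\<^sub>R u x) = (%i. c * coef u i)"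
 by (auto simp: coef_def L2_inner_scale)
lemma coef_cong: "ae_eq L u v ==> u \<in> L2p ==> v \<in> L2p ==> coef u = coef v"
 unfolding coef_def using L2_inner_ae_cong[OF _ _ _ ev_L2(1)] by blast

lemma expands_add: assumes "orthonormal e" "expands e c u" "expands e d v"
 shows "expands e (%i. c i + d i) (%x. u x + v x)"
 unfolding expands_def
proof
 have u: "u \<in> L2p" "v \<in> L2p" using assms by (auto simp: expands_def)
 then show "(%x. u x + v x) \<in> L2p" by (rule L2_add)
 have "(%x. (u x + v x) - comb e (%i. c i + d i) n x) = (%x. (u x - comb e c n x) + (v x - comb e d n x))" for n
  by (auto simp: comb_def sum.distrib scaleR_add_left)
 then have le: "nrm2 (%x. (u x + v x) - comb e (%i. c i + d i) n x) <= nrm2 (%x. u x - comb e c n x) + nrm2 (%x. v x - comb e d n x)" for n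
  using L2_norm_triangle[OF L2_diff[OF u(1) comb_L2] L2_diff[OF u(2) comb_L2]] assms(1) by simp
 have lim: "(%n. nrm2 (%x. u x - comb e c n x) + nrm2 (%x. v x - comb e d n x)) ----> 0 + 0"
  using assms by (intro tendsto_add) (auto simp: expands_def)
 show "(%n. nrm2 (%x. (u x + v x) - comb e (%i. c i + d i) n x)) ----> 0"
 proof (rule Lim_null_comparison[rotated])
  show "(%n. nrm2 (%x. u x - comb e c n x) + nrm2 (%x. v x - comb e d n x)) ----> 0" using lim by simp
  show "\<forall>\<^sub>F n in sequentially. norm (nrm2 (%x. (u x + v x) - comb e (%i. c i + d i) n x)) <= nrm2 (%x. u x - comb e c n x) + nrm2 (%x. v x - comb e d n x)"
   by (rule always_eventually) (simp only: le real_norm_def abs_of_nonneg[OF L2_norm_nonneg] simp_thms)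
 qed
qed

lemma expands_scale: assumes "expands e c u" shows "expands e (%i. k * c i) (%x. k *\<^sub>R u x)"
 unfolding expands_def
proof
 show "(%x. k *\<^sub>R u x) \<in> L2p" using assms by (auto simp: expands_def intro: L2_scale)
 have "(%x. k *\<^sub>R u x - comb e (%i. k * c i) n x) = (%x. k *\<^sub>R (u x - comb e c n x))" for n
  by (auto simp: comb_def scaleR_diff_right scaleR_sum_right)
 then show "(%n. nrm2 (%x. k *\<^sub>R u x - comb e (%i. k * c i) n x)) ----> 0"
  using assms tendsto_mult_right_zero[of "%n. nrm2 (%x. u x - comb e c n x)" sequentially "abs k"] by (simp add: L2_norm_scale expands_def)
qed

lemma H_add: "u \<in> Hs ==> v \<in> Hs ==> (%x. u x + v x) \<in> Hs"
 using expands_add[OF ev_orthonormal(1)] expands_H H_iff by blast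
lemma H_scale: "u \<in> Hs ==> (%x. k *\<^sub>R u x) \<in> Hs"
 using expands_scale expands_H H_iff by blast
lemma H_diff: "u \<in> Hs ==> v \<in> Hs ==> (%x. u x - v x) \<in> Hs"
 using H_add[of u "%x. (-1) *\<^sub>R v x"] H_scale[of v "-1"] by simp

lemma H_ae_eq: assumes "u \<in> Hs" "v \<in> Hs" shows "ae_eq L u v \<longleftrightarrow> coef u = coef v"
proof -
 have "ae_eq L u v \<longleftrightarrow> expands ev (coef u) v"
  using expands_ae_eq[OF ev_orthonormal(1)] assms H_iff H_L2 by blast
 then show ?thesis using assms expands_H H_iff by metis
qed

lemma comb_ev_H: "comb ev c n \<in> Hs" "coef (comb ev c n) = trunc n c"
proof -
 show c: "coef (comb ev c n) = trunc n c" by (auto simp: coef_def comb_inner[OF ev_orthonormal(1)] trunc_def)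
 have "comb ev (trunc n c) m = comb ev c n" if "n <= m" for m by (rule comb_trunc[OF that])
 then have "(%m. nrm2 (%x. comb ev c n x - comb ev (trunc n c) m x)) ----> 0"
  by (intro tendsto_eventually) (auto simp: eventually_sequentially L2_norm_def L2_inner_def intro!: exI[of _ n])
 then show "comb ev c n \<in> Hs" unfolding H_iff c expands_def using comb_L2[OF ev_orthonormal(1)] by simp
qed

lemma ev_H: "ev i \<in> Hs" "coef (ev i) = unit i"
proof -
 have "ev i = comb ev (unit i) (Suc i)" by (auto simp: comb_def unit_def)
 then show "ev i \<in> Hs" "coef (ev i) = unit i" using comb_ev_H[of "unit i" "Suc i"] by (auto simp: trunc_def unit_def)
qed

text \<open>The projection keeps the coefficients along the eigenfields and drops the rest.\<close>

lemma leray: assumes u: "u \<in> L2p" shows "leray L u \<in> Hs" "coef (leray L u) = coef u"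
proof -
 obtain g where g: "g \<in> Hs" "coef g = coef u" using H_exists[OF coef_wfin[OF u]] by blast
 have "inn (%x. u x - g x) v = 0" if v: "v \<in> Hs" for v
  using H_inner[OF v L2_diff[OF u H_L2[OF g(1)]]] by (simp add: L2_inner_commute[of "%x. u x - g x" v] coef_diff[OF u H_L2[OF g(1)]] g(2) ip_def)
 then have ex: "\<exists>g. g \<in> Hs & (\<forall>v\<in>Hs. inn (%x. u x - g x) v = 0)" using g(1) by blast
 note P = someI_ex[OF ex, folded leray_def]
 have l: "leray L u \<in> Hs" "!!v. v \<in> Hs ==> inn (%x. u x - leray L u x) v = 0"
  using conjunct1[OF P] bspec[OF conjunct2[OF P]] by this+
 show "leray L u \<in> Hs" by (rule l)
 have "coef u i - coef (leray L u) i = 0" for i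
  using l(2)[OF ev_H(1)[of i]] fun_cong[OF coef_diff[OF u H_L2[OF l(1)]], of i] by (simp add: coef_def)
 then show "coef (leray L u) = coef u" by (metis eq_iff_diff_eq_0 ext)
qed

end

section \<open>Weak derivatives in Fourier coefficients\<close>
context torus
begin

definition wave :: "int^3 => real^3 => field" where "wave k a x = chi k x *\<^sub>R a"

lemma wave_L2: "wave k a \<in> L2p" unfolding wave_def[abs_def] by (rule chi_vec_L2[OF hp_chi])

lemma ev_wave: "ev i = wave (fr i) (po i)" "ev' i = wave (- fr i) (po i)"
 by (auto simp: ev_def ev'_def wave_def)

lemma L2_scalar_integrable:
 assumes "u \<in> L2p" "continuous_on UNIV f" "periodic L f"
 shows "integrable M (%x. f x *\<^sub>R u x)"
proof -
 have "integrable M (%x. \<Sum>i\<in>UNIV. (u x \<bullet> (f x *\<^sub>R axis i 1)) *\<^sub>R axis i (1::real))"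
  by (intro Bochner_Integration.integrable_sum integrable_scaleR_left impI L2_inner_integrable assms(1) L2_continuous continuous_on_scaleR continuous_on_const assms(2))
   (use assms(3) in "auto simp: periodic_def")
 moreover have "(\<Sum>i\<in>UNIV. (u x \<bullet> (f x *\<^sub>R axis i 1)) *\<^sub>R axis i (1::real)) = f x *\<^sub>R u x" for x
  using basis_expansion[of "f x *\<^sub>R u x"] by (simp add: inner_axis scalar_mult_eq_scaleR)
 ultimately show ?thesis by simp
qed

lemma L2_inner_scalar:
 assumes "u \<in> L2p" "continuous_on UNIV f" "periodic L f"
 shows "inn u (%x. f x *\<^sub>R a) = (LINT x|M. f x *\<^sub>R u x) \<bullet> a"
proof -
 have "(LINT x|M. (f x *\<^sub>R u x) \<bullet> a) = (LINT x|M. f x *\<^sub>R u x) \<bullet> a"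
  by (rule integral_inner_left[OF L2_scalar_integrable[OF assms]])
 then show ?thesis unfolding L2_inner_def by simp
qed

text \<open>Trigonometric functions are admissible test functions, so they determine the Fourier coefficients of a weak derivative.\<close>

lemma weak_partial_wave:
 assumes "u \<in> L2p" "is_weak_partial L j u g"
 shows "inn g (wave k a) = - kap k j * inn u (wave (- k) a)"
proof -
 have g: "g \<in> L2p" using assms(2) by (simp add: is_weak_partial_def)
 note c = hp_continuous[OF hp_chi] chi_periodic
 have "(LINT x|M. partial j (chi k) x *\<^sub>R u x) = - (LINT x|M. chi k x *\<^sub>R g x)"
  using assms(2) hp_C_k[OF hp_chi[of k]] chi_periodic[of k] unfolding is_weak_partial_def by blast
 then have "kap k j *\<^sub>R (LINT x|M. chi (- k) x *\<^sub>R u x) = - (LINT x|M. chi k x *\<^sub>R g x)"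
  unfolding chi_partial scaleR_scaleR[symmetric] integral_scaleR_right .
 from arg_cong[OF this, of "%v. v \<bullet> a"] show ?thesis
  unfolding wave_def[abs_def] L2_inner_scalar[OF g c] L2_inner_scalar[OF assms(1) c] by simp
qed

lemma wave_complete:
 assumes g: "g \<in> L2p" and z: "!!k a. inn g (wave k a) = 0"
 shows "AE x in M. g x = 0"
proof -
 have "AE x in M. g x $ i = 0" for i
 proof (rule hartley_complete)
  have e: "g x $ i = g x \<bullet> axis i 1" for x by (simp add: inner_axis)
  show "integrable M (%x. g x $ i)" unfolding e using L2_integrable[OF g] by simp
  show "(LINT x|M. g x $ i * chi k x) = 0" for k
   using z[of k "axis i 1"] unfolding L2_inner_def wave_def by (simp add: inner_axis mult.commute)
 qed
 then have "AE x in M. \<forall>i. g x $ i = 0" by (simp add: eventually_all_finite)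
 then show ?thesis by eventually_elim (simp add: vec_eq_iff)
qed

lemma weak_partial_unique:
 assumes "u \<in> L2p" "is_weak_partial L j u g" "is_weak_partial L j u g'"
 shows "ae_eq L g g'"
proof -
 have g: "g \<in> L2p" "g' \<in> L2p" using assms by (auto simp: is_weak_partial_def)
 have "AE x in M. g x - g' x = 0"
  by (rule wave_complete[OF L2_diff[OF g]]) (simp add: L2_inner_diff[OF g wave_L2] weak_partial_wave[OF assms(1,2)] weak_partial_wave[OF assms(1,3)])
 then show ?thesis by (simp add: ae_eq_def)
qed

text \<open>The derivative of a Fourier series taken term by term is the weak derivative as soon as the differentiated series converges.\<close>

lemma weak_partial_expansion:
 assumes e: "orthonormal (%i. wave (kappa i) (p i))" "orthonormal (%i. wave (- kappa i) (p i))"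
  and u: "expands (%i. wave (kappa i) (p i)) c u"
  and g: "expands (%i. wave (- kappa i) (p i)) (%i. kap (kappa i) j * c i) g"
 shows "is_weak_partial L j u g"
 unfolding is_weak_partial_def
proof (intro conjI allI impI)
 have u2: "u \<in> L2p" and g2: "g \<in> L2p" using u g by (auto simp: expands_def)
 then show "g \<in> L2p" by simp
 fix phi assume "periodic L phi & (\<forall>n. C_k n phi)"
 then have phi: "periodic L phi" "!!n. C_k n phi" by auto
 have d: "phi differentiable (at x)" "partial j phi differentiable (at x)" for x using phi(2)[of "Suc (Suc 0)"] by auto
 have c: "continuous_on UNIV phi" "continuous_on UNIV (partial j phi)"
  using d by (auto simp: continuous_at_imp_continuous_on differentiable_imp_continuous_within)
 note pp = partial_periodic[OF phi(1), of j]
 have v: "(%x. phi x *\<^sub>R a) \<in> L2p" "(%x. partial j phi x *\<^sub>R a) \<in> L2p" for a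
  using phi(1) pp by (auto intro!: L2_continuous continuous_on_scaleR c simp: periodic_def)
 have "(LINT x|M. partial j phi x *\<^sub>R u x) \<bullet> a = (- (LINT x|M. phi x *\<^sub>R g x)) \<bullet> a" for a
 proof -
  have w: "inn (%x. f x *\<^sub>R a) (wave k b) = (a \<bullet> b) * (LINT x|M. f x * chi k x)" for f k b
   unfolding L2_inner_def wave_def integral_mult_right_zero[symmetric] by (simp add: mult_ac)
  have "c i * inn (%x. partial j phi x *\<^sub>R a) (wave (kappa i) (p i))
   = - (kap (kappa i) j * c i * inn (%x. phi x *\<^sub>R a) (wave (- kappa i) (p i)))" for i
  proof -
   have "(LINT x|M. phi x * (kap (kappa i) j * chi (- kappa i) x)) = kap (kappa i) j * (LINT x|M. phi x * chi (- kappa i) x)"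
    unfolding integral_mult_right_zero[symmetric] by (simp only: mult.left_commute)
   then show ?thesis unfolding w weak_partial_test[OF phi] by simp
  qed
  then have "(%i. - (kap (kappa i) j * c i * inn (%x. phi x *\<^sub>R a) (wave (- kappa i) (p i)))) sums inn u (%x. partial j phi x *\<^sub>R a)"
   using expands_inner[OF e(1) u v(2)[of a]] by simp
  moreover have "(%i. - (kap (kappa i) j * c i * inn (%x. phi x *\<^sub>R a) (wave (- kappa i) (p i)))) sums - inn g (%x. phi x *\<^sub>R a)"
   using expands_inner[OF e(2) g v(1)] by (rule sums_minus)
  ultimately have "inn u (%x. partial j phi x *\<^sub>R a) = - inn g (%x. phi x *\<^sub>R a)" by (rule sums_unique2)
  then show ?thesis by (simp add: L2_inner_scalar[OF u2 c(2) pp] L2_inner_scalar[OF g2 c(1) phi(1)])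
 qed
 then show "(LINT x|M. partial j phi x *\<^sub>R u x) = - (LINT x|M. phi x *\<^sub>R g x)" by (rule vector_eq_rdot[THEN iffD1, OF allI])
qed

lemma ev_weak_partial: "expands ev c u ==> expands ev' (%i. kap (fr i) j * c i) g ==> is_weak_partial L j u g"
 using weak_partial_expansion[of fr po c u j g] ev_orthonormal by (simp add: ev_wave[abs_def])

lemma ev'_weak_partial: "expands ev' c u ==> expands ev (%i. - kap (fr i) j * c i) g ==> is_weak_partial L j u g"
 using weak_partial_expansion[of "%i. - fr i" po c u j g] ev_orthonormal by (simp add: ev_wave[abs_def])

lemma weak_partialI: "is_weak_partial L j u g ==> is_weak_partial L j u (weak_partial L j u)"
 unfolding weak_partial_def by (rule someI[of "is_weak_partial L j u"])

lemma kap_le: "(kap (fr i) j)^2 <= lm i" unfolding lm_def by (intro member_le_sum) auto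

lemma wfin_mult: "wfin one (%i. k i * c i) \<longleftrightarrow> wfin (%i. (k i)^2) c" "wsq one (%i. k i * c i) = wsq (%i. (k i)^2) c"
 by (simp_all add: wfin_def wsq_def power_mult_distrib)

lemma wsq_lm:
 assumes "!!j. wfin (%i. (kap (fr i) j)^2) c"
 shows "wfin lm c" "wsq lm c = (\<Sum>j\<in>UNIV. wsq (%i. (kap (fr i) j)^2) c)"
proof -
 have e: "lm i * (c i)^2 = (\<Sum>j\<in>UNIV. (kap (fr i) j)^2 * (c i)^2)" for i by (simp add: lm_def sum_distrib_right)
 show "wfin lm c" unfolding wfin_def e by (rule summable_sum) (use assms in "simp add: wfin_def")
 show "wsq lm c = (\<Sum>j\<in>UNIV. wsq (%i. (kap (fr i) j)^2) c)"
  unfolding wsq_def e by (rule suminf_sum) (use assms in "simp add: wfin_def")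
qed

lemma wfin_kap: "wfin lm c ==> wfin (%i. (kap (fr i) j)^2) c"
 using wfin_mono(1)[of "%i. (kap (fr i) j)^2" lm c 1] lm_nonneg kap_le by (simp add: nonneg_def)

lemma H_weak_partial:
 assumes u: "u \<in> Hs" and c: "wfin lm (coef u)"
 shows "is_weak_partial L j u (weak_partial L j u)"
  "expands ev' (%i. kap (fr i) j * coef u i) (weak_partial L j u)"
proof -
 obtain g where g: "expands ev' (%i. kap (fr i) j * coef u i) g"
  using riesz_fischer[OF ev_orthonormal(2) wfin_mult(1)[THEN iffD2, OF wfin_kap[OF c]]] by blast
 have p: "is_weak_partial L j u g" by (rule ev_weak_partial[OF u[unfolded H_iff] g])
 show q: "is_weak_partial L j u (weak_partial L j u)" by (rule weak_partialI[OF p])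
 have w: "weak_partial L j u \<in> L2p" using q by (simp add: is_weak_partial_def)
 show "expands ev' (%i. kap (fr i) j * coef u i) (weak_partial L j u)"
  by (rule expands_ae_eq[OF ev_orthonormal(2) g w, THEN iffD1, OF weak_partial_unique[OF H_L2[OF u] p q]])
qed

lemma V_norm_sq_sum:
 assumes "!!j. weak_partial L j u \<in> L2p"
 shows "V_inner L u u = (\<Sum>j\<in>UNIV. (nrm2 (weak_partial L j u))^2)"
proof -
 have i: "integrable M (%x. weak_partial L j u x $ i * weak_partial L j u x $ i)" for i j
 proof (rule Bochner_Integration.integrable_bound[OF L2_perD(2)[OF assms[of j]]])
  have e: "weak_partial L j u x $ i = weak_partial L j u x \<bullet> axis i 1" for x by (simp add: inner_axis)
  show "(%x. weak_partial L j u x $ i * weak_partial L j u x $ i) \<in> borel_measurable M"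
   unfolding e using L2_perD(1)[OF assms[of j]] by (intro borel_measurable_times borel_measurable_inner) auto
  have "abs (v $ i * v $ i) <= (norm v)^2" for v :: "real^3"
   using power_mono[OF component_le_norm_cart[of v i], of 2] by (simp add: power2_eq_square)
  then show "AE x in M. norm (weak_partial L j u x $ i * weak_partial L j u x $ i) <= norm ((norm (weak_partial L j u x))^2)" by simp
 qed
 have "V_inner L u u = (\<Sum>j\<in>UNIV. \<Sum>i\<in>UNIV. LINT x|M. weak_partial L j u x $ i * weak_partial L j u x $ i)"
  unfolding V_inner_def by (rule sum.swap)
 also have "... = (\<Sum>j\<in>UNIV. (nrm2 (weak_partial L j u))^2)"
  unfolding L2_norm_sq L2_inner_def inner_vec_def using i by simp
 finally show ?thesis .
qed

lemma V_norm_coef: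
 assumes u: "u \<in> Hs" and c: "wfin lm (coef u)"
 shows "nrmV u = wnorm lm (coef u)"
proof -
 note x = H_weak_partial[OF u c]
 have "V_inner L u u = (\<Sum>j\<in>UNIV. (nrm2 (weak_partial L j u))^2)"
  by (rule V_norm_sq_sum) (use x(1) in "simp add: is_weak_partial_def")
 also have "... = wsq lm (coef u)"
  unfolding wsq_lm(2)[OF wfin_kap[OF c]] expands_parseval(2)[OF ev_orthonormal(2) x(2)] wfin_mult(2) ..
 finally show ?thesis by (simp add: V_norm_def wnorm_def)
qed

text \<open>A weak derivative in \<open>L^2\<close> has square summable coefficients by Bessel's inequality; conversely the
  differentiated series converges and is the weak derivative.\<close>

lemma V_iff: "u \<in> Vs \<longleftrightarrow> u \<in> Hs & wfin lm (coef u)"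
proof
 assume u: "u \<in> Vs"
 then have u1: "u \<in> H1_per L" and u2: "u \<in> L2p" by (auto simp: V_space_def H1_per_def)
 have "u \<in> Hs"
 proof -
  have "\<exists>p\<in>St. nrm2 (%x. u x - p x) < eps" if e: "0 < eps" for eps
  proof -
   obtain p where p: "p \<in> St" "sqrt ((nrm2 (%x. u x - p x))^2 + (nrmV (%x. u x - p x))^2) < eps"
    using u e unfolding V_space_def by blast
   have "nrm2 (%x. u x - p x) <= sqrt ((nrm2 (%x. u x - p x))^2 + (nrmV (%x. u x - p x))^2)" by (rule real_le_rsqrt) simp
   then show ?thesis using p by (intro bexI[OF _ p(1)]) (rule order.strict_trans1)
  qed
  then show ?thesis using u2 by (simp add: H_space_def)
 qed
 moreover have "wfin lm (coef u)"
 proof (rule wsq_lm(1))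
  fix j
  obtain g where g: "is_weak_partial L j u g" using u1 by (auto simp: H1_per_def)
  then have "g \<in> L2p" by (simp add: is_weak_partial_def)
  from bessel(1)[OF ev_orthonormal(2) this]
  show "wfin (%i. (kap (fr i) j)^2) (coef u)"
   unfolding ev_wave weak_partial_wave[OF u2 g] using wfin_mult(1)[of "%i. kap (fr i) j" "coef u"] by (simp add: coef_def ev_wave)
 qed
 ultimately show "u \<in> Hs & wfin lm (coef u)" by simp
next
 assume "u \<in> Hs & wfin lm (coef u)"
 then have u: "u \<in> Hs" and c: "wfin lm (coef u)" by auto
 have "u \<in> H1_per L" using H_L2[OF u] H_weak_partial(1)[OF u c] by (auto simp: H1_per_def)
 moreover have "\<exists>p\<in>St. sqrt ((nrm2 (%x. u x - p x))^2 + (nrmV (%x. u x - p x))^2) < eps" if e: "0 < eps" for eps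
 proof -
  have k: "coef (%x. u x - comb ev (coef u) n x) = (%i. coef u i - trunc n (coef u) i)" for n
   using coef_diff[OF H_L2[OF u] H_L2[OF comb_ev_H(1)]] by (simp add: comb_ev_H(2))
  have h: "(%x. u x - comb ev (coef u) n x) \<in> Hs" for n by (rule H_diff[OF u comb_ev_H(1)])
  have V: "nrmV (%x. u x - comb ev (coef u) n x) = wnorm lm (%i. coef u i - trunc n (coef u) i)" for n
   using V_norm_coef[OF h] wfin_diff(1)[OF lm_nonneg(1) c wfin_trunc] by (simp add: k)
  have "(%n. sqrt ((nrm2 (%x. u x - comb ev (coef u) n x))^2 + (nrmV (%x. u x - comb ev (coef u) n x))^2)) ----> sqrt (0^2 + 0^2)"
   unfolding V using u[unfolded H_iff expands_def] wnorm_tail_tendsto[OF c] by (intro tendsto_intros) auto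
  then have "\<forall>\<^sub>F n in sequentially. sqrt ((nrm2 (%x. u x - comb ev (coef u) n x))^2 + (nrmV (%x. u x - comb ev (coef u) n x))^2) < eps"
   by (rule order_tendstoD(2)) (use e in simp)
  then show ?thesis using comb_solenoidal by (auto simp: eventually_sequentially)
 qed
 ultimately show "u \<in> Vs" by (simp add: V_space_def)
qed

lemma V_norm_diff:
 assumes "u \<in> Vs" "v \<in> Vs"
 shows "nrmV (%x. u x - v x) = wnorm lm (%i. coef u i - coef v i)"
proof -
 have H: "u \<in> Hs" "v \<in> Hs" using assms V_iff by auto
 have k: "coef (%x. u x - v x) = (%i. coef u i - coef v i)" by (rule coef_diff[OF H_L2[OF H(1)] H_L2[OF H(2)]])
 show ?thesis using V_norm_coef[OF H_diff[OF H]] wfin_diff(1)[OF lm_nonneg(1)] assms unfolding k V_iff by blast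
qed

lemma wfin_lm_mult: "wfin one (%i. lm i * c i) \<longleftrightarrow> wfin lm2 c" "wnorm one (%i. lm i * c i) = wnorm lm2 c"
 by (simp_all add: wfin_mult wnorm_def)

lemma wfin_lm2: "wfin lm2 c ==> wfin lm c"
proof (rule wfin_mono(1)[OF lm_nonneg, of c "1 / lambda1 L"])
 show "lm i <= 1 / lambda1 L * (lm i)^2" for i
  using mult_right_mono[OF lm_lower[of i], of "lm i"] lm_pos[of i] lambda1_pos by (simp add: field_simps power2_eq_square)
qed

lemma second_partial:
 assumes u: "u \<in> Hs" and c: "wfin lm2 (coef u)"
 shows "is_weak_partial L k (weak_partial L j u) (weak_partial L k (weak_partial L j u))"
  "expands ev (%i. - kap (fr i) k * (kap (fr i) j * coef u i)) (weak_partial L k (weak_partial L j u))"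
proof -
 note x = H_weak_partial[OF u wfin_lm2[OF c], of j]
 have x2: "weak_partial L j u \<in> L2p" using x(1) by (simp add: is_weak_partial_def)
 have "(kap (fr i) k * kap (fr i) j)^2 <= 1 * (lm i)^2" for i
  unfolding power_mult_distrib power2_eq_square[of "lm i"] using lm_pos[of i] kap_le by (simp add: mult_mono)
 then have "wfin (%i. (kap (fr i) k * kap (fr i) j)^2) (coef u)"
  by (intro wfin_mono(1)[OF _ lm_nonneg(2) c, where K=1]) (auto simp: nonneg_def)
 then have "wfin one (%i. - kap (fr i) k * (kap (fr i) j * coef u i))"
  by (simp add: wfin_mult(1)[symmetric] mult.assoc) (simp add: wfin_def)
 from riesz_fischer[OF ev_orthonormal(1) this]
 obtain g where g: "expands ev (%i. - kap (fr i) k * (kap (fr i) j * coef u i)) g" by blast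
 have p: "is_weak_partial L k (weak_partial L j u) g" by (rule ev'_weak_partial[OF x(2) g])
 show q: "is_weak_partial L k (weak_partial L j u) (weak_partial L k (weak_partial L j u))" by (rule weak_partialI[OF p])
 then have w: "weak_partial L k (weak_partial L j u) \<in> L2p" by (simp add: is_weak_partial_def)
 show "expands ev (%i. - kap (fr i) k * (kap (fr i) j * coef u i)) (weak_partial L k (weak_partial L j u))"
  by (rule expands_ae_eq[OF ev_orthonormal(1) g w, THEN iffD1, OF weak_partial_unique[OF x2 p q]])
qed

lemma dom_A_iff: "u \<in> Ds \<longleftrightarrow> u \<in> Hs & wfin lm2 (coef u)"
proof
 assume u: "u \<in> Ds"
 then have uH: "u \<in> Hs" "wfin lm (coef u)" and u2: "!!j. weak_partial L j u \<in> H1_per L"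
  by (auto simp: dom_A_def V_iff H2_per_def)
 have "wfin one (%i. (kap (fr i) j)^2 * coef u i)" for j
 proof -
  note x = H_weak_partial[OF uH, of j]
  have x2: "weak_partial L j u \<in> L2p" using x(1) by (simp add: is_weak_partial_def)
  obtain g where g: "is_weak_partial L j (weak_partial L j u) g" using u2[of j] by (auto simp: H1_per_def)
  then have "g \<in> L2p" by (simp add: is_weak_partial_def)
  from bessel(1)[OF ev_orthonormal(1) this]
  have "wfin one (%i. - kap (fr i) j * inn (weak_partial L j u) (ev' i))"
   unfolding ev_wave weak_partial_wave[OF x2 g] .
  then show ?thesis unfolding expands_coeff[OF ev_orthonormal(2) x(2)]
   by (simp add: wfin_def power2_eq_square mult_ac)
 qed
 then have "wfin one (%i. (kap (fr i) 1)^2 * coef u i + (kap (fr i) 2)^2 * coef u i + (kap (fr i) 3)^2 * coef u i)"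
  by (intro wfin_add(1)[OF nonneg_one])
 then have "wfin one (%i. lm i * coef u i)" by (simp add: lm_def sum_3 distrib_right)
 then show "u \<in> Hs & wfin lm2 (coef u)" using uH(1) wfin_lm_mult(1) by blast
next
 assume "u \<in> Hs & wfin lm2 (coef u)"
 then have u: "u \<in> Hs" and c: "wfin lm2 (coef u)" by auto
 have V: "u \<in> Vs" using u wfin_lm2[OF c] V_iff by blast
 have "weak_partial L j u \<in> H1_per L" for j
  using second_partial(1)[OF u c, of _ j] H_weak_partial(1)[OF u wfin_lm2[OF c], of j]
  by (auto simp: H1_per_def is_weak_partial_def[of L j u])
 then show "u \<in> Ds" using V by (simp add: dom_A_def H2_per_def V_space_def)
qed

lemma stokes_coef:
 assumes "u \<in> Ds"
 shows "stokes L u \<in> Hs" "coef (stokes L u) = (%i. lm i * coef u i)"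
  "A_norm L u = wnorm lm2 (coef u)"
proof -
 have u: "u \<in> Hs" and c: "wfin lm2 (coef u)" using assms dom_A_iff by auto
 note x = second_partial(2)[OF u c]
 have "expands ev (%i. - kap (fr i) 1 * (kap (fr i) 1 * coef u i) + - kap (fr i) 2 * (kap (fr i) 2 * coef u i) + - kap (fr i) 3 * (kap (fr i) 3 * coef u i))
  (%x. weak_partial L 1 (weak_partial L 1 u) x + weak_partial L 2 (weak_partial L 2 u) x + weak_partial L 3 (weak_partial L 3 u) x)"
  by (intro expands_add[OF ev_orthonormal(1)] x)
 moreover have "(%x. weak_partial L 1 (weak_partial L 1 u) x + weak_partial L 2 (weak_partial L 2 u) x + weak_partial L 3 (weak_partial L 3 u) x) = laplacian L u"
  by (auto simp: laplacian_def sum_3)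
 moreover have "- kap (fr i) 1 * (kap (fr i) 1 * coef u i) + - kap (fr i) 2 * (kap (fr i) 2 * coef u i) + - kap (fr i) 3 * (kap (fr i) 3 * coef u i) = - 1 * (lm i * coef u i)" for i
  by (simp add: lm_def sum_3 power2_eq_square distrib_right mult.assoc)
 ultimately have "expands ev (%i. - 1 * (lm i * coef u i)) (laplacian L u)" by simp
 from expands_H[OF this] have l: "laplacian L u \<in> L2p" "coef (laplacian L u) = (%i. - 1 * (lm i * coef u i))"
  using H_L2 by auto
 have s: "stokes L u = (%x. (-1) *\<^sub>R leray L (laplacian L u) x)" by (auto simp: stokes_def)
 show H: "stokes L u \<in> Hs" unfolding s by (rule H_scale[OF leray(1)[OF l(1)]])
 show C: "coef (stokes L u) = (%i. lm i * coef u i)" unfolding s coef_scale leray(2)[OF l(1)] l(2) by simp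
 show "A_norm L u = wnorm lm2 (coef u)" unfolding A_norm_def H_parseval(2)[OF H] C wfin_lm_mult ..
qed

lemma dom_A_V: "u \<in> Ds ==> u \<in> Vs" by (simp add: dom_A_def)
lemma V_H: "u \<in> Vs ==> u \<in> Hs" using V_iff by blast

lemma helmholtz_coef:
 assumes "u \<in> Ds"
 shows "helmholtz L alpha u \<in> Hs" "coef (helmholtz L alpha u) = (%i. (1 + alpha^2 * lm i) * coef u i)"
proof -
 have e: "helmholtz L alpha u = (%x. u x + alpha^2 *\<^sub>R stokes L u x)" by (auto simp: helmholtz_def)
 note s = stokes_coef[OF assms] and u = V_H[OF dom_A_V[OF assms]]
 show "helmholtz L alpha u \<in> Hs" unfolding e by (intro H_add H_scale u s)
 show "coef (helmholtz L alpha u) = (%i. (1 + alpha^2 * lm i) * coef u i)"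
  unfolding e coef_add[OF H_L2[OF u] H_L2[OF H_scale[OF s(1)]]] coef_scale s(2) by (simp add: distrib_right mult.assoc)
qed

lemma V_H1_dot: assumes "u \<in> Vs" shows "u \<in> H1_dot L"
proof -
 have u: "u \<in> Hs" by (rule V_H[OF assms])
 have "(LINT x|M. u x) \<bullet> a = 0" for a
 proof -
  have w: "(%x. a) \<in> L2p" by (rule L2_continuous) (auto simp: periodic_def)
  have "coef (%x. a) i = 0" for i
  proof -
   have "coef (%x. a) i = (a \<bullet> po i) * (LINT x|M. chi (fr i) x)"
    unfolding coef_def L2_inner_def ev_def integral_mult_right_zero[symmetric] by (simp add: mult_ac)
   then show ?thesis by (simp add: chi_integral fr_nonzero)
  qed
  then have "inn u (%x. a) = 0" using H_inner[OF u w] by (simp add: ip_def)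
  then show ?thesis using L2_integrable[OF H_L2[OF u]] by (simp add: L2_inner_def)
 qed
 then have "(LINT x|M. u x) = 0" by (rule inner_eq_zero_iff[THEN iffD1])
 then show ?thesis using assms by (simp add: H1_dot_def zero_mean_def V_space_def)
qed

end

section \<open>Continuity of trilinear forms\<close>
context bounded_trilinear
begin

lemma form_continuous:
 assumes a: "wfin om1 a" "!!n. wfin om1 (a' n)" "(%n. wnorm om1 (%i. a' n i - a i)) ----> 0"
  and b: "wfin om2 b" "!!n. wfin om2 (b' n)" "(%n. wnorm om2 (%i. b' n i - b i)) ----> 0"
  and c: "wfin om3 c"
 shows "(%n. form theta (a' n) (b' n) c) ----> form theta a b c"
proof -
 define p where "p n = wnorm om1 (%i. a' n i - a i)" for n
 define q where "q n = wnorm om2 (%i. b' n i - b i)" for n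
 have le: "norm (form theta (a' n) (b' n) c - form theta a b c)
   <= C * p n * (wnorm om2 b + q n) * wnorm om3 c + C * wnorm om1 a * q n * wnorm om3 c" for n
 proof -
  have e: "form theta (a' n) (b' n) c - form theta a b c = form theta (%i. a' n i - a i) (b' n) c + form theta a (%i. b' n i - b i) c"
   by (simp add: form_diff1 form_diff2 a b c)
  have d: "wfin om1 (%i. a' n i - a i)" "wfin om2 (%i. b' n i - b i)" using a b pos wfin_diff(1) by auto
  have "abs (form theta (%i. a' n i - a i) (b' n) c) <= C * p n * wnorm om2 (b' n) * wnorm om3 c"
   unfolding p_def by (rule form_bound[OF d(1) b(2) c])
  also have "... <= C * p n * (wnorm om2 b + q n) * wnorm om3 c"
   using wnorm_triangle_sub[OF pos(2) b(2) b(1), of n] pos d c unfolding p_def q_def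
   by (intro mult_right_mono mult_left_mono mult_nonneg_nonneg wnorm_nonneg) auto
  finally have 1: "abs (form theta (%i. a' n i - a i) (b' n) c) <= C * p n * (wnorm om2 b + q n) * wnorm om3 c" .
  have 2: "abs (form theta a (%i. b' n i - b i) c) <= C * wnorm om1 a * q n * wnorm om3 c"
   unfolding q_def by (rule form_bound[OF a(1) d(2) c])
  show ?thesis unfolding e real_norm_def by (rule order_trans[OF abs_triangle_ineq add_mono[OF 1 2]])
 qed
 have "(%n. C * p n * (wnorm om2 b + q n) * wnorm om3 c + C * wnorm om1 a * q n * wnorm om3 c)
  ----> C * 0 * (wnorm om2 b + 0) * wnorm om3 c + C * wnorm om1 a * 0 * wnorm om3 c"
  using a(3) b(3) unfolding p_def q_def by (intro tendsto_intros)
 then have "(%n. C * p n * (wnorm om2 b + q n) * wnorm om3 c + C * wnorm om1 a * q n * wnorm om3 c) ----> 0" by simp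
 from Lim_null_comparison[OF always_eventually[OF allI[OF le]] this] show ?thesis by (simp add: LIM_zero_iff)
qed

end

section \<open>Summability over the lattice\<close>

definition wt :: "int => real" where "wt m = (1 + (real_of_int m)^2) powr (- (2/3))"

lemma wt_nonneg [simp]: "0 <= wt m" by (simp add: wt_def)

text \<open>One-dimensional sums with exponent \<open>4/3\<close>.\<close>

lemma wt_sum_bounded: "\<exists>Z. \<forall>N. (\<Sum>m\<in>{- int N..int N}. wt m) <= Z"
proof -
 have s: "summable (%n. real n powr (- (4/3)))" by (simp add: summable_real_powr_iff)
 define Z where "Z = (\<Sum>n. real n powr (- (4/3)))"
 have w: "wt m <= real (nat \<bar>m\<bar>) powr (- (4/3))" if "m ~= 0" for m
 proof -
  have "wt m <= ((real_of_int m)^2) powr (- (2/3))" unfolding wt_def using that by (intro powr_mono2') auto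
  also have "... = (abs (real_of_int m) powr 2) powr (- (2/3))" using that by simp
  also have "... = abs (real_of_int m) powr (- (4/3))" unfolding powr_powr by simp
  finally show ?thesis by simp
 qed
 have "(\<Sum>m\<in>{- int N..int N}. wt m) <= 1 + 2 * Z" for N
 proof -
  have pos: "(\<Sum>n=1..N. real n powr (- (4/3))) <= Z" unfolding Z_def by (rule sum_le_suminf[OF s]) auto
  have e: "{- int N..int N} = insert 0 (int ` {1..N} \<union> (%n. - int n) ` {1..N})"
  proof (intro equalityI subsetI)
   fix m assume m: "m \<in> {- int N..int N}"
   show "m \<in> insert 0 (int ` {1..N} \<union> (%n. - int n) ` {1..N})"
    using m by (cases m) (auto simp: image_iff intro!: bexI[of _ "nat \<bar>m\<bar>"])
  qed auto
  have z: "0 \<notin> int ` {1..N} \<union> (%n. - int n) ` {1..N}" and d: "int ` {1..N} \<inter> (%n. - int n) ` {1..N} = {}" by auto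
  have f: "finite (int ` {1..N})" "finite ((%n. - int n) ` {1..N})" by auto
  have "(\<Sum>m\<in>{- int N..int N}. wt m) = wt 0 + ((\<Sum>m\<in>int ` {1..N}. wt m) + (\<Sum>m\<in>(%n. - int n) ` {1..N}. wt m))"
   unfolding e sum.insert[OF finite_UnI[OF f] z] sum.union_disjoint[OF f d] ..
  also have "... = 1 + (\<Sum>n=1..N. wt (int n)) + (\<Sum>n=1..N. wt (- int n))"
   by (subst (1 2) sum.reindex) (auto simp: inj_on_def wt_def)
  also have "... <= 1 + (\<Sum>n=1..N. real n powr (- (4/3))) + (\<Sum>n=1..N. real n powr (- (4/3)))"
   using w[of "int n" for n] w[of "- int n" for n] by (intro add_mono sum_mono) (fastforce+)
  finally show ?thesis using pos by simp
 qed
 then show ?thesis by blast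
qed

text \<open>The frequencies that interact with \<open>a\<close> and \<open>b\<close> in an integral of three functions \<open>chi\<close>.\<close>

definition sums_zero :: "'a::ab_group_add => 'a => 'a set" where
 "sums_zero a b = {a - b, b - a, a + b, - (a + b)}"

lemma sums_zero_sym: "a \<in> sums_zero b c ==> b \<in> sums_zero a c" "a \<in> sums_zero b c ==> c \<in> sums_zero b a"
 unfolding sums_zero_def by (elim insertE emptyE; simp)+

lemma sums_zero_card: "finite (sums_zero a b)" "card (sums_zero a b) <= 4"
 by (auto simp: sums_zero_def card_insert_if)

context torus
begin

text \<open>In three dimensions the inverse fourth power of the length of a lattice vector is summable. It is dominated by a
  product of three one-dimensional weights, by \<open>(1 + x) (1 + y) (1 + z) <= (1 + x + y + z)^3\<close> for nonnegative numbers.\<close>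

lemma lm_summable: "\<exists>S. 0 <= S & (\<forall>n. (\<Sum>i<n. 1 / (lm i)^2) <= S)"
proof -
 obtain Z where Z: "!!N. (\<Sum>m\<in>{- int N..int N}. wt m) <= Z" using wt_sum_bounded by blast
 have Z0: "0 <= Z" using order_trans[OF wt_nonneg[of 0], of Z] Z[of 0] by simp
 define K where "K = 4 / (2 * pi / L) ^ 4"
 have K: "0 <= K" by (simp add: K_def)
 define g where "g k = wt (k $ 1) * wt (k $ 2) * wt (k $ 3)" for k :: "int^3"
 have le: "1 / (lm i)^2 <= K * g (fr i)" for i
 proof -
  define x where "x j = (real_of_int (fr i $ j))^2" for j
  define X where "X = x 1 + x 2 + x 3"
  have x0: "0 <= x j" for j by (simp add: x_def)
  have lmX: "lm i = (2 * pi / L)^2 * X" by (simp add: lm_def kap_sq sum_3 X_def x_def distrib_left)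
  have X1: "1 <= X" using lm_lower[of i] L_pos unfolding lambda1_def lmX by simp
  have "(1 + x 1) * (1 + x 2) * (1 + x 3) <= (1 + X) * (1 + X) * (1 + X)"
   using x0[of 1] x0[of 2] x0[of 3] by (intro mult_mono mult_nonneg_nonneg) (auto simp: X_def)
  also have "... = (1 + X) powr 3" using X1 by (simp add: powr_numeral power3_eq_cube)
  finally have "((1 + X) powr 3) powr (- (2/3)) <= ((1 + x 1) * (1 + x 2) * (1 + x 3)) powr (- (2/3))"
   using x0[of 1] x0[of 2] x0[of 3] by (intro powr_mono2') (auto intro!: mult_pos_pos add_pos_nonneg)
  also have "... = g (fr i)" using x0[of 1] x0[of 2] x0[of 3] by (simp add: g_def wt_def powr_mult x_def)
  finally have "(1 + X) powr (- 2) <= g (fr i)" by (simp add: powr_powr)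
  then have g: "1 / (1 + X)^2 <= g (fr i)" using X1 by (simp add: powr_minus_divide powr_numeral)
  have "(1 + X)^2 <= (2 * X)^2" using X1 by (intro power_mono) auto
  then have "(1 + X)^2 <= 4 * X^2" by (simp add: power_mult_distrib)
  then have "1 / X^2 <= 4 * (1 / (1 + X)^2)" using X1 by (simp add: field_simps)
  also have "... <= 4 * g (fr i)" using g by simp
  finally have "1 / X^2 <= 4 * g (fr i)" .
  then have "1 / (2 * pi / L) ^ 4 * (1 / X^2) <= 1 / (2 * pi / L) ^ 4 * (4 * g (fr i))" by (intro mult_left_mono) auto
  moreover have "1 / (lm i)^2 = 1 / (2 * pi / L) ^ 4 * (1 / X^2)"
  proof -
   have "(lm i)^2 = (2 * pi / L) ^ 4 * X^2" unfolding lmX power_mult_distrib power_mult[symmetric] by simp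
   then show ?thesis by simp
  qed
  ultimately show ?thesis by (simp add: K_def)
 qed
 have "(\<Sum>i<n. 1 / (lm i)^2) <= K * (2 * Z ^ 3)" for n
 proof -
  define iota where "iota i = (fr i $ 1, fr i $ 2, fr i $ 3, snd (mode i))" for i
  define G where "G = (%(a, b, c, s :: bool). wt a * (wt b * wt c))"
  have inj: "inj_on iota {..<n}"
   by (rule inj_onI) (auto simp: iota_def mode_eq[symmetric] prod_eq_iff vec_eq_iff forall_3 fr_def)
  obtain N where N: "!!i j. i < n ==> \<bar>fr i $ j\<bar> <= int N"
  proof
   fix i j assume "i < n"
   have "abs (fr i $ j) <= (\<Sum>m\<in>UNIV. abs (fr i $ m))" by (rule member_le_sum) auto
   also have "... <= (\<Sum>i<n. \<Sum>m\<in>UNIV. abs (fr i $ m))" using \<open>i < n\<close> by (intro member_le_sum) (auto intro: sum_nonneg)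
   moreover have "0 <= (\<Sum>i<n. \<Sum>m\<in>UNIV. abs (fr i $ m))" by (intro sum_nonneg) auto
   ultimately show "abs (fr i $ j) <= int (nat (\<Sum>i<n. \<Sum>m\<in>UNIV. abs (fr i $ m)))" by simp
  qed
  let ?I = "{- int N..int N}"
  have "(\<Sum>i<n. 1 / (lm i)^2) <= (\<Sum>i<n. K * g (fr i))" by (intro sum_mono le)
  also have "... = K * (\<Sum>i<n. G (iota i))" by (simp add: sum_distrib_left g_def G_def iota_def mult.assoc)
  also have "(\<Sum>i<n. G (iota i)) = (\<Sum>z\<in>iota ` {..<n}. G z)" using inj by (simp add: sum.reindex)
  also have "... <= (\<Sum>z\<in>?I \<times> ?I \<times> ?I \<times> UNIV. G z)"
  proof (rule sum_mono2)
   show "iota ` {..<n} \<subseteq> ?I \<times> ?I \<times> ?I \<times> UNIV" using N by (auto simp: iota_def abs_le_iff minus_le_iff)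
  qed (auto simp: G_def)
  also have "... = (\<Sum>a\<in>?I. \<Sum>b\<in>?I. \<Sum>c\<in>?I. \<Sum>s\<in>(UNIV :: bool set). wt a * (wt b * wt c))"
   by (simp only: sum.cartesian_product[symmetric] G_def prod.case)
  also have "... = 2 * (\<Sum>m\<in>?I. wt m) ^ 3"
   by (simp add: power3_eq_cube sum_distrib_left[symmetric] sum_distrib_right[symmetric] mult_ac)
  also have "... <= 2 * Z ^ 3" using Z[of N] by (intro mult_left_mono power_mono sum_nonneg) auto
  finally show ?thesis using K by (simp add: mult_left_mono)
 qed
 moreover have "0 <= K * (2 * Z ^ 3)" using K Z0 by simp
 ultimately show ?thesis by blast
qed

section \<open>The trilinear form on modes\<close>

definition wv :: "nat => real^3" where "wv j = (2 * pi / L) *\<^sub>R kv (fr j)"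
definition th :: "nat => nat => nat => real" where
 "th i j l = - (LINT x|M. chi (fr i) x * chi (- fr j) x * chi (fr l) x) * (cross3 (po i) (cross3 (wv j) (po j)) \<bullet> po l)"

lemma wv_norm: "norm (wv j) = sqrt (lm j)"
 using L_pos by (simp add: wv_def lm_eq real_sqrt_mult)

lemma th_antisym: "th i j l = - th l j i"
proof -
 have a: "cross3 a b \<bullet> c = - (cross3 c b \<bullet> a)" for a b c :: "real^3" by (simp add: cross3_def inner_vec_def sum_3 algebra_simps)
 have m: "(%x. chi (fr i) x * chi (- fr j) x * chi (fr l) x) = (%x. chi (fr l) x * chi (- fr j) x * chi (fr i) x)" by (simp only: mult_ac)
 show ?thesis unfolding th_def m a[of "po i" _ "po l"] by simp
qed

lemma chi3_integral:
 "abs (LINT x|M. chi k x * chi m x * chi l x) <= (if l \<in> sums_zero k m then 2 * nrm else 0)"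
proof -
 have i: "integrable M (%x. chi s x * chi l x)" for s by (rule hp_integrable[OF hp_mult[OF hp_chi hp_chi]])
 have "(LINT x|M. chi k x * chi m x * chi l x) = (LINT x|M. nrm / 2 * (chi (k - m) x * chi l x + chi (m - k) x * chi l x + chi (k + m) x * chi l x - chi (- (k + m)) x * chi l x))"
  unfolding chi_prod[where k=k and l=m] by (simp add: algebra_simps)
 also have "... = nrm / 2 * ((if k - m = l then 1 else 0) + (if m - k = l then 1 else 0) + (if k + m = l then 1 else 0) - (if - (k + m) = l then 1 else 0))"
  unfolding integral_mult_right_zero by (simp only: Bochner_Integration.integral_diff Bochner_Integration.integral_add i Bochner_Integration.integrable_add chi_orthonormal)
 finally have I: "(LINT x|M. chi k x * chi m x * chi l x) = nrm / 2 * ((if k - m = l then 1 else 0) + (if m - k = l then 1 else 0) + (if k + m = l then 1 else 0) - (if - (k + m) = l then 1 else 0))" .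
 have "abs ((if k - m = l then 1 else 0) + (if m - k = l then 1 else 0) + (if k + m = l then 1 else 0) - (if - (k + m) = l then 1 else 0))
  <= (if l \<in> sums_zero k m then 4 else (0 :: real))"
  by (auto simp: sums_zero_def simp del: minus_add_distrib split: if_splits)
 from mult_left_mono[OF this, of "nrm / 2"] show ?thesis unfolding I abs_mult using nrm(1) by (simp split: if_splits)
qed

lemma norm_cross_le: "norm (cross3 a b) <= norm a * norm b"
proof (rule power2_le_imp_le)
 show "(norm (cross3 a b))^2 <= (norm a * norm b)^2" unfolding norm_cross by (simp add: power_mult_distrib)
qed simp

lemma th_bound: "abs (th i j l) <= (if fr l \<in> sums_zero (fr i) (fr j) then 2 * nrm * sqrt (lm j) else 0)"
proof -
 have s: "sums_zero (fr i) (- fr j) = sums_zero (fr i) (fr j)" by (auto simp: sums_zero_def)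
 have "\<bar>cross3 (po i) (cross3 (wv j) (po j)) \<bullet> po l\<bar> <= norm (cross3 (po i) (cross3 (wv j) (po j))) * norm (po l)" by (rule Cauchy_Schwarz_ineq2)
 also have "... <= sqrt (lm j)"
  using norm_cross_le[of "po i" "cross3 (wv j) (po j)"] norm_cross_le[of "wv j" "po j"] by (simp add: po_props wv_norm)
 finally have v: "\<bar>cross3 (po i) (cross3 (wv j) (po j)) \<bullet> po l\<bar> <= sqrt (lm j)" .
 have "abs (th i j l) <= (if fr l \<in> sums_zero (fr i) (fr j) then 2 * nrm else 0) * sqrt (lm j)"
  unfolding th_def abs_mult abs_minus using chi3_integral[of "fr i" "- fr j" "fr l"] v nrm(1) unfolding s by (intro mult_mono) auto
 then show ?thesis by (simp split: if_splits)
qed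

lemma card_fr: "finite F ==> card F <= 4 ==> card {i\<in>{..<n}. fr i \<in> F} <= 8"
proof -
 assume F: "finite F" "card F <= 4"
 have "card {i\<in>{..<n}. fr i \<in> F} = card (mode ` {i\<in>{..<n}. fr i \<in> F})" by (rule card_image[symmetric]) (auto simp: inj_on_def mode_eq)
 also have "... <= card (F \<times> (UNIV :: bool set))" by (rule card_mono) (use F in "auto simp: fr_def mem_Times_iff simp del: split_paired_All intro!: image_subsetI")
 also have "... <= 8" using F by (simp add: card_cartesian_product)
 finally show ?thesis .
qed

lemma sum_related:
 fixes f :: real assumes "0 <= f"
 shows "(\<Sum>i<n. if fr i \<in> sums_zero a b then f else 0) <= 8 * f"
proof -
 have "(\<Sum>i<n. if fr i \<in> sums_zero a b then f else 0) = (\<Sum>i\<in>{i\<in>{..<n}. fr i \<in> sums_zero a b}. f)"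
  by (rule sum.mono_neutral_cong_right) auto
 also have "... = real (card {i\<in>{..<n}. fr i \<in> sums_zero a b}) * f" by simp
 also have "... <= real 8 * f" using card_fr[OF sums_zero_card] assms by (intro mult_right_mono of_nat_mono) auto
 finally show ?thesis by simp
qed

lemma lm_related:
 assumes "fr l \<in> sums_zero (fr i) (fr j)" shows "sqrt (lm j) <= sqrt (lm i) + sqrt (lm l)"
proof -
 have k: "kv (a - b) = kv a - kv b" "kv (a + b) = kv a + kv b" "kv (- a) = - kv a" for a b by (auto simp: kv_def vec_eq_iff)
 have "fr j \<in> sums_zero (fr i) (fr l)" using sums_zero_sym(2)[OF assms] .
 then have "norm (kv (fr j)) <= norm (kv (fr i)) + norm (kv (fr l))"
  unfolding sums_zero_def by (elim insertE emptyE)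
   (simp_all only: k norm_minus_cancel norm_triangle_ineq4 norm_triangle_ineq norm_minus_commute[of "kv (fr l)" "kv (fr i)"])
 then have "2 * pi / L * norm (kv (fr j)) <= 2 * pi / L * (norm (kv (fr i)) + norm (kv (fr l)))" using L_pos by (intro mult_left_mono) auto
 moreover have "sqrt (lm s) = 2 * pi / L * norm (kv (fr s))" for s using L_pos by (simp add: lm_eq real_sqrt_mult)
 ultimately show ?thesis by (simp add: distrib_left)
qed

text \<open>Only triples of related frequencies contribute, and two of the frequencies determine the third up to
  eight modes. The frequency of the middle factor, which carries the derivative, is at most the sum of the
  other two. After the Cauchy-Schwarz inequality over related triples, the remaining weights are summable by \<open>lm_summable\<close>.\<close>

lemma tri_sq_bound:
 assumes S: "0 <= S" "!!n. (\<Sum>i<n. 1 / (lm i)^2) <= S"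
 shows "(tri th n a b c)^2 <= (2 * nrm)^2 * ((8 * (\<Sum>i<n. lm i * (a i)^2) * (\<Sum>l<n. (lm l)^2 * (c l)^2)) * (32 * S * (\<Sum>j<n. (b j)^2)))"
proof -
 define I where "I = {..<n} \<times> {..<n} \<times> {..<n}"
 define ch where "ch i j l = (if fr l \<in> sums_zero (fr i) (fr j) then 1 else 0 :: real)" for i j l
 have ch: "ch i j l = (if fr j \<in> sums_zero (fr i) (fr l) then 1 else 0)" "ch i j l = (if fr i \<in> sums_zero (fr l) (fr j) then 1 else 0)"
  "ch i j l * ch i j l = ch i j l" "0 <= ch i j l" for i j l
 proof -
  have e1: "fr j \<in> sums_zero (fr i) (fr l) \<longleftrightarrow> fr l \<in> sums_zero (fr i) (fr j)" by (rule iffI) (rule sums_zero_sym(2), assumption)+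
  have e2: "fr i \<in> sums_zero (fr l) (fr j) \<longleftrightarrow> fr l \<in> sums_zero (fr i) (fr j)" by (rule iffI) (rule sums_zero_sym(1), assumption)+
  show "ch i j l = (if fr j \<in> sums_zero (fr i) (fr l) then 1 else 0)" "ch i j l = (if fr i \<in> sums_zero (fr l) (fr j) then 1 else 0)"
   unfolding ch_def e1 e2 by (rule refl)+
 qed (simp_all add: ch_def)
 define x where "x i = sqrt (lm i)" for i
 have x0: "0 < x i" and x2: "(x i)^2 = lm i" for i using lm_pos[of i] by (simp_all add: x_def)
 define A where "A i = x i * abs (a i)" for i
 define D where "D l = (x l)^2 * abs (c l)" for l
 define om where "om i l = (x i + x l) / (x i * (x l)^2)" for i l
 define f where "f = (%(i, j, l). ch i j l * (A i * D l))"
 define g where "g = (%(i, j, l). ch i j l * (abs (b j) * om i l))"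
 have "abs (tri th n a b c) <= (\<Sum>i<n. \<Sum>j<n. \<Sum>l<n. 2 * nrm * (f (i, j, l) * g (i, j, l)))"
 proof -
  have t: "abs (a i * b j * c l * th i j l) <= 2 * nrm * (f (i, j, l) * g (i, j, l))" for i j l
  proof (cases "fr l \<in> sums_zero (fr i) (fr j)")
   case True
   have "abs (a i * b j * c l * th i j l) <= abs (a i * b j * c l) * (2 * nrm * (x i + x l))"
   proof -
    have "abs (th i j l) <= 2 * nrm * sqrt (lm j)" using th_bound[of i j l] True by simp
    also have "... <= 2 * nrm * (x i + x l)" using lm_related[OF True] nrm(1) unfolding x_def by (intro mult_left_mono) auto
    finally show ?thesis unfolding abs_mult[of "a i * b j * c l"] by (intro mult_left_mono) auto
   qed
   also have "... = 2 * nrm * (f (i, j, l) * g (i, j, l))"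
    using True x0[of i] x0[of l] by (simp add: f_def g_def ch_def A_def D_def om_def abs_mult power2_eq_square)
   finally show ?thesis .
  next
   case False then show ?thesis using th_bound[of i j l] by (simp add: f_def ch_def)
  qed
  show ?thesis unfolding tri_def by (intro order_trans[OF sum_abs] sum_mono t)
 qed
 also have "... = 2 * nrm * (\<Sum>z\<in>I. f z * g z)"
  unfolding I_def sum_distrib_left by (simp add: sum.cartesian_product case_prod_beta)
 finally have 1: "abs (tri th n a b c) <= 2 * nrm * (\<Sum>z\<in>I. f z * g z)" .
 have "(tri th n a b c)^2 <= (2 * nrm * (\<Sum>z\<in>I. f z * g z))^2" using power_mono[OF 1, of 2] by simp
 also have "... = (2 * nrm)^2 * (\<Sum>z\<in>I. f z * g z)^2" by (rule power_mult_distrib)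
 also have "... <= (2 * nrm)^2 * ((\<Sum>z\<in>I. (f z)^2) * (\<Sum>z\<in>I. (g z)^2))"
  by (intro mult_left_mono Cauchy_Schwarz_ineq_sum) auto
 also have "... <= (2 * nrm)^2 * ((8 * (\<Sum>i<n. lm i * (a i)^2) * (\<Sum>l<n. (lm l)^2 * (c l)^2)) * (32 * S * (\<Sum>j<n. (b j)^2)))"
 proof (intro mult_left_mono mult_mono)
  have I3: "(\<Sum>z\<in>I. h z) = (\<Sum>i<n. \<Sum>j<n. \<Sum>l<n. h (i, j, l))" for h :: "_ => real"
   unfolding I_def by (simp add: sum.cartesian_product case_prod_beta)
  have "(\<Sum>z\<in>I. (f z)^2) = (\<Sum>i<n. \<Sum>j<n. \<Sum>l<n. ch i j l * ((A i)^2 * (D l)^2))"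
   unfolding I3 f_def by (simp add: power_mult_distrib power2_eq_square[of "ch _ _ _"] ch(3))
  also have "... = (\<Sum>i<n. \<Sum>l<n. \<Sum>j<n. ch i j l * ((A i)^2 * (D l)^2))" by (intro sum.cong refl sum.swap)
  also have "... <= (\<Sum>i<n. \<Sum>l<n. 8 * ((A i)^2 * (D l)^2))"
  proof (intro sum_mono)
   fix i l
   show "(\<Sum>j<n. ch i j l * ((A i)^2 * (D l)^2)) <= 8 * ((A i)^2 * (D l)^2)"
    using sum_related[of "(A i)^2 * (D l)^2" "fr i" "fr l" n] by (simp add: ch(1) if_distrib[of "%t. t * _"] cong: if_cong)
  qed
  also have "... = 8 * (\<Sum>i<n. (A i)^2) * (\<Sum>l<n. (D l)^2)" unfolding mult.assoc[of 8] unfolding sum_product by (simp only: sum_distrib_left)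
  also have "... = 8 * (\<Sum>i<n. lm i * (a i)^2) * (\<Sum>l<n. (lm l)^2 * (c l)^2)" by (simp add: A_def D_def power_mult_distrib x2)
  finally show "(\<Sum>z\<in>I. (f z)^2) <= 8 * (\<Sum>i<n. lm i * (a i)^2) * (\<Sum>l<n. (lm l)^2 * (c l)^2)" .
  define s where "s i = 1 / (lm i)^2" for i
  have s0: "0 <= s i" for i by (simp add: s_def)
  have om: "(om i l)^2 <= 3 * s l + s i" for i l
  proof -
   define p where "p = 1 / x i" define q where "q = 1 / x l"
   have w: "om i l = q^2 + p * q" using x0[of i] x0[of l] by (simp add: om_def p_def q_def field_simps power2_eq_square)
   have "s i = p ^ 4" "s l = q ^ 4" unfolding s_def p_def q_def x2[symmetric] by (simp_all add: power_divide)
   moreover have "(q^2 + p * q)^2 <= 3 * q ^ 4 + p ^ 4"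
   proof -
    have "0 <= (q^2 - p * q)^2 + (p^2 - q^2)^2" by simp
    then show ?thesis by (simp add: power2_eq_square power4_eq_xxxx algebra_simps)
   qed
   ultimately show ?thesis unfolding w by simp
  qed
  have "(\<Sum>z\<in>I. (g z)^2) = (\<Sum>i<n. \<Sum>j<n. \<Sum>l<n. ch i j l * ((b j)^2 * (om i l)^2))"
   unfolding I3 g_def by (simp add: power_mult_distrib power2_eq_square[of "ch _ _ _"] ch(3))
  also have "... <= (\<Sum>i<n. \<Sum>j<n. \<Sum>l<n. ch i j l * ((b j)^2 * (3 * s l)) + ch i j l * ((b j)^2 * s i))"
  proof (intro sum_mono)
   fix i j l
   have "ch i j l * ((b j)^2 * (om i l)^2) <= ch i j l * ((b j)^2 * (3 * s l + s i))" by (intro mult_left_mono om ch(4)) auto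
   then show "ch i j l * ((b j)^2 * (om i l)^2) <= ch i j l * ((b j)^2 * (3 * s l)) + ch i j l * ((b j)^2 * s i)" by (simp add: distrib_left)
  qed
  also have "... = (\<Sum>i<n. \<Sum>j<n. \<Sum>l<n. ch i j l * ((b j)^2 * (3 * s l))) + (\<Sum>i<n. \<Sum>j<n. \<Sum>l<n. ch i j l * ((b j)^2 * s i))"
   by (simp add: sum.distrib)
  also have "(\<Sum>i<n. \<Sum>j<n. \<Sum>l<n. ch i j l * ((b j)^2 * (3 * s l))) = (\<Sum>j<n. \<Sum>l<n. \<Sum>i<n. ch i j l * ((b j)^2 * (3 * s l)))"
   by (subst sum.swap) (intro sum.cong refl sum.swap)
  also have "... <= (\<Sum>j<n. \<Sum>l<n. 8 * ((b j)^2 * (3 * s l)))"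
  proof (intro sum_mono)
   fix j l
   show "(\<Sum>i<n. ch i j l * ((b j)^2 * (3 * s l))) <= 8 * ((b j)^2 * (3 * s l))"
    using sum_related[of "(b j)^2 * (3 * s l)" "fr l" "fr j" n] s0[of l] by (simp add: ch(2) if_distrib[of "%t. t * _"] cong: if_cong)
  qed
  also have "... = 24 * ((\<Sum>j<n. (b j)^2) * (\<Sum>l<n. s l))" unfolding sum_product unfolding sum_distrib_left by (intro sum.cong refl) simp
  also have "(\<Sum>i<n. \<Sum>j<n. \<Sum>l<n. ch i j l * ((b j)^2 * s i)) <= (\<Sum>i<n. \<Sum>j<n. 8 * ((b j)^2 * s i))"
  proof (intro sum_mono)
   fix i j
   show "(\<Sum>l<n. ch i j l * ((b j)^2 * s i)) <= 8 * ((b j)^2 * s i)"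
    using sum_related[of "(b j)^2 * s i" "fr i" "fr j" n] s0[of i] by (simp add: ch_def if_distrib[of "%t. t * _"] cong: if_cong)
  qed
  also have "... = 8 * ((\<Sum>j<n. (b j)^2) * (\<Sum>l<n. s l))" unfolding sum_product unfolding sum_distrib_left by (rule sum.swap)
  finally have "(\<Sum>z\<in>I. (g z)^2) <= 32 * ((\<Sum>j<n. (b j)^2) * (\<Sum>l<n. s l))" by (simp add: mult.commute)
  also have "... <= 32 * ((\<Sum>j<n. (b j)^2) * S)" using S(2)[of n] unfolding s_def by (intro mult_left_mono sum_nonneg) auto
  finally show "(\<Sum>z\<in>I. (g z)^2) <= 32 * S * (\<Sum>j<n. (b j)^2)" by (simp add: mult_ac)
 qed (auto intro!: sum_nonneg mult_nonneg_nonneg simp: less_imp_le[OF lm_pos])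
 finally show ?thesis .
qed

lemma th_trilinear: "\<exists>C. bounded_trilinear th lm one lm2 C & bounded_trilinear th lm2 one lm C"
proof -
 obtain S where S: "0 <= S" "!!n. (\<Sum>i<n. 1 / (lm i)^2) <= S" using lm_summable by blast
 define C where "C = 2 * nrm * sqrt (256 * S)"
 have C: "0 <= C" using nrm(1) S by (simp add: C_def)
 have b: "abs (tri th n a b c) <= C * wnorm lm (trunc n a) * wnorm one (trunc n b) * wnorm lm2 (trunc n c)" for n a b c
 proof -
  have sq: "sqrt ((2 * nrm)^2) = 2 * nrm" using nrm(1) by (simp only: real_sqrt_abs)
  have "(tri th n a b c)^2 <= (2 * nrm)^2 * ((8 * (\<Sum>i<n. lm i * (a i)^2) * (\<Sum>l<n. (lm l)^2 * (c l)^2)) * (32 * S * (\<Sum>j<n. (b j)^2)))"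
   by (rule tri_sq_bound[OF S])
  then have "abs (tri th n a b c) <= sqrt ((2 * nrm)^2 * ((8 * (\<Sum>i<n. lm i * (a i)^2) * (\<Sum>l<n. (lm l)^2 * (c l)^2)) * (32 * S * (\<Sum>j<n. (b j)^2))))"
   by (intro real_le_rsqrt) simp
  also have "... = sqrt ((2 * nrm)^2 * (256 * S) * (\<Sum>i<n. lm i * (a i)^2) * (\<Sum>j<n. (b j)^2) * (\<Sum>l<n. (lm l)^2 * (c l)^2))"
   by (rule arg_cong[of _ _ sqrt]) simp
  also have "... = C * wnorm lm (trunc n a) * wnorm one (trunc n b) * wnorm lm2 (trunc n c)"
   unfolding C_def wnorm_def wsq_trunc real_sqrt_mult sq by simp
  finally show ?thesis .
 qed
 have swap: "tri th n a b c = - tri th n c b a" for n a b c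
 proof -
  have "tri th n a b c = (\<Sum>l<n. \<Sum>j<n. \<Sum>i<n. a i * b j * c l * th i j l)"
   unfolding tri_def by (subst sum.swap, subst (2) sum.swap, subst sum.swap) (rule refl)
  also have "... = - tri th n c b a" unfolding tri_def sum_negf[symmetric]
   by (intro sum.cong refl) (subst th_antisym, simp add: mult_ac)
  finally show ?thesis .
 qed
 have b': "abs (tri th n a b c) <= C * wnorm lm2 (trunc n a) * wnorm one (trunc n b) * wnorm lm (trunc n c)" for n a b c
  using b[of n c b a] swap[of n a b c] by (simp add: mult_ac)
 show ?thesis by (rule exI[of _ C]) (auto simp: bounded_trilinear_def C lm_nonneg b b')
qed

section \<open>The bilinear operator\<close>

lemma curl_comb: "curl (comb ev b n) x = (\<Sum>j<n. chi (- fr j) x *\<^sub>R (b j *\<^sub>R cross3 (wv j) (po j)))"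
proof -
 have w: "wv j $ m = kap (fr j) m" for j m by (simp add: wv_def kv_def kap_def)
 have p: "partial m (comb ev b n) x = (\<Sum>j<n. (kap (fr j) m * chi (- fr j) x) *\<^sub>R (b j *\<^sub>R po j))" for m
  unfolding comb_ev by (rule partial_chi_sum) simp
 show ?thesis unfolding curl_def p
  by (simp add: vec_eq_iff forall_3 cross3_def w sum_subtractf[symmetric] right_diff_distrib mult_ac)
qed

definition cross_curl :: "seq => seq => nat => field" where
 "cross_curl a b n = (%x. cross3 (comb ev a n x) (curl (comb ev b n) x))"

lemma cross_curl_sum:
 "cross_curl a b n = (%x. \<Sum>(i, j)\<in>{..<n} \<times> {..<n}. (chi (fr i) x * chi (- fr j) x) *\<^sub>R ((a i * b j) *\<^sub>R cross3 (po i) (cross3 (wv j) (po j))))"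
 unfolding cross_curl_def curl_comb unfolding comb_ev bilinear_sum[OF bilinear_cross] bilinear_lmul[OF bilinear_cross] bilinear_rmul[OF bilinear_cross]
 by (intro ext sum.cong refl) (auto simp: mult_ac)

lemma cross_curl_L2: "cross_curl a b n \<in> L2p"
 unfolding cross_curl_sum case_prod_beta by (intro L2_sum chi_vec_L2 hp_mult hp_chi)

lemma coef_cross_curl: "coef (cross_curl a b n) l = - (\<Sum>i<n. \<Sum>j<n. a i * b j * th i j l)"
proof -
 have e: "inn (%x. (chi k x * chi m x) *\<^sub>R v) (ev l) = (LINT x|M. chi k x * chi m x * chi (fr l) x) * (v \<bullet> po l)" for k m v
  unfolding L2_inner_def ev_def integral_mult_left_zero[symmetric] by (simp add: mult_ac)
 have "coef (cross_curl a b n) l = (\<Sum>(i, j)\<in>{..<n} \<times> {..<n}. inn (%x. (chi (fr i) x * chi (- fr j) x) *\<^sub>R ((a i * b j) *\<^sub>R cross3 (po i) (cross3 (wv j) (po j)))) (ev l))"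
  unfolding coef_def cross_curl_sum case_prod_beta by (rule L2_inner_sum[OF _ ev_L2(1)]) (intro chi_vec_L2 hp_mult hp_chi)
 also have "... = (\<Sum>(i, j)\<in>{..<n} \<times> {..<n}. - (a i * b j * th i j l))"
  unfolding e by (intro sum.cong refl) (auto simp: th_def)
 finally show ?thesis by (simp add: sum.cartesian_product[symmetric] sum_negf)
qed

lemma form_unit: "form th (trunc n a) (trunc n b) (unit l) = (\<Sum>i<n. \<Sum>j<n. a i * b j * th i j l)"
proof -
 have "tri th N (trunc n a) (trunc n b) (unit l) = (\<Sum>i<n. \<Sum>j<n. a i * b j * th i j l)" if "max n (Suc l) <= N" for N
 proof -
  have u: "(\<Sum>m<N. unit l m * th i j m) = th i j l" for i j
  proof -
   have "(\<Sum>m<N. unit l m * th i j m) = (\<Sum>m<N. if m = l then th i j l else 0)" by (intro sum.cong) (auto simp: unit_def)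
   then show ?thesis using that by simp
  qed
  have "tri th N (trunc n a) (trunc n b) (unit l) = (\<Sum>i<N. trunc n a i * (\<Sum>j<N. trunc n b j * (\<Sum>m<N. unit l m * th i j m)))"
   by (simp add: tri_def sum_distrib_left mult.assoc)
  also have "... = (\<Sum>i<n. a i * (\<Sum>j<n. b j * th i j l))" unfolding u using that by (simp add: sum_trunc_gen)
  finally show ?thesis by (simp add: sum_distrib_left mult.assoc)
 qed
 then have "(%N. tri th N (trunc n a) (trunc n b) (unit l)) ----> (\<Sum>i<n. \<Sum>j<n. a i * b j * th i j l)"
  by (intro tendsto_eventually eventually_sequentiallyI[of "max n (Suc l)"])
 then show ?thesis unfolding form_def by (rule limI)
qed

lemma solenoidal_coef: assumes "p \<in> St" shows "\<exists>a n. \<forall>m\<ge>n. p = comb ev (trunc n a) m & coef p = trunc m (trunc n a)"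
proof -
 obtain a n where p: "p = comb ev a n" using solenoidal_is_comb[OF assms] by blast
 have "p = comb ev (trunc n a) m" if "n <= m" for m using comb_trunc[OF that] p by simp
 then show ?thesis using comb_ev_H(2) by metis
qed

lemma solenoidal_H: assumes "p \<in> St" shows "p \<in> Hs" "wfin om (coef p)"
 using solenoidal_is_comb[OF assms] comb_ev_H by auto

text \<open>For trigonometric polynomials the bilinear operator has the coefficients given by the form, by direct computation.\<close>

lemma B_trig_form:
 assumes bt: "bounded_trilinear th om1 om2 om3 C" and p: "p \<in> St" and q: "q \<in> St"
  and w: "w \<in> Hs" "wfin om3 (coef w)"
 shows "inn (B_trig L p q) w = form th (coef p) (coef q) (coef w)"
proof -
 obtain a m where a: "\<forall>n\<ge>m. p = comb ev (trunc m a) n & coef p = trunc n (trunc m a)" using solenoidal_coef[OF p] by blast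
 obtain b k where b: "\<forall>n\<ge>k. q = comb ev (trunc k b) n & coef q = trunc n (trunc k b)" using solenoidal_coef[OF q] by blast
 define n where "n = max m k"
 define a' where "a' = trunc m a" define b' where "b' = trunc k b"
 have pc: "p = comb ev a' n" "coef p = trunc n a'" and qc: "q = comb ev b' n" "coef q = trunc n b'"
  using a b unfolding a'_def b'_def n_def by (meson max.cobounded1 max.cobounded2)+
 have B: "B_trig L p q = (%x. (-1) *\<^sub>R leray L (cross_curl a' b' n) x)" unfolding pc(1) qc(1) by (auto simp: B_trig_def cross_curl_def)
 have BH: "B_trig L p q \<in> Hs" unfolding B by (intro H_scale leray cross_curl_L2)
 have Bc: "coef (B_trig L p q) l = form th (coef p) (coef q) (unit l)" for l
  unfolding B coef_scale leray(2)[OF cross_curl_L2] coef_cross_curl pc(2) qc(2) form_unit by simp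
 have "(%l. coef w l * form th (coef p) (coef q) (unit l)) sums form th (coef p) (coef q) (coef w)"
  by (rule bounded_trilinear.form_expand3[OF bt _ _ w(2)]) (simp_all add: pc(2) qc(2))
 then show ?thesis unfolding H_inner[OF BH H_L2[OF w(1)]] ip_def Bc by (simp add: sums_iff mult.commute)
qed

text \<open>The form is continuous in the norms in which the approximations converge; the partial sums of
  the expansions show that there is at most one limit.\<close>

lemma B_extension_form:
 assumes bt: "bounded_trilinear th om one om3 C"
  and N: "!!p. p \<in> St ==> N (%x. p x - u x) = wnorm om (%i. coef p i - coef u i)"
  and u: "wfin om (coef u)" and v: "v \<in> Hs" and w: "w \<in> Hs" "wfin om3 (coef w)"
 shows "B_extension L N u v w = form th (coef u) (coef v) (coef w)"
proof -
 have lim: "(%n. inn (B_trig L (p n) (q n)) w) ----> form th (coef u) (coef v) (coef w)"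
  if s: "!!n. p n \<in> St" "!!n. q n \<in> St" and l: "(%n. N (%x. p n x - u x)) ----> 0"
   "(%n. nrm2 (%x. q n x - v x)) ----> 0" for p q
  unfolding B_trig_form[OF bt s w]
 proof (rule bounded_trilinear.form_continuous[OF bt u _ _ H_parseval(1)[OF v] _ _ w(2)])
  show "(%n. wnorm om (%i. coef (p n) i - coef u i)) ----> 0" using l(1) unfolding N[OF s(1)] .
  have "nrm2 (%x. q n x - v x) = wnorm one (%i. coef (q n) i - coef v i)" for n
   using H_parseval(2)[OF H_diff[OF solenoidal_H(1)[OF s(2)] v]] coef_diff[OF H_L2[OF solenoidal_H(1)[OF s(2)]] H_L2[OF v]] by simp
  then show "(%n. wnorm one (%i. coef (q n) i - coef v i)) ----> 0" using l(2) by simp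
 qed (rule solenoidal_H(2)[OF s(1)] solenoidal_H(2)[OF s(2)])+
 have ex: "(%n. N (%x. comb ev (coef u) n x - u x)) ----> 0" "(%n. nrm2 (%x. comb ev (coef v) n x - v x)) ----> 0"
 proof -
  show "(%n. N (%x. comb ev (coef u) n x - u x)) ----> 0"
   unfolding N[OF comb_solenoidal] comb_ev_H(2) using wnorm_tail_tendsto[OF u] by (simp add: wnorm_diff_commute)
  show "(%n. nrm2 (%x. comb ev (coef v) n x - v x)) ----> 0"
   using v[unfolded H_iff expands_def] L2_norm_minus_commute[of _ v] by simp
 qed
 show ?thesis unfolding B_extension_def
 proof (rule the_equality)
  show "\<forall>p q. (\<forall>n. p n \<in> St & q n \<in> St) & (%n. N (%x. p n x - u x)) ----> 0 \<and>
   (%n. nrm2 (%x. q n x - v x)) ----> 0 --> (%n. inn (B_trig L (p n) (q n)) w) ----> form th (coef u) (coef v) (coef w)"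
   using lim by blast
  fix r
  assume r: "\<forall>p q. (\<forall>n. p n \<in> St & q n \<in> St) & (%n. N (%x. p n x - u x)) ----> 0 \<and>
   (%n. nrm2 (%x. q n x - v x)) ----> 0 --> (%n. inn (B_trig L (p n) (q n)) w) ----> r"
  have "(%n. inn (B_trig L (comb ev (coef u) n) (comb ev (coef v) n)) w) ----> r"
   by (rule r[rule_format]) (simp add: ex comb_solenoidal)
  then show "r = form th (coef u) (coef v) (coef w)"
   by (rule LIMSEQ_unique) (rule lim[OF comb_solenoidal comb_solenoidal ex])
 qed
qed

lemma B_VH_form:
 assumes u: "u \<in> Vs" and v: "v \<in> Hs" and w: "w \<in> Ds"
 shows "B_VH L u v w = form th (coef u) (coef v) (coef w)"
proof -
 obtain C where C: "bounded_trilinear th lm one lm2 C" using th_trilinear by blast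
 have uH: "u \<in> Hs" "wfin lm (coef u)" using u V_iff by auto
 have "nrmV (%x. p x - u x) = wnorm lm (%i. coef p i - coef u i)" if "p \<in> St" for p
  by (rule V_norm_diff[OF _ u]) (use solenoidal_H[OF that] V_iff in blast)
 then show ?thesis unfolding B_VH_def using w dom_A_iff by (intro B_extension_form[OF C _ uH(2) v]) auto
qed

lemma B_DH_form:
 assumes u: "u \<in> Ds" and v: "v \<in> Hs" and w: "w \<in> Vs"
 shows "B_DH L u v w = form th (coef u) (coef v) (coef w)"
proof -
 obtain C where C: "bounded_trilinear th lm2 one lm C" using th_trilinear by blast
 have uH: "u \<in> Hs" "wfin lm2 (coef u)" using u dom_A_iff by auto
 have "A_norm L (%x. p x - u x) = wnorm lm2 (%i. coef p i - coef u i)" if "p \<in> St" for p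
 proof -
  note p = solenoidal_H[OF that]
  have c: "coef (%x. p x - u x) = (%i. coef p i - coef u i)" by (rule coef_diff[OF H_L2[OF p(1)] H_L2[OF uH(1)]])
  have "(%x. p x - u x) \<in> Ds" unfolding dom_A_iff c using H_diff[OF p(1) uH(1)] wfin_diff(1)[OF lm_nonneg(2) p(2) uH(2)] by blast
  from stokes_coef(3)[OF this] show ?thesis unfolding c .
 qed
 then show ?thesis unfolding B_DH_def using w V_iff by (intro B_extension_form[OF C _ uH(2) v]) auto
qed

lemma th_k3:
 assumes "B_bound L k3" "wfin lm2 u" "wfin one v" "wfin lm w"
 shows "abs (form th u v w) <= k3 * (sqrt (wnorm lm u) * sqrt (wnorm lm2 u) * wnorm one v * wnorm lm w
    + wnorm lm2 u * wnorm one v * sqrt (wnorm one w) * sqrt (wnorm lm w))"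
proof -
 have l: "wfin one c" if "wfin lm c" for c
  by (rule wfin_mono(1)[OF nonneg_one lm_nonneg(1) that, of "1 / lambda1 L"]) (use lm_lower lambda1_pos in "simp add: field_simps")
 obtain U where U: "U \<in> Hs" "coef U = u" using H_exists[OF l[OF wfin_lm2[OF assms(2)]]] by blast
 obtain W where W: "W \<in> Hs" "coef W = w" using H_exists[OF l[OF assms(4)]] by blast
 obtain v' where v': "v' \<in> Hs" "coef v' = v" using H_exists[OF assms(3)] by blast
 have m: "U \<in> Ds" "W \<in> Vs" using U W assms dom_A_iff V_iff by auto
 have "nrmV U = wnorm lm u" "nrmV W = wnorm lm w" using V_norm_coef U W wfin_lm2[OF assms(2)] assms(4) by auto
 moreover have "A_norm L U = wnorm lm2 u" "nrm2 v' = wnorm one v" "nrm2 W = wnorm one w"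
  using stokes_coef(3)[OF m(1)] H_parseval(2) U W v' by auto
 ultimately show ?thesis using assms(1) m v' U(2) W(2) B_DH_form[OF m(1) v'(1) m(2)] unfolding B_bound_def by metis
qed

end

section \<open>Measurability in time and fields with given coefficients\<close>
lemma simple_function_rounding:
 assumes a: "a \<in> borel_measurable A" and K: "0 < (K :: real)"
 shows "simple_function A (%t. real_of_int \<lfloor>K * max (- B) (min B (a t))\<rfloor> / K)"
proof (rule simple_function_borel_measurable)
 have m: "(%t. K * max (- B) (min B (a t))) \<in> borel_measurable A" using a by measurable
 have "(%t. real_of_int \<lfloor>K * max (- B) (min B (a t))\<rfloor>) \<in> borel_measurable A"
  by (rule measurable_compose[OF m borel_measurable_real_floor])
 then show "(%t. real_of_int \<lfloor>K * max (- B) (min B (a t))\<rfloor> / K) \<in> borel_measurable A" by (intro borel_measurable_divide) auto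
 have "\<lfloor>K * max (- B) (min B x)\<rfloor> \<in> {\<lfloor>K * - abs B\<rfloor>..\<lfloor>K * abs B\<rfloor>}" for x
 proof -
  have "- abs B <= max (- B) (min B x)" "max (- B) (min B x) <= abs B" by auto
  then show ?thesis using K by (simp only: atLeastAtMost_iff floor_mono mult_left_mono less_imp_le simp_thms)
 qed
 then have "(%t. real_of_int \<lfloor>K * max (- B) (min B (a t))\<rfloor> / K) ` space A
  \<subseteq> (%z. real_of_int z / K) ` {\<lfloor>K * - abs B\<rfloor>..\<lfloor>K * abs B\<rfloor>}" by (intro image_subsetI) (rule imageI)
 then show "finite ((%t. real_of_int \<lfloor>K * max (- B) (min B (a t))\<rfloor> / K) ` space A)" by (rule finite_subset) simp
qed

lemma rounding_error: assumes "0 < (K :: real)" "abs x <= B" shows "\<bar>real_of_int \<lfloor>K * max (- B) (min B x)\<rfloor> / K - x\<bar> <= 1 / K"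
proof -
 have e: "max (- B) (min B x) = x" using assms(2) by simp
 have "\<bar>real_of_int \<lfloor>K * x\<rfloor> - K * x\<bar> <= 1" by linarith
 then have "\<bar>real_of_int \<lfloor>K * x\<rfloor> - K * x\<bar> / K <= 1 / K" using assms(1) by (simp add: divide_right_mono)
 moreover have "\<bar>real_of_int \<lfloor>K * x\<rfloor> - K * x\<bar> / K = \<bar>real_of_int \<lfloor>K * x\<rfloor> / K - x\<bar>"
 proof -
  have "real_of_int \<lfloor>K * x\<rfloor> / K - x = (real_of_int \<lfloor>K * x\<rfloor> - K * x) / K" using assms(1) by (simp add: diff_divide_distrib)
  then show ?thesis using assms(1) by (simp add: abs_divide)
 qed
 ultimately show ?thesis unfolding e by simp
qed

context torus
begin

definition fld :: "seq => field" where "fld c = (SOME u. u \<in> Hs & coef u = c)"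

lemma fld: assumes "wfin one c" shows "fld c \<in> Hs" "coef (fld c) = c"
 using someI_ex[OF H_exists[OF assms]] unfolding fld_def by blast+

lemma lm_D0: "wfin lm c ==> wfin one c"
 by (rule wfin_mono(1)[OF nonneg_one lm_nonneg(1), of c "1 / lambda1 L"]) (use lm_lower lambda1_pos in "auto simp: field_simps")

lemma fld_V: "wfin lm c ==> fld c \<in> Vs" using fld[OF lm_D0] by (simp add: V_iff)

lemma ev_dom_A: "ev l \<in> Ds" by (simp add: dom_A_iff ev_H)

lemma coef_le_norm: assumes "u \<in> L2p" shows "abs (coef u l) <= nrm2 u"
 using L2_cauchy_schwarz[OF assms ev_L2(1)[of l]] ev_orthonormal(1) by (simp add: coef_def L2_norm_def[of L "ev l"] orthonormal_def)

lemma stokes_dual_coef: assumes "v \<in> Hs" "phi \<in> Ds"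
 shows "stokes_dual L v phi = ip (coef v) (%i. lm i * coef phi i)"
 using H_inner[OF assms(1) H_L2[OF stokes_coef(1)[OF assms(2)]]] by (simp add: stokes_dual_def stokes_coef(2)[OF assms(2)])

lemma helmholtz_dual_coef: assumes "v \<in> Hs" "phi \<in> Ds"
 shows "helmholtz_dual L alpha v phi = ip (coef v) (%i. (1 + alpha^2 * lm i) * coef phi i)"
proof -
 have phi: "phi \<in> Hs" "wfin one (coef phi)" using V_H[OF dom_A_V[OF assms(2)]] H_parseval(1) by auto
 have s: "wfin one (%i. lm i * coef phi i)" using H_parseval(1)[OF stokes_coef(1)[OF assms(2)]] stokes_coef(2)[OF assms(2)] by simp
 have "(%i. (1 + alpha^2 * lm i) * coef phi i) = (%i. coef phi i + alpha^2 * (lm i * coef phi i))" by (auto simp: algebra_simps)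
 then have "ip (coef v) (%i. (1 + alpha^2 * lm i) * coef phi i) = ip (coef v) (coef phi) + alpha^2 * ip (coef v) (%i. lm i * coef phi i)"
  using ip_add_right[OF H_parseval(1)[OF assms(1)] phi(2) wfin_scale(1)[OF s]] ip_scale[OF s H_parseval(1)[OF assms(1)], of "alpha^2"]
  by (simp add: ip_commute[of "coef v"])
 then show ?thesis unfolding helmholtz_dual_def stokes_dual_coef[OF assms] using H_inner[OF assms(1) H_L2[OF phi(1)]] by simp
qed

lemma ip_unit: "ip x (%i. k i * unit l i) = k l * x l"
proof -
 have "(\<Sum>i. x i * (k i * unit l i)) = (\<Sum>i\<in>{l}. x i * (k i * unit l i))" by (rule suminf_finite) (auto simp: unit_def)
 then show ?thesis by (simp add: ip_def unit_def)
qed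

text \<open>Strong measurability of the field gives measurability of each coefficient.\<close>

lemma L2_time_coef:
 assumes g: "L2_time T (Hs) (nrm2) g"
 shows "integrable (Leb 0 T) (%t. coef (g t) l)" "AE t in Leb 0 T. g t \<in> Hs"
  "integrable (Leb 0 T) (%t. (wnorm one (coef (g t)))^2)"
proof -
 let ?M = "Leb 0 T"
 have S: "{0..T} \<in> sets lebesgue" by simp
 show H: "AE t in ?M. g t \<in> Hs" using g by (simp add: L2_time_def)
 obtain s where s: "!!n. simple_function ?M (s n)" "!!n t. t \<in> {0..T} ==> s n t \<in> Hs"
  "AE t in ?M. (%n. nrm2 (%x. s n t x - g t x)) ----> 0" using g unfolding L2_time_def by blast
 have i: "integrable ?M (%t. (nrm2 (g t))^2)" using g by (simp add: L2_time_def)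
 show n: "integrable ?M (%t. (wnorm one (coef (g t)))^2)"
  by (rule integrable_AE_eq_on[OF i S]) (use H in eventually_elim, simp add: H_parseval(2))
 have "(%t. coef (g t) l) \<in> borel_measurable ?M"
 proof (rule borel_measurable_AE_lim_on[OF _ S])
  show "(%t. coef (s n t) l) \<in> borel_measurable ?M" for n
   using simple_function_compose1[OF s(1)[of n], of "%u. coef u l"] by (rule borel_measurable_simple_function)
  have sp: "AE t in ?M. t \<in> {0..T}" using AE_space[of ?M] by simp
  show "AE t in ?M. (%n. coef (s n t) l) ----> coef (g t) l" using s(3) H sp
  proof eventually_elim
   case (elim t)
   have "norm (coef (s n t) l - coef (g t) l) <= nrm2 (%x. s n t x - g t x)" for n
    using coef_le_norm[OF L2_diff[OF H_L2[OF s(2)[OF elim(3)]] H_L2[OF elim(2)]], of n l]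
     fun_cong[OF coef_diff[OF H_L2[OF s(2)[OF elim(3)]] H_L2[OF elim(2)]], of n l] by simp
   from Lim_null_comparison[OF always_eventually[OF allI[OF this]] elim(1)] show ?case by (simp add: LIM_zero_iff)
  qed
 qed
 then show "integrable ?M (%t. coef (g t) l)"
 proof (rule Bochner_Integration.integrable_bound[rotated])
  show "integrable ?M (%t. 1 + (nrm2 (g t))^2)" using i finite_measure.integrable_const[OF finite_measure_lebesgue_on, of "{0..T}"] by simp
  show "AE t in ?M. norm (coef (g t) l) <= norm (1 + (nrm2 (g t))^2)" using H
  proof eventually_elim
   case (elim t)
   have "2 * nrm2 (g t) <= 1 + (nrm2 (g t))^2" using zero_le_power2[of "nrm2 (g t) - 1"] by (simp add: power2_diff)
   then show ?case using coef_le_norm[OF H_L2[OF elim], of l] L2_norm_nonneg[of "g t"] by simp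
  qed
 qed
qed

text \<open>The approximating simple functions take the first \<open>n\<close> coefficients, cut off at \<open>n\<close> and rounded to a grid of width
  \<open>1 / K n\<close>. The grid is so fine that the rounding errors in the weighted norm tend to zero.\<close>

lemma L2_time_fields:
 assumes om: "nonneg om" "!!c. wfin om c ==> wfin one c"
  and X: "!!u. u \<in> X \<longleftrightarrow> u \<in> Hs & wfin om (coef u)" and N: "!!u. u \<in> X ==> N u = wnorm om (coef u)"
  and m: "!!i. (%t. a t i) \<in> borel_measurable (Leb 0 T)"
  and fin: "AE t in Leb 0 T. wfin om (a t) & g t \<in> Hs & coef (g t) = a t"
  and int: "integrable (Leb 0 T) (%t. (wnorm om (a t))^2)"
 shows "L2_time T X N g"
 unfolding L2_time_def
proof (intro conjI)
 let ?M = "Leb 0 T"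
 show "AE t in ?M. g t \<in> X" using fin by eventually_elim (simp add: X)
 have "AE t in ?M. (wnorm om (a t))^2 = (N (g t))^2" using fin by eventually_elim (simp add: X N)
 then show "integrable ?M (%t. (N (g t))^2)" by (rule integrable_AE_eq_on[OF int, rotated]) simp
 define K where "K n = real n * (1 + (\<Sum>i<n. om i)) + 1" for n
 have oms: "0 <= (\<Sum>i<n. om i)" for n using om(1) by (intro sum_nonneg) (auto simp: nonneg_def)
 have K: "1 <= K n" for n using oms[of n] by (simp add: K_def)
 define q where "q n x = real_of_int \<lfloor>K n * max (- real n) (min (real n) x)\<rfloor> / K n" for n x
 define s where "s n t = comb ev (%i. q n (a t i)) n" for n t
 have simp_s: "simple_function ?M (%t. comb ev (%i. q n (a t i)) k)" for n k
 proof (induction k)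
  case 0 then show ?case by (simp add: comb_def)
 next
  case (Suc k)
  have r: "simple_function ?M (%t. q n (a t k))" unfolding q_def using K[of n] by (intro simple_function_rounding m) simp
  show ?case using simple_function_compose2[OF Suc r, of "%u r x. u x + r *\<^sub>R ev k x"] by (simp add: comb_def)
 qed
 have sX: "s n t \<in> X" "coef (s n t) = trunc n (%i. q n (a t i))" for n t by (simp_all add: X s_def comb_ev_H)
 have "AE t in ?M. (%n. N (%x. s n t x - g t x)) ----> 0" using fin
 proof eventually_elim
  case (elim t)
  have gH: "g t \<in> Hs" and gc: "coef (g t) = a t" and f: "wfin om (a t)" using elim by auto
  define d1 where "d1 n = trunc n (%i. q n (a t i) - a t i)" for n
  define d2 where "d2 n = (%i. trunc n (a t) i - a t i)" for n
  have d2f: "wfin om (d2 n)" for n unfolding d2_def by (rule wfin_diff(1)[OF om(1) wfin_trunc f])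
  have sH: "s n t \<in> Hs" for n using sX(1) X by blast
  have Nd: "N (%x. s n t x - g t x) = wnorm om (%i. d1 n i + d2 n i)" for n
  proof -
   have c: "coef (%x. s n t x - g t x) = (%i. d1 n i + d2 n i)"
    unfolding coef_diff[OF H_L2[OF sH] H_L2[OF gH]] sX(2) gc by (auto simp: d1_def d2_def trunc_def)
   have "(%x. s n t x - g t x) \<in> X"
    unfolding X c using H_diff[OF sH gH] wfin_add(1)[OF om(1) _ d2f, of "d1 n"] by (simp add: d1_def)
   from N[OF this] show ?thesis unfolding c .
  qed
  have a0: "wfin one (a t)" by (rule om(2)[OF f])
  have bd: "abs (a t i) <= wnorm one (a t)" for i
   using coef_le_norm[OF H_L2[OF gH], of i] unfolding H_parseval(2)[OF gH] gc .
  have d1: "wnorm om (d1 n) <= sqrt (1 / real n)" if n: "wnorm one (a t) <= real n" "1 <= n" for n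
  proof -
   have "wsq om (d1 n) = (\<Sum>i<n. om i * (q n (a t i) - a t i)^2)" unfolding d1_def by (rule wsq_trunc)
   also have "... <= (\<Sum>i<n. om i * (1 / K n)^2)"
   proof (intro sum_mono mult_left_mono)
    fix i
    have "abs (q n (a t i) - a t i) <= 1 / K n" unfolding q_def using K[of n] bd[of i] n by (intro rounding_error) auto
    from power_mono[OF this, of 2] show "(q n (a t i) - a t i)^2 <= (1 / K n)^2" by simp
    show "0 <= om i" using om(1) by (simp add: nonneg_def)
   qed
   also have "... = (\<Sum>i<n. om i) * (1 / K n)^2" by (simp only: sum_distrib_right)
   also have "... <= 1 / real n"
   proof -
    have "real n * (\<Sum>i<n. om i) <= K n" by (simp add: K_def distrib_left)
    also have "... <= (K n)^2" using mult_left_mono[OF K[of n], of "K n"] K[of n] by (simp add: power2_eq_square)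
    finally have "(\<Sum>i<n. om i) * real n <= (K n)^2" by (simp add: mult.commute)
    then show ?thesis using K[of n] n(2) by (simp add: power_divide field_simps)
   qed
   finally show ?thesis unfolding wnorm_def by (rule real_sqrt_le_mono)
  qed
  show "(%n. N (%x. s n t x - g t x)) ----> 0"
  proof (rule Lim_null_comparison)
   obtain n0 where n0: "wnorm one (a t) <= real n0" using real_arch_simple by blast
   show "\<forall>\<^sub>F n in sequentially. norm (N (%x. s n t x - g t x)) <= sqrt (1 / real n) + wnorm om (d2 n)"
   proof (rule eventually_sequentiallyI[of "max 1 n0"])
    fix n assume n: "max 1 n0 <= n"
    then have "wnorm one (a t) <= real n" using n0 by simp
    then have "wnorm om (d1 n) <= sqrt (1 / real n)" using n by (intro d1) auto
    moreover have "wfin om (d1 n)" by (simp add: d1_def)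
    ultimately show "norm (N (%x. s n t x - g t x)) <= sqrt (1 / real n) + wnorm om (d2 n)"
     unfolding Nd using wfin_add[OF om(1) _ d2f[of n], of "d1 n"] wnorm_nonneg[OF om(1)] by simp
   qed
   have "(%n. sqrt (1 / real n) + wnorm om (d2 n)) ----> sqrt 0 + 0"
    using wnorm_tail_tendsto[OF f] unfolding d2_def wnorm_diff_commute[of _ "trunc _ (a t)"]
    by (intro tendsto_add tendsto_real_sqrt lim_1_over_n)
   then show "(%n. sqrt (1 / real n) + wnorm om (d2 n)) ----> 0" by simp
  qed
 qed
 then show "\<exists>s. (\<forall>n. simple_function ?M (s n) & (\<forall>t\<in>{0..T}. s n t \<in> X)) & (AE t in ?M. (%n. N (%x. s n t x - g t x)) ----> 0)"
  using simp_s sX(1) by (intro exI[of _ s]) (auto simp: s_def[abs_def])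
qed

definition Cth :: real where "Cth = (SOME C. bounded_trilinear th lm one lm2 C)"

lemma Cth: "bounded_trilinear th lm one lm2 Cth"
 unfolding Cth_def by (rule someI_ex) (use th_trilinear in blast)

end

section \<open>The nudged equations\<close>

locale nudged_torus = torus +
 fixes nu alpha k3 h c1 mu :: real and Ih :: "field => field"
 assumes nu: "0 < nu" and alpha: "0 < alpha" and k3: "0 < k3" and B: "B_bound L k3" and h: "0 < h"
  and Ih: "linear_H1_L2 L Ih" and c1: "0 < c1"
  and Ih_near: "!!phi. phi \<in> Vs ==> (nrm2 (leray L (%x. phi x - Ih phi x)))^2 <= c1^2 * h^2 * (nrmV phi)^2"
  and mu: "0 < mu" and small_h: "h^2 < nu / (2 * mu * c1^2)"
begin

text \<open>Since \<open>fld c\<close> is only determined almost everywhere, \<open>R\<close> is well defined on coefficients because \<open>Ih\<close> respects equality almost everywhere (\<open>coef_Ih\<close>).\<close>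

definition R :: "seq => nat => real" where "R c = coef (Ih (fld c))"

lemma Ih_L2: "phi \<in> Vs ==> Ih phi \<in> L2p"
 using Ih V_H1_dot by (auto simp: linear_H1_L2_def L2_dot_def)

lemma coef_Ih: assumes "phi \<in> Vs" shows "coef (Ih phi) = R (coef phi)"
proof -
 have c: "wfin lm (coef phi)" and H: "phi \<in> Hs" using assms V_iff by auto
 note f = fld_V[OF c]
 have "ae_eq L phi (fld (coef phi))" using H_ae_eq[OF H V_H[OF f]] fld(2)[OF lm_D0[OF c]] by simp
 then have "ae_eq L (Ih phi) (Ih (fld (coef phi)))" using Ih V_H1_dot[OF assms] V_H1_dot[OF f] unfolding linear_H1_L2_def by blast
 then show ?thesis unfolding R_def by (rule coef_cong[OF _ Ih_L2[OF assms] Ih_L2[OF f]])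
qed

lemma V_add: "phi \<in> Vs ==> psi \<in> Vs ==> (%x. phi x + psi x) \<in> Vs"
 unfolding V_iff using H_add coef_add[OF H_L2 H_L2] wfin_add(1)[OF lm_nonneg(1)] by auto

lemma V_scale: "phi \<in> Vs ==> (%x. k *\<^sub>R phi x) \<in> Vs"
 unfolding V_iff coef_scale using H_scale wfin_scale(1) by auto

sublocale nm: nudged_modes lm th "lambda1 L" nu alpha k3 Cth mu "c1 * h" R
proof unfold_locales
 show "0 < lambda1 L" by (rule lambda1_pos)
 show "lambda1 L <= lm i" for i by (rule lm_lower)
 show "filterlim lm at_top sequentially" by (rule lm_at_top)
 show "0 < nu" "0 < alpha" "0 < k3" "0 < mu" by (rule nu alpha k3 mu)+
 show "0 <= Cth" using Cth by (simp add: bounded_trilinear_def)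
 show "th i j l = - th l j i" for i j l by (rule th_antisym)
 show "abs (tri th n a b c) <= Cth * wnorm lm (trunc n a) * wnorm one (trunc n b) * wnorm lm2 (trunc n c)" for n a b c
  by (rule bounded_trilinear.tri_bound[OF Cth])
 show "abs (form th u v w) <= k3 * (sqrt (wnorm lm u) * sqrt (wnorm lm2 u) * wnorm one v * wnorm lm w
    + wnorm lm2 u * wnorm one v * sqrt (wnorm one w) * sqrt (wnorm lm w))"
  if "wfin lm2 u" "wfin one v" "wfin lm w" for u v w by (rule th_k3[OF B that])
 show "0 <= c1 * h" using c1 h by simp
 have "h^2 * (2 * mu * c1^2) < nu" using small_h mu c1 by (simp add: pos_less_divide_eq)
 then show "mu * (c1 * h)^2 <= nu / 2" by (simp add: power_mult_distrib mult_ac)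
 show "wfin one (R c)" if "wfin lm c" for c unfolding R_def by (rule coef_wfin[OF Ih_L2[OF fld_V[OF that]]])
 show "R (%i. a i + b i) = (%i. R a i + R b i)" if "wfin lm a" "wfin lm b" for a b
 proof -
  note f = fld_V[OF that(1)] fld_V[OF that(2)]
  have c: "coef (%x. fld a x + fld b x) = (%i. a i + b i)"
   unfolding coef_add[OF H_L2[OF V_H[OF f(1)]] H_L2[OF V_H[OF f(2)]]] fld(2)[OF lm_D0[OF that(1)]] fld(2)[OF lm_D0[OF that(2)]] ..
  have "ae_eq L (Ih (%x. fld a x + fld b x)) (%x. Ih (fld a) x + Ih (fld b) x)"
   using Ih V_H1_dot[OF f(1)] V_H1_dot[OF f(2)] unfolding linear_H1_L2_def by blast
  then have "coef (Ih (%x. fld a x + fld b x)) = coef (%x. Ih (fld a) x + Ih (fld b) x)"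
   by (rule coef_cong[OF _ Ih_L2[OF V_add[OF f]] L2_add[OF Ih_L2[OF f(1)] Ih_L2[OF f(2)]]])
  then show ?thesis unfolding coef_Ih[OF V_add[OF f]] c coef_add[OF Ih_L2[OF f(1)] Ih_L2[OF f(2)]] R_def[of a] R_def[of b] .
 qed
 show "R (%i. k * a i) = (%i. k * R a i)" if "wfin lm a" for a k
 proof -
  note f = fld_V[OF that]
  have c: "coef (%x. k *\<^sub>R fld a x) = (%i. k * a i)" unfolding coef_scale fld(2)[OF lm_D0[OF that]] ..
  have "ae_eq L (Ih (%x. k *\<^sub>R fld a x)) (%x. k *\<^sub>R Ih (fld a) x)"
   using Ih V_H1_dot[OF f] unfolding linear_H1_L2_def by blast
  then have "coef (Ih (%x. k *\<^sub>R fld a x)) = coef (%x. k *\<^sub>R Ih (fld a) x)"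
   by (rule coef_cong[OF _ Ih_L2[OF V_scale[OF f]] L2_scale[OF Ih_L2[OF f]]])
  then show ?thesis unfolding coef_Ih[OF V_scale[OF f]] c coef_scale R_def[of a] .
 qed
 show "wnorm one (%i. c i - R c i) <= c1 * h * wnorm lm c" if "wfin lm c" for c
 proof (rule power2_le_imp_le)
  note f = fld_V[OF that]
  have H: "fld c \<in> Hs" by (rule V_H[OF f])
  have c: "coef (fld c) = c" by (rule fld(2)[OF lm_D0[OF that]])
  have d: "(%x. fld c x - Ih (fld c) x) \<in> L2p" by (rule L2_diff[OF H_L2[OF H] Ih_L2[OF f]])
  have "nrm2 (leray L (%x. fld c x - Ih (fld c) x)) = wnorm one (%i. c i - R c i)"
   unfolding H_parseval(2)[OF leray(1)[OF d]] leray(2)[OF d] coef_diff[OF H_L2[OF H] Ih_L2[OF f]] c R_def ..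
  moreover have "nrmV (fld c) = wnorm lm c" using V_norm_coef[OF H] that c by simp
  ultimately show "(wnorm one (%i. c i - R c i))^2 <= (c1 * h * wnorm lm c)^2"
   using Ih_near[OF f] by (simp add: power_mult_distrib)
  show "0 <= c1 * h * wnorm lm c" using c1 h wnorm_nonneg[OF lm_nonneg(1) that] by simp
 qed
qed

lemma hel_eq: "(%i. (1 + alpha^2 * lm i) * c i) = nm.hel c" by (simp add: nm.hel_def)

lemma weak_form:
 assumes v: "v \<in> Ds" and g: "g \<in> Hs" and phi: "phi \<in> Ds"
 shows "helmholtz_dual L alpha g phi + nu * stokes_dual L (helmholtz L alpha v) phi + B_VH L v (helmholtz L alpha v) phi
  = ip (coef g) (nm.hel (coef phi)) + nu * ip (%i. lm i * coef v i) (nm.hel (coef phi)) + nm.beta (coef v) (nm.hel (coef v)) (coef phi)"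
proof -
 have "ip (coef (helmholtz L alpha v)) (%i. lm i * coef phi i) = ip (%i. lm i * coef v i) (nm.hel (coef phi))"
  unfolding helmholtz_coef(2)[OF v] ip_def nm.hel_def by (simp add: mult_ac)
 then show ?thesis
  unfolding helmholtz_dual_coef[OF g phi] stokes_dual_coef[OF helmholtz_coef(1)[OF v] phi] B_VH_form[OF dom_A_V[OF v] helmholtz_coef(1)[OF v] phi]
  by (simp add: hel_eq helmholtz_coef(2)[OF v])
qed

text \<open>Testing the weak equation with the eigenfields yields one ordinary differential equation for each coefficient.\<close>

lemma regular_solution_modes:
 assumes reg: "regular_solution L nu alpha Fd v0 T v" and v0: "v0 \<in> Vs" and T: "0 < T"
  and Fd: "!!t phi. t \<in> {0..T} ==> v t \<in> Vs ==> phi \<in> Ds ==>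
   Fd t phi = ip (F t) (nm.hel (coef phi)) - mu * ip (R (coef (v t))) (nm.hel (coef phi))"
 shows "nm.sol T F (%t. coef (v t))" "coef (v 0) = coef v0" "!!t. t \<in> {0..T} ==> v t \<in> Vs"
proof -
 let ?M = "Leb 0 T"
 show V: "!!t. t \<in> {0..T} ==> v t \<in> Vs" using reg by (auto simp: regular_solution_def continuous_in_V_def)
 have H: "v t \<in> Hs" if "t \<in> {0..T}" for t using V_H[OF V[OF that]] .
 show "coef (v 0) = coef v0" using reg H_ae_eq[OF H V_H[OF v0]] T by (simp add: regular_solution_def)
 obtain g where g: "L2_time T (Hs) (nrm2) g" "time_derivative L T v g"
  "AE t in ?M. \<forall>phi\<in>Ds. helmholtz_dual L alpha (g t) phi + nu * stokes_dual L (helmholtz L alpha (v t)) phi + B_VH L (v t) (helmholtz L alpha (v t)) phi = Fd t phi"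
  using reg unfolding regular_solution_def by blast
 have vt: "AE t in ?M. v t \<in> Ds" "integrable ?M (%t. (A_norm L (v t))^2)" using reg by (auto simp: regular_solution_def L2_time_def)
 note gt = L2_time_coef[OF g(1)]
 have "nm.traj T (%t. coef (v t)) (%t. coef (g t))" unfolding nm.traj_def
 proof (intro conjI allI impI ballI)
  show "wfin lm (coef (v t))" if "t \<in> {0..T}" for t using V[OF that] V_iff by blast
  show "AE t in ?M. wfin lm2 (coef (v t))" using vt(1) by eventually_elim (simp add: dom_A_iff)
  show "integrable ?M (%t. (wnorm lm2 (coef (v t)))^2)"
   by (rule integrable_AE_eq_on[OF vt(2)]) (simp, use vt(1) in eventually_elim, simp add: stokes_coef(3))
  show "integrable ?M (%t. coef (g t) i)" for i by (rule gt(1))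
  show "AE t in ?M. wfin one (coef (g t))" using gt(2) by eventually_elim (rule H_parseval(1))
  show "integrable ?M (%t. (wnorm one (coef (g t)))^2)" by (rule gt(3))
  fix i s t assume st: "(0::real) <= s" "s <= t" "t <= T"
  have "inn (%x. v t x - v s x) (ev i) = (LINT tau|Leb s t. inn (g tau) (ev i))"
   using g(2) ev_H(1) st unfolding time_derivative_def by blast
  then show "coef (v t) i - coef (v s) i = (LINT tau|Leb s t. coef (g tau) i)"
   using L2_inner_diff[OF H_L2[OF H] H_L2[OF H] ev_L2(1), of t s i] st by (simp add: coef_def)
 qed
 moreover have "AE t in ?M. \<forall>i. coef (g t) i = nm.flow (F t) (coef (v t)) i"
 proof -
  have sp: "AE t in ?M. t \<in> {0..T}" using AE_space[of ?M] by simp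
  show ?thesis using g(3) vt(1) gt(2) sp
  proof eventually_elim
   case (elim t)
   show ?case
   proof
    fix i
    define k where "k = 1 + alpha^2 * lm i"
    have k: "k ~= 0" using nm.hel_pos[of i] by (simp add: k_def)
    have u: "ip x (nm.hel (coef (ev i))) = k * x i" for x unfolding nm.hel_def ev_H(2) ip_unit k_def ..
    have "helmholtz_dual L alpha (g t) (ev i) + nu * stokes_dual L (helmholtz L alpha (v t)) (ev i) + B_VH L (v t) (helmholtz L alpha (v t)) (ev i) = Fd t (ev i)"
     using elim(1) ev_dom_A by blast
    then have "k * coef (g t) i + nu * (k * (lm i * coef (v t) i)) + nm.beta (coef (v t)) (nm.hel (coef (v t))) (unit i) = k * F t i - mu * (k * R (coef (v t)) i)"
     unfolding weak_form[OF elim(2,3) ev_dom_A] Fd[OF elim(4) V[OF elim(4)] ev_dom_A] u by (simp add: ev_H(2))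
    then have "k * coef (g t) i = k * nm.flow (F t) (coef (v t)) i"
     unfolding nm.flow_def k_def[symmetric] using k by (simp add: algebra_simps)
    then show "coef (g t) i = nm.flow (F t) (coef (v t)) i" using k by simp
   qed
  qed
 qed
 ultimately show "nm.sol T F (%t. coef (v t))" unfolding nm.sol_def by blast
qed

text \<open>The equations for the coefficients are summed against an arbitrary test field; dominated convergence
  exchanges this sum with the time integral.\<close>

lemma modes_regular_solution:
 assumes sol: "nm.sol T F c" and T: "0 < T" and F: "!!t. t \<in> {0..T} ==> wfin one (F t)"
  and cont: "!!t. t \<in> {0..T} ==> ((%s. wnorm lm (%i. c s i - c t i)) \<longlongrightarrow> 0) (at t within {0..T})"
  and w: "!!t. t \<in> {0..T} ==> w t \<in> Hs & coef (w t) = c t"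
  and w0: "w0 \<in> Vs" "c 0 = coef w0"
  and Fd: "!!t phi. t \<in> {0..T} ==> w t \<in> Vs ==> phi \<in> Ds ==>
   Fd t phi = ip (F t) (nm.hel (coef phi)) - mu * ip (R (coef (w t))) (nm.hel (coef phi))"
 shows "regular_solution L nu alpha Fd w0 T w"
proof -
 let ?M = "Leb 0 T"
 obtain g where g: "nm.traj T c g" "AE t in ?M. \<forall>i. g t i = nm.flow (F t) (c t) i" using sol unfolding nm.sol_def by blast
 note d = nm.trajD[OF g(1)]
 have sp: "AE t in ?M. t \<in> {0..T}" using AE_space[of ?M] by simp
 have V: "w t \<in> Vs" if "t \<in> {0..T}" for t using w[OF that] d(1)[of t] that by (simp add: V_iff)
 have 1: "continuous_in_V L T w" unfolding continuous_in_V_def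
 proof (intro ballI conjI V)
  fix t assume t: "t \<in> {0..T}"
  have "nrmV (%x. w s x - w t x) = wnorm lm (%i. c s i - c t i)" if s: "s \<in> {0..T}" for s
   using V_norm_diff[OF V[OF s] V[OF t]] w[OF s] w[OF t] by simp
  then have "\<forall>\<^sub>F s in at t within {0..T}. wnorm lm (%i. c s i - c t i) = nrmV (%x. w s x - w t x)"
   by (simp add: eventually_at_filter)
  from tendsto_cong[OF this] cont[OF t] show "((%s. nrmV (%x. w s x - w t x)) \<longlongrightarrow> 0) (at t within {0..T})" by blast
 qed
 have 2: "L2_time T (Ds) (A_norm L) w"
 proof (rule L2_time_fields[OF lm_nonneg(2) _ dom_A_iff stokes_coef(3)])
  show "wfin one e" if "wfin lm2 e" for e by (rule lm_D0[OF wfin_lm2[OF that]])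
  show "(%t. c t i) \<in> borel_measurable ?M" for i by (rule continuous_imp_measurable_on_sets_lebesgue[OF nm.traj_continuous[OF g(1)]]) simp
  show "AE t in ?M. wfin lm2 (c t) & w t \<in> Hs & coef (w t) = c t" using d(2) sp by eventually_elim (use w in blast)
  show "integrable ?M (%t. (wnorm lm2 (c t))^2)" by (rule d(3))
 qed
 define G where "G t = fld (g t)" for t
 have GH: "AE t in ?M. wfin one (g t) & G t \<in> Hs & coef (G t) = g t" using d(5) by eventually_elim (simp add: G_def fld)
 have 3: "L2_time T (Hs) (nrm2) G"
  by (rule L2_time_fields[OF nonneg_one _ _ _ borel_measurable_integrable[OF d(4)] GH d(6)]) (auto simp: H_parseval)
 have 4: "time_derivative L T w G" unfolding time_derivative_def
 proof (intro ballI allI impI)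
  fix psi s t assume psi: "psi \<in> Hs" and st: "(0::real) <= s & s <= t & t <= T"
  let ?N = "Leb s t"
  define p where "p = coef psi"
  have p: "wfin one p" unfolding p_def by (rule H_parseval(1)[OF psi])
  have GN: "AE tau in ?N. wfin one (g tau) & G tau \<in> Hs & coef (G tau) = g tau"
   by (rule AE_lebesgue_on_subset[OF GH]) (use st in auto)
  have gi: "integrable ?N (%tau. g tau i)" "integrable ?N (%tau. (wnorm one (g tau))^2)" for i using d(4,6) st by (auto intro: integrable_within)
  define q where "q n tau = (\<Sum>i<n. g tau i * p i)" for n tau
  have qi: "integrable ?N (q n)" for n unfolding q_def using gi by auto
  have lim: "AE tau in ?N. (%n. q n tau) ----> inn (G tau) psi" using GN
  proof eventually_elim
   case (elim tau)
   then have "inn (G tau) psi = ip (g tau) p" using H_inner[OF _ H_L2[OF psi], of "G tau"] by (simp add: p_def)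
   then show ?case unfolding q_def ip_def using summable_LIMSEQ[OF ip_summable(2)[OF _ p, of "g tau"]] elim by simp
  qed
  have "(%n. LINT tau|?N. q n tau) ----> (LINT tau|?N. inn (G tau) psi)"
  proof (rule integral_dominated_convergence[where w = "%tau. (1 + (wnorm one (g tau))^2) * wnorm one p"])
   show "integrable ?N (%tau. (1 + (wnorm one (g tau))^2) * wnorm one p)"
    using gi(2) finite_measure.integrable_const[OF finite_measure_lebesgue_on, of "{s..t}" "1::real"] by simp
   show "q n \<in> borel_measurable ?N" for n using qi by auto
   show "(%tau. inn (G tau) psi) \<in> borel_measurable ?N" by (rule borel_measurable_AE_lim_on[OF _ _ lim]) (use qi in auto)
   show "AE tau in ?N. norm (q n tau) <= (1 + (wnorm one (g tau))^2) * wnorm one p" for n using GN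
   proof eventually_elim
    case (elim tau)
    then have f: "wfin one (g tau)" by simp
    have "norm (q n tau) <= (\<Sum>i<n. abs (g tau i * p i))" unfolding q_def by (simp add: sum_abs)
    also have "... <= (\<Sum>i. abs (g tau i * p i))" by (rule sum_le_suminf[OF ip_summable(1)[OF f p]]) auto
    also have "... <= wnorm one (g tau) * wnorm one p" by (rule ip_summable(3)[OF f p])
    also have "... <= (1 + (wnorm one (g tau))^2) * wnorm one p"
    proof (rule mult_right_mono)
     have "2 * wnorm one (g tau) <= 1 + (wnorm one (g tau))^2" using zero_le_power2[of "wnorm one (g tau) - 1"] by (simp add: power2_diff)
     then show "wnorm one (g tau) <= 1 + (wnorm one (g tau))^2" using wnorm_nonneg[OF nonneg_one f] by linarith
    qed (rule wnorm_nonneg[OF nonneg_one p])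
    finally show ?case .
   qed
  qed (rule lim)
  moreover have "(LINT tau|?N. q n tau) = (\<Sum>i<n. (c t i - c s i) * p i)" for n
   unfolding q_def using gi(1) d(7)[of s t] st by simp
  moreover have "(%n. \<Sum>i<n. (c t i - c s i) * p i) ----> inn (%x. w t x - w s x) psi"
  proof -
   have ts: "t \<in> {0..T}" "s \<in> {0..T}" using st by auto
   have H: "(%x. w t x - w s x) \<in> Hs" using H_diff w ts by blast
   have k: "coef (%x. w t x - w s x) = (%i. c t i - c s i)" using coef_diff[OF H_L2 H_L2] w[OF ts(1)] w[OF ts(2)] by simp
   show ?thesis using summable_LIMSEQ[OF ip_summable(2)[OF H_parseval(1)[OF H] p]] unfolding H_inner[OF H H_L2[OF psi]] ip_def k p_def .
  qed
  ultimately show "inn (%x. w t x - w s x) psi = (LINT tau|?N. inn (G tau) psi)" using LIMSEQ_unique by simp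
 qed
 have 5: "AE t in ?M. \<forall>phi\<in>Ds. helmholtz_dual L alpha (G t) phi + nu * stokes_dual L (helmholtz L alpha (w t)) phi + B_VH L (w t) (helmholtz L alpha (w t)) phi = Fd t phi"
  using d(2) GH g(2) sp
 proof eventually_elim
  case (elim t)
  note wt = w[OF elim(4)]
  have wA: "w t \<in> Ds" using wt elim(1) by (simp add: dom_A_iff)
  show ?case
  proof
   fix phi assume phi: "phi \<in> Ds"
   have p: "wfin lm2 (coef phi)" using phi dom_A_iff by blast
   have "ip (nm.hel (coef phi)) (g t) = - nu * ip (%i. lm i * c t i) (nm.hel (coef phi)) - nm.beta (c t) (nm.hel (c t)) (coef phi)
    + ip (F t) (nm.hel (coef phi)) - mu * ip (R (c t)) (nm.hel (coef phi))"
    by (rule nm.test_flow[OF elim(1) F[OF elim(4)] _ p]) (use elim(3) in blast)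
   then show "helmholtz_dual L alpha (G t) phi + nu * stokes_dual L (helmholtz L alpha (w t)) phi + B_VH L (w t) (helmholtz L alpha (w t)) phi = Fd t phi"
    using elim(2) wt unfolding Fd[OF elim(4) V[OF elim(4)] phi] by (subst weak_form[OF wA _ phi]) (auto simp: ip_commute[of "g t"])
  qed
 qed
 have 0: "ae_eq L (w 0) w0" using H_ae_eq[OF _ V_H[OF w0(1)], of "w 0"] w[of 0] w0(2) T by simp
 show ?thesis unfolding regular_solution_def using 0 1 2 3 4 5 by blast
qed

text \<open>The forcing of the nudged system: the original force, and the observations of the reference solution \<open>c\<close>.
  With this forcing the reference solution satisfies the nudged system, because the two nudging terms cancel.\<close>

definition force :: "field => seq => nat => real" where
 "force f c i = coef f i / (1 + alpha^2 * lm i) + mu * R c i"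

lemma force_D0:
 assumes f: "f \<in> Hs" and c: "wfin lm c"
 shows "wfin one (%i. coef f i / (1 + alpha^2 * lm i))" "wfin one (force f c)" "wnorm one (force f c) <= nrm2 f + mu * (nm.CR * wnorm lm c)"
proof -
 have le: "one i * (coef f i / (1 + alpha^2 * lm i))^2 <= one i * (coef f i)^2" for i
 proof -
  have k: "1 <= 1 + alpha^2 * lm i" using lm_pos[of i] by (simp add: less_imp_le)
  have "abs (coef f i / (1 + alpha^2 * lm i)) <= abs (coef f i)"
   using k mult_left_mono[OF k, of "abs (coef f i)"] by (simp add: abs_divide pos_divide_le_eq)
  from power_mono[OF this, of 2] show ?thesis by (simp only: power2_abs abs_ge_zero mult_1 simp_thms)
 qed
 have B: "(\<Sum>i<n. one i * (coef f i / (1 + alpha^2 * lm i))^2) <= (nrm2 f)^2" for n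
 proof -
  have "(\<Sum>i<n. one i * (coef f i / (1 + alpha^2 * lm i))^2) <= (\<Sum>i<n. one i * (coef f i)^2)" by (rule sum_mono[OF le])
  also have "... <= (nrm2 f)^2"
   unfolding H_parseval(2)[OF f] wnorm_sq[OF nonneg_one H_parseval(1)[OF f]] by (rule wsq_partial_le[OF nonneg_one H_parseval(1)[OF f]])
  finally show ?thesis .
 qed
 note s = wfin_bounded[OF nonneg_one B]
 show w: "wfin one (%i. coef f i / (1 + alpha^2 * lm i))" by (rule s(1))
 note r = nm.R_D0[OF c]
 have F: "force f c = (%i. coef f i / (1 + alpha^2 * lm i) + mu * R c i)" by (auto simp: force_def)
 show "wfin one (force f c)" unfolding F by (rule wfin_add(1)[OF nonneg_one w wfin_scale(1)[OF r]])
 have "wnorm one (force f c) <= wnorm one (%i. coef f i / (1 + alpha^2 * lm i)) + wnorm one (%i. mu * R c i)"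
  unfolding F by (rule wfin_add(2)[OF nonneg_one w wfin_scale(1)[OF r]])
 also have "... <= nrm2 f + mu * (nm.CR * wnorm lm c)"
 proof (rule add_mono)
  show "wnorm one (%i. coef f i / (1 + alpha^2 * lm i)) <= nrm2 f" unfolding wnorm_def by (rule real_le_lsqrt) (use s wsq_nonneg[OF nonneg_one w] in auto)
  show "wnorm one (%i. mu * R c i) <= mu * (nm.CR * wnorm lm c)" unfolding wfin_scale(3)[OF r] using nm.R_bound[OF c] mu by simp
 qed
 finally show "wnorm one (force f c) <= nrm2 f + mu * (nm.CR * wnorm lm c)" .
qed

lemma force_ip:
 assumes f: "f \<in> Hs" and c: "wfin lm c" and phi: "phi \<in> Ds"
 shows "ip (force f c) (nm.hel (coef phi)) = inn f phi + mu * ip (R c) (nm.hel (coef phi))"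
proof -
 have hd: "wfin one (nm.hel (coef phi))" using phi dom_A_iff nm.hel_D0 by blast
 note r = nm.R_D0[OF c] and w = force_D0(1)[OF f c]
 have "ip (%i. coef f i / (1 + alpha^2 * lm i)) (nm.hel (coef phi)) = ip (coef f) (coef phi)"
 proof -
  have "coef f i / (1 + alpha^2 * lm i) * nm.hel (coef phi) i = coef f i * coef phi i" for i
   using nm.hel_pos[of i] by (simp add: nm.hel_def)
  then show ?thesis by (simp add: ip_def)
 qed
 then have "ip (%i. coef f i / (1 + alpha^2 * lm i)) (nm.hel (coef phi)) = inn f phi"
  using H_inner[OF f H_L2[OF V_H[OF dom_A_V[OF phi]]]] by simp
 moreover have "force f c = (%i. coef f i / (1 + alpha^2 * lm i) + mu * R c i)" by (auto simp: force_def)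
 ultimately show ?thesis
  using ip_add_right[OF hd w wfin_scale(1)[OF r, of mu]] ip_scale[OF r hd, of mu] by (simp add: ip_commute[of "nm.hel (coef phi)"])
qed

lemma nudging_ip:
 assumes w: "w \<in> Vs" and u: "u \<in> Vs" and phi: "phi \<in> Ds" and f: "f \<in> Hs"
 shows "inn f phi - mu * helmholtz_dual L alpha (leray L (%x. Ih w x - Ih u x)) phi
  = ip (force f (coef u)) (nm.hel (coef phi)) - mu * ip (R (coef w)) (nm.hel (coef phi))"
proof -
 have c: "wfin lm (coef w)" "wfin lm (coef u)" using w u V_iff by auto
 have hd: "wfin one (nm.hel (coef phi))" using phi dom_A_iff nm.hel_D0 by blast
 have d: "(%x. Ih w x - Ih u x) \<in> L2p" by (rule L2_diff[OF Ih_L2[OF w] Ih_L2[OF u]])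
 have "helmholtz_dual L alpha (leray L (%x. Ih w x - Ih u x)) phi = ip (%i. R (coef w) i - R (coef u) i) (nm.hel (coef phi))"
  unfolding helmholtz_dual_coef[OF leray(1)[OF d] phi] leray(2)[OF d] coef_diff[OF Ih_L2[OF w] Ih_L2[OF u]] coef_Ih[OF w] coef_Ih[OF u] hel_eq ..
 also have "... = ip (R (coef w)) (nm.hel (coef phi)) - ip (R (coef u)) (nm.hel (coef phi))"
  by (rule ip_diff_left[OF hd nm.R_D0[OF c(1)] nm.R_D0[OF c(2)]])
 finally show ?thesis unfolding force_ip[OF f c(2) phi] by (simp add: right_diff_distrib)
qed

lemma sol_mono: assumes "nm.sol T F c" "0 <= t" "t <= T" shows "nm.sol t F c"
proof -
 obtain g where g: "nm.traj T c g" "AE s in Leb 0 T. \<forall>i. g s i = nm.flow (F s) (c s) i" using assms(1) unfolding nm.sol_def by blast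
 have "AE s in Leb 0 t. \<forall>i. g s i = nm.flow (F s) (c s) i" by (rule AE_lebesgue_on_subset[OF g(2)]) (use assms in auto)
 then show ?thesis using nm.traj_mono[OF g(1) assms(2,3)] unfolding nm.sol_def by blast
qed

lemma sol_cong: assumes s: "nm.sol T F c" and e: "!!t. t \<in> {0..T} ==> c t = c' t" shows "nm.sol T F c'"
proof -
 obtain g where g: "nm.traj T c g" "AE s in Leb 0 T. \<forall>i. g s i = nm.flow (F s) (c s) i" using s unfolding nm.sol_def by blast
 have sp: "AE t in Leb 0 T. t \<in> {0..T}" using AE_space[of "Leb 0 T"] by simp
 note d = nm.trajD[OF g(1)]
 have ae: "AE s in Leb 0 T. (wnorm lm2 (c s))^2 = (wnorm lm2 (c' s))^2" using sp by eventually_elim (simp add: e)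
 have "nm.traj T c' g" unfolding nm.traj_def
 proof (intro conjI allI impI ballI)
  show "wfin lm (c' t)" if "t \<in> {0..T}" for t using d(1)[of t] that by (simp add: e)
  show "AE t in Leb 0 T. wfin lm2 (c' t)" using d(2) sp by eventually_elim (simp add: e)
  show "integrable (Leb 0 T) (%t. (wnorm lm2 (c' t))^2)" by (rule integrable_AE_eq_on[OF d(3) _ ae]) simp
  show "c' t i - c' s i = (LINT tau|Leb s t. g tau i)" if "0 <= s" "s <= t" "t <= T" for i s t
   using d(7)[OF that, of i] e[of t] e[of s] that by simp
 qed (rule d(4-6))+
 moreover have "AE s in Leb 0 T. \<forall>i. g s i = nm.flow (F s) (c' s) i" using g(2) sp by eventually_elim (simp add: e)
 ultimately show ?thesis unfolding nm.sol_def by blast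
qed

text \<open>Equal initial data have zero energy difference, which stays zero by \<open>difference_decay\<close>.\<close>

lemma sol_unique:
 assumes T: "0 <= T" and s: "nm.sol T F c" "nm.sol T F c'" and F: "!!t. t \<in> {0..T} ==> wfin one (F t)" and i: "c 0 = c' 0"
 shows "c T = c' T"
proof -
 have D: "wfin lm (c T)" "wfin lm (c' T)" using s T nm.trajD(1) unfolding nm.sol_def by auto
 have sp: "AE t in Leb 0 T. t \<in> {0..T}" using AE_space[of "Leb 0 T"] by simp
 have "AE t in Leb 0 T. wfin one (F t)" using sp by eventually_elim (rule F)
 note e = nm.difference_decay[OF T s this]
 have "nm.en (%i. c 0 i - c' 0 i) = 0" unfolding i by (simp add: nm.en_def wnorm_def wsq_def)
 then have le: "nm.en (%i. c T i - c' T i) <= 0" using e by simp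
 have f: "wfin one (%i. c T i - c' T i)" by (rule wfin_diff(1)[OF nonneg_one lm_D0[OF D(1)] lm_D0[OF D(2)]])
 have "0 <= alpha^2 * (wnorm lm (%i. c T i - c' T i))^2" by simp
 then have z: "(wnorm one (%i. c T i - c' T i))^2 = 0" using le zero_le_power2[of "wnorm one (%i. c T i - c' T i)"] unfolding nm.en_def by linarith
 have "c T i - c' T i = 0" for i
 proof -
  have "one i * (c T i - c' T i)^2 <= 0" using nm.sq_le_wnorm_sq[OF nonneg_one f, of i] unfolding z .
  then show ?thesis by simp
 qed
 then show ?thesis by (metis eq_iff_diff_eq_0 ext)
qed

text \<open>The left-hand side is the mean growth rate that the reference solution can force on a difference.\<close>

lemma grashof_sq: assumes "f \<in> Hs"
 shows "8 * k3^2 / (sqrt (lambda1 L) * nu) * ((wnorm one (coef f))^2 / (2 * nu * lambda1 L)) / (2 * nu * alpha^2)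
  = 2 * (k3^2 * nu * (grashof L nu f)^2 / alpha^2)"
proof -
 define s where "s = sqrt (lambda1 L)"
 have s: "0 < s" "lambda1 L = s^2" using lambda1_pos by (simp_all add: s_def)
 have "lambda1 L powr (3/4) = (s powr 2) powr (3/4)" using s by simp
 also have "... = s powr (3/2)" unfolding powr_powr by simp
 finally have "(lambda1 L powr (3/4))^2 = s powr 3" by (simp add: power2_eq_square powr_add[symmetric])
 then have p: "(lambda1 L powr (3/4))^2 = s ^ 3" using s by (simp add: powr_numeral)
 have G: "(grashof L nu f)^2 = (wnorm one (coef f))^2 / (nu ^ 4 * s ^ 3)"
  unfolding grashof_def H_parseval(2)[OF assms] power_divide power_mult_distrib p by simp
 have "8 * K / (s * nu) * (W / (2 * nu * s^2)) / (2 * nu * alpha^2) = 2 * (K * nu * (W / (nu ^ 4 * s ^ 3)) / alpha^2)" for K W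
  using s(1) nu alpha by (simp add: field_simps power2_eq_square power3_eq_cube power4_eq_xxxx)
 moreover have "sqrt (s^2) = s" using s(1) by simp
 ultimately show ?thesis unfolding G s(2) by simp
qed

text \<open>Solutions on bounded intervals are patched together by uniqueness. For the decay, the exponent of
  \<open>difference_decay\<close> is at most \<open>A - kappa * t\<close>, with \<open>kappa\<close> positive by the lower bound on \<open>mu\<close>.\<close>

theorem synchronisation:
 assumes f: "f \<in> Hs" and u0: "u0 \<in> Vs" and w0: "w0 \<in> Vs" and u: "NS_alpha_solution L nu alpha f u0 u"
  and large: "15 * k3^2 * nu * (grashof L nu f)^2 / alpha^2 < mu"
 shows "\<exists>w. nudged_solution L nu alpha f mu Ih u w0 w
      & (\<forall>w'. nudged_solution L nu alpha f mu Ih u w0 w' --> (\<forall>t\<ge>0. ae_eq L (w' t) (w t)))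
      & ((%t. nrm2 (%x. w t x - u t x)) \<longlongrightarrow> 0) at_top
      & ((%t. nrmV (%x. w t x - u t x)) \<longlongrightarrow> 0) at_top"
proof -
 define cu where "cu t = coef (u t)" for t
 define F where "F t = force f (cu t)" for t
 have reg: "regular_solution L nu alpha (%t phi. inn f phi) u0 T u" if "0 < T" for T using u that by (simp add: NS_alpha_solution_def)
 have Vu: "u t \<in> Vs" if "0 <= t" for t using reg[of "t + 1"] that by (auto simp: regular_solution_def continuous_in_V_def)
 have cu1: "wfin lm (cu t)" if "0 <= t" for t using Vu[OF that] by (simp add: V_iff cu_def)
 have FD0: "wfin one (F t)" if "0 <= t" for t unfolding F_def by (rule force_D0(2)[OF f cu1[OF that]])
 have solu: "nm.sol T F cu" if T: "0 < T" for T
  unfolding cu_def[abs_def]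
 proof (rule regular_solution_modes(1)[OF reg[OF T] u0 T])
  fix t phi assume a: "t \<in> {0..T}" "u t \<in> Vs" "phi \<in> Ds"
  show "inn f phi = ip (F t) (nm.hel (coef phi)) - mu * ip (R (coef (u t))) (nm.hel (coef phi))"
   using force_ip[OF f cu1 a(3), of t] a(1) by (simp add: F_def cu_def)
 qed
 have cu_cont: "((%s. wnorm lm (%i. cu s i - cu t i)) \<longlongrightarrow> 0) (at t within {0..T})" if t: "t \<in> {0..T}" "0 < T" for t T
 proof -
  have "nrmV (%x. u s x - u t x) = wnorm lm (%i. cu s i - cu t i)" if s: "s \<in> {0..T}" for s
   unfolding cu_def by (rule V_norm_diff) (use Vu s t in auto)
  then have e: "\<forall>\<^sub>F s in at t within {0..T}. nrmV (%x. u s x - u t x) = wnorm lm (%i. cu s i - cu t i)" by (simp add: eventually_at_filter)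
  have l: "((%s. nrmV (%x. u s x - u t x)) \<longlongrightarrow> 0) (at t within {0..T})"
   using reg[OF t(2)] t(1) by (auto simp: regular_solution_def continuous_in_V_def)
  show ?thesis by (rule tendsto_cong[OF e, THEN iffD1, OF l])
 qed
 have ex: "\<exists>w. nm.sol T F w & w 0 = coef w0 & (\<forall>t\<in>{0..T}. ((%s. wnorm lm (%i. w s i - w t i)) \<longlongrightarrow> 0) (at t within {0..T}))"
  if T: "0 < T" for T
 proof -
  have "continuous_on {0..T} (%t. wnorm lm (cu t))" unfolding continuous_on_def
  proof
   fix t assume t: "t \<in> {0..T}"
   have "norm (wnorm lm (cu s) - wnorm lm (cu t)) <= wnorm lm (%i. cu s i - cu t i)" if s: "s \<in> {0..T}" for s
    using wnorm_triangle_sub[OF lm_nonneg(1) cu1 cu1, of s t] wnorm_triangle_sub[OF lm_nonneg(1) cu1 cu1, of t s] s t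
     wnorm_diff_commute[of lm "cu s" "cu t"] by simp
   then have "\<forall>\<^sub>F s in at t within {0..T}. norm (wnorm lm (cu s) - wnorm lm (cu t)) <= wnorm lm (%i. cu s i - cu t i)" by (simp add: eventually_at_filter)
   from Lim_null_comparison[OF this cu_cont[OF t T]] show "((%t. wnorm lm (cu t)) \<longlongrightarrow> wnorm lm (cu t)) (at t within {0..T})" by (simp add: LIM_zero_iff)
  qed
  from continuous_interval_bound[OF this] obtain K where K: "0 < K" "!!t. t \<in> {0..T} ==> \<bar>wnorm lm (cu t)\<bar> <= K" by blast
  have CR: "0 <= nm.CR" by (rule nm.CR_nonneg)
  have Rb: "abs (R a i) <= nm.CR * wnorm lm a" if a: "wfin lm a" for a i
  proof (rule order_trans[OF _ nm.R_bound[OF a]], rule power2_le_imp_le)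
   show "(abs (R a i))^2 <= (wnorm one (R a))^2" using nm.sq_le_wnorm_sq[OF nonneg_one nm.R_D0[OF a], of i] by simp
  qed (rule wnorm_nonneg[OF nonneg_one nm.R_D0[OF a]])
  show ?thesis
  proof (rule nm.sol_exists[where Fb = "nrm2 f + mu * (nm.CR * K)"])
   show "0 <= T" using T by simp
   show "wfin lm (coef w0)" using w0 V_iff by blast
   fix t assume t: "(0::real) <= t" "t <= T"
   have "wnorm one (F t) <= nrm2 f + mu * (nm.CR * wnorm lm (cu t))" unfolding F_def by (rule force_D0(3)[OF f cu1[OF t(1)]])
   also have "... <= nrm2 f + mu * (nm.CR * K)" using K(2)[of t] t mu CR by (intro add_left_mono mult_left_mono) auto
   finally show "wfin one (F t) & wnorm one (F t) <= nrm2 f + mu * (nm.CR * K)" using FD0[OF t(1)] by blast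
  next
   fix i
   have "continuous_on {0..T} (%t. R (cu t) i)" unfolding continuous_on_def
   proof
    fix t assume t: "t \<in> {0..T}"
    have "norm (R (cu s) i - R (cu t) i) <= nm.CR * wnorm lm (%i. cu s i - cu t i)" if s: "s \<in> {0..T}" for s
    proof -
     have c: "wfin lm (cu s)" "wfin lm (cu t)" using cu1 s t by auto
     show ?thesis using Rb[OF wfin_diff(1)[OF lm_nonneg(1) c], of i] unfolding nm.R_diff[OF c] by simp
    qed
    then have "\<forall>\<^sub>F s in at t within {0..T}. norm (R (cu s) i - R (cu t) i) <= nm.CR * wnorm lm (%i. cu s i - cu t i)" by (simp add: eventually_at_filter)
    from Lim_null_comparison[OF this tendsto_mult_right_zero[OF cu_cont[OF t T]]] show "((%t. R (cu t) i) \<longlongrightarrow> R (cu t) i) (at t within {0..T})" by (simp add: LIM_zero_iff)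
   qed
   then show "continuous_on {0..T} (%t. F t i)" unfolding F_def force_def by (intro continuous_intros)
  qed
 qed
 define W where "W T = (SOME w. nm.sol T F w & w 0 = coef w0 & (\<forall>t\<in>{0..T}. ((%s. wnorm lm (%i. w s i - w t i)) \<longlongrightarrow> 0) (at t within {0..T})))" for T
 have W: "nm.sol T F (W T)" "W T 0 = coef w0" "!!t. t \<in> {0..T} ==> ((%s. wnorm lm (%i. W T s i - W T t i)) \<longlongrightarrow> 0) (at t within {0..T})" if T: "0 < T" for T
  using someI_ex[OF ex[OF T]] unfolding W_def[symmetric] by blast+
 (* By uniqueness the value at t does not depend on the interval; t + 1 keeps its length positive. *)
 define c where "c t = W (t + 1) t" for t
 have patch: "c' t = c t" if t: "0 <= t" and s: "nm.sol T F c'" "t <= T" "c' 0 = coef w0" for c' T t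
  unfolding c_def
 proof (rule sol_unique[OF t sol_mono[OF s(1) t s(2)] sol_mono[OF W(1) t]])
  show "c' 0 = W (t + 1) 0" using s(3) W(2) t by simp
 qed (use FD0 t in auto)
 have Wc: "W T t = c t" if "t \<in> {0..T}" "0 < T" for t T using patch[OF _ W(1)[OF that(2)] _ W(2)[OF that(2)]] that by auto
 have csol: "nm.sol T F c" if T: "0 < T" for T by (rule sol_cong[OF W(1)[OF T] Wc[OF _ T]])
 have c1: "wfin lm (c t)" if "0 <= t" for t using csol[of "t + 1"] nm.trajD(1) that unfolding nm.sol_def by force
 have c00: "c 0 = coef w0" using W(2)[of 1] by (simp add: c_def)
 define w where "w t = fld (c t)" for t
 have wH: "w t \<in> Hs" "coef (w t) = c t" if "0 <= t" for t unfolding w_def using fld[OF lm_D0[OF c1[OF that]]] by auto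
 have nud: "nudged_solution L nu alpha f mu Ih u w0 w" unfolding nudged_solution_def
 proof (intro allI impI)
  fix T :: real assume T: "0 < T"
  show "regular_solution L nu alpha (%t phi. inn f phi - mu * helmholtz_dual L alpha (leray L (%x. Ih (w t) x - Ih (u t) x)) phi) w0 T w"
  proof (rule modes_regular_solution[OF csol[OF T] T FD0 _ _ w0 c00])
   fix t assume t: "t \<in> {0..T}"
   have e: "\<forall>\<^sub>F s in at t within {0..T}. wnorm lm (%i. W T s i - W T t i) = wnorm lm (%i. c s i - c t i)"
    using Wc[OF _ T] t by (simp add: eventually_at_filter)
   show "((%s. wnorm lm (%i. c s i - c t i)) \<longlongrightarrow> 0) (at t within {0..T})" by (rule tendsto_cong[OF e, THEN iffD1, OF W(3)[OF T t]])
   show "w t \<in> Hs & coef (w t) = c t" using wH t by simp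
  next
   fix t phi assume a: "t \<in> {0..T}" "w t \<in> Vs" "phi \<in> Ds"
   show "inn f phi - mu * helmholtz_dual L alpha (leray L (%x. Ih (w t) x - Ih (u t) x)) phi = ip (F t) (nm.hel (coef phi)) - mu * ip (R (coef (w t))) (nm.hel (coef phi))"
    using nudging_ip[OF a(2) Vu a(3) f] a(1) by (simp add: F_def cu_def)
  qed simp
 qed
 have uni: "ae_eq L (w' t) (w t)" if n: "nudged_solution L nu alpha f mu Ih u w0 w'" and t: "0 <= t" for w' t
 proof -
  have T: "0 < t + 1" using t by simp
  have "regular_solution L nu alpha (%t phi. inn f phi - mu * helmholtz_dual L alpha (leray L (%x. Ih (w' t) x - Ih (u t) x)) phi) w0 (t + 1) w'"
   using n T by (simp add: nudged_solution_def)
  note m = regular_solution_modes[OF this w0 T, of F]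
  have fd: "inn f phi - mu * helmholtz_dual L alpha (leray L (%x. Ih (w' s) x - Ih (u s) x)) phi = ip (F s) (nm.hel (coef phi)) - mu * ip (R (coef (w' s))) (nm.hel (coef phi))"
   if "s \<in> {0..t + 1}" "w' s \<in> Vs" "phi \<in> Ds" for s phi
   using nudging_ip[OF that(2) Vu that(3) f] that(1) by (simp add: F_def cu_def)
  have "coef (w' t) = c t" using patch[OF t m(1)[OF fd] _ m(2)[OF fd]] by simp
  moreover have "w' t \<in> Hs" using V_H[OF m(3)[OF fd]] t by simp
  ultimately show ?thesis using H_ae_eq[OF _ wH(1)[OF t]] wH(2)[OF t] by simp
 qed
 define d where "d t = (%i. c t i - cu t i)" for t
 have d1: "wfin lm (d t)" if "0 <= t" for t unfolding d_def by (rule wfin_diff(1)[OF lm_nonneg(1) c1[OF that] cu1[OF that]])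
 define K where "K = 8 * k3^2 / (sqrt (lambda1 L) * nu)"
 have K: "0 <= K" using lambda1_pos nu by (simp add: K_def)
 define Q where "Q = (wnorm one (coef f))^2 / (2 * nu * lambda1 L)"
 define A where "A = K * nm.en (cu 0) / (2 * nu * alpha^2)"
 define kappa where "kappa = mu - K * Q / (2 * nu * alpha^2)"
 have kappa: "0 < kappa"
 proof -
  define g where "g = k3^2 * nu * (grashof L nu f)^2 / alpha^2"
  have "0 <= g" using nu by (simp add: g_def)
  moreover have "K * Q / (2 * nu * alpha^2) = 2 * g" unfolding K_def Q_def g_def by (rule grashof_sq[OF f])
  moreover have "15 * g < mu" using large by (simp add: g_def mult.assoc)
  ultimately show ?thesis by (simp add: kappa_def)
 qed
 have decay: "nm.en (d t) <= nm.en (d 0) * exp (A - kappa * t)" if t: "0 < t" for t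
 proof -
  let ?N = "Leb 0 t"
  define I where "I = (LINT s|?N. (wnorm lm2 (cu s))^2)"
  have t0: "0 <= t" using t by simp
  have sp: "AE s in ?N. s \<in> {0..t}" using AE_space[of ?N] by simp
  have F0: "AE s in ?N. wfin one (F s)" using sp by eventually_elim (simp add: FD0)
  have int: "integrable ?N (%s. (wnorm lm2 (cu s))^2)" using solu[OF t] nm.trajD(3) unfolding nm.sol_def by blast
  have "(LINT s|?N. - mu + K * (wnorm lm2 (cu s))^2) = - mu * t + K * I"
   using int t finite_measure.integrable_const[OF finite_measure_lebesgue_on, of "{0..t}"] unfolding I_def
   by (simp add: measure_restrict_space mult.commute)
  then have e: "nm.en (d t) <= nm.en (d 0) * exp (- mu * t + K * I)"
   using nm.difference_decay[OF t0 csol[OF t] solu[OF t] F0] unfolding d_def K_def by simp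
  have FF: "F = (%t i. coef f i / (1 + alpha^2 * lm i) + mu * R (cu t) i)" by (intro ext) (simp add: F_def force_def)
  have "2 * nu * alpha^2 * I <= nm.en (cu 0) + t * Q"
   unfolding I_def Q_def by (rule nm.dissipation_bound[OF t0 H_parseval(1)[OF f] solu[OF t, unfolded FF]])
  then have "I <= (nm.en (cu 0) + t * Q) / (2 * nu * alpha^2)" using nu alpha by (simp add: pos_le_divide_eq mult.commute)
  from mult_left_mono[OF this K] have "K * I <= A + t * (K * Q / (2 * nu * alpha^2))" by (simp add: A_def add_divide_distrib distrib_left mult_ac)
  moreover have "kappa * t = mu * t - t * (K * Q / (2 * nu * alpha^2))" unfolding kappa_def left_diff_distrib by (simp only: mult.commute[of t])
  ultimately have "- mu * t + K * I <= A - kappa * t" by linarith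
  then have "nm.en (d 0) * exp (- mu * t + K * I) <= nm.en (d 0) * exp (A - kappa * t)" by (intro mult_left_mono nm.en_nonneg) simp
  with e show ?thesis by linarith
 qed
 have "((%t. nm.en (d 0) * (exp A * exp (- (kappa * t)))) \<longlongrightarrow> 0) at_top"
 proof (intro tendsto_mult_right_zero filterlim_compose[OF exp_at_bot])
  have "filterlim (%t. kappa * t) at_top at_top" by (rule filterlim_tendsto_pos_mult_at_top[OF tendsto_const kappa filterlim_ident])
  then show "filterlim (%t. - (kappa * t)) at_bot at_top" by (simp add: filterlim_uminus_at_bot)
 qed
 then have lim: "((%t. nm.en (d 0) * exp (A - kappa * t)) \<longlongrightarrow> 0) at_top" by (simp add: exp_add[symmetric])
 have en0: "((%t. sqrt (nm.en (d t))) \<longlongrightarrow> 0) at_top"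
 proof -
  have "((%t. nm.en (d t)) \<longlongrightarrow> 0) at_top"
  proof (rule Lim_null_comparison[OF _ lim])
   show "\<forall>\<^sub>F t in at_top. norm (nm.en (d t)) <= nm.en (d 0) * exp (A - kappa * t)"
    using eventually_gt_at_top[of 0] by eventually_elim (simp add: decay nm.en_nonneg)
  qed
  from tendsto_real_sqrt[OF this] show ?thesis by simp
 qed
 have k: "coef (%x. w t x - u t x) = d t" "(%x. w t x - u t x) \<in> Hs" if t: "0 <= t" for t
  using coef_diff[OF H_L2[OF wH(1)[OF t]] H_L2[OF V_H[OF Vu[OF t]]]] wH(2)[OF t] H_diff[OF wH(1)[OF t] V_H[OF Vu[OF t]]] by (auto simp: d_def cu_def)
 have L: "((%t. nrm2 (%x. w t x - u t x)) \<longlongrightarrow> 0) at_top"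
 proof (rule Lim_null_comparison[OF _ en0])
  show "\<forall>\<^sub>F t in at_top. norm (nrm2 (%x. w t x - u t x)) <= sqrt (nm.en (d t))" using eventually_ge_at_top[of 0]
  proof eventually_elim
   case (elim t)
   have "nrm2 (%x. w t x - u t x) = wnorm one (d t)" using H_parseval(2)[OF k(2)[OF elim]] k(1)[OF elim] by simp
   then show ?case by (simp add: real_le_rsqrt nm.en_def)
  qed
 qed
 have "((%t. sqrt (nm.en (d t)) / alpha) \<longlongrightarrow> 0) at_top" using tendsto_divide_zero[OF en0] by simp
 then have V: "((%t. nrmV (%x. w t x - u t x)) \<longlongrightarrow> 0) at_top"
 proof (rule Lim_null_comparison[rotated])
  show "\<forall>\<^sub>F t in at_top. norm (nrmV (%x. w t x - u t x)) <= sqrt (nm.en (d t)) / alpha" using eventually_ge_at_top[of 0]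
  proof eventually_elim
   case (elim t)
   have v: "nrmV (%x. w t x - u t x) = wnorm lm (d t)" using V_norm_coef[OF k(2)[OF elim]] d1[OF elim] by (simp add: k(1)[OF elim])
   have "alpha * wnorm lm (d t) <= sqrt (nm.en (d t))" by (rule real_le_rsqrt) (simp add: nm.en_def power_mult_distrib)
   then show ?case unfolding v using alpha wnorm_nonneg[OF lm_nonneg(1) d1[OF elim]] by (simp add: pos_le_divide_eq mult.commute)
  qed
 qed
 show ?thesis using nud uni L V by blast
qed

end

theorem theorem4:
  fixes L \<nu> \<alpha> k3 h c1 \<mu> :: real
    and f u0 w0 :: field
    and u :: "real \<Rightarrow> field"
    and Ih :: "field \<Rightarrow> field"
  assumes "L > 0" and "\<nu> > 0" and "\<alpha> > 0"
    and "k3 > 0" and "B_bound L k3"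
    and "f \<in> H_space L" and "u0 \<in> V_space L" and "w0 \<in> V_space L"
    and "NS_alpha_solution L \<nu> \<alpha> f u0 u"
    and "h > 0"
    and "linear_H1_L2 L Ih"
    and "c1 > 0"
    and "\<And>\<phi>. \<phi> \<in> V_space L \<Longrightarrow>
           (L2_norm L (leray L (\<lambda>x. \<phi> x - Ih \<phi> x)))\<^sup>2 \<le> c1\<^sup>2 * h\<^sup>2 * (V_norm L \<phi>)\<^sup>2"
    and "\<mu> > 0"
    and "\<mu> > 24 * k3\<^sup>2 * \<nu> * lambda1 L * (grashof L \<nu> f)\<^sup>2
             + 15 * k3\<^sup>2 * \<nu> * (grashof L \<nu> f)\<^sup>2 / \<alpha>\<^sup>2"
    and "h\<^sup>2 < \<nu> / (2 * \<mu> * c1\<^sup>2)"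
  shows "\<exists>w. nudged_solution L \<nu> \<alpha> f \<mu> Ih u w0 w
           \<and> (\<forall>w'. nudged_solution L \<nu> \<alpha> f \<mu> Ih u w0 w' \<longrightarrow> (\<forall>t\<ge>0. ae_eq L (w' t) (w t)))
           \<and> ((\<lambda>t. L2_norm L (\<lambda>x. w t x - u t x)) \<longlongrightarrow> 0) at_top
           \<and> ((\<lambda>t. V_norm L (\<lambda>x. w t x - u t x)) \<longlongrightarrow> 0) at_top"
proof -
  interpret nudged_torus L \<nu> \<alpha> k3 h c1 \<mu> Ih by unfold_locales (use assms in auto)
  have "0 \<le> 24 * k3\<^sup>2 * \<nu> * lambda1 L * (grashof L \<nu> f)\<^sup>2" using assms(2) lambda1_pos by simp
  then have "15 * k3\<^sup>2 * \<nu> * (grashof L \<nu> f)\<^sup>2 / \<alpha>\<^sup>2 < \<mu>" using assms(15) by linarith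
  then show ?thesis by (rule synchronisation[OF assms(6-9)])
qed

end
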